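(* Let $T>0$, $Q_T=(0,1)\times(0,T]$, and let $\sigma:\mathbb{R}\to\mathbb{R}$ be a nonmonotone $C^1$ function with $\sigma(u)\to\pm\infty$ as $u\to\pm\infty$, whose stored energy $W(u)=\int_0^u\sigma(\tau)\,d\tau$ satisfies, for some $p>1$ and constants $c,C>0$, $$c|u|^p-C\le W(u)\le C|u|^p .$$ Let $(u^\varepsilon,v^\varepsilon)$ and $S^\varepsilon=\sigma(u^\varepsilon)+v^\varepsilon_x$ be a family of solutions (with $S^\varepsilon$ the total stress) of $$\partial_t u=\partial_x v,\qquad \partial_t v=\partial_x\big(\sigma(u)+v_x\big),\qquad 0\le x\le 1,\ t>0,$$ with boundary conditions $S^\varepsilon(0,t)=S^\varepsilon(1,t)=0$, induced by initial data $u^\varepsilon(x,0)=u_0^\varepsilon(x)$, $v^\varepsilon(x,0)=v_0^\varepsilon(x)$ satisfying the uniform bounds $$\|u_0^\varepsilon\|_{L^\infty}\le C,\qquad \|v_0^\varepsilon\|_{W^{1,\infty}}\le C .$$ Let $M=\sqrt{\mathcal{E}(0)}$, where $\mathcal{E}(0)=\mathcal{E}^\varepsilon(0)=\int_0^1\tfrac12(v_0^\varepsilon)^2+W(u_0^\varepsilon)\,dx$ is the initial energy (the dependence on $\varepsilon$ being suppressed in the notation), set $$B(u,M)=\max_{s\in[0,1],\ |A|\le M}\big|\sigma'(u+(1-s)A)\big|\,|A|,$$ and assume $$\lim_{u\to\infty}\big(\sigma(u)-B(u,M)\big)=+\infty,\qquad \lim_{u\to-\infty}\big(\sigma(u)+B(u,M)\big)=-\infty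 .$$ Then a subsequence defines $u(t,x)$, $v(t,x)$, $S(t,x)$ via $$u^\varepsilon\rightharpoonup u\ \text{ weak-}\ast\text{ in }L^\infty(Q_T),\qquad v^\varepsilon\to v\ \text{ in }L^2(Q_T),\qquad S^\varepsilon\to S\ \text{ a.e. }(x,t)\in Q_T,$$ and $F(t,x,\xi)$, $\xi\in\mathbb{R}$, via $$\mathbf 1_{u^\varepsilon<\xi}\rightharpoonup F(t,x,\xi)\quad\text{weak-}\ast\text{ in }L^\infty(Q_T),$$ or via $F(t,x,\xi)=\int_{(-\infty,\xi]}d\nu_{t,x}(\lambda)$, where $\nu_{t,x}$ is the Young measure associated with $\{u^\varepsilon\}$. The function $(F,v)$ satisfies, for $(x,t)\in Q_T$ and $\xi\in\mathbb{R}$, the system $$\begin{cases}\partial_tF+\partial_\xi\Big(\big(v_x+\overline{\sigma(u)}-\sigma(\xi)\big)F\Big)+\sigma'(\xi)F=0,\\[3pt] \partial_tv=\partial_{xx}v+\partial_x\big(\overline{\sigma(u)}\big),\\[3pt] S=\overline{\sigma(u)}+v_x=\int\sigma(\xi)\,dF_{t,x}(\xi)+v_x,\end{cases}$$ subject to $S=0$ at $x=0$ and $x=1$ for $0<t<T$ and to the initial data (at $t=0$) $$v=v_0(x)=\text{s-}\lim v_0^\varepsilon(x),\qquad F=\text{wk-}\ast\lim\big(\mathbf 1_{u_0^\varepsilon(x)<\xi}\big).$$ Alternatively, $(F,S)$ is determined via the system, for $(x,t)\in Q_T$ and $\xi\in\mathbb{R}$, $$\begin{cases}\partial_tF+\partial_\xi\Big(\big(S-\sigma(\xi)\big)F\Big)+\sigma'(\xi)F=0,\\[3pt]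 \partial_tS=\partial_{xx}S+\int\sigma'(\xi)\big(S-\sigma(\xi)\big)\,dF_{t,x}(\xi),\end{cases}$$ subject to $S=0$ at $x=0$ and $x=1$ for $0<t<T$ and to the initial data (at $t=0$) $$S=S_0(x)=\text{wk-}\lim\big(\sigma(u_0^\varepsilon(x))+\partial_xv_0^\varepsilon\big),\qquad F=\text{wk-}\ast\lim\big(\mathbf 1_{u_0^\varepsilon(x)<\xi}\big).$$
   Context: The system describes shear motions of a viscoelastic material, with $u$ the shear deformation, $v$ the velocity and $S$ the total stress; the boundary conditions are traction-free. Constants in the data bounds are independent of $\varepsilon$. Solutions are considered in the framework of the energy bound $$\int_0^1\tfrac12 (v^\varepsilon)^2(x,t)+W(u^\varepsilon(x,t))\,dx+\int_0^t\!\!\int_0^1 (v_x^\varepsilon)^2\le\int_0^1\tfrac12(v_0^\varepsilon)^2+W(u_0^\varepsilon)\,dx=\mathcal{E}^\varepsilon(0)\le C .$$ $\mathbf 1_{u<\xi}$ equals $1$ if $u<\xi$ and $0$ otherwise, and $F\in L^\infty(Q_T\times\mathbb{R})$; the distribution-function formula picks the representative of $F$ that is right continuous in $\xi$. The Young measure $\nu_{t,x}$ is the parametrized family of probability measures on $\mathbb{R}$ with $\beta(u^\varepsilon)\rightharpoonup\int\beta(\lambda)\,d\nu_{t,x}(\lambda)$ weak-$\ast$ in $L^\infty(Q_T)$ for every continuous $\beta$. The notation $dF_{t,x}(\xi)$ means integration against $\nu_{t,x}$, and for continuous $f$, $\overline{f(u)}=\int f(\xi)\,dF_{t,x}(\xi)=\int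 f(\lambda)\,d\nu_{t,x}(\lambda)$ denotes the weak-$\ast$ limit of $f(u^\varepsilon)$ in $L^\infty$. "s-lim", "wk-lim" and "wk-$\ast$ lim" denote strong, weak and weak-$\ast$ limits as $\varepsilon\to0$ along the subsequence. The equation for $F$ is understood in the sense of distributions. *)

theory Defs
  imports "HOL-Analysis.Analysis" "HOL-Probability.Giry_Monad"
begin

text \<open>Conventions: space-time points are pairs z = (x, t), and points of phase space are
  pairs (z, \<xi>). Elements of Lebesgue spaces are given by Borel representatives.\<close>

definition pd :: "'a::euclidean_space \<Rightarrow> ('a \<Rightarrow> real) \<Rightarrow> 'a \<Rightarrow> real" where
  "pd b \<phi> z = frechet_derivative \<phi> (at z) b"

primrec Ck :: "nat \<Rightarrow> ('a::euclidean_space \<Rightarrow> real) \<Rightarrow> bool" where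
  "Ck 0 \<phi> \<longleftrightarrow> continuous_on UNIV \<phi>"
| "Ck (Suc k) \<phi> \<longleftrightarrow> (\<forall>z. \<phi> differentiable (at z)) \<and> (\<forall>b\<in>Basis. Ck k (pd b \<phi>))"

definition test_fun :: "'a::euclidean_space set \<Rightarrow> ('a \<Rightarrow> real) \<Rightarrow> bool" where
  "test_fun \<Omega> \<phi> \<longleftrightarrow> (\<forall>k. Ck k \<phi>) \<and>
     compact (closure {z. \<phi> z \<noteq> 0}) \<and> closure {z. \<phi> z \<noteq> 0} \<subseteq> \<Omega>"

definition loc_integrable :: "'a::euclidean_space set \<Rightarrow> ('a \<Rightarrow> real) \<Rightarrow> bool" where
  "loc_integrable \<Omega> f \<longleftrightarrow> (\<forall>K. compact K \<and> K \<subseteq> \<Omega> \<longrightarrow> set_integrable lborel K f)"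

definition weak_pd ::
  "'a::euclidean_space set \<Rightarrow> 'a \<Rightarrow> ('a \<Rightarrow> real) \<Rightarrow> ('a \<Rightarrow> real) \<Rightarrow> bool" where
  "weak_pd \<Omega> b f g \<longleftrightarrow> loc_integrable \<Omega> f \<and> loc_integrable \<Omega> g \<and>
     (\<forall>\<phi>. test_fun \<Omega> \<phi> \<longrightarrow>
        (LINT z:\<Omega>|lborel. f z * pd b \<phi> z) = - (LINT z:\<Omega>|lborel. g z * \<phi> z))"

definition Linf_bound :: "'a::euclidean_space set \<Rightarrow> real \<Rightarrow> ('a \<Rightarrow> real) \<Rightarrow> bool" where
  "Linf_bound A K f \<longleftrightarrow> set_borel_measurable lborel A f \<and> (AE z\<in>A in lborel. \<bar>f z\<bar> \<le> K)"

definition Linf :: "'a::euclidean_space set \<Rightarrow> ('a \<Rightarrow> real) \<Rightarrow> bool" where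
  "Linf A f \<longleftrightarrow> (\<exists>K. Linf_bound A K f)"

definition L2 :: "'a::euclidean_space set \<Rightarrow> ('a \<Rightarrow> real) \<Rightarrow> bool" where
  "L2 A f \<longleftrightarrow> set_borel_measurable lborel A f \<and> set_integrable lborel A (\<lambda>z. (f z)\<^sup>2)"

definition weakstar_Linf ::
  "'a::euclidean_space set \<Rightarrow> (nat \<Rightarrow> 'a \<Rightarrow> real) \<Rightarrow> ('a \<Rightarrow> real) \<Rightarrow> bool" where
  "weakstar_Linf A f g \<longleftrightarrow> (\<forall>n. Linf A (f n)) \<and> Linf A g \<and>
     (\<forall>\<phi>. set_integrable lborel A \<phi> \<longrightarrow>
        (\<lambda>n. LINT z:A|lborel. f n z * \<phi> z) \<longlonglongrightarrow> (LINT z:A|lborel. g z * \<phi> z))"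

definition strong_L2 ::
  "'a::euclidean_space set \<Rightarrow> (nat \<Rightarrow> 'a \<Rightarrow> real) \<Rightarrow> ('a \<Rightarrow> real) \<Rightarrow> bool" where
  "strong_L2 A f g \<longleftrightarrow> (\<forall>n. L2 A (f n)) \<and> L2 A g \<and>
     (\<lambda>n. LINT z:A|lborel. (f n z - g z)\<^sup>2) \<longlonglongrightarrow> 0"

definition weak_L2 ::
  "'a::euclidean_space set \<Rightarrow> (nat \<Rightarrow> 'a \<Rightarrow> real) \<Rightarrow> ('a \<Rightarrow> real) \<Rightarrow> bool" where
  "weak_L2 A f g \<longleftrightarrow> (\<forall>n. L2 A (f n)) \<and> L2 A g \<and>
     (\<forall>\<phi>. L2 A \<phi> \<longrightarrow>
        (\<lambda>n. LINT z:A|lborel. f n z * \<phi> z) \<longlonglongrightarrow> (LINT z:A|lborel. g z * \<phi> z))"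

text \<open>The integrability clause is needed because \<open>\<beta>\<close> may be unbounded and the
  Bochner integral of a non-integrable function is 0 by convention.\<close>

definition young_measure ::
  "'a::euclidean_space set \<Rightarrow> (nat \<Rightarrow> 'a \<Rightarrow> real) \<Rightarrow> ('a \<Rightarrow> real measure) \<Rightarrow> bool" where
  "young_measure A f \<nu> \<longleftrightarrow>
     \<nu> \<in> restrict_space borel A \<rightarrow>\<^sub>M prob_algebra borel \<and>
     (\<forall>\<beta> :: real \<Rightarrow> real. continuous_on UNIV \<beta> \<longrightarrow>
        (AE z\<in>A in lborel. integrable (\<nu> z) \<beta>) \<and>
        weakstar_Linf A (\<lambda>n z. \<beta> (f n z)) (\<lambda>z. LINT r|\<nu> z. \<beta> r))"

definition Q :: "real \<Rightarrow> (real \<times> real) set" where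
  "Q T = {0<..<1} \<times> {0<..T}"

definition stored_energy :: "(real \<Rightarrow> real) \<Rightarrow> real \<Rightarrow> real" where
  "stored_energy \<sigma> r = (LBINT \<tau>=0..r. \<sigma> \<tau>)"

definition initial_energy ::
  "(real \<Rightarrow> real) \<Rightarrow> (real \<Rightarrow> real) \<Rightarrow> (real \<Rightarrow> real) \<Rightarrow> real" where
  "initial_energy \<sigma> u0 v0 =
     (LINT x:{0<..<1}|lborel. (v0 x)\<^sup>2 / 2 + stored_energy \<sigma> (u0 x))"

text \<open>For M \<ge> 0 and continuous \<open>\<sigma>'\<close> the supremum is over a compact set and hence a maximum.\<close>

definition B :: "(real \<Rightarrow> real) \<Rightarrow> real \<Rightarrow> real \<Rightarrow> real" where
  "B \<sigma> r M = (SUP (s, A)\<in>{0..1} \<times> {A. \<bar>A\<bar> \<le> M}. \<bar>deriv \<sigma> (r + (1 - s) * A)\<bar> * \<bar>A\<bar>)"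

text \<open>Weak solutions on \<open>(0,1) \<times> (0,\<infinity>)\<close>; \<open>vx\<close> is the weak derivative \<open>v\<^sub>x\<close>. The test
  functions need not vanish at t = 0, which encodes the initial data. In the momentum
  equation they need not vanish at x = 0 and x = 1 either: this is the traction-free
  condition \<open>\<sigma>(u) + v\<^sub>x = 0\<close> at both ends as a natural boundary condition.\<close>

definition weak_solution ::
  "(real \<Rightarrow> real) \<Rightarrow> (real \<Rightarrow> real) \<Rightarrow> (real \<Rightarrow> real) \<Rightarrow>
   (real \<times> real \<Rightarrow> real) \<Rightarrow> (real \<times> real \<Rightarrow> real) \<Rightarrow> (real \<times> real \<Rightarrow> real) \<Rightarrow> bool" where
  "weak_solution \<sigma> u0 v0 u v vx \<longleftrightarrow>
     (\<forall>T>0. set_integrable lborel (Q T) u \<and> set_integrable lborel (Q T) (\<lambda>z. \<sigma> (u z)) \<and>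
        L2 (Q T) v \<and> L2 (Q T) vx) \<and>
     weak_pd ({0<..<1} \<times> {0<..}) (1, 0) v vx \<and>
     (\<forall>\<phi>. test_fun ({0<..<1} \<times> UNIV) \<phi> \<longrightarrow>
        (LINT z:{0<..<1} \<times> {0<..}|lborel. u z * pd (0, 1) \<phi> z - v z * pd (1, 0) \<phi> z)
        + (LINT x:{0<..<1}|lborel. u0 x * \<phi> (x, 0)) = 0) \<and>
     (\<forall>\<phi>. test_fun UNIV \<phi> \<longrightarrow>
        (LINT z:{0<..<1} \<times> {0<..}|lborel.
            v z * pd (0, 1) \<phi> z - (\<sigma> (u z) + vx z) * pd (1, 0) \<phi> z)
        + (LINT x:{0<..<1}|lborel. v0 x * \<phi> (x, 0)) = 0)"

definition energy_bound ::
  "(real \<Rightarrow> real) \<Rightarrow> (real \<Rightarrow> real) \<Rightarrow> (real \<Rightarrow> real) \<Rightarrow>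
   (real \<times> real \<Rightarrow> real) \<Rightarrow> (real \<times> real \<Rightarrow> real) \<Rightarrow> (real \<times> real \<Rightarrow> real) \<Rightarrow> bool" where
  "energy_bound \<sigma> u0 v0 u v vx \<longleftrightarrow>
     (AE t\<in>{0<..} in lborel.
        L2 {0<..<1} (\<lambda>x. v (x, t)) \<and>
        set_integrable lborel {0<..<1} (\<lambda>x. stored_energy \<sigma> (u (x, t))) \<and>
        (LINT x:{0<..<1}|lborel. (v (x, t))\<^sup>2 / 2 + stored_energy \<sigma> (u (x, t)))
        + (LINT z:Q t|lborel. (vx z)\<^sup>2) \<le> initial_energy \<sigma> u0 v0)"

text \<open>In the two equations below the initial data are again built into the weak
  formulation: the test functions vanish near the lateral boundary and near t = T, but not at t = 0.
  No boundary conditions are included.\<close>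

text \<open>\<open>\<partial>\<^sub>t F + \<partial>\<^sub>\<xi> ((G - \<sigma>(\<xi>)) F) + \<sigma>'(\<xi>) F = 0\<close> in \<open>Q\<^sub>T \<times> \<real>\<close>, \<open>F = F0\<close> at t = 0.\<close>

definition kinetic_equation ::
  "(real \<Rightarrow> real) \<Rightarrow> real \<Rightarrow> (real \<times> real \<Rightarrow> real) \<Rightarrow>
   (real \<times> real \<Rightarrow> real \<Rightarrow> real) \<Rightarrow> (real \<Rightarrow> real \<Rightarrow> real) \<Rightarrow> bool" where
  "kinetic_equation \<sigma> T G F F0 \<longleftrightarrow>
     (\<forall>\<phi>. test_fun (({0<..<1} \<times> {..<T}) \<times> UNIV) \<phi> \<longrightarrow>
        set_integrable lborel (Q T \<times> UNIV)
          (\<lambda>(z, \<xi>). F z \<xi> * pd ((0, 1), 0) \<phi> (z, \<xi>)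
             + (G z - \<sigma> \<xi>) * F z \<xi> * pd ((0, 0), 1) \<phi> (z, \<xi>)
             - deriv \<sigma> \<xi> * F z \<xi> * \<phi> (z, \<xi>)) \<and>
        set_integrable lborel ({0<..<1} \<times> UNIV) (\<lambda>(x, \<xi>). F0 x \<xi> * \<phi> ((x, 0), \<xi>)) \<and>
        (LINT (z, \<xi>):Q T \<times> UNIV|lborel. F z \<xi> * pd ((0, 1), 0) \<phi> (z, \<xi>)
             + (G z - \<sigma> \<xi>) * F z \<xi> * pd ((0, 0), 1) \<phi> (z, \<xi>)
             - deriv \<sigma> \<xi> * F z \<xi> * \<phi> (z, \<xi>))
        + (LINT (x, \<xi>):{0<..<1} \<times> UNIV|lborel. F0 x \<xi> * \<phi> ((x, 0), \<xi>)) = 0)"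

text \<open>\<open>\<partial>\<^sub>t w = \<partial>\<^sub>x\<^sub>x w + \<partial>\<^sub>x h + g\<close> in \<open>Q\<^sub>T\<close>, \<open>w = w0\<close> at t = 0.\<close>

definition heat_equation ::
  "real \<Rightarrow> (real \<times> real \<Rightarrow> real) \<Rightarrow> (real \<times> real \<Rightarrow> real) \<Rightarrow>
   (real \<times> real \<Rightarrow> real) \<Rightarrow> (real \<Rightarrow> real) \<Rightarrow> bool" where
  "heat_equation T h g w w0 \<longleftrightarrow>
     set_integrable lborel (Q T) w \<and> set_integrable lborel (Q T) h \<and>
     set_integrable lborel (Q T) g \<and> set_integrable lborel {0<..<1} w0 \<and>
     (\<forall>\<phi>. test_fun ({0<..<1} \<times> {..<T}) \<phi> \<longrightarrow>
        (LINT z:Q T|lborel. w z * pd (0, 1) \<phi> z + w z * pd (1, 0) (pd (1, 0) \<phi>) z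
             - h z * pd (1, 0) \<phi> z + g z * \<phi> z)
        + (LINT x:{0<..<1}|lborel. w0 x * \<phi> (x, 0)) = 0)"

end

theory Submission
 imports Defs "HOL-Probability.Probability"
begin

text \<open>Write \<open>P(x,t) = \<integral>\<^sub>0\<^sup>x v\<close>. The momentum equation integrates to \<open>P\<^sub>t = S\<close>, hence
  \<open>(u - P)\<^sub>t = - \<sigma>(u)\<close>, and the energy bound on P makes \<open>\<bar>u\<bar> \<le> R\<close> with R independent of \<open>\<epsilon>\<close>. The
  stress solves \<open>S\<^sub>t = S\<^sub>x\<^sub>x + \<sigma>'(u) v\<^sub>x\<close> with Dirichlet conditions, so its sine modes solve scalar linear
  equations with a forcing in \<open>L\<^sup>2\<close>: S is bounded, and weak-* convergence of the data and of the forcing gives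
  pointwise convergence of S. Then \<open>v\<^sub>x = S - \<sigma>(u)\<close> is bounded, so v is Lipschitz in x, and it converges because
  P does. The kinetic equation is the chain rule for \<open>\<phi>(x, t, u(x,t) + \<eta>)\<close>, integrated over \<open>\<eta> > 0\<close>. Its only
  product of two limits is F S, where S converges strongly.\<close>

text \<open>Velocity and \<open>vx\<close> start out merely square integrable, so no equation can be
  read pointwise. Testing with sines and cosines turns each one into a scalar integral equation in
  time, and uniqueness of Fourier coefficients leads back to almost every point. The stress must be
  bounded down to t = 0, where the modes of the initial stress, a merely bounded function, need not
  be summable. That part is therefore estimated through the Dirichlet heat kernel, which a Neumann
  kernel of mass one dominates because a theta function is nonnegative. The forcing part needs no
  kernel: its modes are square summable over space-time. Passing to the limit threatens to be
  circular, since the limit of the stress depends on the weak limit of the forcing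
  \<open>sg'(u) vx\<close>. Compactness first supplies some limit \<open>gL\<close>; this already
  makes the stress converge pointwise, and only then is the limit of
  \<open>sg'(u) vx = sg'(u) S - sg'(u) sg(u)\<close> expressed by the Young measure. A diagonal
  extraction handles only countably many levels, so F is assembled from rational levels and
  recovered at almost every level.\<close>

abbreviation (input) ind :: "'a set \<Rightarrow> 'a \<Rightarrow> real" where "ind \<equiv> indicator"
abbreviation (input) L1 :: "('a::euclidean_space \<Rightarrow> real) \<Rightarrow> bool" where "L1 \<equiv> integrable lborel"
abbreviation (input) BM :: "('a::topological_space \<Rightarrow> 'b::topological_space) set" where "BM \<equiv> borel_measurable borel"
abbreviation (input) BM2 :: "('a::topological_space \<times> 'b::topological_space \<Rightarrow> real) set" where "BM2 \<equiv> borel_measurable (borel \<Otimes>\<^sub>M borel)"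
abbreviation (input) BL :: "('a::euclidean_space \<Rightarrow> 'b::topological_space) set" where "BL \<equiv> borel_measurable lborel"
abbreviation (input) almost_all :: "('a::euclidean_space \<Rightarrow> bool) \<Rightarrow> bool" (binder "AEL " 10) where "almost_all P \<equiv> AE x in lborel. P x"
abbreviation (input) LSQ :: "(nat \<Rightarrow> 'a::topological_space) \<Rightarrow> 'a \<Rightarrow> bool" (infix "---->" 60) where "X ----> L \<equiv> X \<longlonglongrightarrow> L"
lemmas i_add = Bochner_Integration.integrable_add and i_diff = Bochner_Integration.integrable_diff
  and int_add = Bochner_Integration.integral_add and int_diff = Bochner_Integration.integral_diff
  and i_bound = Bochner_Integration.integrable_bound and int_sum = Bochner_Integration.integral_sum and int_cong = Bochner_Integration.integral_cong
  and bm_cont = borel_measurable_continuous_onI and i_ind = integrable_real_indicator and ind_def = indicator_def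
  and i_ml = integrable_mult_left and i_mr = integrable_mult_right and deqs = derivative_eq_intros and alg = algebra_simps
  and cints = continuous_intros and AE_sing = AE_lborel_singleton and iab = integral_abs_bound and mlm = mult_left_mono

section \<open>Products with bounded factors, Fubini and null sets\<close>

lemma imb:
 fixes f g :: "'a => real"
 assumes "integrable M f" "g \<in> borel_measurable M" "AE x in M. abs(g x) <= C"
 shows "integrable M (%x. f x * g x)" "integrable M (%x. g x * f x)"
proof -
 have m[measurable]: "f \<in> borel_measurable M" "g \<in> borel_measurable M" using assms by auto
 show "integrable M (%x. f x * g x)"
 proof (rule i_bound[of M "%x. C * f x"])
  show "AE x in M. norm (f x * g x) <= norm (C * f x)"
   using assms(3)
  proof eventually_elim
   case (elim x)
   have "abs(f x) * abs(g x) <= abs(f x) * abs(C)" using elim by (intro mlm) auto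
   thus ?case by (simp add: abs_mult mult.commute)
  qed
 qed (use assms in auto)
 thus "integrable M (%x. g x * f x)" by (simp add: mult.commute)
qed

lemma lp_fst:
 fixes f :: "'a::euclidean_space \<times> 'b::euclidean_space => real"
 assumes "L1 f"
 shows "AEL x. L1 (%y. f (x, y))"
  and "L1 (%x. LBINT y. f (x, y))"
  and "(\<integral>x. \<integral>y. f (x, y) \<partial>lborel \<partial>lborel) = (LBINT z. f z)"
proof -
 have "integrable (lborel \<Otimes>\<^sub>M lborel) f" using assms by (simp add: lborel_prod)
 note * = lborel_pair.AE_integrable_fst'[OF this] lborel_pair.integrable_fst'[OF this] lborel_pair.integral_fst'[OF this]
 show "AEL x. L1 (%y. f (x, y))"
  "L1 (%x. LBINT y. f (x, y))"
  "(\<integral>x. \<integral>y. f (x, y) \<partial>lborel \<partial>lborel) = (LBINT z. f z)"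
  using * by (simp_all add: lborel_prod)
qed

lemma lp_snd:
 fixes f :: "'a::euclidean_space \<times> 'b::euclidean_space => real"
 assumes "L1 f"
 shows "AEL y. L1 (%x. f (x, y))"
  and "L1 (%y. LBINT x. f (x, y))"
  and "(\<integral>y. \<integral>x. f (x, y) \<partial>lborel \<partial>lborel) = (LBINT z. f z)"
proof -
 have "integrable (lborel \<Otimes>\<^sub>M lborel) (case_prod (%x y. f (x, y)))" using assms by (simp add: lborel_prod)
 note * = lborel_pair.AE_integrable_snd[OF this] lborel_pair.integrable_snd[OF this] lborel_pair.integral_snd[OF this]
 show "AEL y. L1 (%x. f (x, y))"
  "L1 (%y. LBINT x. f (x, y))"
  "(\<integral>y. \<integral>x. f (x, y) \<partial>lborel \<partial>lborel) = (LBINT z. f z)"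
  using * by (simp_all add: lborel_prod)
qed

lemma lborel_fubini_swap:
 fixes f :: "'a::euclidean_space \<times> 'b::euclidean_space => real"
 assumes "L1 f"
 shows "(\<integral>y. \<integral>x. f (x, y) \<partial>lborel \<partial>lborel) = (\<integral>x. \<integral>y. f (x, y) \<partial>lborel \<partial>lborel)"
 using lp_fst(3)[OF assms] lp_snd(3)[OF assms] by simp

text \<open>The set where \<open>P\<close> fails need not be measurable, and exchanging the two
  quantifiers is only possible for measurable sets. Both orders are therefore proved for a
  measurable null superset \<open>N\<close> of the failure set.\<close>

lemma AE_pairD:
 fixes P :: "'a::euclidean_space \<times> 'b::euclidean_space => bool"
 assumes "AEL z. P z"
 shows "AEL x. AEL y. P (x, y)" "AEL y. AEL x. P (x, y)"
proof -
 have "AE z in lborel \<Otimes>\<^sub>M lborel. P z" using assms unfolding lborel_prod .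
 from AE_E[OF this] obtain N where N: "{z. ~ P z} \<subseteq> N" "N \<in> sets (lborel \<Otimes>\<^sub>M lborel)" "emeasure (lborel \<Otimes>\<^sub>M lborel) N = 0"
  by (auto simp: space_pair_measure)
 hence "N \<in> null_sets (lborel \<Otimes>\<^sub>M lborel)" by (auto intro: null_setsI)
 hence A: "AE z in lborel \<Otimes>\<^sub>M lborel. z ~: N" by (rule AE_not_in)
 have B: "AEL x. AEL y. (x, y) ~: N" using lborel_pair.AE_pair[OF A] by simp
 have [measurable]: "N \<in> sets (lborel \<Otimes>\<^sub>M lborel)" by fact
 have m: "{z \<in> space (lborel \<Otimes>\<^sub>M lborel). (%x y. (x, y) ~: N) (fst z) (snd z)} \<in> sets (lborel \<Otimes>\<^sub>M lborel)"
 proof -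
  have "{z \<in> space (lborel \<Otimes>\<^sub>M lborel). (fst z, snd z) ~: N} = space (lborel \<Otimes>\<^sub>M lborel) - N" by auto
  thus ?thesis using N(2) by (simp only: sets.compl_sets)
 qed
 have C: "AEL y. AEL x. (x, y) ~: N"
  using B lborel_pair.AE_commute[OF m] by blast
 show "AEL x. AEL y. P (x, y)"
  using B
 proof eventually_elim
  case (elim x) thus ?case by eventually_elim (use N(1) in auto)
 qed
 show "AEL y. AEL x. P (x, y)"
  using C
 proof eventually_elim
  case (elim y) thus ?case by eventually_elim (use N(1) in auto)
 qed
qed

text \<open>Measurability of the set carries weight here: a non-measurable set can have null slices
  without being null. The second coordinate is outermost because the Fourier arguments produce
  statements of the form "for almost every time, for almost every x".\<close>

lemma AE_lborel_pairI:
 fixes P :: "'a::euclidean_space \<times> 'b::euclidean_space => bool"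
 assumes m: "{z. P z} \<in> sets borel" and "AEL y. AEL x. P (x, y)"
 shows "AEL z. P z"
proof -
 from m have "{z. P z} \<in> sets (lborel \<Otimes>\<^sub>M lborel)" unfolding lborel_prod by simp
 hence m: "{z \<in> space (lborel \<Otimes>\<^sub>M lborel). (%x y. P (x, y)) (fst z) (snd z)} \<in> sets (lborel \<Otimes>\<^sub>M lborel)"
  by (simp only: space_pair_measure space_lborel space_borel UNIV_Times_UNIV prod.collapse UNIV_I simp_thms)
 have "AEL x. AEL y. P (x, y)"
  using assms(2) lborel_pair.AE_commute[OF m] by blast
 hence "AE z in lborel \<Otimes>\<^sub>M lborel. P z"
  using lborel_pair.AE_pair_iff[of "%x y. P (x,y)"] m by simp
 thus ?thesis unfolding lborel_prod .
qed

text \<open>Half-lines generate the Borel sets and are stable under intersection. Vanishing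
  integrals therefore spread to all Borel sets by induction over disjoint unions and complements,
  and \<open>density_zero\<close> concludes.\<close>

lemma AE_zero_if_interval_integrals_zero:
 fixes f :: "real => real"
 assumes f: "L1 f" and z: "!!b. (LBINT x. ind {..b} x * f x) = 0"
 shows "AEL x. f x = 0"
proof (rule sigma_finite_measure.density_zero[OF lborel.sigma_finite_measure_axioms f])
 have bs: "sets (borel :: real measure) = sigma_sets UNIV (range (%a. {..a}))"
  by (subst borel_eq_atMost) (simp add: sets_measure_of)
 fix A :: "real set" assume "A \<in> sets lborel"
 hence A: "A \<in> sigma_sets UNIV (range (%a. {..a}))"
  by (simp add: bs)
 \<comment> \<open>Complements need the integral over the whole line, which is the limit of the
   half-lines \<open>{..real n}\<close>.\<close>
 have Z0: "(LBINT x. f x) = 0"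
 proof -
  have "(%n. LBINT x. ind {..real n} x * f x) ----> (LBINT x. f x)"
  proof (rule integral_dominated_convergence[where w="%x. abs(f x)"])
   show "AEL x. (%n. ind {..real n} x * f x) ----> f x"
   proof (rule AE_I2)
   fix x :: real
   obtain N where "x <= real N" using real_arch_simple by blast
   hence "\<forall>\<^sub>F n in sequentially. ind {..real n} x * f x = f x"
   by (intro eventually_sequentiallyI[of N]) (auto simp: ind_def)
   thus "(%n. ind {..real n} x * f x) ----> f x" by (rule tendsto_eventually)
   qed
  qed (use f in "auto simp: ind_def")
  thus ?thesis using z by (simp add: LIMSEQ_const_iff)
 qed
 have IS: "Int_stable (range (%a::real. {..a}))" by (auto simp: Int_stable_def)
 have PW: "range (%a::real. {..a}) \<subseteq> Pow UNIV" by auto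
 have ii: "L1 (%x. ind A x * f x)" if "A \<in> sets lborel" for A
  using integrable_mult_indicator[OF that f] by simp
 have "(LBINT x. ind A x * f x) = 0"
  using IS PW A
 proof (induction rule: sigma_sets_induct_disjoint)
  fix A :: "real set" assume "A \<in> range (%a. {..a})" thus "(LBINT x. ind A x * f x) = 0" using z by auto
 next
  show "(LBINT x. ind {} x * f x) = 0" by simp
 next
  fix A :: "real set" assume a: "A \<in> sigma_sets UNIV (range (%a. {..a}))" and h: "(LBINT x. ind A x * f x) = 0"
  have "A \<in> sets lborel" using a by (simp add: bs)
  hence "(LBINT x. f x - ind A x * f x) = 0" using f ii[of A] h Z0 by simp
  thus "(LBINT x. ind (UNIV - A) x * f x) = 0"
   by (rule trans[rotated]) (auto intro!: int_cong simp: ind_def)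
 next
  fix A :: "nat => real set" assume d: "disjoint_family A" and a: "range A \<subseteq> sigma_sets UNIV (range (%a. {..a}))"
   and h: "!!i. (LBINT x. ind (A i) x * f x) = 0"
  have "range A \<subseteq> sets lborel" using a by (simp add: bs)
  hence A: "!!i. A i \<in> sets lborel" by auto
  have "(LINT x:(\<Union>i. A i)|lborel. f x) = (\<Sum>i. LINT x:A i|lborel. f x)"
   using A d by (intro lebesgue_integral_countable_add) (auto simp: set_integrable_def disjoint_family_on_def intro!: ii)
  thus "(LBINT x. ind (\<Union>i. A i) x * f x) = 0"
   using h by (simp add: set_lebesgue_integral_def)
 qed
 thus "(LINT x:A|lborel. f x) = 0" by (simp add: set_lebesgue_integral_def)
qed

section \<open>Smooth functions, cut-offs and test functions\<close>

lemma pd_eq: "(f has_derivative f') (at z) ==> pd b f z = f' b"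
 unfolding pd_def using frechet_derivative_at by metis

lemma has_derivative_frechet: "f differentiable (at z) ==> (f has_derivative frechet_derivative f (at z)) (at z)"
 by (simp add: frechet_derivative_works)

lemma Ck_SucD: "Ck (Suc k) f ==> Ck k f"
proof (induction k arbitrary: f)
 case 0 thus ?case
  by (auto simp: continuous_on_eq_continuous_at intro: differentiable_imp_continuous_within)
next
 case (Suc k) thus ?case by (metis Ck.simps(2))
qed

lemma pd_const: "pd b (%z. c) = (%z. 0)"
 by (rule ext, rule pd_eq) (auto intro: deqs)

lemma Ck_const: "Ck k (%z. c)"
 by (induction k arbitrary: c) (auto simp: pd_const)

lemma pd_add:
 assumes "!!z. f differentiable (at z)" "!!z. g differentiable (at z)"
 shows "pd b (%z. f z + g z) = (%z. pd b f z + pd b g z)"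
proof (rule ext)
 fix z
 show "pd b (%z. f z + g z) z = pd b f z + pd b g z"
  using has_derivative_add[OF has_derivative_frechet[OF assms(1)] has_derivative_frechet[OF assms(2)]]
  by (subst pd_eq) (auto simp: pd_def)
qed

lemma pd_mult:
 assumes "!!z. f differentiable (at z)" "!!z. g differentiable (at z)"
 shows "pd b (%z. f z * g z) = (%z. f z * pd b g z + pd b f z * g z)"
proof (rule ext)
 fix z
 show "pd b (%z. f z * g z) z = f z * pd b g z + pd b f z * g z"
  using has_derivative_mult[OF has_derivative_frechet[OF assms(1)] has_derivative_frechet[OF assms(2)]]
  by (subst pd_eq) (auto simp: pd_def)
qed

lemma Ck_add: "Ck k f ==> Ck k g ==> Ck k (%z. f z + g z)"
 by (induction k arbitrary: f g) (auto intro!: cints differentiable_add simp: pd_add)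

lemma Ck_mult: "Ck k f ==> Ck k g ==> Ck k (%z. f z * g z)"
proof (induction k arbitrary: f g)
 case 0 thus ?case by (auto intro!: cints)
next
 case (Suc k)
 have "Ck k f" "Ck k g" using Suc.prems Ck_SucD by blast+
 thus ?case using Suc by (auto intro!: differentiable_mult Ck_add simp: pd_mult)
qed

lemma Ck_minus: "Ck k f ==> Ck k (%z. - f z)"
 using Ck_mult[OF Ck_const[of k "-1"], of f] by simp

lemma Ck_inverse:
 assumes "Ck k f" "!!z. f z ~= 0"
 shows "Ck k (%z. inverse (f z))"
 using assms
proof (induction k arbitrary: f)
 case 0 thus ?case by (auto intro!: cints)
next
 case (Suc k)
 have d: "f differentiable (at z)" for z using Suc by simp
 have hd: "((%z. inverse (f z)) has_derivative (%h. - (inverse (f z) * frechet_derivative f (at z) h * inverse (f z)))) (at z)" for z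
  by (rule Deriv.has_derivative_inverse[OF _ has_derivative_frechet[OF d]]) (use Suc in auto)
 have p: "pd b (%z. inverse (f z)) = (%z. - (inverse (f z) * pd b f z * inverse (f z)))" for b
  by (rule ext) (subst pd_eq[OF hd], simp add: pd_def)
 have "Ck k f" using Suc Ck_SucD by blast
 hence "Ck k (%z. inverse (f z))" using Suc by blast
 hence "Ck k (pd b (%z. inverse (f z)))" if "b \<in> Basis" for b
  unfolding p using Suc.prems that by (intro Ck_minus Ck_mult) auto
 thus ?case using hd by (auto simp: differentiable_def)
qed

lemma Ck_compose_affine:
 fixes f :: "real => real"
 assumes l: "bounded_linear l"
 shows "Ck k f ==> Ck k (%z. f (l z + c))"
proof (induction k arbitrary: f)
 case 0
 have "continuous_on UNIV l" using l by (simp add: linear_continuous_on)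
 with 0 show ?case
  by (auto intro!: continuous_on_compose2[of UNIV f UNIV "%z. l z + c"] cints)
next
 case (Suc k)
 have d: "f differentiable (at y)" for y using Suc by simp
 have hl: "((%z. l z + c) has_derivative l) (at z)" for z
  by (auto intro!: deqs bounded_linear_imp_has_derivative[OF l])
 have hd: "((%z. f (l z + c)) has_derivative (%h. frechet_derivative f (at (l z + c)) (l h))) (at z)" for z
  using has_derivative_compose[OF hl has_derivative_frechet[OF d]] by simp
 have lin: "frechet_derivative f (at y) h = h * pd 1 f y" for y h
 proof -
  have "linear (frechet_derivative f (at y))" by (rule linear_frechet_derivative[OF d])
  from linear_scale[OF this, of h 1] show ?thesis by (simp add: pd_def)
 qed
 have p: "pd b (%z. f (l z + c)) = (%z. l b * pd 1 f (l z + c))" for b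
  by (rule ext) (subst pd_eq[OF hd], simp add: lin)
 have "Ck k (pd 1 f)" using Suc by simp
 hence "Ck k (%z. pd 1 f (l z + c))" by (rule Suc.IH)
 hence "Ck k (pd b (%z. f (l z + c)))" for b
  unfolding p by (intro Ck_mult Ck_const)
 thus ?case using hd by (auto simp: differentiable_def)
qed

lemma pd_1_real: "(f has_real_derivative d) (at x) ==> pd 1 f x = d"
 using pd_eq[of f "(*) d" x 1] by (simp add: has_field_derivative_def)

lemma Ck_Suc_realI:
 assumes "!!x. (f has_real_derivative f' x) (at x)" "Ck k f'"
 shows "Ck (Suc k) f"
proof -
 have "pd 1 f = f'" using assms pd_1_real by blast
 thus ?thesis using assms
  by (auto simp: real_differentiable_def)
qed

lemma Ck_sin_cos: "Ck k (%x::real. sin (c * x))" "Ck k (%x::real. cos (c * x))"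
proof (induction k)
 case 0
 { case 1 show ?case by (auto intro!: cints) }
 { case 2 show ?case by (auto intro!: cints) }
next
 case (Suc k)
 { case 1 show ?case
   by (rule Ck_Suc_realI[where f'="%x. c * cos (c * x)"]) (auto intro!: deqs Ck_mult Ck_const Suc) }
 { case 2 show ?case
   by (rule Ck_Suc_realI[where f'="%x. (- c) * sin (c * x)"]) (auto intro!: deqs Ck_mult Ck_const Suc Ck_minus) }
qed

text \<open>The power of x in the denominator makes the family closed under differentiation up to
  linear combinations, so smoothness of all members is a single induction over the order, without
  polynomials in 1/x.\<close>

definition flat_exp :: "nat => real => real" where
 "flat_exp m x = (if x > 0 then exp (- 1 / x) / x ^ m else 0)"

text \<open>One term of the exponential series suffices: exp (1/x) is at least (1/x)^(m+2) / (m+2)!.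
  The surplus of two powers leaves a quadratic bound, which makes both the value and the derivative
  at the origin zero.\<close>

lemma flat_exp_bound: "abs(flat_exp m x) <= fact (m + 2) * x^2"
proof (cases "x > 0")
 case True
 have "inverse x ^ (m + 2) / fact (m + 2) <= exp (inverse x)"
  using exp_lower_Taylor_quadratic
 proof -
  have "(\<Sum>k<m+3. inverse x ^ k / fact k) <= (\<Sum>k. inverse x ^ k / fact k)"
   using True by (intro sum_le_suminf) (auto simp: summable_exp_generic[of "inverse x", simplified] divide_inverse mult.commute)
  moreover have "inverse x ^ (m + 2) / fact (m + 2) <= (\<Sum>k<m+3. inverse x ^ k / fact k)"
   using True by (intro member_le_sum) auto
  ultimately show ?thesis by (simp add: exp_def scaleR_conv_of_real divide_inverse mult.commute)
 qed
 hence "1 / exp (inverse x) <= fact (m+2) * x ^ (m + 2)"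
  using True by (simp add: divide_simps power_inverse del: fact_Suc power_Suc add_2_eq_Suc') (simp add: mult_ac del: fact_Suc power_Suc add_2_eq_Suc')
 moreover have "exp (- 1 / x) = 1 / exp (inverse x)" by (simp add: exp_minus divide_inverse)
 ultimately have e: "exp (- 1 / x) <= fact (m+2) * x ^ (m + 2)" by simp
 have "exp (- 1 / x) / x ^ m <= fact (m + 2) * x ^ (m + 2) / x ^ m"
  by (rule divide_right_mono[OF e]) (use True in simp)
 also have "... = fact (m + 2) * x^2" using True by (simp add: power_add del: fact_Suc add_2_eq_Suc')
 finally have "exp (- 1 / x) / x ^ m <= fact (m + 2) * x^2" .
 thus ?thesis using True by (simp add: flat_exp_def)
qed (auto simp: flat_exp_def)

lemma flat_exp_deriv: "(flat_exp m has_real_derivative (- real m * flat_exp (m + 1) x + flat_exp (m + 2) x)) (at x)"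
proof -
 consider "x > 0" | "x < 0" | "x = 0" by linarith
 thus ?thesis
 proof cases
  case 1
  have "((%x. exp (- 1 / x) / x ^ m) has_real_derivative (- real m * flat_exp (m + 1) x + flat_exp (m + 2) x)) (at x)"
  proof (cases m)
   case 0
   thus ?thesis using 1 by (auto intro!: deqs simp: flat_exp_def power2_eq_square)
  next
   case (Suc n)
   thus ?thesis using 1
   by (auto intro!: deqs simp: flat_exp_def field_simps power2_eq_square power_add) (cases n; simp)
  qed
  moreover have "eventually (%y. exp (- 1 / y) / y ^ m = flat_exp m y) (nhds x)"
   using eventually_nhds_in_open[of "{0<..}" x] 1 by (auto elim!: eventually_mono simp: flat_exp_def)
  ultimately show ?thesis by (rule DERIV_cong_ev[THEN iffD1, rotated -1, OF _ refl _ refl])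
 next
  case 2
  have "((%x. 0) has_real_derivative (- real m * flat_exp (m + 1) x + flat_exp (m + 2) x)) (at x)"
   using 2 by (auto simp: flat_exp_def)
  moreover have "eventually (%y. 0 = flat_exp m y) (nhds x)"
   using eventually_nhds_in_open[of "{..<0}" x] 2 by (auto elim!: eventually_mono simp: flat_exp_def)
  ultimately show ?thesis by (rule DERIV_cong_ev[THEN iffD1, rotated -1, OF _ refl _ refl])
 next
  case 3
  have "(%h. flat_exp m h / h) \<midarrow>0\<rightarrow> 0"
  proof (rule Lim_null_comparison)
   show "\<forall>\<^sub>F h in at 0. norm (flat_exp m h / h) <= fact (m + 2) * abs(h)"
   proof (rule always_eventually, rule allI)
   fix h :: real
   show "norm (flat_exp m h / h) <= fact (m + 2) * abs(h)"
   proof (cases "h = 0")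
   case False
   have "abs(flat_exp m h) <= (fact (m + 2) * abs(h)) * abs(h)"
   using flat_exp_bound[of m h] by (simp add: power2_eq_square mult.assoc)
   thus ?thesis using False by (simp add: divide_le_eq abs_mult)
   qed simp
   qed
   show "((%h. fact (m + 2) * abs(h)) \<longlongrightarrow> 0) (at (0::real))"
   by (auto intro!: tendsto_eq_intros)
  qed
  thus ?thesis using 3 by (simp add: DERIV_def flat_exp_def)
 qed
qed

lemma Ck_flat_exp: "Ck k (flat_exp m)"
proof (induction k arbitrary: m)
 case 0
 show ?case using flat_exp_deriv by (auto simp: continuous_on_eq_continuous_at intro: DERIV_isCont)
next
 case (Suc k)
 show ?case
  by (rule Ck_Suc_realI[OF flat_exp_deriv]) (intro Ck_add Ck_mult Ck_const Suc)
qed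

text \<open>The denominator of flat_exp 0 x / (flat_exp 0 x + flat_exp 0 (1 - x)) never vanishes, so
  the quotient is smooth. Every cut-off below is a rescaled copy; the bound \<open>C\<close> and the
  vanishing of \<open>th'\<close> outside [0, 1] show how large the derivative of such a copy is,
  and where.\<close>

lemma smooth_step:
 obtains th th' :: "real => real" and C :: real
 where "!!k. Ck k th" "!!x. (th has_real_derivative th' x) (at x)" "continuous_on UNIV th'"
  "!!x. 0 <= th x" "!!x. th x <= 1" "!!x. x <= 0 ==> th x = 0" "!!x. x >= 1 ==> th x = 1"
  "!!x. abs(th' x) <= C" "!!x. x < 0 \<or> x > 1 ==> th' x = 0"
proof -
 define d where "d = (%x. flat_exp 0 x + flat_exp 0 (1 - x))"
 define th where "th = (%x. flat_exp 0 x * inverse (d x))"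
 have dp: "d x > 0" for x unfolding d_def flat_exp_def
  by (cases "x > 0"; cases "x < 1") (auto intro: add_pos_pos)
 have nn: "flat_exp 0 x >= 0" for x by (simp add: flat_exp_def)
 have "Ck k d" for k
  using Ck_compose_affine[of "%x. - x" k "flat_exp 0" 1] Ck_flat_exp
  unfolding d_def by (intro Ck_add) (auto simp: bounded_linear_minus[OF bounded_linear_ident])
 hence C: "Ck k th" for k
  unfolding th_def using dp by (intro Ck_mult Ck_inverse Ck_flat_exp) (auto simp: less_imp_neq[symmetric])
 define th' where "th' = deriv th"
 have D: "(th has_real_derivative th' x) (at x)" for x
 proof -
  have "th differentiable (at x)" using C[of 1] by simp
  thus ?thesis unfolding th'_def by (simp add: DERIV_deriv_iff_real_differentiable)
 qed
 have "pd 1 th = th'" using D pd_1_real by blast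
 hence cont: "continuous_on UNIV th'" using C[of 1] by simp
 have z: "th' x = 0" if "x < 0 \<or> x > 1" for x
 proof (cases "x < 0")
  case True
  have "eventually (%y. 0 = th y) (nhds x)"
   using eventually_nhds_in_open[of "{..<0}" x] True by (auto elim!: eventually_mono simp: flat_exp_def th_def)
  hence "(th has_real_derivative 0) (at x)" using DERIV_cong_ev[OF refl _ refl, of "%y. 0" th x 0] by simp
  thus ?thesis using D DERIV_unique by blast
 next
  case False
  hence "x > 1" using that by simp
  have "eventually (%y. 1 = th y) (nhds x)"
   using eventually_nhds_in_open[of "{1<..}" x] \<open>x > 1\<close> by (auto elim!: eventually_mono simp: flat_exp_def th_def d_def)
  hence "(th has_real_derivative 0) (at x)" using DERIV_cong_ev[OF refl _ refl, of "%y. 1" th x 0] by simp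
  thus ?thesis using D DERIV_unique by blast
 qed
 have "compact (th' ` {0..1})" by (intro compact_continuous_image continuous_on_subset[OF cont]) auto
 then obtain c where c: "!!x. x \<in> {0..1} ==> norm (th' x) <= c"
  using compact_imp_bounded bounded_iff by (metis imageI)
 have "abs(th' x) <= abs(c)" for x using c[of x] z[of x] by (cases "x \<in> {0..1}") auto
 thus ?thesis
 proof (intro that[of th th' "abs(c)"])
  fix x :: real
  show "0 <= th x" using dp[of x] nn[of x] by (simp add: th_def)
  show "th x <= 1" using dp[of x] nn[of "1-x"] by (simp add: th_def d_def field_simps)
  show "x <= 0 ==> th x = 0" by (simp add: th_def flat_exp_def)
  show "x >= 1 ==> th x = 1" by (simp add: th_def flat_exp_def d_def)
 qed (use C D cont z in auto)
qed

lemma test_funI: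
 assumes "!!k. Ck k ph" "compact K" "K \<subseteq> Om" "!!z. z ~: K ==> ph z = 0"
 shows "test_fun Om ph"
proof -
 have "closure {z. ph z ~= 0} \<subseteq> K"
  using assms(2,4) by (intro closure_minimal) (auto intro: compact_imp_closed)
 moreover have "compact (closure {z. ph z ~= 0})"
  using compact_Int_closed[OF assms(2) closed_closure, of "{z. ph z ~= 0}"] calculation
  by (simp add: Int_absorb1 inf.absorb2)
 ultimately show ?thesis using assms unfolding test_fun_def by blast
qed

lemma test_fun_differentiable: "test_fun Om ph ==> ph differentiable (at z)"
 unfolding test_fun_def by (metis Ck.simps(2))

lemma pd_zero_locally:
 assumes "open U" "z \<in> U" "!!y. y \<in> U ==> ph y = 0"
 shows "pd b ph z = 0"
proof -
 have "(ph has_derivative (%h. 0)) (at z)"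
  by (rule has_derivative_transform_within_open[of "%_. 0" _ _ _ U]) (use assms in auto)
 thus ?thesis by (simp add: pd_eq)
qed

lemma test_fun_support:
 assumes "test_fun Om ph"
 obtains K where "compact K" "K \<subseteq> Om" "!!z. z ~: K ==> ph z = 0" "!!b z. z ~: K ==> pd b ph z = 0"
proof (rule that[of "closure {z. ph z ~= 0}"])
 show "pd b ph z = 0" if "z ~: closure {z. ph z ~= 0}" for b z
  by (rule pd_zero_locally[of "- closure {z. ph z ~= 0}"]) (use that closure_subset[of "{z. ph z ~= 0}"] in auto)
qed (use assms closure_subset[of "{z. ph z ~= 0}"] in "auto simp: test_fun_def")

lemma test_fun_zero:
 assumes "test_fun Om ph" "z ~: Om"
 shows "ph z = 0" "pd b ph z = 0"
 using test_fun_support[OF assms(1)] assms(2) by (metis subsetD)+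

lemma test_fun_pd: "test_fun Om ph ==> b \<in> Basis ==> test_fun Om (pd b ph)"
proof -
 assume a: "test_fun Om ph" "b \<in> Basis"
 obtain K where K: "compact K" "K \<subseteq> Om" "!!z. z ~: K ==> pd b ph z = 0"
  using test_fun_support[OF a(1)] by metis
 show ?thesis
 proof (rule test_funI[OF _ K])
  fix k
  have "Ck (Suc k) ph" using a by (simp add: test_fun_def del: Ck.simps)
  thus "Ck k (pd b ph)" using a by simp
 qed
qed

lemma test_fun_continuous: "test_fun Om ph ==> continuous_on UNIV ph"
 unfolding test_fun_def by (metis Ck.simps(1))

lemma test_fun_measurable: "test_fun Om ph ==> ph \<in> BM"
 by (rule bm_cont) (rule test_fun_continuous)

lemma test_fun_bounded:
 assumes "test_fun Om ph"
 obtains C where "!!z. abs(ph z) <= C" "C >= 0"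
proof -
 obtain K where K: "compact K" "K \<subseteq> Om" "!!z. z ~: K ==> ph z = 0"
  using test_fun_support[OF assms] by metis
 have "compact (ph ` K)"
  by (intro compact_continuous_image K continuous_on_subset[OF test_fun_continuous[OF assms]]) auto
 then obtain c where c: "!!x. x \<in> K ==> norm (ph x) <= c"
  using compact_imp_bounded bounded_iff by (metis imageI)
 have "abs(ph z) <= abs(c)" for z using c[of z] K(3)[of z] by (cases "z \<in> K") auto
 thus ?thesis using that[of "abs(c)"] by auto
qed

lemma test_fun_mono: "test_fun Om ph ==> Om \<subseteq> Om' ==> test_fun Om' ph"
 unfolding test_fun_def by blast

lemma pd_fst:
 assumes "ph differentiable (at (x, y))"
 shows "((%x. ph (x, y)) has_real_derivative pd (1, 0) ph (x, y)) (at x)"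
proof -
 have 1: "((%x::real. (x, y)) has_derivative (%h. (h, 0))) (at x)"
  by (auto intro!: deqs)
 have "((%x. ph (x, y)) has_derivative (%h. frechet_derivative ph (at (x, y)) (h, 0))) (at x)"
  using has_derivative_compose[OF 1 has_derivative_frechet[OF assms]] .
 moreover have "frechet_derivative ph (at (x, y)) (h, 0) = pd (1, 0) ph (x, y) * h" for h :: real
  using linear_scale[OF linear_frechet_derivative[OF assms], of h "(1,0)"] by (simp add: pd_def)
 ultimately show ?thesis by (simp add: has_field_derivative_def)
qed

lemma pd_snd:
 assumes "ph differentiable (at (x, y))"
 shows "((%y. ph (x, y)) has_real_derivative pd (0, 1) ph (x, y)) (at y)"
proof -
 have 1: "((%y::real. (x, y)) has_derivative (%h. (0, h))) (at y)"
  by (auto intro!: deqs)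
 have "((%y. ph (x, y)) has_derivative (%h. frechet_derivative ph (at (x, y)) (0, h))) (at y)"
  using has_derivative_compose[OF 1 has_derivative_frechet[OF assms]] .
 moreover have "frechet_derivative ph (at (x, y)) (0, h) = pd (0, 1) ph (x, y) * h" for h :: real
  using linear_scale[OF linear_frechet_derivative[OF assms], of h "(0,1)"] by (simp add: pd_def)
 ultimately show ?thesis by (simp add: has_field_derivative_def)
qed

lemma Basis_real2: "(1::real, 0::real) \<in> Basis" "(0::real, 1::real) \<in> Basis"
 by (auto simp: Basis_prod_def)

text \<open>The fundamental theorem in time writes an increment of \<open>ph\<close> as an integral
  of \<open>pd (0,1) ph\<close>. Differentiating under the integral in x, and the result again in
  its upper limit, produces both orders of differentiation.\<close>

lemma pd_mixed:
 assumes t: "test_fun Om (ph :: real * real => real)"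
 shows "pd (0, 1) (pd (1, 0) ph) = pd (1, 0) (pd (0, 1) ph)"
proof (rule ext, clarify)
 fix x t0 :: real
 define b where "b = t0 + 1"
 define a where "a = t0 - 1"
 define ps where "ps = pd (1,0) (pd (0,1) ph)"
 have tt: "test_fun Om (pd (1,0) ph)" "test_fun Om (pd (0,1) ph)" "test_fun Om ps"
  using t Basis_real2 by (auto simp: ps_def intro!: test_fun_pd)
 have c: "continuous_on UNIV (pd (0,1) ph)" "continuous_on UNIV ps" using tt test_fun_continuous by blast+
 have key: "pd (1,0) ph (x, s) - pd (1,0) ph (x, a) = integral {a..s} (%r. ps (x, r))" if "s \<in> {a..b}" for s
 proof -
  have ab: "a <= s" using that by auto
  have i: "integral {a..s} (%r. pd (0,1) ph (y, r)) = ph (y, s) - ph (y, a)" for y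
   by (intro integral_unique fundamental_theorem_of_calculus ab)
   (auto intro!: has_field_derivative_at_within pd_snd test_fun_differentiable[OF t] simp flip: has_real_derivative_iff_has_vector_derivative)
  have "((%y. integral (cbox a s) (%r. pd (0,1) ph (y, r))) has_field_derivative integral (cbox a s) (%r. ps (x, r))) (at x within UNIV)"
  proof (rule leibniz_rule_field_derivative)
   show "((%x. pd (0, 1) ph (x, t)) has_field_derivative ps (y, t)) (at y within UNIV)" for y t
   unfolding ps_def by (rule pd_fst) (rule test_fun_differentiable[OF tt(2)])
   show "(%r. pd (0, 1) ph (y, r)) integrable_on cbox a s" for y
   by (intro integrable_continuous continuous_on_compose2[OF c(1)]) (auto intro!: cints)
   show "continuous_on (UNIV \<times> cbox a s) (%(x, t). ps (x, t))"
   using continuous_on_subset[OF c(2), of "UNIV \<times> cbox a s"] by (simp add: case_prod_beta')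
  qed auto
  hence "((%y. ph (y, s) - ph (y, a)) has_field_derivative integral {a..s} (%r. ps (x, r))) (at x)"
   by (simp add: i)
  moreover have "((%y. ph (y, s) - ph (y, a)) has_field_derivative pd (1,0) ph (x, s) - pd (1,0) ph (x, a)) (at x)"
   by (intro derivative_intros pd_fst test_fun_differentiable[OF t])
  ultimately show ?thesis by (rule DERIV_unique[symmetric])
 qed
 have "((%s. integral {a..s} (%r. ps (x, r))) has_real_derivative ps (x, t0)) (at t0 within {a..b})"
  by (rule integral_has_real_derivative) (auto simp: a_def b_def intro!: continuous_on_compose2[OF c(2)] cints)
 hence "((%s. pd (1,0) ph (x, s) - pd (1,0) ph (x, a)) has_real_derivative ps (x, t0)) (at t0 within {a..b})"
  by (rule has_field_derivative_transform_within[where d=1]) (use key in "auto simp: a_def b_def")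
 hence "((%s. pd (1,0) ph (x, s) - pd (1,0) ph (x, a)) has_real_derivative ps (x, t0)) (at t0)"
  by (subst (asm) at_within_interior) (auto simp: a_def b_def)
 moreover have "((%s. pd (1,0) ph (x, s) - pd (1,0) ph (x, a)) has_real_derivative pd (0,1) (pd (1,0) ph) (x, t0)) (at t0)"
  by (auto intro!: deqs pd_snd test_fun_differentiable[OF tt(1)])
 ultimately show "pd (0, 1) (pd (1, 0) ph) (x, t0) = pd (1, 0) (pd (0, 1) ph) (x, t0)"
  unfolding ps_def by (rule DERIV_unique[symmetric])
qed

section \<open>Fourier analysis on the unit interval\<close>

text \<open>This is the k-th Fourier sine coefficient and not the cardinal sine. Its arguments
  vanish outside (0, 1) in all applications, so the integral may run over the whole line.\<close>

definition sinc :: "nat => (real => real) => real" where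
 "sinc k f = (LBINT x. f x * sin (real k * pi * x))"

definition cosc :: "nat => (real => real) => real" where
 "cosc k f = (LBINT x. f x * cos (real k * pi * x))"

lemma i_trig:
 assumes "L1 (f :: real => real)"
 shows "L1 (%x. f x * sin (c * x))" "L1 (%x. f x * cos (c * x))"
  "L1 (%x. f x * sin (c * x) * cos (d * x) ^ m)" "L1 (%x. f x * cos (c * x) * cos (d * x) ^ m)"
  "L1 (%x. f x * cos (d * x) ^ m)"
proof -
 have 1: "L1 (%x. f x * cos (d * x) ^ m)" if "L1 f" for f :: "real => real"
  by (rule imb[OF that, where C=1]) (auto simp: power_abs power_le_one)
 show 2: "L1 (%x. f x * sin (c * x))" "L1 (%x. f x * cos (c * x))"
  by (rule imb[OF assms, where C=1]; simp)+
 from 1[OF 2(1)] 1[OF 2(2)] 1[OF assms] show "L1 (%x. f x * sin (c * x) * cos (d * x) ^ m)" "L1 (%x. f x * cos (c * x) * cos (d * x) ^ m)"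
  "L1 (%x. f x * cos (d * x) ^ m)"
  by simp_all
qed

text \<open>On (0, 1) the function cos (pi x) is strictly decreasing, so it can serve as the
  variable. Stone-Weierstrass passes from its powers to all continuous functions of it, and these
  approximate indicators of half-lines.\<close>

lemma cos_moments_zero:
 assumes f: "L1 (f :: real => real)" and z: "!!x. x ~: {0<..<1} ==> f x = 0"
  and mom: "!!m. (LBINT x. f x * cos (pi * x) ^ m) = 0"
 shows "AEL x. f x = 0"
proof (rule AE_zero_if_interval_integrals_zero[OF f])
 have [measurable]: "f \<in> BM" using f by auto
 have H: "(LBINT x. f x * h (cos (pi * x))) = 0" if h: "continuous_on UNIV h" for h :: "real => real"
 proof -
  define A where "A = (LBINT x. abs(f x))"
  have A0: "A >= 0" by (simp add: A_def)
  have hm[measurable]: "h \<in> BM" using h by (rule bm_cont)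
  have "compact (h ` {-1..1})" by (intro compact_continuous_image continuous_on_subset[OF h]) auto
  from compact_imp_bounded[OF this] obtain C where C: "!!x. x \<in> {-1..1} ==> norm (h x) <= C"
   unfolding bounded_iff by blast
  have "abs(h (cos (pi * x))) <= C" for x using C[of "cos (pi * x)"] by simp
  hence ih: "L1 (%x. f x * h (cos (pi * x)))"
   by (intro imb(1)[OF f, where C=C]) simp_all
  have "abs(\<integral>x. f x * h (cos (pi * x)) \<partial>lborel) <= e * (A + 1)" if "e > 0" for e
  proof -
   obtain g where g: "real_polynomial_function g" "!!x. x \<in> {-1..1} ==> abs(h x - g x) < e"
   using Stone_Weierstrass_real_polynomial_function[OF compact_Icc continuous_on_subset[OF h subset_UNIV] \<open>e > 0\<close>, of "-1" 1] by blast
   then obtain a n where gn: "g = (%x. \<Sum>i\<le>n. a i * x ^ i)" using real_polynomial_function_iff_sum by blast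
   define P where "P = (%i x. f x * cos (pi * x) ^ i)"
   have iP: "L1 (P i)" for i unfolding P_def by (rule i_trig(5)[OF f])
   have eP: "(%x. f x * g (cos (pi * x))) = (%x. \<Sum>i\<le>n. a i * P i x)"
   unfolding gn P_def sum_distrib_left by (intro ext sum.cong refl) (rule mult.left_commute)
   have ig: "L1 (%x. f x * g (cos (pi * x)))"
   unfolding eP by (intro Bochner_Integration.integrable_sum i_mr iP)
   have "(LBINT x. f x * g (cos (pi * x))) = (\<Sum>i\<le>n. LBINT x. a i * P i x)"
   unfolding eP by (intro int_sum i_mr iP)
   also have "... = (\<Sum>i\<le>n. a i * (LBINT x. P i x))" by simp
   also have "... = 0" using mom unfolding P_def by simp
   finally have g0: "(LBINT x. f x * g (cos (pi * x))) = 0" .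
   have "abs(\<integral>x. f x * h (cos (pi * x)) \<partial>lborel) = abs(\<integral>x. f x * h (cos (pi * x)) - f x * g (cos (pi * x)) \<partial>lborel)"
   using g0 by (subst int_diff[OF ih ig]) simp
   also have "... <= (LBINT x. abs(f x * h (cos (pi * x)) - f x * g (cos (pi * x))))"
   by (rule iab)
   also have "... <= (LBINT x. e * abs(f x))"
   proof (rule integral_mono)
   show "L1 (%x. abs(f x * h (cos (pi * x)) - f x * g (cos (pi * x))))" by (intro integrable_abs i_diff ih ig)
   show "L1 (%x. e * abs(f x))" by (intro i_mr integrable_abs f)
   fix x
   have "abs(h (cos (pi * x)) - g (cos (pi * x))) < e" by (rule g(2)) simp
   hence "abs(h (cos (pi * x)) - g (cos (pi * x))) <= e" by (rule less_imp_le)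
   hence "abs(f x) * abs(h (cos (pi * x)) - g (cos (pi * x))) <= abs(f x) * e" by (rule mlm) simp
   thus "abs(f x * h (cos (pi * x)) - f x * g (cos (pi * x))) <= e * abs(f x)"
   by (simp add: abs_mult mult.commute flip: right_diff_distrib)
   qed
   also have "... = e * A" by (simp add: A_def)
   finally show ?thesis using \<open>e > 0\<close> by (simp add: alg)
  qed
  note le = this
  show ?thesis
  proof (rule ccontr)
   assume ne: "(LBINT x. f x * h (cos (pi * x))) ~= 0"
   define I where "I = abs(\<integral>x. f x * h (cos (pi * x)) \<partial>lborel)"
   have "I > 0" using ne by (simp add: I_def)
   hence "I / (2 * (A + 1)) > 0" using A0 by simp
   from le[OF this] have "I <= I / (2 * (A + 1)) * (A + 1)" by (simp only: I_def)
   also have "... = I / 2" using A0 by (simp add: field_simps)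
   finally show False using \<open>I > 0\<close> by simp
  qed
 qed
 fix b :: real
 consider "b <= 0" | "b >= 1" | "0 < b" "b < 1" by linarith
 thus "(LBINT x. ind {..b} x * f x) = 0"
 proof cases
  case 1
  hence "(%x. ind {..b} x * f x) = (%x. 0)" using z by (intro ext) (auto simp: ind_def)
  thus ?thesis by simp
 next
  case 2
  hence "(%x. ind {..b} x * f x) = f" using z by (intro ext) (auto simp: ind_def)
  thus ?thesis using mom[of 0] by simp
 next
  case 3
  \<comment> \<open>A ramp of slope n that reaches 1 at the level cos (pi b). As the cosine
    decreases, \<open>h n (cos (pi * x))\<close> equals 1 for x at most b and becomes 0 for every
    larger x once n is large.\<close>
  define h where "h = (%n y. max 0 (min 1 (1 + real n * (y - cos (pi * b)))))"
  have hc: "continuous_on UNIV (h n)" for n unfolding h_def by (intro cints)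
  have hm[measurable]: "h n \<in> BM" for n using hc by (rule bm_cont)
  have "(%n. LBINT x. f x * h n (cos (pi * x))) ----> (LBINT x. ind {..b} x * f x)"
  proof (rule integral_dominated_convergence[where w="%x. abs(f x)"])
   show "AEL x. (%n. f x * h n (cos (pi * x))) ----> ind {..b} x * f x"
   proof (rule AE_I2)
   fix x :: real
   show "(%n. f x * h n (cos (pi * x))) ----> ind {..b} x * f x"
   proof (cases "x \<in> {0<..<1}")
   case False thus ?thesis using z by simp
   next
   case True
   show ?thesis
   proof (cases "x <= b")
   case xb: True
   have "cos (pi * b) <= cos (pi * x)" using True 3 xb by (intro cos_monotone_0_pi_le) auto
   hence "h n (cos (pi * x)) = 1" for n by (simp add: h_def)
   thus ?thesis using xb by simp
   next
   case xb: False
   have lt: "cos (pi * x) < cos (pi * b)" using True 3 xb by (intro cos_monotone_0_pi) auto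
   obtain N where N: "1 / (cos (pi * b) - cos (pi * x)) < real N" using reals_Archimedean2 by blast
   have "f x * h n (cos (pi * x)) = ind {..b} x * f x" if "n >= N" for n
   proof -
   have "1 / (cos (pi * b) - cos (pi * x)) < real n" using N that by linarith
   hence "1 < real n * (cos (pi * b) - cos (pi * x))" using lt by (simp add: divide_less_eq)
   also have "... = - (real n * (cos (pi * x) - cos (pi * b)))" by (simp add: right_diff_distrib)
   finally have "h n (cos (pi * x)) = 0" unfolding h_def by simp
   thus ?thesis using xb by simp
   qed
   thus ?thesis by (intro tendsto_eventually eventually_sequentiallyI[of N]) auto
   qed
   qed
   qed
   show "AEL x. norm (f x * h n (cos (pi * x))) <= abs(f x)" for n
   by (rule AE_I2) (auto simp: h_def abs_mult intro!: mult_left_le)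
  qed (use f in auto)
  thus ?thesis using H[OF hc] by (simp add: LIMSEQ_const_iff)
 qed
qed

text \<open>The formula 2 sin (k a) cos a = sin ((k+1) a) + sin ((k-1) a) trades one power of the
  cosine for neighbouring sine modes. Hence all cosine moments of f(x) sin (pi x) vanish, and the
  factor sin (pi x) is positive on (0, 1) and can be divided out.\<close>

lemma sin_uniqueness:
 assumes f: "L1 (f :: real => real)" and z: "!!x. x ~: {0<..<1} ==> f x = 0"
  and s: "!!k. sinc k f = 0"
 shows "AEL x. f x = 0"
proof -
 have *: "(LBINT x. f x * sin (real k * pi * x) * cos (pi * x) ^ m) = 0" for k m
 proof (induction m arbitrary: k)
  case 0 thus ?case using s[of k] by (simp add: sinc_def)
 next
  case (Suc m)
  show ?case
  proof (cases k)
   case (Suc j)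
   have e: "f x * sin (real k * pi * x) * cos (pi * x) ^ Suc m =
   (f x * sin (real (k + 1) * pi * x) * cos (pi * x) ^ m + f x * sin (real j * pi * x) * cos (pi * x) ^ m) / 2" for x
   proof -
   have e1: "sin (real (k + 1) * pi * x) = sin (real k * pi * x) * cos (pi * x) + cos (real k * pi * x) * sin (pi * x)"
   using sin_add[of "real k * pi * x" "pi * x"] by (simp add: alg)
   have e2: "sin (real j * pi * x) = sin (real k * pi * x) * cos (pi * x) - cos (real k * pi * x) * sin (pi * x)"
   using sin_diff[of "real k * pi * x" "pi * x"] by (simp add: Suc alg)
   show ?thesis unfolding e1 e2 by (simp add: field_simps)
   qed
   show ?thesis unfolding e
   using i_trig(3)[OF f, of "real (k+1) * pi" pi m] i_trig(3)[OF f, of "real j * pi" pi m] Suc.IH[of "k+1"] Suc.IH[of j]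
   by (simp del: of_nat_add)
  qed simp
 qed
 have "AEL x. f x * sin (pi * x) = 0"
  by (rule cos_moments_zero) (use *[of 1] z i_trig(1)[OF f, of pi] in auto)
 thus ?thesis
 proof eventually_elim
  case (elim x)
  show ?case
  proof (cases "x \<in> {0<..<1}")
   case True
   hence "sin (pi * x) > 0" by (intro sin_gt_zero) auto
   thus ?thesis using elim by simp
  qed (use z in auto)
 qed
qed

text \<open>The recursion of \<open>sin_uniqueness\<close> for cosines. Mode 0 is treated apart,
  since it has no left neighbour: there the extra factor cos (pi x) is mode 1 itself.\<close>

lemma cos_uniqueness:
 assumes f: "L1 (f :: real => real)" and z: "!!x. x ~: {0<..<1} ==> f x = 0"
  and s: "!!k. cosc k f = 0"
 shows "AEL x. f x = 0"
proof -
 have *: "(LBINT x. f x * cos (real k * pi * x) * cos (pi * x) ^ m) = 0" for k m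
 proof (induction m arbitrary: k)
  case 0 thus ?case using s[of k] by (simp add: cosc_def)
 next
  case (Suc m)
  show ?case
  proof (cases k)
   case 0
   show ?thesis using Suc.IH[of 1] by (simp add: 0 mult.assoc)
  next
   case (Suc j)
   have e: "f x * cos (real k * pi * x) * cos (pi * x) ^ Suc m =
   (f x * cos (real (k + 1) * pi * x) * cos (pi * x) ^ m + f x * cos (real j * pi * x) * cos (pi * x) ^ m) / 2" for x
   proof -
   have e1: "cos (real (k + 1) * pi * x) = cos (real k * pi * x) * cos (pi * x) - sin (real k * pi * x) * sin (pi * x)"
   using cos_add[of "real k * pi * x" "pi * x"] by (simp add: alg)
   have e2: "cos (real j * pi * x) = cos (real k * pi * x) * cos (pi * x) + sin (real k * pi * x) * sin (pi * x)"
   using cos_diff[of "real k * pi * x" "pi * x"] by (simp add: Suc alg)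
   show ?thesis unfolding e1 e2 by (simp add: field_simps)
   qed
   show ?thesis unfolding e
   using i_trig(4)[OF f, of "real (k+1) * pi" pi m] i_trig(4)[OF f, of "real j * pi" pi m] Suc.IH[of "k+1"] Suc.IH[of j]
   by (simp del: of_nat_add)
  qed
 qed
 show ?thesis
  by (rule cos_moments_zero) (use *[of 0] z f in auto)
qed

lemma integral_bounded_series:
 fixes g :: "'a => real" and e :: "nat => 'a => real"
 assumes g: "integrable M g" and e[measurable]: "!!k. e k \<in> borel_measurable M" and b: "!!k x. abs(e k x) <= 1"
  and a: "summable (%k. abs(a k))"
 shows "(%k. a k * (\<integral>x. g x * e k x \<partial>M)) sums (\<integral>x. g x * (\<Sum>k. a k * e k x) \<partial>M)"
  and "integrable M (%x. g x * (\<Sum>k. a k * e k x))"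
  and "summable (%k. abs(a k * (\<integral>x. g x * e k x \<partial>M)))"
proof -
 have [measurable]: "g \<in> borel_measurable M" using g by auto
 have ba: "abs(a k * e k x) <= abs(a k)" for k x using mlm[OF b[of k x], of "abs(a k)"] by (simp add: abs_mult)
 have sx: "summable (%k. abs(a k * e k x))" for x
  by (rule summable_comparison_test'[OF a, of 0]) (use ba in auto)
 have ig: "integrable M (%x. g x * e k x)" for k
  by (rule imb[OF g, where C=1]) (use b in auto)
 have i: "integrable M (%x. a k * (g x * e k x))" for k using ig by simp
 have n: "(\<integral>x. norm (a k * (g x * e k x)) \<partial>M) <= abs(a k) * (\<integral>x. abs(g x) \<partial>M)" for k
 proof -
  have "(\<integral>x. norm (a k * (g x * e k x)) \<partial>M) <= (\<integral>x. abs(a k) * abs(g x) \<partial>M)"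
  proof (rule integral_mono)
   fix x show "norm (a k * (g x * e k x)) <= abs(a k) * abs(g x)"
   using mlm[OF ba[of k x], of "abs(g x)"] by (simp add: abs_mult mult_ac)
  qed (use i g in auto)
  thus ?thesis by simp
 qed
 have s2: "summable (%k. \<integral>x. norm (a k * (g x * e k x)) \<partial>M)"
  by (rule summable_comparison_test'[of "%k. abs(a k) * (\<integral>x. abs(g x) \<partial>M)" 0]) (use n in "auto intro!: summable_mult2 a")
 have s1: "AE x in M. summable (%k. norm (a k * (g x * e k x)))"
 proof (rule AE_I2)
  fix x show "summable (%k. norm (a k * (g x * e k x)))"
   using summable_mult[OF sx[of x], of "abs(g x)"] by (simp add: abs_mult mult_ac)
 qed
 have e1: "(\<Sum>k. a k * (g x * e k x)) = g x * (\<Sum>k. a k * e k x)" for x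
  using suminf_mult[OF summable_rabs_cancel[OF sx[of x]], of "g x"] by (simp add: mult_ac)
 have "(%k. \<integral>x. a k * (g x * e k x) \<partial>M) sums (\<integral>x. (\<Sum>k. a k * (g x * e k x)) \<partial>M)"
  by (rule sums_integral[OF i s1 s2])
 thus "(%k. a k * (\<integral>x. g x * e k x \<partial>M)) sums (\<integral>x. g x * (\<Sum>k. a k * e k x) \<partial>M)"
  by (simp add: e1)
 show "integrable M (%x. g x * (\<Sum>k. a k * e k x))"
  using integrable_suminf[OF i s1 s2] by (simp add: e1)
 show "summable (%k. abs(a k * (\<integral>x. g x * e k x \<partial>M)))"
 proof (rule summable_comparison_test'[OF s2, of 0])
  fix k show "norm (abs(a k * (\<integral>x. g x * e k x \<partial>M))) <= (\<integral>x. norm (a k * (g x * e k x)) \<partial>M)"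
   using integral_norm_bound[of M "%x. a k * (g x * e k x)"] by simp
 qed
qed

lemma i01: "L1 (ind {0<..<1::real} :: real => real)"
 by (rule i_ind) auto

text \<open>The frequency is allowed to be any integer because products of two sines produce the
  differences j - k as well as the sums j + k.\<close>

lemma integral_cos_01:
 assumes "m \<in> \<int>"
 shows "(LBINT x. ind {0<..<1} x * cos (m * pi * x)) = (if m = 0 then 1 else 0)"
proof (cases "m = 0")
 case False
 have "(LBINT x. ind {0<..<1} x * cos (m * pi * x)) = (LBINT x. cos (m * pi * x) * ind {0..1} x)"
 proof (rule integral_cong_AE)
  have "AEL x. x ~= (0::real)" "AEL x. x ~= (1::real)"
   by (auto intro: AE_sing)
  thus "AEL x. ind {0<..<1} x * cos (m * pi * x) = cos (m * pi * x) * ind {0..1} x"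
   by eventually_elim (auto simp: ind_def)
 qed auto
 also have "... = sin (m * pi * 1) / (m * pi) - sin (m * pi * 0) / (m * pi)"
  by (rule integral_FTC_Icc_real) (use False in "auto intro!: deqs cints")
 also have "... = 0" using assms by (auto simp: sin_integer_2pi elim!: Ints_cases)
   (metis mult.commute sin_zero_iff_int2)
 finally show ?thesis using False by simp
qed (simp)

lemma sin_orthogonal:
 "(LBINT x. ind {0<..<1} x * (sin (real j * pi * x) * sin (real k * pi * x))) = (if j = k & k ~= 0 then 1 / 2 else 0)"
proof -
 have e: "ind {0<..<1} x * (sin (real j * pi * x) * sin (real k * pi * x)) =
  (ind {0<..<1} x * cos ((real j - real k) * pi * x) - ind {0<..<1} x * cos ((real j + real k) * pi * x)) / 2" for x :: real
  by (simp add: sin_times_sin alg)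
 have "(LBINT x. ind {0<..<1} x * (sin (real j * pi * x) * sin (real k * pi * x))) =
  ((LBINT x. ind {0<..<1} x * cos ((real j - real k) * pi * x)) - (LBINT x. ind {0<..<1} x * cos ((real j + real k) * pi * x))) / 2"
  unfolding e using i_trig(2)[OF i01] by simp
 thus ?thesis by (subst (asm) (1 2) integral_cos_01) auto
qed

text \<open>The factor 2 is the reciprocal of the squared norm 1/2 of a sine mode on (0, 1), so that
  \<open>a\<close> is the sequence of unnormalised coefficients \<open>sinc\<close>.\<close>

definition sin_series :: "(nat => real) => real => real" where
 "sin_series a x = (\<Sum>k. 2 * a k * sin (real k * pi * x))"

lemma summable_sin_series:
 assumes "summable (%k. abs(a k))"
 shows "summable (%k. 2 * a k * sin (real k * pi * x))"
proof (rule summable_comparison_test'[of "%k. 2 * abs(a k)" 0])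
 show "summable (%k. 2 * abs(a k))" using assms by (rule summable_mult)
 fix k show "norm (2 * a k * sin (real k * pi * x)) <= 2 * abs(a k)"
  using mlm[OF abs_sin_le_one, of "2 * abs(a k)"] by (simp add: abs_mult)
qed

text \<open>Mode 0 is excluded because its sine vanishes identically and the series cannot see
  \<open>a 0\<close>.\<close>

lemma sinc_sin_series:
 assumes a: "summable (%k. abs(a k))" and "j ~= 0"
 shows "sinc j (%x. ind {0<..<1} x * sin_series a x) = a j"
proof -
 have 2: "summable (%k. abs(2 * a k))" using summable_mult[OF a, of 2] by (simp add: abs_mult)
 have "(%k. 2 * a k * (LBINT x. (ind {0<..<1} x * sin (real j * pi * x)) * sin (real k * pi * x))) sums
  (LBINT x. (ind {0<..<1} x * sin (real j * pi * x)) * (\<Sum>k. 2 * a k * sin (real k * pi * x)))"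
  by (rule integral_bounded_series(1)[OF i_trig(1)[OF i01] _ _ 2]) auto
 moreover have "(%k. 2 * a k * (LBINT x. (ind {0<..<1} x * sin (real j * pi * x)) * sin (real k * pi * x))) sums a j"
 proof -
  have "2 * a k * (LBINT x. (ind {0<..<1} x * sin (real j * pi * x)) * sin (real k * pi * x)) = (if k = j then a j else 0)" for k
   using sin_orthogonal[of j k] \<open>j ~= 0\<close> by (simp add: mult.assoc)
  thus ?thesis using sums_single[of j "%k. a j"] by simp
 qed
 ultimately have "(LBINT x. (ind {0<..<1} x * sin (real j * pi * x)) * (\<Sum>k. 2 * a k * sin (real k * pi * x))) = a j"
  by (rule sums_unique2)
 thus ?thesis by (simp add: sinc_def sin_series_def mult_ac)
qed

lemma continuous_sin_series:
 assumes a: "summable (%k. abs(a k))"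
 shows "continuous_on UNIV (sin_series a)"
proof -
 have "uniform_limit UNIV (%n x. \<Sum>k<n. 2 * a k * sin (real k * pi * x)) (%x. \<Sum>k. 2 * a k * sin (real k * pi * x)) sequentially"
 proof (rule Weierstrass_m_test)
  show "summable (%k. 2 * abs(a k))" using a by (rule summable_mult)
  fix k x show "norm (2 * a k * sin (real k * pi * x)) <= 2 * abs(a k)"
   using mlm[OF abs_sin_le_one, of "2 * abs(a k)"] by (simp add: abs_mult)
 qed
 thus ?thesis unfolding sin_series_def[abs_def]
  by (rule uniform_limit_theorem[rotated]) (auto intro!: always_eventually cints)
qed

text \<open>With absolutely summable coefficients the series is a bounded continuous function whose
  sine coefficients are those of f, so uniqueness of the coefficients applies to the
  difference.\<close>

lemma sin_series_eq:
 assumes f: "L1 f" and z: "!!x. x ~: {0<..<1} ==> f x = 0"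
  and s: "summable (%k. abs(sinc k f))"
 shows "AEL x. x \<in> {0<..<1} --> f x = sin_series (%k. sinc k f) x"
proof -
 define a where "a = (%k. sinc k f)"
 have a: "summable (%k. abs(a k))" using s by (simp add: a_def)
 have m[measurable]: "sin_series a \<in> BM"
  by (rule bm_cont[OF continuous_sin_series[OF a]])
 have i: "L1 (%x. ind {0<..<1} x * sin_series a x)"
  unfolding sin_series_def
  by (rule integral_bounded_series(2)[OF i01]) (use summable_mult[OF a, of 2] in "auto simp: abs_mult")
 have "AEL x. f x - ind {0<..<1} x * sin_series a x = 0"
 proof (rule sin_uniqueness)
  fix k
  have "sinc k (%x. f x - ind {0<..<1} x * sin_series a x) = sinc k f - sinc k (%x. ind {0<..<1} x * sin_series a x)"
   unfolding sinc_def left_diff_distrib using i_trig(1)[OF f] i_trig(1)[OF i] by simp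
  also have "... = 0"
   by (cases "k = 0") (use sinc_sin_series[OF a, of k] in "simp_all add: a_def sinc_def")
  finally show "sinc k (%x. f x - ind {0<..<1} x * sin_series a x) = 0" .
 qed (use f i z in auto)
 thus ?thesis by eventually_elim (auto simp: a_def)
qed

text \<open>The square of f minus its partial sum \<open>p\<close> is expanded. The trigonometric
  sum \<open>p\<close> does not vanish outside (0, 1), hence the indicator in front of
  \<open>p x * p x\<close>.\<close>

lemma bessel:
 assumes f: "L1 f" and z: "!!x. x ~: {0<..<1} ==> f x = 0"
  and f2: "L1 (%x. (f x)^2)"
 shows "(\<Sum>k<N. 2 * (sinc k f)^2) <= (LBINT x. (f x)^2)"
proof -
 define s where "s = (%k. sinc k f)"
 define p where "p = (%x. \<Sum>k<N. 2 * s k * sin (real k * pi * x))"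
 have [measurable]: "p \<in> BM" unfolding p_def by measurable
 have bp: "abs(p x) <= (\<Sum>k<N. 2 * abs(s k))" for x
  unfolding p_def
 proof (rule order_trans[OF sum_abs sum_mono])
  show "abs(2 * s k * sin (real k * pi * x)) <= 2 * abs(s k)" for k
   using mlm[OF abs_sin_le_one[of "real k * pi * x"], of "2 * abs(s k)"] by (simp add: abs_mult)
 qed
 have if1: "L1 (%x. f x * p x)"
  by (rule imb[OF f]) (use bp in auto)
 have pp: "abs(p x * p x) <= (\<Sum>k<N. 2 * abs(s k)) * (\<Sum>k<N. 2 * abs(s k))" for x
  unfolding abs_mult by (intro mult_mono bp order_trans[OF abs_ge_zero bp] abs_ge_zero)
 have i2: "L1 (%x. ind {0<..<1} x * (p x * p x))"
  by (intro imb[OF i01, where C="(\<Sum>k<N. 2 * abs(s k)) * (\<Sum>k<N. 2 * abs(s k))"])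
   (use pp in auto)
 have A: "(LBINT x. f x * p x) = (\<Sum>k<N. 2 * (s k)^2)"
 proof -
  have "(LBINT x. f x * p x) = (\<Sum>k<N. 2 * s k * (LBINT x. f x * sin (real k * pi * x)))"
   unfolding p_def sum_distrib_left
  proof (subst int_sum)
   have e: "(%x. f x * (2 * s k * sin (real k * pi * x))) = (%x. 2 * s k * (f x * sin (real k * pi * x)))" for k
   by (rule ext) (rule mult.left_commute)
   show "L1 (%x. f x * (2 * s k * sin (real k * pi * x)))" for k
   unfolding e by (intro i_mr i_trig(1)[OF f])
   show "(\<Sum>k<N. LBINT x. f x * (2 * s k * sin (real k * pi * x))) = (\<Sum>k<N. 2 * s k * (LBINT x. f x * sin (real k * pi * x)))"
   unfolding e by simp
  qed
  thus ?thesis by (simp add: s_def sinc_def power2_eq_square mult.assoc)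
 qed
 have B: "(LBINT x. ind {0<..<1} x * (p x * p x)) = (\<Sum>k<N. 2 * (s k)^2)"
 proof -
  have i: "L1 (%x. ind {0<..<1} x * (sin (real j * pi * x) * sin (real k * pi * x)))" for j k
   using i_trig(1)[OF i_trig(1)[OF i01, of "real j * pi"], of "real k * pi"]
   by (simp only: mult.assoc)
  have e: "ind {0<..<1} x * (p x * p x) = (\<Sum>j<N. \<Sum>k<N. 4 * s j * s k * (ind {0<..<1} x * (sin (real j * pi * x) * sin (real k * pi * x))))" for x :: real
  proof -
   have "p x * p x = (\<Sum>j<N. \<Sum>k<N. (2 * s j * sin (real j * pi * x)) * (2 * s k * sin (real k * pi * x)))"
   by (simp only: p_def sum_product)
   hence "ind {0<..<1} x * (p x * p x) = (\<Sum>j<N. \<Sum>k<N. ind {0<..<1} x * ((2 * s j * sin (real j * pi * x)) * (2 * s k * sin (real k * pi * x))))"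
   by (simp only: sum_distrib_left)
   also have "... = (\<Sum>j<N. \<Sum>k<N. 4 * s j * s k * (ind {0<..<1} x * (sin (real j * pi * x) * sin (real k * pi * x))))"
   by (intro sum.cong refl) simp
   finally show ?thesis .
  qed
  have "(LBINT x. ind {0<..<1} x * (p x * p x)) = (\<Sum>j<N. \<Sum>k<N. 4 * s j * s k * (if j = k & k ~= 0 then 1 / 2 else 0))"
  proof -
   have ii: "L1 (%x. 4 * s j * s k * (ind {0<..<1} x * (sin (real j * pi * x) * sin (real k * pi * x))))" for j k
   by (intro i_mr i)
   have "(LBINT x. ind {0<..<1} x * (p x * p x)) = (\<Sum>j<N. \<Sum>k<N. LBINT x. 4 * s j * s k * (ind {0<..<1} x * (sin (real j * pi * x) * sin (real k * pi * x))))"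
   unfolding e by (simp only: int_sum Bochner_Integration.integrable_sum ii)
   thus ?thesis by (simp only: integral_mult_right_zero sin_orthogonal)
  qed
  also have "... = (\<Sum>j<N. 2 * (s j)^2)"
  proof (rule sum.cong[OF refl])
   fix j assume j: "j \<in> {..<N}"
   have "(\<Sum>k<N. 4 * s j * s k * (if j = k & k ~= 0 then 1 / 2 else 0)) = (\<Sum>k<N. if k = j then 2 * (s j)^2 else 0)"
   by (rule sum.cong) (auto simp: power2_eq_square s_def sinc_def)
   thus "(\<Sum>k<N. 4 * s j * s k * (if j = k & k ~= 0 then 1 / 2 else 0)) = 2 * (s j)^2" using j by simp
  qed
  finally show ?thesis .
 qed
 have "0 <= (LBINT x. (f x)^2 - 2 * (f x * p x) + ind {0<..<1} x * (p x * p x))"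
 proof (rule Bochner_Integration.integral_nonneg)
  fix x
  show "0 <= (f x)^2 - 2 * (f x * p x) + ind {0<..<1} x * (p x * p x)"
  proof (cases "x \<in> {0<..<1}")
   case True
   have "0 <= (f x - p x)^2" by simp
   thus ?thesis using True by (simp add: power2_eq_square alg)
  qed (simp add: z)
 qed
 also have "... = (LBINT x. (f x)^2) - 2 * (LBINT x. f x * p x) + (LBINT x. ind {0<..<1} x * (p x * p x))"
  using f2 if1 i2 by simp
 finally show ?thesis by (simp add: A B s_def)
qed

section \<open>A theta function and the sup-norm contraction of the heat flow\<close>

text \<open>Positive definiteness of the Gaussian. In exp (-c (j-l)^2) = exp (-c j^2) exp (-c l^2)
  exp (2 c j l) the last factor is expanded in powers of j l, and cos ((j-l) s) splits into products
  of cosines and sines. Each power then contributes a sum of two squares with a nonnegative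
  weight.\<close>

lemma theta_sum_nonneg:
 fixes c s :: real assumes "c > 0"
 shows "0 <= (\<Sum>j<N. \<Sum>l<N. exp (- c * (real j - real l)^2) * cos ((real j - real l) * s))"
proof -
 define ca where "ca = (%m j. exp (- c * (real j)^2) * real j ^ m * cos (real j * s))"
 define sa where "sa = (%m j. exp (- c * (real j)^2) * real j ^ m * sin (real j * s))"
 define tm where "tm = (%j l m. (2 * c) ^ m / fact m * (ca m j * ca m l + sa m j * sa m l))"
 have "tm j l sums (exp (- c * (real j - real l)^2) * cos ((real j - real l) * s))" for j l
 proof -
  define a where "a = exp (- c * (real j)^2)"
  define b where "b = exp (- c * (real l)^2)"
  define C where "C = cos (real j * s) * cos (real l * s) + sin (real j * s) * sin (real l * s)"
  have "(%m. (2 * c * real j * real l) ^ m / fact m) sums exp (2 * c * real j * real l)"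
   using exp_converges[of "2 * c * real j * real l"] by (simp add: divide_inverse mult.commute)
  hence S: "(%m. a * b * C * ((2 * c * real j * real l) ^ m / fact m)) sums (a * b * C * exp (2 * c * real j * real l))"
   by (rule sums_mult)
  have "a * b * exp (2 * c * real j * real l) = exp (- c * (real j)^2 + - c * (real l)^2 + 2 * c * real j * real l)"
   by (simp only: a_def b_def exp_add)
  also have "- c * (real j)^2 + - c * (real l)^2 + 2 * c * real j * real l = - c * (real j - real l)^2"
   by (simp add: power2_eq_square alg)
  finally have X: "a * b * exp (2 * c * real j * real l) = exp (- c * (real j - real l)^2)" .
  have Y: "C = cos ((real j - real l) * s)"
   by (simp add: C_def cos_diff left_diff_distrib)
  have "a * b * C * exp (2 * c * real j * real l) = (a * b * exp (2 * c * real j * real l)) * C" by (simp only: mult_ac)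
  hence Z: "a * b * C * exp (2 * c * real j * real l) = exp (- c * (real j - real l)^2) * cos ((real j - real l) * s)"
   by (simp only: X Y)
  have "(%m. a * b * C * ((2 * c * real j * real l) ^ m / fact m)) = tm j l"
  proof (rule ext)
   fix m
   have "ca m j * ca m l + sa m j * sa m l = a * b * real j ^ m * real l ^ m * C"
   unfolding ca_def sa_def a_def b_def C_def by (simp only: distrib_left mult_ac)
   thus "a * b * C * ((2 * c * real j * real l) ^ m / fact m) = tm j l m"
   by (simp add: tm_def power_mult_distrib)
  qed
  thus ?thesis using S Z by simp
 qed
 hence S1: "(%m. \<Sum>j<N. \<Sum>l<N. tm j l m) sums (\<Sum>j<N. \<Sum>l<N. exp (- c * (real j - real l)^2) * cos ((real j - real l) * s))"
  by (intro sums_sum)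
 have P1: "0 <= (\<Sum>j<N. \<Sum>l<N. tm j l m)" for m
 proof -
  have "(\<Sum>j<N. \<Sum>l<N. tm j l m) = (2 * c) ^ m / fact m * ((\<Sum>j<N. ca m j) * (\<Sum>l<N. ca m l) + (\<Sum>j<N. sa m j) * (\<Sum>l<N. sa m l))"
  proof -
   have "(\<Sum>j<N. \<Sum>l<N. tm j l m) = (\<Sum>j<N. (2 * c) ^ m / fact m * (\<Sum>l<N. ca m j * ca m l + sa m j * sa m l))"
   by (simp only: tm_def sum_distrib_left)
   also have "... = (2 * c) ^ m / fact m * (\<Sum>j<N. \<Sum>l<N. ca m j * ca m l + sa m j * sa m l)"
   by (rule sum_distrib_left[symmetric])
   also have "(\<Sum>j<N. \<Sum>l<N. ca m j * ca m l + sa m j * sa m l) = (\<Sum>j<N. \<Sum>l<N. ca m j * ca m l) + (\<Sum>j<N. \<Sum>l<N. sa m j * sa m l)"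
   by (simp only: sum.distrib)
   finally show ?thesis by (simp only: sum_product)
  qed
  thus ?thesis using assms by simp
 qed
 show ?thesis by (rule sums_le[OF P1 sums_zero S1])
qed

lemma summable_exp_square:
 fixes c :: real assumes "c > 0" shows "summable (%k. exp (- c * (real k)^2))"
proof (rule summable_comparison_test'[of "%k. inverse c * inverse (real k ^ 2)" 1])
 show "summable (%k. inverse c * inverse (real k ^ 2))" by (intro summable_mult inverse_power_summable) auto
 fix k :: nat assume "k >= 1"
 have "c * (real k)^2 <= exp (c * (real k)^2)" using exp_ge_add_one_self[of "c * (real k)^2"] by linarith
 thus "norm (exp (- c * (real k)^2)) <= inverse c * inverse (real k ^ 2)"
  using assms \<open>k >= 1\<close> by (simp add: exp_minus field_simps)
qed

text \<open>The nonnegative double sums \<open>D N\<close> grow by symmetric partial sums of the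
  theta series. If these partial sums had a negative limit L, the increments would eventually stay
  below L/2 and \<open>D N\<close> would tend to minus infinity.\<close>

lemma theta_nonneg:
 fixes c s :: real assumes c: "c > 0"
 shows "0 <= 1 + 2 * (\<Sum>k. exp (- c * (real (Suc k))^2) * cos (real (Suc k) * s))"
proof (rule ccontr)
 define b where "b = (%k. exp (- c * (real (Suc k))^2) * cos (real (Suc k) * s))"
 define g where "g = (%j l. exp (- c * (real j - real l)^2) * cos ((real j - real l) * s))"
 define D where "D = (%N. \<Sum>j<N. \<Sum>l<N. g j l)"
 define L where "L = 1 + 2 * (\<Sum>k. b k)"
 assume "~ ?thesis"
 hence L: "L < 0" by (simp add: L_def b_def)
 have "summable (%k. exp (- c * (real (Suc k))^2))"
  using summable_exp_square[OF c] by (subst summable_Suc_iff)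
 hence "summable b"
 proof (rule summable_comparison_test'[where N=0])
  fix k show "norm (b k) <= exp (- c * (real (Suc k))^2)"
   unfolding b_def norm_mult using mlm[OF abs_cos_le_one, of "exp (- c * (real (Suc k))^2)"] by simp
 qed
 hence lim: "(%N. 1 + 2 * (\<Sum>k<N. b k)) ----> L"
  unfolding L_def by (intro tendsto_intros) (simp add: summable_LIMSEQ)
 \<comment> \<open>By symmetry of \<open>g\<close> the new row and the new column contribute the
   same partial sum, and the new diagonal entry contributes 1.\<close>
 have D: "D (Suc N) = D N + (1 + 2 * (\<Sum>k<N. b k))" for N
 proof -
  have 1: "(\<Sum>l<N. g N l) = (\<Sum>k<N. b k)"
  proof -
   have "(\<Sum>l<N. g N l) = (\<Sum>l<N. b (N - Suc l))"
   proof (rule sum.cong[OF refl])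
   fix l assume "l \<in> {..<N}"
   hence "real (Suc (N - Suc l)) = real N - real l" by auto
   thus "g N l = b (N - Suc l)" unfolding g_def b_def by metis
   qed
   thus ?thesis using sum.nat_diff_reindex[of b N] by simp
  qed
  have gs: "g j l = g l j" for j l
  proof -
   have "(real j - real l) * s = - ((real l - real j) * s)" by (simp add: alg)
   hence "cos ((real j - real l) * s) = cos ((real l - real j) * s)" by (metis cos_minus)
   thus ?thesis by (simp add: g_def power2_commute)
  qed
  have 2: "(\<Sum>j<N. g j N) = (\<Sum>k<N. b k)" using 1 gs by simp
  have "D (Suc N) = D N + (\<Sum>j<N. g j N) + (\<Sum>l<N. g N l) + g N N"
   by (simp add: D_def sum.distrib)
  thus ?thesis using 1 2 by (simp add: g_def)
 qed
 have "eventually (%N. 1 + 2 * (\<Sum>k<N. b k) < L / 2) sequentially"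
  using L by (intro order_tendstoD(2)[OF lim]) auto
 then obtain N0 where N0: "!!N. N >= N0 ==> 1 + 2 * (\<Sum>k<N. b k) < L / 2" by (auto simp: eventually_sequentially)
 have "D (N0 + n) <= D N0 + real n * (L / 2)" for n
 proof (induction n)
  case (Suc n)
  have "D (N0 + Suc n) = D (N0 + n) + (1 + 2 * (\<Sum>k<N0 + n. b k))" using D[of "N0 + n"] by (simp only: add_Suc_right)
  moreover have "real (Suc n) * (L / 2) = real n * (L / 2) + L / 2" by (simp add: field_simps)
  ultimately show ?case using N0[of "N0 + n"] Suc by linarith
 qed simp
 moreover obtain n where "D N0 / (- L / 2) < real n" using reals_Archimedean2 by blast
 hence "D N0 + real n * (L / 2) < 0" using L by (simp add: field_simps)
 moreover have "D (N0 + n) >= 0" unfolding D_def g_def by (rule theta_sum_nonneg[OF c])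
 ultimately show False by (meson not_le order_trans)
qed

text \<open>The Dirichlet eigenvalues of minus the second derivative on (0, 1), extended by the
  value 0 at k = 0.\<close>

definition eig :: "nat => real" where "eig k = (real k * pi)^2"

lemma summable_exp_eig: "t > 0 ==> summable (%k. exp (- eig k * t))"
 using summable_exp_square[of "pi^2 * t"] by (simp add: eig_def power_mult_distrib mult_ac)

text \<open>The Dirichlet heat kernel is dominated by the Neumann heat kernel, and the latter has
  mass one. Unlike a term-by-term estimate of the series, this bound does not deteriorate as t tends
  to 0, which is what merely bounded initial data require.\<close>

lemma heat_contraction:
 assumes f: "L1 f" and z: "!!x. x ~: {0<..<1} ==> f x = 0"
  and K: "AEL x. abs(f x) <= K" and t: "t > 0"
 shows "abs(sin_series (%k. exp (- eig k * t) * sinc k f) x) <= K"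
proof -
 have [measurable]: "f \<in> BM" using f by auto
 have K0: "K >= 0"
 proof -
  have "AE x in lborel :: real measure. 0 <= K" using K by eventually_elim auto
  moreover have "ae_filter (lborel :: real measure) ~= bot" by (simp add: ae_filter_eq_bot_iff)
  ultimately show ?thesis by (simp add: eventually_const_iff)
 qed
 define q where "q = (%k. exp (- eig k * t))"
 have q: "summable q" "summable (%k. abs(q k))" unfolding q_def using summable_exp_eig[OF t] by auto
 define a where "a = (%k. 2 * q k * sin (real k * pi * x))"
 define d where "d = (%k. 2 * q k * cos (real k * pi * x))"
 have sa: "summable (%k. abs(a k))"
 proof (rule summable_comparison_test'[of "%k. 2 * q k" 0])
  show "summable (%k. 2 * q k)" by (rule summable_mult[OF q(1)])
  show "norm (abs(a k)) <= 2 * q k" for k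
   using mlm[OF abs_sin_le_one[of "real k * pi * x"], of "2 * q k"] by (simp add: a_def abs_mult q_def)
 qed
 have sd: "summable (%k. abs(d k))"
 proof (rule summable_comparison_test'[of "%k. 2 * q k" 0])
  show "summable (%k. 2 * q k)" by (rule summable_mult[OF q(1)])
  show "norm (abs(d k)) <= 2 * q k" for k
   using mlm[OF abs_cos_le_one[of "real k * pi * x"], of "2 * q k"] by (simp add: d_def abs_mult q_def)
 qed
 define H where "H = (%y. \<Sum>k. a k * sin (real k * pi * y))"
 \<comment> \<open>The term k = 0 is counted with weight 2 instead of 1, so \<open>J\<close> is the
   Neumann kernel plus 1: its integral over (0, 1) is 2, and \<open>J y - 1\<close> has integral
   1.\<close>
 define J where "J = (%y. \<Sum>k. d k * cos (real k * pi * y))"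
 have I1: "(%k. a k * (LBINT y. f y * sin (real k * pi * y))) sums (LBINT y. f y * H y)" "L1 (%y. f y * H y)"
  unfolding H_def by (intro integral_bounded_series f sa; simp)+
 have I2: "(%k. d k * (LBINT y. ind {0<..<1} y * cos (real k * pi * y))) sums (LBINT y. ind {0<..<1} y * J y)"
  "L1 (%y. ind {0<..<1} y * J y)"
  unfolding J_def by (intro integral_bounded_series i01 sd; simp)+
 have J1: "(LBINT y. ind {0<..<1} y * J y) = 2"
 proof -
  have "(%k. d k * (LBINT y. ind {0<..<1} y * cos (real k * pi * y))) = (%k. if k = 0 then 2 else 0)"
   by (rule ext, subst integral_cos_01) (auto simp: d_def q_def eig_def)
  hence "(%k. if k = 0 then 2 else 0) sums (LBINT y. ind {0<..<1} y * J y)" using I2(1) by simp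
  from sums_unique2[OF this sums_single[of 0 "%k. 2::real"]] show ?thesis .
 qed
 \<comment> \<open>Product formulas express both kernels by \<open>Th\<close> at pi (x - y) and pi
   (x + y). The two inequalities hidden in the absolute value are exactly the nonnegativity of
   \<open>1 + 2 * Th s\<close> at these two points.\<close>
 have HJ: "abs(H y) <= J y - 1" for y
 proof -
  define Th where "Th = (%s. \<Sum>k. q (Suc k) * cos (real (Suc k) * s))"
  have pos: "0 <= 1 + 2 * Th s" for s
   using theta_nonneg[of "pi^2 * t" s] t by (simp add: Th_def q_def eig_def power_mult_distrib mult_ac)
  have sq: "summable (%k. q k * cos (real k * s))" for s
  proof (rule summable_comparison_test'[OF q(1), of 0])
   show "norm (q k * cos (real k * s)) <= q k" for k
   using mlm[OF abs_cos_le_one[of "real k * s"], of "q k"] by (simp add: abs_mult q_def)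
  qed
  have Th: "(\<Sum>k. q k * cos (real k * s)) = 1 + Th s" for s
   using suminf_split_head[OF sq[of s]] by (simp add: Th_def q_def eig_def)
  have "H y = (\<Sum>k. q k * cos (real k * (pi * (x - y))) - q k * cos (real k * (pi * (x + y))))"
   unfolding H_def a_def
  proof (intro suminf_cong)
   fix k
   have e: "real k * (pi * (x - y)) = real k * pi * x - real k * pi * y" "real k * (pi * (x + y)) = real k * pi * x + real k * pi * y"
   by (simp_all only: right_diff_distrib distrib_left mult.assoc)
   show "2 * q k * sin (real k * pi * x) * sin (real k * pi * y) = q k * cos (real k * (pi * (x - y))) - q k * cos (real k * (pi * (x + y)))"
   unfolding e cos_diff cos_add by (simp add: right_diff_distrib distrib_left)
  qed
  also have "... = Th (pi * (x - y)) - Th (pi * (x + y))"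
   using suminf_diff[OF sq[of "pi * (x - y)"] sq[of "pi * (x + y)"]] unfolding Th by simp
  finally have H: "H y = Th (pi * (x - y)) - Th (pi * (x + y))" .
  have "J y = (\<Sum>k. q k * cos (real k * (pi * (x - y))) + q k * cos (real k * (pi * (x + y))))"
   unfolding J_def d_def
  proof (intro suminf_cong)
   fix k
   have e: "real k * (pi * (x - y)) = real k * pi * x - real k * pi * y" "real k * (pi * (x + y)) = real k * pi * x + real k * pi * y"
   by (simp_all only: right_diff_distrib distrib_left mult.assoc)
   show "2 * q k * cos (real k * pi * x) * cos (real k * pi * y) = q k * cos (real k * (pi * (x - y))) + q k * cos (real k * (pi * (x + y)))"
   unfolding e cos_diff cos_add by (simp add: right_diff_distrib distrib_left)
  qed
  also have "... = (1 + Th (pi * (x - y))) + (1 + Th (pi * (x + y)))"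
   using suminf_add[OF sq[of "pi * (x - y)"] sq[of "pi * (x + y)"]] unfolding Th by simp
  finally have J: "J y = 2 + Th (pi * (x - y)) + Th (pi * (x + y))" by simp
  show ?thesis using H J pos[of "pi * (x - y)"] pos[of "pi * (x + y)"] by linarith
 qed
 have "sin_series (%k. exp (- eig k * t) * sinc k f) x = (LBINT y. f y * H y)"
  using sums_unique[OF I1(1)] by (simp add: sin_series_def a_def q_def sinc_def mult_ac)
 also have "abs(...) <= (LBINT y. abs(f y * H y))" by (rule iab)
 also have "... <= (LBINT y. K * (ind {0<..<1} y * J y - ind {0<..<1} y))"
 proof (rule integral_mono_AE)
  show "AEL y. abs(f y * H y) <= K * (ind {0<..<1} y * J y - ind {0<..<1} y)"
   using K
  proof eventually_elim
   case (elim y)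
   show ?case
   proof (cases "y \<in> {0<..<1}")
   case True
   have "abs(f y) * abs(H y) <= K * (J y - 1)" using elim HJ[of y] K0 by (intro mult_mono) auto
   thus ?thesis using True by (simp add: abs_mult)
   qed (simp add: z)
  qed
 qed (use I1 I2 i01 in auto)
 also have "... = K" using I2 J1 i01 by simp
 finally show ?thesis .
qed

section \<open>Indefinite integrals and the chain rule along them\<close>

text \<open>Integration starts at minus infinity, which avoids oriented integrals. The integrands in
  the applications vanish up to 0, so there it is the usual integral from 0.\<close>

definition prim :: "(real => real) => real => real" where
 "prim h t = (LBINT s. ind {..t} s * h s)"

lemma i_im:
 fixes h :: "'a => real"
 assumes "integrable M h" "A \<in> sets M"
 shows "integrable M (%s. ind A s * h s)"
 using integrable_mult_indicator[OF assms(2,1)] by simp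

lemma prim_diff:
 assumes h: "L1 h" and "a <= b"
 shows "prim h b - prim h a = (LBINT s. ind {a<..b} s * h s)"
proof -
 have "prim h b - prim h a = (LBINT s. ind {..b} s * h s - ind {..a} s * h s)"
  unfolding prim_def by (intro int_diff[symmetric] i_im h) auto
 also have "(%s. ind {..b} s * h s - ind {..a} s * h s) = (%s. ind {a<..b} s * h s)"
  using assms(2) by (intro ext) (auto simp: ind_def)
 finally show ?thesis .
qed

lemma continuous_prim:
 assumes h: "L1 h"
 shows "continuous_on UNIV (prim h)"
proof -
 have [measurable]: "h \<in> BM" using h by auto
 have "isCont (prim h) t" for t
  unfolding continuous_at_sequentially comp_def
 proof (intro allI impI)
  fix x :: "nat => real" assume x: "x ----> t"
  show "(%n. prim h (x n)) ----> prim h t"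
   unfolding prim_def
  proof (rule integral_dominated_convergence[where w="%s. abs(h s)"])
   have "AEL s. s ~= t" by (rule AE_sing)
   thus "AEL s. (%n. ind {..x n} s * h s) ----> ind {..t} s * h s"
   proof eventually_elim
   case (elim s)
   have "eventually (%n. ind {..x n} s * h s = ind {..t} s * h s) sequentially"
   proof (cases "s < t")
   case True
   from order_tendstoD(1)[OF x True] show ?thesis by eventually_elim (use True in simp)
   next
   case False
   hence "t < s" using elim by simp
   from order_tendstoD(2)[OF x this] show ?thesis by eventually_elim (use \<open>t < s\<close> in simp)
   qed
   thus ?case by (rule tendsto_eventually)
   qed
   show "AEL s. norm (ind {..x n} s * h s) <= abs(h s)" for n
   by (rule AE_I2) (simp add: ind_def)
   show "L1 (%s. abs(h s))" using h by simp
  qed measurable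
 qed
 thus ?thesis by (simp add: continuous_on_eq_continuous_at)
qed

lemma prim_measurable: "L1 h ==> prim h \<in> BM"
 by (rule bm_cont) (rule continuous_prim)

lemma prim_bound:
 assumes h: "L1 h"
 shows "abs(prim h t) <= (LBINT s. abs(h s))"
proof -
 have "abs(prim h t) <= (LBINT s. abs(ind {..t} s * h s))" unfolding prim_def by (rule iab)
 also have "... <= (LBINT s. abs(h s))"
 proof (rule integral_mono)
  show "L1 (%s. abs(ind {..t} s * h s))" by (intro integrable_abs i_im h) auto
  show "abs(ind {..t} s * h s) <= abs(h s)" for s by (simp add: ind_def)
 qed (use h in simp)
 finally show ?thesis .
qed

lemma prim_eq_0:
 assumes "!!s. s <= a ==> h s = 0" "t <= a"
 shows "prim h t = 0"
proof -
 have "(%s. ind {..t} s * h s) = (%s. 0)" using assms by (intro ext) (auto simp: ind_def)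
 thus ?thesis by (simp add: prim_def)
qed

text \<open>Both sides are increments, so the inequality adds up over a uniform partition whose mesh
  is below \<open>de\<close>.\<close>

lemma local_bound_imp_global_bound:
 fixes E N :: "real => real"
 assumes "a <= b" "de > 0"
  and le: "!!s t. a <= s ==> s <= t ==> t <= b ==> t - s < de ==> abs(E t - E s) <= N t - N s"
 shows "abs(E b - E a) <= N b - N a"
proof -
 obtain n where n: "(b - a) / de < real n" using reals_Archimedean2 by blast
 hence "real n > 0" using assms(1,2) by (smt (verit) divide_nonneg_pos)
 define d where "d = (b - a) / real n"
 define p where "p = (%k. a + real k * d)"
 have step: "p (Suc k) - p k = d" for k by (simp add: p_def alg)
 have st: "d < de" using n \<open>real n > 0\<close> assms(2) by (simp add: d_def field_simps)
 have d0: "0 <= d" using assms(1) by (simp add: d_def)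
 have pn: "p n = b" using \<open>real n > 0\<close> by (simp add: p_def d_def)
 have ple: "p k <= b" if "k <= n" for k
 proof -
  have "real k * d <= real n * d" using that d0 by (intro mult_right_mono) auto
  thus ?thesis using pn by (simp add: p_def)
 qed
 have age: "a <= p k" for k using d0 by (simp add: p_def)
 have "abs(E (p k) - E a) <= N (p k) - N a" if "k <= n" for k
  using that
 proof (induction k)
  case 0 thus ?case by (simp add: p_def)
 next
  case (Suc k)
  have "abs(E (p (Suc k)) - E (p k)) <= N (p (Suc k)) - N (p k)"
   by (rule le) (use step[of k] st d0 age ple Suc in auto)
  thus ?case using Suc by linarith
 qed
 from this[of n] show ?thesis by (simp add: pn)
qed

text \<open>No differentiation theorem for indefinite integrals is used: the defect of the chain rule
 over \<open>[s, t]\<close> is at most \<open>ep \<integral>\<^sub>s\<^sup>t (1 + \<bar>h\<bar>)\<close> once \<open>t - s\<close> is small, and such bounds add up.\<close>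

lemma ac_chain_rule:
 fixes Ps D1 D2 :: "real * real => real" and c :: real
 assumes dP: "!!z. (Ps has_derivative (%d. D1 z * fst d + D2 z * snd d)) (at z)"
  and c1: "continuous_on UNIV D1" and c2: "continuous_on UNIV D2"
  and h: "L1 h" and ab: "a <= b"
  and U_def: "U = (%t. c + prim h t)"
 shows "Ps (b, U b) - Ps (a, U a) = (LBINT s. ind {a<..b} s * (D1 (s, U s) + D2 (s, U s) * h s))"
  and "L1 (%s. ind {a<..b} s * (D1 (s, U s) + D2 (s, U s) * h s))"
proof -
 have [measurable]: "h \<in> BM" using h by auto
 have cU: "continuous_on UNIV U" unfolding U_def by (intro cints continuous_prim h)
 have cs: "continuous_on UNIV (%s. (s, U s))" by (intro continuous_on_Pair continuous_on_id cU)
 have mD: "(%s. D1 (s, U s)) \<in> BL" "(%s. D2 (s, U s)) \<in> BL"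
  using bm_cont[OF continuous_on_compose2[OF c1 cs]]
   bm_cont[OF continuous_on_compose2[OF c2 cs]] by simp_all
 have ms: "{a<..b} \<in> sets (lborel :: real measure)" by simp
 have mi: "(%s. ind {a<..b} s * D1 (s, U s)) \<in> BL"
   "(%s. ind {a<..b} s * D2 (s, U s)) \<in> BL"
  by (rule borel_measurable_times[OF borel_measurable_indicator[OF ms] mD(1)], rule borel_measurable_times[OF borel_measurable_indicator[OF ms] mD(2)])
 have "compact (U ` {a..b})" by (intro compact_continuous_image continuous_on_subset[OF cU]) auto
 from compact_imp_bounded[OF this] obtain m where m: "!!s. s \<in> {a..b} ==> abs(U s) <= m"
  unfolding bounded_iff by (auto simp del: atLeastAtMost_iff)
 \<comment> \<open>The box contains the graph of \<open>U\<close> and, being convex, also every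
   segment joining two points of it.\<close>
 define K where "K = {a..b} \<times> {- m..m}"
 have cK: "compact K" unfolding K_def by (intro compact_Times) auto
 have sUK: "(s, U s) \<in> K" if "s \<in> {a..b}" for s using m[OF that] that by (auto simp: K_def)
 have "compact (D1 ` K)" "compact (D2 ` K)"
  by (auto intro!: compact_continuous_image cK continuous_on_subset[OF c1] continuous_on_subset[OF c2])
 from compact_imp_bounded[OF this(1)] compact_imp_bounded[OF this(2)]
 obtain B1 B2 where "ALL y:D1 ` K. norm y <= B1" "ALL y:D2 ` K. norm y <= B2"
  unfolding bounded_iff by blast
 hence B: "!!z. z \<in> K ==> abs(D1 z) <= B1" "!!z. z \<in> K ==> abs(D2 z) <= B2" by auto
 have bd: "abs(ind {a<..b} s * D1 (s, U s)) <= abs(B1)" "abs(ind {a<..b} s * D2 (s, U s)) <= abs(B2)" for s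
  using B(1)[OF sUK[of s]] B(2)[OF sUK[of s]] by (cases "s \<in> {a<..b}"; simp)+
 have i1: "L1 (ind {a<..b} :: real => real)"
  by (rule i_ind) (use ab in auto)
 have i2: "L1 (%s. ind {a<..b} s * h s)" by (rule i_im[OF h]) auto
 have "L1 (%s. ind {a<..b} s * (ind {a<..b} s * D1 (s, U s)))"
  by (rule imb(1)[OF i1, where C="abs(B1)"])
   (rule mi(1), rule AE_I2, rule bd(1))
 moreover have "L1 (%s. (ind {a<..b} s * h s) * (ind {a<..b} s * D2 (s, U s)))"
  by (rule imb(1)[OF i2, where C="abs(B2)"])
   (rule mi(2), rule AE_I2, rule bd(2))
 ultimately have "L1 (%s. ind {a<..b} s * (ind {a<..b} s * D1 (s, U s)) +
   (ind {a<..b} s * h s) * (ind {a<..b} s * D2 (s, U s)))" by (rule i_add)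
 also have "(%s. ind {a<..b} s * (ind {a<..b} s * D1 (s, U s)) +
   (ind {a<..b} s * h s) * (ind {a<..b} s * D2 (s, U s))) = (%s. ind {a<..b} s * (D1 (s, U s) + D2 (s, U s) * h s))"
  by (rule ext) (simp add: ind_def)
 finally show ig: "L1 (%s. ind {a<..b} s * (D1 (s, U s) + D2 (s, U s) * h s))" .
 define g where "g = (%s. ind {a<..b} s * (D1 (s, U s) + D2 (s, U s) * h s))"
 \<comment> \<open>The weight bounds the errors of both partial derivatives at once: 1 for
   \<open>D1\<close>, and |h| for \<open>D2\<close>, which is multiplied by h.\<close>
 define w where "w = (%s. ind {a<..b} s * (1 + abs(h s)))"
 have iw: "L1 w"
  unfolding w_def distrib_left using i1 i_im[OF integrable_abs[OF h], of "{a<..b}"] by simp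
 have ig': "L1 g" using ig by (simp add: g_def)
 define E where "E = (%t. Ps (t, U t) - prim g t)"
 have "abs(E b - E a) <= e * prim w b - e * prim w a" if e: "e > 0" for e
 proof -
  have uc: "uniformly_continuous_on K D1" "uniformly_continuous_on K D2"
   by (auto intro!: compact_uniformly_continuous cK continuous_on_subset[OF c1] continuous_on_subset[OF c2])
  obtain d1 where d1: "d1 > 0" "!!z z'. z \<in> K ==> z' \<in> K ==> dist z' z < d1 ==> dist (D1 z') (D1 z) < e"
   using uniformly_continuous_onE[OF uc(1) e] by blast
  obtain d2 where d2: "d2 > 0" "!!z z'. z \<in> K ==> z' \<in> K ==> dist z' z < d2 ==> dist (D2 z') (D2 z) < e"
   using uniformly_continuous_onE[OF uc(2) e] by blast
  note d = d1 d2
  \<comment> \<open>The half leaves one share for the time coordinate and one for the second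
    coordinate, since the distance is at most the sum of the coordinate distances.\<close>
  define d0 where "d0 = min d1 d2 / 2"
  have d0: "d0 > 0" using d by (simp add: d0_def)
  have ucU: "uniformly_continuous_on {a..b} U"
   by (intro compact_uniformly_continuous continuous_on_subset[OF cU]) auto
  obtain d3 where d3: "d3 > 0" "!!s t. s \<in> {a..b} ==> t \<in> {a..b} ==> dist t s < d3 ==> dist (U t) (U s) < d0"
   using uniformly_continuous_onE[OF ucU d0] by blast
  have "abs(E b - E a) <= (%t. e * prim w t) b - (%t. e * prim w t) a"
  proof (rule local_bound_imp_global_bound[OF ab, of "min d0 d3"])
   show "min d0 d3 > 0" using d0 d3 by simp
   fix s t assume st: "a <= s" "s <= t" "t <= b" "t - s < min d0 d3"
   \<comment> \<open>The segment between the two points of the graph. The mean value theorem along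
     it evaluates both derivatives at one point \<open>ze\<close>, close to (r, U r) for every r
     between s and t; no derivative of \<open>U\<close> is used.\<close>
   define q where "q = (%th. (s + th * (t - s), U s + th * (U t - U s)))"
   have dq: "((%th. Ps (q th)) has_derivative (%d. D1 (q th) * (d * (t - s)) + D2 (q th) * (d * (U t - U s)))) (at th within {0..1})" for th
   proof -
   have "(q has_derivative (%d. (d * (t - s), d * (U t - U s)))) (at th within {0..1})"
   unfolding q_def by (auto intro!: deqs)
   from has_derivative_compose[OF this dP] show ?thesis by simp
   qed
   obtain th where th: "th \<in> {0..1}" and mv: "Ps (q 1) - Ps (q 0) = D1 (q th) * (t - s) + D2 (q th) * (U t - U s)"
   using mvt_very_simple[of 0 1 "%th. Ps (q th)", OF _ dq] by auto
   define ze where "ze = q th"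
   have close: "dist ze (r, U r) < min d1 d2" "ze \<in> K" "(r, U r) \<in> K" if r: "r \<in> {s<..t}" for r
   proof -
   have sab: "s \<in> {a..b}" "t \<in> {a..b}" "r \<in> {a..b}" using st r by auto
   have 0: "0 <= th * (t - s)" "th * (t - s) <= t - s" using th st by (auto simp: mult_left_le_one_le)
   have fz: "fst ze = s + th * (t - s)" by (simp add: ze_def q_def)
   have sr: "s < r" "r <= t" using r by auto
   have f1: "abs(fst ze - r) <= t - s" using 0 sr fz by linarith
   have us: "abs(U s - U r) < d0" "abs(U t - U r) < d0"
   using d3(2)[OF sab(3) sab(1)] d3(2)[OF sab(3) sab(2)] st r by (auto simp: dist_real_def)
   have e1: "snd ze - U r = (1 - th) * (U s - U r) + th * (U t - U r)" by (simp add: ze_def q_def alg)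
   have "abs(snd ze - U r) <= (1 - th) * abs(U s - U r) + th * abs(U t - U r)"
   unfolding e1 using th by (intro order_trans[OF abs_triangle_ineq]) (simp add: abs_mult)
   also have "... <= (1 - th) * d0 + th * d0"
   using th us by (intro add_mono mlm) auto
   also have "... = d0" by (simp add: alg)
   finally have f2: "abs(snd ze - U r) <= d0" .
   have "dist ze (r, U r) = sqrt ((fst ze - r)^2 + (snd ze - U r)^2)"
   by (cases ze) (simp add: dist_Pair_Pair dist_real_def)
   also have "... <= abs(fst ze - r) + abs(snd ze - U r)" by (rule sqrt_sum_squares_le_sum_abs)
   finally show "dist ze (r, U r) < min d1 d2" using f1 f2 st(4) by (simp add: d0_def)
   show "(r, U r) \<in> K" by (rule sUK[OF sab(3)])
   have "snd ze = (1 - th) * U s + th * U t" by (simp add: ze_def q_def alg)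
   moreover have "abs((1 - th) * U s + th * U t) <= (1 - th) * abs(U s) + th * abs(U t)"
   using th by (intro order_trans[OF abs_triangle_ineq]) (simp add: abs_mult)
   moreover have "... <= (1 - th) * m + th * m"
   using th m[OF sab(1)] m[OF sab(2)] by (intro add_mono mlm) auto
   moreover have "(1 - th) * m + th * m = m" by (simp add: alg)
   ultimately have "abs(snd ze) <= m" by linarith
   moreover have "a <= fst ze" "fst ze <= b" using 0 st fz by linarith+
   ultimately show "ze \<in> K" by (cases ze) (auto simp: K_def)
   qed
   have iis: "L1 (ind {s<..t} :: real => real)"
   by (rule i_ind) (use st in auto)
   have ih: "L1 (%r. ind {s<..t} r * h r)" by (rule i_im[OF h]) auto
   have "Ps (t, U t) - Ps (s, U s) = D1 ze * (t - s) + D2 ze * (U t - U s)"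
   using mv by (simp add: q_def ze_def)
   also have "U t - U s = (LBINT r. ind {s<..t} r * h r)"
   using prim_diff[OF h st(2)] by (simp add: U_def)
   also have "t - s = (LBINT r. ind {s<..t} r)" using st by simp
   also have "D1 ze * (LBINT r. ind {s<..t} r) + D2 ze * (LBINT r. ind {s<..t} r * h r)
   = (LBINT r. D1 ze * ind {s<..t} r + D2 ze * (ind {s<..t} r * h r))"
   using iis ih by simp
   finally have e1: "Ps (t, U t) - Ps (s, U s) = (LBINT r. D1 ze * ind {s<..t} r + D2 ze * (ind {s<..t} r * h r))" .
   have e2: "prim g t - prim g s = (LBINT r. ind {s<..t} r * g r)" by (rule prim_diff[OF ig' st(2)])
   have e3: "prim w t - prim w s = (LBINT r. ind {s<..t} r * w r)" by (rule prim_diff[OF iw st(2)])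
   have ii1: "L1 (%r. D1 ze * ind {s<..t} r + D2 ze * (ind {s<..t} r * h r))"
   using iis ih by simp
   have ii2: "L1 (%r. ind {s<..t} r * g r)" by (rule i_im[OF ig']) auto
   have ii3: "L1 (%r. ind {s<..t} r * w r)" by (rule i_im[OF iw]) auto
   have pointwise: "abs(D1 ze * ind {s<..t} r + D2 ze * (ind {s<..t} r * h r) - ind {s<..t} r * g r) <= e * (ind {s<..t} r * w r)" for r
   proof (cases "r \<in> {s<..t}")
   case True
   hence rab: "r \<in> {a<..b}" using st(1,3) by simp
   have b1: "abs(D1 ze - D1 (r, U r)) <= e" "abs(D2 ze - D2 (r, U r)) <= e"
   proof -
   have c: "dist ze (r, U r) < d1" "dist ze (r, U r) < d2" using close(1)[OF True] by linarith+
   show "abs(D1 ze - D1 (r, U r)) <= e" "abs(D2 ze - D2 (r, U r)) <= e"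
   using less_imp_le[OF d(2)[OF close(3)[OF True] close(2)[OF True] c(1)]] less_imp_le[OF d(4)[OF close(3)[OF True] close(2)[OF True] c(2)]]
   unfolding dist_real_def .
   qed
   have "D1 ze + D2 ze * h r - g r = (D1 ze - D1 (r, U r)) + (D2 ze - D2 (r, U r)) * h r"
   using rab by (simp add: g_def alg)
   also have "abs(...) <= abs(D1 ze - D1 (r, U r)) + abs(D2 ze - D2 (r, U r)) * abs(h r)"
   by (intro order_trans[OF abs_triangle_ineq]) (simp add: abs_mult)
   also have "... <= e + e * abs(h r)" using b1 by (intro add_mono mult_right_mono) auto
   also have "... = e * w r" using rab by (simp add: w_def alg)
   finally show ?thesis using True by simp
   qed simp
   have Eq: "E t - E s = (LBINT r. D1 ze * ind {s<..t} r + D2 ze * (ind {s<..t} r * h r) - ind {s<..t} r * g r)"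
   using e1 e2 int_diff[OF ii1 ii2] by (simp add: E_def)
   have "abs(E t - E s) <= (LBINT r. abs(D1 ze * ind {s<..t} r + D2 ze * (ind {s<..t} r * h r) - ind {s<..t} r * g r))"
   unfolding Eq by (rule iab)
   also have "... <= (LBINT r. e * (ind {s<..t} r * w r))"
   by (rule integral_mono[OF integrable_abs[OF i_diff[OF ii1 ii2]] i_mr[OF ii3] pointwise])
   also have "... = e * prim w t - e * prim w s" using e3 by (simp flip: right_diff_distrib)
   finally show "abs(E t - E s) <= e * prim w t - e * prim w s" .
  qed
  thus ?thesis .
 qed
 hence le: "abs(E b - E a) <= e * (prim w b - prim w a)" if "e > 0" for e using that by (simp add: right_diff_distrib)
 have "E b = E a"
 proof (rule ccontr)
  assume "E b ~= E a"
  define W where "W = abs(prim w b - prim w a) + 1"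
  have W: "W > 0" by (simp add: W_def)
  have "abs(E b - E a) <= abs(E b - E a) / (2 * W) * (prim w b - prim w a)"
   by (rule le) (use \<open>E b ~= E a\<close> W in simp)
  also have "... <= abs(E b - E a) / (2 * W) * W"
   using W by (intro mlm) (auto simp: W_def)
  also have "... = abs(E b - E a) / 2" using W by simp
  finally show False using \<open>E b ~= E a\<close> by simp
 qed
 hence "Ps (b, U b) - Ps (a, U a) = prim g b - prim g a" by (simp add: E_def)
 also have "... = (LBINT s. ind {a<..b} s * g s)" by (rule prim_diff[OF ig' ab])
 also have "(%s. ind {a<..b} s * g s) = g" by (intro ext) (simp add: g_def ind_def)
 finally show "Ps (b, U b) - Ps (a, U a) = (LBINT s. ind {a<..b} s * (D1 (s, U s) + D2 (s, U s) * h s))"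
  unfolding g_def .
qed

section \<open>Weak-* compactness of bounded functions\<close>

lemma diagonal_convergent:
 fixes X :: "nat => nat => real"
 assumes "!!i n. abs(X i n) <= C i"
 shows "EX r. strict_mono (r :: nat => nat) & (ALL i. convergent (%n. X i (r n)))"
proof -
 interpret subseqs "%i s. convergent (%n. X i (s n))"
 proof
  fix i and s :: "nat => nat" assume "strict_mono s"
  have "bounded (range (%n. X i (s n)))" using assms unfolding bounded_iff by auto
  from bounded_imp_convergent_subsequence[OF this]
  obtain l r where "strict_mono r" "((%n. X i (s n)) \<circ> r) ----> l" by blast
  thus "EX r. strict_mono r & convergent (%n. X i ((s \<circ> r) n))"
   by (intro exI[of _ r]) (auto simp: convergent_def comp_def)
 qed
 have "convergent (%n. X i (diagseq n))" for i
 proof -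
  have "convergent (%n. X i ((diagseq \<circ> ((+) (Suc i))) n))"
  proof (rule diagseq_holds)
   fix r s :: "nat => nat" and n assume "strict_mono r" "convergent (%k. X n (s k))"
   thus "convergent (%k. X n ((s \<circ> r) k))"
   unfolding convergent_def using LIMSEQ_subseq_LIMSEQ[of "%k. X n (s k)" _ r] by (auto simp: comp_def)
  qed
  hence "convergent (%n. X i (diagseq (n + Suc i)))" by (simp add: comp_def add.commute)
  from convergentD[OF this] obtain L where "(%n. X i (diagseq (n + Suc i))) ----> L" by blast
  from LIMSEQ_offset[OF this] show ?thesis by (rule convergentI)
 qed
 thus ?thesis using subseq_diagseq by blast
qed

text \<open>Finite intersections of a countable base. The empty intersection contributes
  \<open>UNIV\<close>, which the complement step of later inductions over Borel sets relies
  on.\<close>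

lemma countable_Int_stable_generator:
 obtains G :: "nat => 'a::second_countable_topology set"
 where "Int_stable (range G)" "sets borel = sigma_sets UNIV (range G)" "UNIV \<in> range G"
proof -
 obtain B :: "'a set set" where B: "countable B" "topological_basis B" using ex_countable_basis by blast
 define H where "H = Inter ` {F. finite F & F \<subseteq> B}"
 have cH: "countable H" unfolding H_def by (intro countable_image countable_Collect_finite_subset B(1))
 have U: "UNIV \<in> H" unfolding H_def by (rule image_eqI[of _ _ "{}"]) auto
 hence ne: "H ~= {}" by blast
 define G where "G = from_nat_into H"
 have r: "range G = H" unfolding G_def by (rule range_from_nat_into[OF ne cH])
 have "Int_stable H"
 proof (rule Int_stableI)
  fix a b assume "a \<in> H" "b \<in> H"
  then obtain F F' where "finite F" "F \<subseteq> B" "a = \<Inter>F" "finite F'" "F' \<subseteq> B" "b = \<Inter>F'" unfolding H_def by blast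
  thus "a \<inter> b \<in> H" unfolding H_def by (intro image_eqI[of _ _ "F \<union> F'"]) auto
 qed
 moreover have "sets borel = sigma_sets UNIV H"
 proof
  have "sets borel = sigma_sets UNIV B"
   by (subst borel_eq_countable_basis[OF B]) (simp add: sets_measure_of)
  moreover have "B \<subseteq> H" unfolding H_def by (auto intro!: image_eqI[of _ _ "{b}" for b])
  ultimately show "sets borel \<subseteq> sigma_sets UNIV H" using sigma_sets_mono' by metis
  have "H \<subseteq> sets borel"
   unfolding H_def using topological_basis_open[OF B(2)] by (auto intro!: borel_open open_Inter)
  thus "sigma_sets UNIV H \<subseteq> sets borel" using sets.sigma_sets_subset[of H borel] by simp
 qed
 ultimately show ?thesis using that[of G] r U by metis
qed

text \<open>A version on the whole space: functions are multiplied by indicators beforehand, so set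
  integrals do not appear. In contrast to \<open>weakstar_Linf\<close> it asks for no bounds; these
  are supplied separately wherever they matter.\<close>

definition weakstar :: "(nat => 'a::euclidean_space => real) => ('a => real) => bool" where
 "weakstar f g \<longleftrightarrow> (ALL ph. L1 ph -->
  (%n. LBINT z. f n z * ph z) ----> (LBINT z. g z * ph z))"

lemma weakstarD: "weakstar f g ==> L1 ph ==>
  (%n. LBINT z. f n z * ph z) ----> (LBINT z. g z * ph z)"
 by (simp add: weakstar_def)

lemma weakstar_subseq: "weakstar f g ==> strict_mono r ==> weakstar (%n. f (r n)) g"
 unfolding weakstar_def
 using LIMSEQ_subseq_LIMSEQ[of "%n. LBINT z. f n z * ph z" _ r for ph] by (simp add: comp_def)

lemma ibf:
 fixes f :: "'a => real"
 assumes "f \<in> borel_measurable M" "A \<in> sets M" "emeasure M A < \<infinity>" "!!z. abs(f z) <= K" "!!z. z ~: A ==> f z = 0"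
 shows "integrable M f"
proof -
 have "integrable M (%z. ind A z * f z)"
  by (rule imb[where C=K]) (use assms in "auto intro!: i_ind")
 also have "(%z. ind A z * f z) = f" using assms(5) by (intro ext) (auto simp: ind_def)
 finally show ?thesis .
qed

text \<open>The common bound \<open>K\<close> makes the pairings Lipschitz in the test function with
  respect to the L^1 norm, uniformly in n, so convergence extends from indicators to simple
  functions and then to all integrable functions.\<close>

lemma weakstar_indicators:
 fixes f :: "nat => 'a::euclidean_space => real"
 assumes fm: "!!n. f n \<in> BM" and fb: "!!n z. abs(f n z) <= K"
  and gm: "g \<in> BM" and gb: "!!z. abs(g z) <= K"
  and conv: "!!D. D \<in> sets borel ==> emeasure lborel D < \<infinity> ==> (%n. LBINT z. f n z * ind D z) ----> (LBINT z. g z * ind D z)"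
 shows "weakstar f g"
 unfolding weakstar_def
proof (intro allI impI)
 fix ph :: "'a => real" assume "L1 ph"
 have K0: "K >= 0" using gb[of undefined] by linarith
 have if': "L1 (%z. f n z * ph z)" if "L1 ph" for n ph
  by (rule imb(2)[OF that, where C=K]) (use fm fb in auto)
 have ig': "L1 (%z. g z * ph z)" if "L1 ph" for ph
  by (rule imb(2)[OF that, where C=K]) (use gm gb in auto)
 show "(%n. LBINT z. f n z * ph z) ----> (LBINT z. g z * ph z)"
  using \<open>L1 ph\<close>
 proof (induction rule: integrable_induct)
  case (base A c)
  have "(%n. (LBINT z. f n z * ind A z) * c) ----> (LBINT z. g z * ind A z) * c"
   by (intro tendsto_mult conv tendsto_const) (use base in auto)
  moreover have "(LBINT z. h z * (ind A z *\<^sub>R c)) = (LBINT z. h z * ind A z) * c" for h :: "'a => real"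
   by (simp flip: integral_mult_left_zero add: mult.assoc)
  ultimately show ?case by simp
 next
  case (add ph ps)
  have "(%n. (LBINT z. f n z * ph z) + (LBINT z. f n z * ps z)) ----> (LBINT z. g z * ph z) + (LBINT z. g z * ps z)"
   by (intro tendsto_add add)
  thus ?case using if'[OF add.hyps(1)] if'[OF add.hyps(2)] ig'[OF add.hyps(1)] ig'[OF add.hyps(2)] by (simp add: distrib_left)
 next
  case (lim ph s)
  define d where "d = (%i. LBINT z. abs(ph z - s i z))"
  have [measurable]: "ph \<in> BL" "s i \<in> BL" for i using lim by auto
  have "d ----> (\<integral>z. (0::real) \<partial>(lborel :: 'a measure))"
   unfolding d_def
  proof (rule integral_dominated_convergence[where w="%z. 3 * abs(ph z)"])
   show "AEL z. (%i. abs(ph z - s i z)) ----> 0"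
   proof (rule AE_I2)
   fix z :: 'a
   have "(%i. s i z) ----> ph z" using lim by simp
   from tendsto_rabs[OF tendsto_diff[OF tendsto_const[of "ph z"] this]]
   show "(%i. abs(ph z - s i z)) ----> 0" by simp
   qed
   show "AEL z. norm (abs(ph z - s i z)) <= 3 * abs(ph z)" for i
   proof (rule AE_I2)
   fix z :: 'a
   have "norm (s i z) <= 2 * norm (ph z)" using lim by simp
   thus "norm (abs(ph z - s i z)) <= 3 * abs(ph z)" by simp
   qed
  qed (use lim in auto)
  hence d: "d ----> 0" by simp
  have close: "abs((LBINT z. h z * ph z) - (LBINT z. h z * s i z)) <= K * d i"
   if "!!z. abs(h z) <= K" "!!ph. L1 ph ==> L1 (%z. h z * ph z)" for h i
  proof -
   have "(LBINT z. h z * ph z) - (LBINT z. h z * s i z) = (LBINT z. h z * ph z - h z * s i z)"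
   by (intro int_diff[symmetric] that lim)
   also have "abs(...) <= (LBINT z. abs(h z * ph z - h z * s i z))" by (rule iab)
   also have "... <= (LBINT z. K * abs(ph z - s i z))"
   proof (rule integral_mono)
   show "L1 (%z. abs(h z * ph z - h z * s i z))"
   by (intro integrable_abs i_diff that lim)
   show "L1 (%z. K * abs(ph z - s i z))"
   by (intro i_mr integrable_abs i_diff lim)
   show "abs(h z * ph z - h z * s i z) <= K * abs(ph z - s i z)" for z
   unfolding right_diff_distrib[symmetric] abs_mult by (intro mult_right_mono that) auto
   qed
   finally show ?thesis by (simp add: d_def)
  qed
  show ?case
  proof (rule LIMSEQ_I)
   fix e :: real assume e: "e > 0"
   have "EX i. K * d i < e / 3"
   proof -
   have "(%i. K * d i) ----> K * 0" by (intro tendsto_mult tendsto_const d)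
   from order_tendstoD(2)[OF this, of "e/3"] e obtain i where "K * d i < e / 3" by (auto simp: eventually_sequentially)
   thus ?thesis by blast
   qed
   then obtain i where i: "K * d i < e / 3" by blast
   have "(%n. LBINT z. f n z * s i z) ----> (LBINT z. g z * s i z)" using lim by simp
   from LIMSEQ_D[OF this, of "e/3"] e obtain N where N: "!!n. n >= N ==> abs((LBINT z. f n z * s i z) - (LBINT z. g z * s i z)) < e / 3"
   by auto
   show "EX N. ALL n>=N. norm ((LBINT z. f n z * ph z) - (LBINT z. g z * ph z)) < e"
   proof (intro exI[of _ N] allI impI)
   fix n assume "n >= N"
   from N[OF this] close[OF fb if', of n i] close[OF gb ig', of i] i
   show "norm ((LBINT z. f n z * ph z) - (LBINT z. g z * ph z)) < e" unfolding real_norm_def by linarith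
   qed
  qed
 qed
qed

text \<open>The limits \<open>l D\<close> satisfy |l D| <= K m(D). Adding \<open>K * m D\<close>
  makes the set function nonnegative, hence an honest measure that is absolutely continuous; its
  Radon-Nikodym density minus \<open>K\<close> on \<open>A\<close> is the limit function.\<close>

lemma weakstar_compact_set_function:
 fixes f :: "nat => 'a::euclidean_space => real"
 assumes A: "A \<in> sets borel" "emeasure lborel A < \<infinity>"
  and fm: "!!n. f n \<in> BM" and fb: "!!n z. abs(f n z) <= K" and fz: "!!n z. z ~: A ==> f n z = 0"
  and conv: "!!D. D \<in> sets borel ==> convergent (%n. LBINT z. f n z * ind D z)"
 shows "EX g:borel_measurable borel. (ALL z. abs(g z) <= K) & (ALL z. z ~: A --> g z = 0) & weakstar f g"
proof -
 have K0: "K >= 0" using fb[of undefined undefined] by linarith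
 have [measurable]: "A \<in> sets borel" "f n \<in> BM" for n using A fm by auto
 define l where "l = (%D. lim (%n. LBINT z. f n z * ind D z))"
 have l: "(%n. LBINT z. f n z * ind D z) ----> l D" if "D \<in> sets borel" for D
  using conv[OF that] by (simp add: l_def convergent_LIMSEQ_iff)
 define m where "m = (%D. measure lborel (A \<inter> D))"
 have mfin: "emeasure lborel (A \<inter> D) < \<infinity>" if "D \<in> sets borel" for D
  using emeasure_mono[of "A \<inter> D" A lborel] A that by (auto intro: le_less_trans)
 have mi: "m D = (LBINT z. ind A z * ind D z)" if "D \<in> sets borel" for D
 proof -
  have "(%z. ind A z * ind D z) = (ind (A \<inter> D) :: 'a => real)" by (rule ext) (simp add: ind_def)
  thus ?thesis using that by (simp add: m_def)
 qed
 have ifD: "L1 (%z. f n z * ind D z)" if "D \<in> sets borel" for n D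
  by (rule ibf[of _ _ A K]) (use that A fb fz K0 in "auto simp: ind_def")
 have iAD: "L1 (%z. ind A z * ind D z :: real)" if "D \<in> sets borel" for D
  by (rule ibf[of _ _ A 1]) (use that A in "auto simp: ind_def")
 have fle: "abs(\<integral>z. f n z * ind D z \<partial>lborel) <= K * m D" if D: "D \<in> sets borel" for n D
 proof -
  have "abs(\<integral>z. f n z * ind D z \<partial>lborel) <= (LBINT z. abs(f n z * ind D z))" by (rule iab)
  also have "... <= (LBINT z. K * (ind A z * ind D z))"
   by (rule integral_mono) (use ifD[OF D] iAD[OF D] fb fz K0 in "auto simp: ind_def")
  also have "... = K * m D" using mi[OF D] by simp
  finally show ?thesis .
 qed
 have lle: "abs(l D) <= K * m D" if "D \<in> sets borel" for D
  by (rule tendsto_upperbound[OF tendsto_rabs[OF l[OF that]]]) (use fle[OF that] in auto)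
 define \<mu> where "\<mu> = (%D. ennreal (l D + K * m D))"
 have lsum: "(%i. l (D i)) sums l (\<Union>i. D i)" "(%i. m (D i)) sums m (\<Union>i. D i)"
  if D: "range D \<subseteq> sets borel" and dj: "disjoint_family D" for D :: "nat => 'a set"
 proof -
  have Di: "D i \<in> sets borel" for i using D by auto
  have UD: "(\<Union>i. D i) \<in> sets borel" using Di by blast
  have djA: "disjoint_family (%i. A \<inter> D i)" using dj unfolding disjoint_family_on_def by blast
  have "(%i. measure lborel (A \<inter> D i)) sums measure lborel (\<Union>i. A \<inter> D i)"
  proof (rule measure_UNION)
   show "emeasure lborel (\<Union>i. A \<inter> D i) ~= \<infinity>" using mfin[OF UD] unfolding Int_UN_distrib by (simp add: less_top del: UN_simps)
  qed (use djA Di A in auto)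
  thus ms: "(%i. m (D i)) sums m (\<Union>i. D i)" unfolding m_def Int_UN_distrib .
  have fs: "(LBINT z. f n z * ind (\<Union>i. D i) z) = (\<Sum>i. LBINT z. f n z * ind (D i) z)" for n
  proof -
   have "(LINT z:(\<Union>i. D i)|lborel. f n z) = (\<Sum>i. LINT z:D i|lborel. f n z)"
   proof (rule lebesgue_integral_countable_add)
   show "set_integrable lborel (\<Union>i. D i) (f n)" using ifD[OF UD] by (simp add: set_integrable_def mult.commute)
   qed (use Di dj in "auto simp: disjoint_family_on_def")
   thus ?thesis by (simp add: set_lebesgue_integral_def mult.commute)
  qed
  \<comment> \<open>Countable additivity of the limit is an exchange of sum and limit, dominated by
    the summable sequence \<open>K * m (D i)\<close>.\<close>
  have T: "summable (%i. norm (l (D i))) & (%n. \<Sum>i. LBINT z. f n z * ind (D i) z) ----> (\<Sum>i. l (D i))"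
  proof -
   have "eventually (%(i, n). norm (LBINT z. f n z * ind (D i) z) <= K * m (D i)) (at_top \<times>\<^sub>F sequentially)"
   using fle[OF Di] by (intro always_eventually) auto
   from tannerys_theorem[OF l[OF Di] this summable_mult[OF sums_summable[OF ms]]] show ?thesis by simp
  qed
  hence "(%n. LBINT z. f n z * ind (\<Union>i. D i) z) ----> (\<Sum>i. l (D i))" by (simp add: fs)
  from LIMSEQ_unique[OF this l[OF UD]] T show "(%i. l (D i)) sums l (\<Union>i. D i)"
   using summable_sums[OF summable_norm_cancel] by metis
 qed
 define N where "N = measure_of (UNIV :: 'a set) (sets borel) \<mu>"
 have sN: "sets N = sets borel" unfolding N_def using sets.sigma_sets_eq[of borel] by (simp add: sets_measure_of)
 have nn: "0 <= l D + K * m D" if "D \<in> sets borel" for D using lle[OF that] by linarith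
 have eN: "emeasure N D = \<mu> D" if "D \<in> sets borel" for D
 proof (rule emeasure_measure_of[OF N_def])
  show "positive (sets N) \<mu>"
  proof -
   have "l {} = 0" using LIMSEQ_unique[OF l[of "{}"], of 0] by simp
   thus ?thesis by (simp add: positive_def \<mu>_def m_def)
  qed
  show "countably_additive (sets N) \<mu>"
  proof (rule countably_additiveI)
   fix D :: "nat => 'a set" assume "range D \<subseteq> sets N" "disjoint_family D" "\<Union> (range D) \<in> sets N"
   hence D: "range D \<subseteq> sets borel" "disjoint_family D" by (auto simp: sN)
   have "(%i. l (D i) + K * m (D i)) sums (l (\<Union>i. D i) + K * m (\<Union>i. D i))"
   by (intro sums_add sums_mult lsum D)
   thus "(\<Sum>i. \<mu> (D i)) = \<mu> (\<Union> (range D))"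
   unfolding \<mu>_def using D(1) nn by (intro suminf_ennreal_eq) auto
  qed
  show "D \<in> sets N" using that sN by simp
 qed auto
 have "absolutely_continuous lborel N"
  unfolding absolutely_continuous_def
 proof
  fix D :: "'a set" assume "D \<in> null_sets lborel"
  hence D: "D \<in> sets borel" "emeasure lborel D = 0" by auto
  have "emeasure lborel (A \<inter> D) <= emeasure lborel D" by (rule emeasure_mono) (use D in auto)
  hence "m D = 0" using D by (simp add: m_def measure_def)
  hence "\<mu> D = 0" using lle[OF D(1)] by (simp add: \<mu>_def)
  thus "D \<in> null_sets N" using D sN eN by auto
 qed
 from sigma_finite_measure.Radon_Nikodym[OF lborel.sigma_finite_measure_axioms this] sN obtain h where h: "h \<in> BL" "density lborel h = N" by auto
 have hD: "(\<integral>\<^sup>+z\<in>D. h z \<partial>lborel) = \<mu> D" if "D \<in> sets borel" for D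
  using emeasure_density[OF h(1), of D] that h(2) eN[OF that] by simp
 have hfin: "(\<integral>\<^sup>+z. h z \<partial>lborel) < \<infinity>" using hD[of UNIV] by (simp add: \<mu>_def)
 have AEfin: "AEL z. h z ~= \<infinity>" by (rule nn_integral_PInf_AE[OF h(1)]) (use hfin in auto)
 define g0 where "g0 = (%z. enn2real (h z))"
 have [measurable]: "g0 \<in> BM" using h(1) by (auto simp: g0_def)
 have g0D: "has_bochner_integral lborel (%z. g0 z * ind D z) (l D + K * m D)" if D: "D \<in> sets borel" for D
 proof (rule has_bochner_integral_nn_integral)
  have "(\<integral>\<^sup>+z. ennreal (g0 z * ind D z) \<partial>lborel) = (\<integral>\<^sup>+z\<in>D. h z \<partial>lborel)"
  proof (rule nn_integral_cong_AE)
   show "AEL z. ennreal (g0 z * ind D z) = h z * indicator D z"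
   using AEfin by eventually_elim (simp add: g0_def ind_def less_top)
  qed
  thus "(\<integral>\<^sup>+z. ennreal (g0 z * ind D z) \<partial>lborel) = ennreal (l D + K * m D)" using hD[OF D] by (simp add: \<mu>_def)
  show "(%z. g0 z * ind D z) \<in> BL" using D by measurable
  show "AEL z. 0 <= g0 z * ind D z" by (rule AE_I2) (simp add: g0_def)
  show "0 <= l D + K * m D" by (rule nn[OF D])
 qed
 define g1 where "g1 = (%z. g0 z - K * ind A z)"
 have i0: "L1 g0" using g0D[of UNIV] by (auto simp: has_bochner_integral_iff)
 have iA: "L1 (ind A :: 'a => real)" using A by (auto intro: i_ind)
 have i1: "L1 g1" unfolding g1_def using i0 iA by simp
 have g1D: "(LBINT z. g1 z * ind D z) = l D" if D: "D \<in> sets borel" for D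
 proof -
  have "(LBINT z. g1 z * ind D z) = (LBINT z. g0 z * ind D z - K * (ind A z * ind D z))"
   by (simp add: g1_def left_diff_distrib mult.assoc)
  also have "... = (l D + K * m D) - K * m D"
   using g0D[OF D] iAD[OF D] mi[OF D] by (subst int_diff) (auto simp: has_bochner_integral_iff)
  finally show ?thesis by simp
 qed
 have up: "AEL z. 0 <= K * ind A z - g1 z"
 proof (rule sigma_finite_measure.density_nonneg[OF lborel.sigma_finite_measure_axioms])
  show "L1 (%z. K * ind A z - g1 z)" using i1 iA by simp
  fix D :: "'a set" assume "D \<in> sets lborel"
  hence D: "D \<in> sets borel" by simp
  have "L1 (%z. g1 z * ind D z)"
   by (rule imb(1)[OF i1, where C=1]) (use D in "auto simp: ind_def")
  hence "(LINT z:D|lborel. K * ind A z - g1 z) = K * m D - l D"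
   using iAD[OF D] by (simp add: set_lebesgue_integral_def mi[OF D] g1D[OF D, symmetric] right_diff_distrib mult.commute mult.left_commute)
  thus "0 <= (LINT z:D|lborel. K * ind A z - g1 z)" using lle[OF D] by linarith
 qed
 have lo: "g1 z >= - K * ind A z" for z by (simp add: g1_def g0_def)
 \<comment> \<open>The density satisfies its bounds only almost everywhere. Setting it to 0 where
   they fail makes bound and support valid at every point.\<close>
 define g where "g = (%z. if (abs(g1 z)) <= K * ind A z then g1 z else 0)"
 have [measurable]: "g1 \<in> BM" using i1 by auto
 have gm[measurable]: "g \<in> BM" unfolding g_def by measurable
 have gb: "abs(g z) <= K" for z using K0 by (auto simp: g_def ind_def split: if_splits)
 have gz: "z ~: A ==> g z = 0" for z by (simp add: g_def)
 have ae: "AEL z. g z = g1 z"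
  using up
 proof eventually_elim
  case (elim z)
  have "abs(g1 z) <= K * ind A z" using elim lo[of z] by linarith
  thus ?case by (simp add: g_def)
 qed
 have "weakstar f g"
 proof (rule weakstar_indicators[OF fm fb gm gb])
  fix D :: "'a set" assume D: "D \<in> sets borel"
  have "(LBINT z. g z * ind D z) = (LBINT z. g1 z * ind D z)"
   by (rule integral_cong_AE) (use D ae in "auto elim: eventually_mono")
  thus "(%n. LBINT z. f n z * ind D z) ----> (LBINT z. g z * ind D z)"
   using l[OF D] g1D[OF D] by simp
 qed
 thus ?thesis using gm gb gz by blast
qed

text \<open>The index j allows one extraction for countably many sequences. Pairs of a sequence j
  and a generating set i are coded by \<open>prod_decode\<close> for the diagonal argument;
  convergence then spreads from the generator to every Borel set, disjoint unions being handled by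
  dominated exchange of sum and limit.\<close>

lemma weakstar_compact:
 fixes f :: "nat => nat => 'a::euclidean_space => real"
 assumes A: "A \<in> sets borel" "emeasure lborel A < \<infinity>"
  and fm: "!!j n. f j n \<in> BM" and fb: "!!j n z. abs(f j n z) <= K j" and fz: "!!j n z. z ~: A ==> f j n z = 0"
 shows "EX r. strict_mono (r :: nat => nat) & (ALL j. EX g:borel_measurable borel. (ALL z. abs(g z) <= K j) & (ALL z. z ~: A --> g z = 0) & weakstar (%n. f j (r n)) g)"
proof -
 obtain G :: "nat => 'a set" where G: "Int_stable (range G)" "sets borel = sigma_sets UNIV (range G)" "UNIV \<in> range G"
  by (rule countable_Int_stable_generator)
 have K0: "K j >= 0" for j using fb[of j undefined undefined] by linarith
 have [measurable]: "A \<in> sets borel" "f j n \<in> BM" for j n using A fm by auto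
 have Gs: "G i \<in> sets borel" for i unfolding G(2) by (rule sigma_sets.Basic) auto
 define m where "m = (%D. measure lborel (A \<inter> D))"
 have mfin: "emeasure lborel (A \<inter> D) < \<infinity>" if "D \<in> sets borel" for D
  using emeasure_mono[of "A \<inter> D" A lborel] A that by (auto intro: le_less_trans)
 have mi: "m D = (LBINT z. ind A z * ind D z)" if "D \<in> sets borel" for D
 proof -
  have "(%z. ind A z * ind D z) = (ind (A \<inter> D) :: 'a => real)" by (rule ext) (simp add: ind_def)
  thus ?thesis using that by (simp add: m_def)
 qed
 have ifD: "L1 (%z. f j n z * ind D z)" if "D \<in> sets borel" for j n D
  by (rule ibf[of _ _ A "K j"]) (use that A fb fz K0 in "auto simp: ind_def")
 have iAD: "L1 (%z. ind A z * ind D z :: real)" if "D \<in> sets borel" for D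
  by (rule ibf[of _ _ A 1]) (use that A in "auto simp: ind_def")
 have fle: "abs(\<integral>z. f j n z * ind D z \<partial>lborel) <= K j * m D" if D: "D \<in> sets borel" for j n D
 proof -
  have "abs(\<integral>z. f j n z * ind D z \<partial>lborel) <= (LBINT z. abs(f j n z * ind D z))" by (rule iab)
  also have "... <= (LBINT z. K j * (ind A z * ind D z))"
   by (rule integral_mono) (use ifD[OF D] iAD[OF D] fb fz K0 in "auto simp: ind_def")
  also have "... = K j * m D" using mi[OF D] by simp
  finally show ?thesis .
 qed
 define X where "X = (%k n. case prod_decode k of (j, i) => \<integral>z. f j n z * ind (G i) z \<partial>lborel)"
 have "abs(X k n) <= (case prod_decode k of (j, i) => K j * m (G i))" for k n
  unfolding X_def using fle[OF Gs] by (auto split: prod.split)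
 from diagonal_convergent[of X, OF this]
 obtain r where r: "strict_mono (r :: nat => nat)" "!!k. convergent (%n. X k (r n))" by blast
 have cG: "convergent (%n. LBINT z. f j (r n) z * ind (G i) z)" for i j
  using r(2)[of "prod_encode (j, i)"] by (simp add: X_def)
 have PW: "range G \<subseteq> Pow UNIV" by simp
 have conv: "convergent (%n. LBINT z. f j (r n) z * ind D z)" if "D \<in> sets borel" for j D
  using G(1) PW that[unfolded G(2)]
 proof (induction rule: sigma_sets_induct_disjoint)
  case (basic D) thus ?case using cG by blast
 next
  case empty thus ?case by (simp add: convergent_const)
 next
  case (compl D)
  have D: "D \<in> sets borel" using compl G(2) by simp
  obtain i where "G i = UNIV" using G(3) by (auto simp: image_def)
  with cG[of j i] have U: "convergent (%n. LBINT z. f j (r n) z * ind UNIV z)" by simp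
  have e: "(%z. f j n z * ind (UNIV - D) z) = (%z. f j n z * ind UNIV z - f j n z * ind D z)" for n
   by (rule ext) (simp add: ind_def)
  have "(%n. LBINT z. f j (r n) z * ind (UNIV - D) z) = (%n. (LBINT z. f j (r n) z * ind UNIV z) - (LBINT z. f j (r n) z * ind D z))"
   unfolding e by (rule ext) (rule int_diff[OF ifD ifD[OF D]], simp)
  thus ?case using convergent_diff[OF U compl.IH] by simp
 next
  case (union D)
  have Di: "D i \<in> sets borel" for i using union G(2) by auto
  hence UD: "(\<Union>i. D i) \<in> sets borel" by blast
  have djA: "disjoint_family (%i. A \<inter> D i)" using union(1) unfolding disjoint_family_on_def by blast
  have "(%i. measure lborel (A \<inter> D i)) sums measure lborel (\<Union>i. A \<inter> D i)"
  proof (rule measure_UNION)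
   show "emeasure lborel (\<Union>i. A \<inter> D i) ~= \<infinity>" using mfin[OF UD] unfolding Int_UN_distrib by (simp add: less_top del: UN_simps)
  qed (use djA Di A in auto)
  hence ms: "summable (%i. m (D i))" by (simp add: m_def sums_summable)
  have fs: "(LBINT z. f j n z * ind (\<Union>i. D i) z) = (\<Sum>i. LBINT z. f j n z * ind (D i) z)" for n
  proof -
   have "(LINT z:(\<Union>i. D i)|lborel. f j n z) = (\<Sum>i. LINT z:D i|lborel. f j n z)"
   proof (rule lebesgue_integral_countable_add)
   show "set_integrable lborel (\<Union>i. D i) (f j n)" using ifD[OF UD] by (simp add: set_integrable_def mult.commute)
   qed (use Di union(1) in "auto simp: disjoint_family_on_def")
   thus ?thesis by (simp add: set_lebesgue_integral_def mult.commute)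
  qed
  have l: "(%n. LBINT z. f j (r n) z * ind (D i) z) ----> lim (%n. LBINT z. f j (r n) z * ind (D i) z)" for i
   using union.IH[of i] by (simp add: convergent_LIMSEQ_iff)
  have "eventually (%(i, n). norm (LBINT z. f j (r n) z * ind (D i) z) <= K j * m (D i)) (at_top \<times>\<^sub>F sequentially)"
   using fle[OF Di] by (intro always_eventually) auto
  from tannerys_theorem[OF l this summable_mult[OF ms]] show ?case by (auto simp: fs convergent_def)
 qed
 show ?thesis
  using r(1) weakstar_compact_set_function[OF A fm fb fz conv] by (intro exI[of _ r] conjI allI)
qed

lemma integrable_weak_pairing:
 fixes f :: "'a::euclidean_space => real"
 assumes "f \<in> BM" "!!z. abs(f z) <= K" "L1 ph"
 shows "L1 (%z. f z * ph z)"
 by (rule imb(2)[OF assms(3), where C=K]) (use assms in auto)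

section \<open>Distribution functions and Young measures\<close>

lemma weakstar_AE_le:
 fixes f f' :: "nat => 'a::euclidean_space => real"
 assumes A: "A \<in> sets borel" "emeasure lborel A < \<infinity>"
  and m: "!!n. f n \<in> BM" "!!n. f' n \<in> BM" "g \<in> BM" "g' \<in> BM"
  and b: "!!n z. abs(f n z) <= K" "!!n z. abs(f' n z) <= K" "!!z. abs(g z) <= K" "!!z. abs(g' z) <= K"
  and z: "!!z. z ~: A ==> g z = 0" "!!z. z ~: A ==> g' z = 0"
  and w: "weakstar f g" "weakstar f' g'" and le: "!!n z. f n z <= f' n z"
 shows "AEL z. g z <= g' z"
proof -
 have "AEL z. 0 <= g' z - g z"
 proof (rule sigma_finite_measure.density_nonneg[OF lborel.sigma_finite_measure_axioms])
  show "L1 (%z. g' z - g z)"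
   by (intro i_diff ibf[of _ _ A K]) (use A m b z in auto)
  fix D :: "'a set" assume D: "D \<in> sets lborel"
  have "emeasure lborel (A \<inter> D) < \<infinity>"
   using emeasure_mono[of "A \<inter> D" A lborel] A D by (auto intro: le_less_trans)
  hence i: "L1 (ind (A \<inter> D) :: 'a => real)"
   using A D by (intro i_ind) auto
  have "(LBINT z. g z * ind (A \<inter> D) z) <= (LBINT z. g' z * ind (A \<inter> D) z)"
  proof (rule LIMSEQ_le[OF weakstarD[OF w(1) i] weakstarD[OF w(2) i]], intro exI allI impI)
   fix n
   show "(LBINT z. f n z * ind (A \<inter> D) z) <= (LBINT z. f' n z * ind (A \<inter> D) z)"
   by (rule integral_mono[OF integrable_weak_pairing[OF m(1) b(1) i] integrable_weak_pairing[OF m(2) b(2) i]])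
   (use le in "auto intro: mult_right_mono")
  qed
  hence "0 <= (LBINT z. g' z * ind (A \<inter> D) z) - (LBINT z. g z * ind (A \<inter> D) z)" by simp
  also have "... = (LBINT z. g' z * ind (A \<inter> D) z - g z * ind (A \<inter> D) z)"
   by (rule int_diff[symmetric, OF integrable_weak_pairing[OF m(4) b(4) i] integrable_weak_pairing[OF m(3) b(3) i]])
  also have "(%z. g' z * ind (A \<inter> D) z - g z * ind (A \<inter> D) z) = (%z. ind D z *\<^sub>R (g' z - g z))"
   by (rule ext) (auto simp: ind_def z)
  finally show "0 <= (LINT z:D|lborel. g' z - g z)" by (simp add: set_lebesgue_integral_def)
 qed
 thus ?thesis by eventually_elim simp
qed

text \<open>Limits are extracted at the countably many rational levels, where they are monotone in
  the level off a null set; F is their limit from the right. At a given level xi it is the weak-*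
  limit of the indicators as soon as its total integral is continuous there, which can fail only for
  countably many xi.\<close>

lemma young_distribution_exists:
 fixes u :: "nat => 'a::euclidean_space => real"
 assumes A: "A \<in> sets borel" "emeasure lborel A < \<infinity>"
  and um: "!!n. u n \<in> BM" and ub: "!!n z. abs(u n z) <= R"
 obtains r :: "nat => nat" and F :: "'a => real => real"
 where "strict_mono r" "(%x. F (fst x) (snd x)) \<in> BM"
  "!!z xi xi'. xi <= xi' ==> F z xi <= F z xi'" "!!z xi. continuous (at_right xi) (F z)"
  "!!z xi. xi < - R ==> F z xi = 0" "!!z xi. R <= xi ==> F z xi = 1"
  "AEL xi. weakstar (%n z. ind A z * of_bool (u (r n) z < xi)) (%z. ind A z * F z xi)"
proof -
 have R0: "R >= 0" using ub[of undefined undefined] by linarith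
 have [measurable]: "A \<in> sets borel" "u n \<in> BM" for n using A um by auto
 define q :: "nat => real" where "q = (%j. real_of_rat (from_nat j))"
 have qd: "EX j. a < q j & q j < b" if ab: "a < b" for a b :: real
 proof -
  obtain p :: rat where p: "a < of_rat p" "of_rat p < b" using of_rat_dense[OF ab] by blast
  thus ?thesis by (intro exI[of _ "to_nat p"]) (simp add: q_def)
 qed
 define f where "f = (%j n z. ind A z * of_bool (u n z < q j) :: real)"
 have fm: "f j n \<in> BM" for j n unfolding f_def by measurable
 have fb: "abs(f j n z) <= 1" for j n z by (simp add: f_def ind_def)
 have fz: "z ~: A ==> f j n z = 0" for j n z by (simp add: f_def)
 obtain r where r: "strict_mono (r :: nat => nat)"
  and "ALL j. EX g. g \<in> BM & (ALL z. abs(g z) <= 1) & (ALL z. z ~: A --> g z = 0) & weakstar (%n. f j (r n)) g"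
  using weakstar_compact[OF A, of f "%j. 1", OF fm fb fz] by blast
 from choice[OF this(2)] obtain g where
  g: "!!j. g j \<in> BM" "!!j z. abs(g j z) <= 1" "!!j z. z ~: A ==> g j z = 0" "!!j. weakstar (%n. f j (r n)) (g j)"
  by blast
 note g(1)[measurable]
 have iAm: "(ind A :: 'a => real) \<in> BM" by measurable
 have wA: "weakstar (%n. ind A) (ind A :: 'a => real)" and w0: "weakstar (%n z. 0) (%z::'a. 0)"
  by (auto simp: weakstar_def)
 have le1: "AEL z. g i z <= g j z" if "q i <= q j" for i j
  by (rule weakstar_AE_le[OF A fm fm g(1) g(1) fb fb g(2) g(2) g(3) g(3) g(4) g(4)])
   (use that in "auto simp: f_def ind_def")
 have le2: "AEL z. 0 <= g j z" for j
  by (rule weakstar_AE_le[OF A _ fm _ g(1) _ fb _ g(2) _ g(3) w0 g(4)]) (auto simp: f_def ind_def)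
 have le3: "AEL z. g j z <= ind A z" for j
  by (rule weakstar_AE_le[OF A fm _ g(1) _ fb _ g(2) _ g(3) _ g(4) wA]) (auto simp: f_def ind_def)
 \<comment> \<open>The indicator uses the strict inequality u < q j: it is certainly 1 only for
   \<open>q j > R\<close>, but already 0 at \<open>q j = - R\<close>. The asymmetric ranges for F at
   the two ends come from this.\<close>
 have le4: "AEL z. ind A z <= g j z" if "q j > R" for j
 proof (rule weakstar_AE_le[OF A _ fm _ g(1) _ fb _ g(2) _ g(3) wA g(4)])
  fix n z
  have "u (r n) z < q j" using ub[of "r n" z] that by linarith
  thus "ind A z <= f j (r n) z" by (simp add: f_def)
 qed (auto simp: ind_def)
 have le5: "AEL z. g j z <= 0" if "q j <= - R" for j
 proof (rule weakstar_AE_le[OF A fm _ g(1) _ fb _ g(2) _ g(3) _ g(4) w0])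
  fix n z
  have "~ u (r n) z < q j" using ub[of "r n" z] that by linarith
  thus "f j (r n) z <= 0" by (simp add: f_def)
 qed auto
 define Gd where "Gd = {z \<in> A. (ALL i j. q i <= q j --> g i z <= g j z) & (ALL j. 0 <= g j z & g j z <= ind A z) &
  (ALL j. q j > R --> ind A z <= g j z) & (ALL j. q j <= - R --> g j z <= 0)}"
 have "{z \<in> space borel. z \<in> A & (ALL i j. q i <= q j --> g i z <= g j z) & (ALL j. 0 <= g j z & g j z <= ind A z) &
  (ALL j. q j > R --> ind A z <= g j z) & (ALL j. q j <= - R --> g j z <= 0)} \<in> sets borel"
  by measurable
 hence Gdm[measurable]: "Gd \<in> sets borel" by (simp add: Gd_def)
 have AEG: "AEL z. z \<in> A --> z \<in> Gd"
 proof -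
  have "AEL z. ALL i j. q i <= q j --> g i z <= g j z" using le1 by (simp add: AE_all_countable AE_impI)
  moreover have "AEL z. ALL j. 0 <= g j z & g j z <= ind A z" using le2 le3 by (simp add: AE_all_countable)
  moreover have "AEL z. ALL j. q j > R --> ind A z <= g j z" using le4 by (simp add: AE_all_countable AE_impI)
  moreover have "AEL z. ALL j. q j <= - R --> g j z <= 0" using le5 by (simp add: AE_all_countable AE_impI)
  ultimately show ?thesis
  proof eventually_elim
   case (elim z)
   show ?case
   proof
   assume "z \<in> A"
   with elim show "z \<in> Gd" by (simp add: Gd_def)
   qed
  qed
 qed
 \<comment> \<open>Outside \<open>Gd\<close> the data of a unit mass at 0 are used, so that
   \<open>F z\<close> becomes a distribution function for every z and not just for almost every
   z.\<close>
 define gg where "gg = (%j z. if z \<in> Gd then g j z else of_bool (q j > 0))"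
 have ggm[measurable]: "gg j \<in> BM" for j unfolding gg_def by measurable
 have gg01: "0 <= gg j z" "gg j z <= 1" for j z by (auto simp: gg_def Gd_def)
 have ggmono: "gg i z <= gg j z" if "q i <= q j" for i j z using that by (auto simp: gg_def Gd_def)
 have gg1: "gg j z = 1" if "q j > R" for j z using that R0 by (auto simp: gg_def Gd_def intro!: antisym)
 have gg0: "gg j z = 0" if "q j <= - R" for j z using that R0 by (auto simp: gg_def Gd_def intro!: antisym)
 \<comment> \<open>Taking only levels strictly above xi builds in right continuity: F z xi < a is
   witnessed by one level above xi, and the same level serves all nearby xi.\<close>
 define F where "F = (%z xi. INF j\<in>{j. xi < q j}. gg j z)"
 have ne: "{j. xi < q j} ~= {}" for xi using qd[of xi "xi + 1"] by auto
 have bd: "bdd_below ((%j. gg j z) ` {j. xi < q j})" for z xi by (rule bdd_belowI[of _ 0]) (use gg01 in auto)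
 have Fle: "F z xi <= gg j z" if "xi < q j" for z xi j unfolding F_def by (rule cINF_lower[OF bd]) (use that in simp)
 have Fge: "c <= F z xi" if "!!j. xi < q j ==> c <= gg j z" for c z xi unfolding F_def by (rule cINF_greatest[OF ne]) (use that in simp)
 have Fless: "F z xi < a \<longleftrightarrow> (EX j. xi < q j & gg j z < a)" for z xi a
  unfolding F_def using cINF_less_iff[OF ne bd] by simp
 have ggle: "gg j z <= F z xi" if "q j <= xi" for j z xi by (rule Fge, rule ggmono) (use that in simp)
 have mono: "F z xi <= F z xi'" if "xi <= xi'" for z xi xi' by (rule Fge, rule Fle) (use that in simp)
 have F01: "0 <= F z xi" "F z xi <= 1" for z xi
 proof -
  show "0 <= F z xi" by (rule Fge) (rule gg01)
  obtain j where "xi < q j" using ne[of xi] by auto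
  from order_trans[OF Fle[OF this] gg01(2)] show "F z xi <= 1" .
 qed
 have rc: "continuous (at_right xi) (F z)" for z xi
  unfolding continuous_within
 proof (rule order_tendstoI)
  fix a assume "a < F z xi"
  thus "\<forall>\<^sub>F x in at_right xi. a < F z x"
   using less_le_trans[OF _ mono[of xi _ z]] by (auto simp: eventually_at_right_field intro!: exI[of _ "xi + 1"])
 next
  fix a assume "F z xi < a"
  then obtain j where j: "xi < q j" "gg j z < a" using Fless by blast
  thus "\<forall>\<^sub>F x in at_right xi. F z x < a"
   using le_less_trans[OF Fle[of _ j z]] by (auto simp: eventually_at_right_field intro!: exI[of _ "q j"])
 qed
 have F0: "F z xi = 0" if xR: "xi < - R" for z xi
 proof -
  obtain j where "xi < q j" "q j < - R" using qd[OF xR] by blast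
  thus ?thesis using Fle[of xi j z] gg0[of j z] F01(1)[of z xi] by simp
 qed
 have F1: "F z xi = 1" if "R <= xi" for z xi
  using F01(2)[of z xi] Fge[of xi 1 z] gg1[of _ z] that by (intro antisym) auto
 have "(%x. F (fst x) (snd x)) \<in> BM2"
 proof (rule borel_measurableI_less)
  fix a
  have "{x \<in> space (borel \<Otimes>\<^sub>M borel). EX j. snd x < q j & gg j (fst x) < a} \<in> sets (borel \<Otimes>\<^sub>M (borel :: real measure))"
   by measurable
  thus "{x \<in> space (borel \<Otimes>\<^sub>M borel). F (fst x) (snd x) < a} \<in> sets (borel \<Otimes>\<^sub>M borel)"
   unfolding Fless .
 qed
 hence Fm: "(%x. F (fst x) (snd x)) \<in> BM" unfolding borel_prod .
 have Fz[measurable]: "(%z. F z xi) \<in> BM" for xi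
 proof (rule borel_measurableI_less)
  fix a
  have "{z \<in> space borel. EX j. xi < q j & gg j z < a} \<in> sets borel" by measurable
  thus "{z \<in> space borel. F z xi < a} \<in> sets borel" unfolding Fless .
 qed
 have iF: "L1 (%z. ind A z * F z xi)" for xi
  by (rule ibf[of _ _ A 1]) (use A F01 in "auto simp: ind_def")
 \<comment> \<open>A monotone function of one real variable, hence continuous off a countable set.
   Its continuity at xi controls how much F can change near xi after integration over z.\<close>
 define a where "a = (%xi. LBINT z. ind A z * F z xi)"
 have "mono a"
 proof (rule monoI)
  fix x y :: real assume "x <= y"
  show "a x <= a y" unfolding a_def
   by (rule integral_mono[OF iF iF]) (use mono[OF \<open>x <= y\<close>] in "auto intro: mlm")
 qed
 from mono_ctble_discont[OF this] have "countable {xi. ~ isCont a xi}" .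
 hence "{xi. ~ isCont a xi} \<in> null_sets lborel" by (rule countable_imp_null_set_lborel)
 from AE_not_in[OF this] have AEc: "AEL xi. isCont a xi" by eventually_elim simp
 have "AEL xi. weakstar (%n z. ind A z * of_bool (u (r n) z < xi)) (%z. ind A z * F z xi)"
  using AEc
 proof eventually_elim
  case (elim xi)
  define h where "h = (%n z. ind A z * of_bool (u (r n) z < xi) :: real)"
  have hm: "h n \<in> BM" for n unfolding h_def by measurable
  have hb: "abs(h n z) <= 1" for n z by (simp add: h_def ind_def)
  have "weakstar h (%z. ind A z * F z xi)"
  proof (rule weakstar_indicators[of _ 1])
   show "h n \<in> BM" "abs(h n z) <= 1" for n z by (rule hm hb)+
   show "(%z. ind A z * F z xi) \<in> BM" by measurable
   show "abs(ind A z * F z xi) <= 1" for z using F01[of z xi] by (simp add: ind_def)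
   fix D :: "'a set" assume D: "D \<in> sets borel" "emeasure lborel D < \<infinity>"
   have iD: "L1 (ind D :: 'a => real)" using D by (intro i_ind) auto
   have iFD: "L1 (%z. (ind A z * F z xi) * ind D z)"
   by (rule imb(1)[OF iF, where C=1]) (use D in "auto simp: ind_def")
   have lim: "(%m. a (xi + 1 / real (Suc m)) - a (xi - 1 / real (Suc m))) ----> a xi - a xi"
   proof (intro tendsto_diff isCont_tendsto_compose[OF elim])
   have "(%m. 1 / real (Suc m)) ----> 0" by (rule LIMSEQ_Suc[OF lim_1_over_n])
   from tendsto_add[OF tendsto_const[of xi] this] tendsto_diff[OF tendsto_const[of xi] this]
   show "(%m. xi + 1 / real (Suc m)) ----> xi" "(%m. xi - 1 / real (Suc m)) ----> xi" by simp_all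
   qed
   show "(%n. LBINT z. h n z * ind D z) ----> (LBINT z. ind A z * F z xi * ind D z)"
   proof (rule LIMSEQ_I)
   fix e :: real assume e: "e > 0"
   have "eventually (%m. a (xi + 1 / real (Suc m)) - a (xi - 1 / real (Suc m)) < e / 2) sequentially"
   by (rule order_tendstoD(2)[OF lim]) (use e in simp)
   then obtain m where m: "a (xi + 1 / real (Suc m)) - a (xi - 1 / real (Suc m)) < e / 2" by (auto simp: eventually_sequentially)
   define de where "de = 1 / real (Suc m)"
   have d0: "de > 0" by (simp add: de_def)
   \<comment> \<open>Rational levels slightly below and above xi enclose the indicator at xi. Their
     weak limits differ from the candidate by less than e/2 after integration, by the choice of
     \<open>m\<close>.\<close>
   obtain i where i: "xi - de < q i" "q i < xi" using qd[of "xi - de" xi] d0 by auto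
   obtain k where k: "xi < q k" "q k < xi + de" using qd[of xi "xi + de"] d0 by auto
   have close: "abs((LBINT z. g j z * ind D z) - (LBINT z. ind A z * F z xi * ind D z)) <= a (xi + de) - a (xi - de)"
   if j: "xi - de < q j" "q j < xi + de" for j
   proof -
   have igD: "L1 (%z. g j z * ind D z)" by (rule integrable_weak_pairing[OF g(1) g(2) iD])
   have "(LBINT z. g j z * ind D z) - (LBINT z. ind A z * F z xi * ind D z)
   = (LBINT z. g j z * ind D z - ind A z * F z xi * ind D z)"
   by (rule int_diff[symmetric, OF igD iFD])
   hence "abs((LBINT z. g j z * ind D z) - (LBINT z. ind A z * F z xi * ind D z))
   <= (LBINT z. abs(g j z * ind D z - ind A z * F z xi * ind D z))"
   by (simp only: iab)
   moreover have "(LBINT z. abs(g j z * ind D z - ind A z * F z xi * ind D z))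
   <= (LBINT z. ind A z * F z (xi + de) - ind A z * F z (xi - de))"
   proof (rule integral_mono_AE[OF integrable_abs[OF i_diff[OF igD iFD]] i_diff[OF iF iF]])
   show "AEL z. abs(g j z * ind D z - ind A z * F z xi * ind D z) <= ind A z * F z (xi + de) - ind A z * F z (xi - de)"
   using AEG
   proof eventually_elim
   case (elim z)
   have m1: "F z (xi - de) <= F z xi" "F z xi <= F z (xi + de)" using d0 by (auto intro!: mono)
   show ?case
   proof (cases "z \<in> A")
   case True
   hence "gg j z = g j z" using elim by (simp add: gg_def)
   moreover have "gg j z <= F z (xi + de)" by (rule ggle) (use j in simp)
   moreover have "F z (xi - de) <= gg j z" by (rule Fle) (use j in simp)
   ultimately have "abs(g j z - F z xi) <= F z (xi + de) - F z (xi - de)" using m1 by linarith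
   thus ?thesis using True m1 by (cases "z \<in> D") auto
   qed (simp add: g(3))
   qed
   qed
   moreover have "(LBINT z. ind A z * F z (xi + de) - ind A z * F z (xi - de)) = a (xi + de) - a (xi - de)"
   unfolding a_def by (rule int_diff[OF iF iF])
   ultimately show ?thesis by linarith
   qed
   define C where "C = (LBINT z. ind A z * F z xi * ind D z)"
   from close[of i] close[of k] i k d0 m
   have ci: "abs((LBINT z. g i z * ind D z) - C) < e / 2" and ck: "abs((LBINT z. g k z * ind D z) - C) < e / 2"
   by (auto simp: de_def C_def)
   obtain N1 where N1: "!!n. n >= N1 ==> abs((LBINT z. f i (r n) z * ind D z) - (LBINT z. g i z * ind D z)) < e / 2"
   using LIMSEQ_D[OF weakstarD[OF g(4) iD], of "e/2" i] e by auto
   obtain N2 where N2: "!!n. n >= N2 ==> abs((LBINT z. f k (r n) z * ind D z) - (LBINT z. g k z * ind D z)) < e / 2"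
   using LIMSEQ_D[OF weakstarD[OF g(4) iD], of "e/2" k] e by auto
   show "EX N. ALL n>=N. norm ((LBINT z. h n z * ind D z) - (LBINT z. ind A z * F z xi * ind D z)) < e"
   proof (intro exI[of _ "max N1 N2"] allI impI)
   fix n assume n: "n >= max N1 N2"
   have lo: "(LBINT z. f i (r n) z * ind D z) <= (LBINT z. h n z * ind D z)"
   by (rule integral_mono[OF integrable_weak_pairing[OF fm fb iD] integrable_weak_pairing[OF hm hb iD]])
   (use i in "auto simp: f_def h_def ind_def")
   have up: "(LBINT z. h n z * ind D z) <= (LBINT z. f k (r n) z * ind D z)"
   by (rule integral_mono[OF integrable_weak_pairing[OF hm hb iD] integrable_weak_pairing[OF fm fb iD]])
   (use k in "auto simp: f_def h_def ind_def")
   show "norm ((LBINT z. h n z * ind D z) - (LBINT z. ind A z * F z xi * ind D z)) < e"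
   using lo up ci ck N1[of n] N2[of n] n unfolding real_norm_def C_def[symmetric] by linarith
   qed
   qed
  qed
  thus ?case by (simp add: h_def)
 qed
 with that[of r F] r Fm mono rc F0 F1 show ?thesis by blast
qed


text \<open>All bounds and the properties of F hold at every point. Solutions are bounded only
  almost everywhere, so they are truncated by \<open>clip\<close> before they are placed into this
  setting.\<close>

locale young_limit =
 fixes A :: "'a::euclidean_space set" and u :: "nat => 'a => real" and R :: real and F :: "'a => real => real"
 assumes A: "A \<in> sets borel" "emeasure lborel A < \<infinity>"
  and um: "!!n. u n \<in> BM" and ub: "!!n z. abs(u n z) <= R"
  and Fm: "(%x. F (fst x) (snd x)) \<in> BM"
  and Fmono: "!!z xi xi'. xi <= xi' ==> F z xi <= F z xi'" and Frc: "!!z xi. continuous (at_right xi) (F z)"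
  and F0: "!!z xi. xi < - R ==> F z xi = 0" and F1: "!!z xi. R <= xi ==> F z xi = 1"
  and Fw: "AEL xi. weakstar (%n z. ind A z * of_bool (u n z < xi)) (%z. ind A z * F z xi)"
begin

definition nu :: "'a => real measure" where "nu z = interval_measure (F z)"

lemma R0: "R >= 0" using ub[of undefined undefined] by linarith

lemma F_bot: "(F z \<longlongrightarrow> 0) at_bot"
 by (rule tendsto_eventually) (use F0 in \<open>auto simp: eventually_at_bot_linorder intro!: exI[of _ "- R - 1"]\<close>)

lemma F_top: "(F z \<longlongrightarrow> 1) at_top"
 by (rule tendsto_eventually) (use F1 in "auto simp: eventually_at_top_linorder")

lemma F01: "0 <= F z xi" "F z xi <= 1"
 using Fmono[of "min xi (- R - 1)" xi z] F0[of "min xi (- R - 1)" z] Fmono[of xi "max xi R" z] F1[of "max xi R" z] by auto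

lemma distr: "real_distribution (nu z)"
 unfolding nu_def by (rule real_distribution_interval_measure[OF Fmono Frc F_bot F_top])

lemma prob: "prob_space (nu z)" using distr by (simp add: real_distribution_def)

lemma sets_nu[simp, measurable_cong]: "sets (nu z) = sets borel" by (simp add: nu_def)

lemma space_nu[simp]: "space (nu z) = UNIV" by (simp add: nu_def)

lemma measure_nu: "measure (nu z) {..xi} = F z xi"
 unfolding nu_def by (rule measure_interval_measure_Iic[OF Fmono Frc F_bot])

lemma F_slice: "(%z. F z xi) \<in> BM"
proof -
 have "(%x. F (fst x) (snd x)) \<in> BM2" using Fm unfolding borel_prod .
 from measurable_compose[OF _ this, of "%z. (z, xi)"] show ?thesis by simp
qed

lemma nu_measurable: "nu \<in> borel \<rightarrow>\<^sub>M prob_algebra borel"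
proof (rule measurable_prob_algebra_generated[of borel UNIV "range (%a::real. {..a})"])
 show "sets borel = sigma_sets UNIV (range (%a::real. {..a}))"
  by (subst borel_eq_atMost) (simp add: sets_measure_of)
 show "Int_stable (range (%a::real. {..a}))" by (auto simp: Int_stable_def)
 show "prob_space (nu z)" for z by (rule prob)
 fix B :: "real set" assume "B \<in> range (%a. {..a})"
 then obtain xi where B: "B = {..xi}" by blast
 have "emeasure (nu z) B = ennreal (F z xi)" for z
  using finite_measure.emeasure_eq_measure[OF prob_space.finite_measure[OF prob], of z B] measure_nu[of z xi] by (simp add: B)
 thus "(%z. emeasure (nu z) B) \<in> BM" using F_slice by simp
qed simp_all

text \<open>The margin matters on the left: F z may jump at \<open>- R\<close>, so
  \<open>{..- R}\<close> can carry mass, whereas \<open>{..- R - 1}\<close> cannot.\<close>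

lemma AE_nu: "AE x in nu z. x \<in> {- R - 1..R + 1}"
proof -
 interpret p: prob_space "nu z" by (rule prob)
 have "measure (nu z) {..- R - 1} = 0" using measure_nu[of z "- R - 1"] F0 by simp
 hence 1: "AE x in nu z. x ~: {..- R - 1}"
  by (intro AE_not_in null_setsI) (auto simp: p.emeasure_eq_measure)
 have "measure (nu z) {..R + 1} = 1" using measure_nu[of z "R + 1"] F1 by simp
 hence 2: "AE x in nu z. x \<in> {..R + 1}" by (subst (asm) p.prob_eq_1) (auto simp: p.prob_eq_1)
 show ?thesis using 1 2 by eventually_elim auto
qed

lemma integrable_nu:
 assumes "continuous_on UNIV (be :: real => real)"
 shows "integrable (nu z) be"
proof -
 interpret p: prob_space "nu z" by (rule prob)
 have "compact (be ` {- R - 1..R + 1})" by (intro compact_continuous_image continuous_on_subset[OF assms]) auto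
 from compact_imp_bounded[OF this] obtain C where C: "ALL y:be ` {- R - 1..R + 1}. norm y <= C" unfolding bounded_iff by blast
 show ?thesis
 proof (rule p.integrable_const_bound[where B=C])
  show "AE x in nu z. norm (be x) <= C" using AE_nu by eventually_elim (use C in blast)
  show "be \<in> borel_measurable (nu z)" using bm_cont[OF assms] by simp
 qed
qed

lemma nu_integral_close:
 assumes be: "continuous_on UNIV (be :: real => real)" and p: "continuous_on UNIV p"
  and cl: "!!x. x \<in> {- R - 1..R + 1} ==> abs(be x - p x) <= e"
 shows "abs((\<integral>x. be x \<partial>nu z) - (\<integral>x. p x \<partial>nu z)) <= e"
proof -
 interpret p: prob_space "nu z" by (rule prob)
 have "(\<integral>x. be x \<partial>nu z) - (\<integral>x. p x \<partial>nu z) = (\<integral>x. be x - p x \<partial>nu z)"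
  by (rule int_diff[symmetric, OF integrable_nu[OF be] integrable_nu[OF p]])
 hence "abs((\<integral>x. be x \<partial>nu z) - (\<integral>x. p x \<partial>nu z)) <= (\<integral>x. abs(be x - p x) \<partial>nu z)"
  by (simp only: iab)
 also have "... <= (\<integral>x. e \<partial>nu z)"
 proof (rule integral_mono_AE)
  show "integrable (nu z) (%x. abs(be x - p x))"
   by (intro integrable_abs i_diff integrable_nu be p)
  show "AE x in nu z. abs(be x - p x) <= e" using AE_nu by eventually_elim (rule cl)
 qed simp
 also have "... = e" using p.prob_space by simp
 finally show ?thesis .
qed

context
 fixes be be' :: "real => real"
 assumes d: "!!x. (be has_real_derivative be' x) (at x)" and c: "continuous_on UNIV be'"
begin

definition w :: "real => real" where "w xi = ind {- R - 1..R + 1} xi * be' xi"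

lemma w_measurable[measurable]: "w \<in> BM"
 using bm_cont[OF c] unfolding w_def[abs_def] by measurable

lemma w_bound: obtains C where "!!xi. abs(w xi) <= C" "C >= 0"
proof -
 have "compact (be' ` {- R - 1..R + 1})" by (intro compact_continuous_image continuous_on_subset[OF c]) auto
 from compact_imp_bounded[OF this] obtain C where C: "ALL y:be' ` {- R - 1..R + 1}. norm y <= C" unfolding bounded_iff by blast
 have "abs(w xi) <= abs(C)" for xi
 proof (cases "xi \<in> {- R - 1..R + 1}")
  case True
  hence "norm (be' xi) <= C" using C by blast
  thus ?thesis using True by (simp add: w_def)
 qed (simp add: w_def)
 thus ?thesis using that[of "abs(C)"] by auto
qed

lemma w_zero: "xi ~: {- R - 1..R + 1} ==> w xi = 0" by (simp add: w_def)

text \<open>Layer-cake formula: it reduces integrals of \<open>be\<close> to distribution functions.\<close>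

lemma layer_cake:
 assumes x: "x \<in> {- R - 1..R + 1}"
 shows "be x = be (R + 1) - (LBINT xi. w xi * of_bool (x <= xi))" "be x = be (R + 1) - (LBINT xi. w xi * of_bool (x < xi))"
proof -
 have "(LBINT xi. be' xi * ind {x..R + 1} xi) = be (R + 1) - be x"
  by (rule integral_FTC_Icc_real) (use x d c in "auto simp: continuous_on_eq_continuous_at")
 moreover have "(%xi. be' xi * ind {x..R + 1} xi) = (%xi. w xi * of_bool (x <= xi))"
  using x by (intro ext) (auto simp: w_def ind_def)
 ultimately show 1: "be x = be (R + 1) - (LBINT xi. w xi * of_bool (x <= xi))" by simp
 have "(LBINT xi. w xi * of_bool (x <= xi)) = (LBINT xi. w xi * of_bool (x < xi))"
 proof (rule integral_cong_AE)
  show "AEL xi. w xi * of_bool (x <= xi) = w xi * of_bool (x < xi)"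
   using AE_sing[of x] by eventually_elim auto
 qed measurable
 with 1 show "be x = be (R + 1) - (LBINT xi. w xi * of_bool (x < xi))" by simp
qed

text \<open>The layer-cake formula is integrated over \<open>nu z\<close> and the integrals are
  exchanged. The form with \<open>x <= xi\<close> is the right one here, because the measure of
  \<open>{..xi}\<close> is exactly F z xi.\<close>

lemma nu_layer_cake: "(\<integral>x. be x \<partial>nu z) = be (R + 1) - (LBINT xi. w xi * F z xi)"
proof -
 interpret p: prob_space "nu z" by (rule prob)
 interpret pp: pair_sigma_finite "nu z" "lborel :: real measure" ..
 obtain C where C: "!!xi. abs(w xi) <= C" "C >= 0" by (rule w_bound) blast
 have cb: "continuous_on UNIV be" using d by (auto simp: continuous_on_eq_continuous_at intro: DERIV_isCont)
 define f where "f = (%x xi. w xi * of_bool (x <= xi))"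
 have "{p \<in> space (nu z \<Otimes>\<^sub>M (lborel :: real measure)). fst p <= snd p} \<in> sets (nu z \<Otimes>\<^sub>M lborel)" by measurable
 hence [measurable]: "Measurable.pred (nu z \<Otimes>\<^sub>M (lborel :: real measure)) (%p. fst p <= snd p)" by (simp add: pred_def)
 have i: "integrable (nu z \<Otimes>\<^sub>M lborel) (case_prod f)"
 proof (rule ibf[of _ _ "UNIV \<times> {- R - 1..R + 1}" C])
  show "case_prod f \<in> borel_measurable (nu z \<Otimes>\<^sub>M lborel)" unfolding f_def case_prod_beta' by measurable
  show "UNIV \<times> {- R - 1..R + 1} \<in> sets (nu z \<Otimes>\<^sub>M lborel)" by (intro pair_measureI) auto
  have "emeasure (nu z \<Otimes>\<^sub>M lborel) (UNIV \<times> {- R - 1..R + 1}) = emeasure (nu z) UNIV * emeasure lborel {- R - 1..R + 1}"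
   by (rule lborel.emeasure_pair_measure_Times) auto
  also have "... < \<infinity>" using p.emeasure_space_1 R0 by simp
  finally show "emeasure (nu z \<Otimes>\<^sub>M lborel) (UNIV \<times> {- R - 1..R + 1}) < \<infinity>" .
  show "abs(case_prod f p) <= C" for p using C by (auto simp: f_def split: prod.split)
  show "p ~: UNIV \<times> {- R - 1..R + 1} ==> case_prod f p = 0" for p by (cases p) (auto simp: f_def w_def)
 qed
 have "(LBINT xi. w xi * F z xi) = (\<integral>xi. (\<integral>x. f x xi \<partial>nu z) \<partial>lborel)"
 proof (rule int_cong[OF refl])
  fix xi
  have "(\<integral>x. f x xi \<partial>nu z) = w xi * (\<integral>x. ind {..xi} x \<partial>nu z)"
   unfolding f_def by (simp add: ind_def)
  also have "... = w xi * F z xi" using measure_nu[of z xi] by simp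
  finally show "w xi * F z xi = (\<integral>x. f x xi \<partial>nu z)" by simp
 qed
 also have "... = (\<integral>x. (LBINT xi. f x xi) \<partial>nu z)" by (rule pp.Fubini_integral[OF i])
 also have "... = (\<integral>x. be (R + 1) - be x \<partial>nu z)"
 proof (rule integral_cong_AE)
  show "AE x in nu z. (LBINT xi. f x xi) = be (R + 1) - be x"
   using AE_nu
  proof eventually_elim
   case (elim x)
   show ?case using layer_cake(1)[OF elim] unfolding f_def by linarith
  qed
  show "(%x. LBINT xi. f x xi) \<in> borel_measurable (nu z)"
   using pp.integrable_fst[OF i] by simp
 qed (use bm_cont[OF cb] in simp)
 also have "... = be (R + 1) - (\<integral>x. be x \<partial>nu z)"
  using integrable_nu[OF cb, of z] p.prob_space by simp
 finally show ?thesis by simp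
qed

text \<open>By the layer-cake formula both sides are integrals over xi of pairings of indicators,
  respectively of F, with the set \<open>E\<close>. Convergence at almost every level is enough for
  dominated convergence in xi, so the exceptional levels do no harm.\<close>

lemma weakstar_C1:
 assumes D: "D \<in> sets borel"
 shows "(%n. LBINT z. (ind A z * be (u n z)) * ind D z) ----> (\<integral>z. (ind A z * (\<integral>x. be x \<partial>nu z)) * ind D z \<partial>lborel)"
proof -
 obtain C where C: "!!xi. abs(w xi) <= C" "C >= 0" by (rule w_bound) blast
 have [measurable]: "A \<in> sets borel" "u n \<in> BM" for n using A um by auto
 note D[measurable]
 define E where "E = A \<inter> D"
 have E[measurable]: "E \<in> sets borel" by (simp add: E_def)
 have Ef: "emeasure lborel E < \<infinity>"
  unfolding E_def using emeasure_mono[of "A \<inter> D" A lborel] A D by (auto intro: le_less_trans)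
 have iE: "L1 (ind E :: 'a => real)" using Ef by (intro i_ind) auto
 have ind: "ind A z * b * ind D z = ind E z * b" for z and b :: real by (simp add: E_def ind_def)
 have fub: "(LBINT z. ind E z * (LBINT xi. w xi * k z xi)) = (LBINT xi. w xi * (LBINT z. ind E z * k z xi))"
  "L1 (%z. ind E z * (LBINT xi. w xi * k z xi))"
  "L1 (%xi. w xi * (LBINT z. ind E z * k z xi))"
  if km: "(%p. k (fst p) (snd p)) \<in> BM" and kb: "!!z xi. abs(k z xi) <= 1" for k :: "'a => real => real"
 proof -
  define f where "f = (%p. ind E (fst p) * (w (snd p) * k (fst p) (snd p)))"
  have i: "L1 f"
  proof (rule ibf[of _ _ "E \<times> {- R - 1..R + 1}" C])
   have "(%p::'a * real. ind E (fst p) :: real) \<in> BM2" "(%p::'a * real. w (snd p)) \<in> BM2"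
   by measurable
   thus "f \<in> BL" unfolding f_def borel_prod using km by simp
   show "E \<times> {- R - 1..R + 1} \<in> sets lborel"
   unfolding lborel_prod[symmetric] by (intro pair_measureI) auto
   have "emeasure (lborel \<Otimes>\<^sub>M lborel) (E \<times> {- R - 1..R + 1}) = emeasure lborel E * emeasure lborel {- R - 1..R + 1}"
   by (rule lborel.emeasure_pair_measure_Times) auto
   also have "... < \<infinity>" using Ef R0 by (simp add: ennreal_mult_less_top)
   finally show "emeasure lborel (E \<times> {- R - 1..R + 1}) < \<infinity>" unfolding lborel_prod .
   have "abs(w xi) * abs(k z xi) <= C * 1" for z xi by (intro mult_mono C kb) auto
   thus "abs(f p) <= C" for p using C(2) by (simp add: f_def abs_mult ind_def)
   show "p ~: E \<times> {- R - 1..R + 1} ==> f p = 0" for p using w_zero by (cases p) (auto simp: f_def ind_def)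
  qed
  have e1: "(LBINT xi. f (z, xi)) = ind E z * (LBINT xi. w xi * k z xi)" for z
   by (simp add: f_def)
  have "f (z, xi) = w xi * (ind E z * k z xi)" for z xi by (simp add: f_def)
  hence e2: "(LBINT z. f (z, xi)) = w xi * (LBINT z. ind E z * k z xi)" for xi
   by simp
  show "(LBINT z. ind E z * (LBINT xi. w xi * k z xi)) = (LBINT xi. w xi * (LBINT z. ind E z * k z xi))"
   using lborel_fubini_swap[OF i] unfolding e1 e2 by simp
  show "L1 (%z. ind E z * (LBINT xi. w xi * k z xi))"
   using lp_fst(2)[OF i] unfolding e1 .
  show "L1 (%xi. w xi * (LBINT z. ind E z * k z xi))"
   using lp_snd(2)[OF i] unfolding e2 .
 qed
 have km: "(%p. of_bool (u n (fst p) < snd p) :: real) \<in> BM" for n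
 proof -
  have "(%p. of_bool (u n (fst p) < snd p) :: real) \<in> BM2" by measurable
  thus ?thesis unfolding borel_prod .
 qed
 have kb: "abs(of_bool b :: real) <= 1" for b by simp
 have Fb: "abs(F z xi) <= 1" for z xi using F01[of z xi] by simp
 have L: "(LBINT z. (ind A z * be (u n z)) * ind D z)
  = be (R + 1) * measure lborel E - (LBINT xi. w xi * (LBINT z. ind E z * of_bool (u n z < xi)))" for n
 proof -
  have "be (u n z) = be (R + 1) - (LBINT xi. w xi * of_bool (u n z < xi))" for z
   by (rule layer_cake(2)) (use ub[of n z] in auto)
  hence "(LBINT z. (ind A z * be (u n z)) * ind D z)
   = (LBINT z. be (R + 1) * ind E z - ind E z * (LBINT xi. w xi * of_bool (u n z < xi)))"
   unfolding ind by (simp add: right_diff_distrib mult.commute)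
  also have "... = be (R + 1) * measure lborel E - (LBINT z. ind E z * (LBINT xi. w xi * of_bool (u n z < xi)))"
   using fub(2)[OF km kb] iE by simp
  also have "(LBINT z. ind E z * (LBINT xi. w xi * of_bool (u n z < xi))) = (LBINT xi. w xi * (LBINT z. ind E z * of_bool (u n z < xi)))"
   by (rule fub(1)[OF km kb])
  finally show ?thesis .
 qed
 have M: "(\<integral>z. (ind A z * (\<integral>x. be x \<partial>nu z)) * ind D z \<partial>lborel)
  = be (R + 1) * measure lborel E - (LBINT xi. w xi * (LBINT z. ind E z * F z xi))"
 proof -
  have "(\<integral>z. (ind A z * (\<integral>x. be x \<partial>nu z)) * ind D z \<partial>lborel)
   = (LBINT z. be (R + 1) * ind E z - ind E z * (LBINT xi. w xi * F z xi))"
   unfolding ind nu_layer_cake by (simp add: right_diff_distrib mult.commute)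
  also have "... = be (R + 1) * measure lborel E - (LBINT z. ind E z * (LBINT xi. w xi * F z xi))"
   using fub(2)[OF Fm Fb] iE by simp
  also have "(LBINT z. ind E z * (LBINT xi. w xi * F z xi)) = (LBINT xi. w xi * (LBINT z. ind E z * F z xi))"
   by (rule fub(1)[OF Fm Fb])
  finally show ?thesis .
 qed
 have "(%n. LBINT xi. w xi * (LBINT z. ind E z * of_bool (u n z < xi)))
  ----> (LBINT xi. w xi * (LBINT z. ind E z * F z xi))"
 proof (rule integral_dominated_convergence[where w="%xi. C * measure lborel E * ind {- R - 1..R + 1} xi"])
  show "(%xi. w xi * (LBINT z. ind E z * F z xi)) \<in> BL"
   using fub(3)[OF Fm Fb] by simp
  show "(%xi. w xi * (LBINT z. ind E z * of_bool (u n z < xi))) \<in> BL" for n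
   using fub(3)[OF km kb, of n] by simp
  show "L1 (%xi. C * measure lborel E * ind {- R - 1..R + 1} xi)"
   using R0 by (intro i_mr i_ind) auto
  show "AEL xi. (%n. w xi * (LBINT z. ind E z * of_bool (u n z < xi))) ----> w xi * (LBINT z. ind E z * F z xi)"
   using Fw
  proof eventually_elim
   case (elim xi)
   have i1: "ind A z * b * ind E z = ind E z * b" for z and b :: real by (simp add: E_def ind_def)
   show ?case using weakstarD[OF elim iE] unfolding i1 by (intro tendsto_mult tendsto_const)
  qed
  show "AEL xi. norm (w xi * (LBINT z. ind E z * of_bool (u n z < xi))) <= C * measure lborel E * ind {- R - 1..R + 1} xi" for n
  proof (rule AE_I2)
   fix xi :: real
   have "abs(\<integral>z. ind E z * of_bool (u n z < xi) \<partial>lborel) <= (LBINT z. abs(ind E z * of_bool (u n z < xi) :: real))"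
   by (rule iab)
   also have "... <= (LBINT z. ind E z)"
   by (rule integral_mono[OF integrable_abs[OF imb(1)[OF iE, where C=1]] iE]) (auto simp: ind_def)
   also have "... = measure lborel E" by simp
   finally have "abs(w xi) * abs(\<integral>z. ind E z * of_bool (u n z < xi) \<partial>lborel) <= C * measure lborel E"
   by (intro mult_mono C) auto
   thus "norm (w xi * (LBINT z. ind E z * of_bool (u n z < xi))) <= C * measure lborel E * ind {- R - 1..R + 1} xi"
   by (cases "xi \<in> {- R - 1..R + 1}") (simp_all add: abs_mult w_zero)
  qed
 qed
 from tendsto_diff[OF tendsto_const[of "be (R + 1) * measure lborel E"] this]
 show ?thesis unfolding L M .
qed

lemma nu_integral_measurable_C1: "(%z. \<integral>x. be x \<partial>nu z) \<in> BM"
proof -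
 have "borel_measurable (borel \<Otimes>\<^sub>M lborel) = (BM2 :: ('a * real => real) set)"
  by (intro measurable_cong_sets sets_pair_measure_cong) simp_all
 hence [measurable]: "(%x. F (fst x) (snd x)) \<in> borel_measurable (borel \<Otimes>\<^sub>M lborel)"
  using Fm unfolding borel_prod by simp
 have "(%z. LBINT xi. w xi * F z xi) \<in> BM"
  by (rule lborel.borel_measurable_lebesgue_integral) (simp add: case_prod_beta')
 thus ?thesis unfolding nu_layer_cake by simp
qed

end

lemma poly_approx:
 assumes "continuous_on UNIV (be :: real => real)" "e > 0"
 obtains p p' where "!!x. (p has_real_derivative p' x) (at x)" "continuous_on UNIV p'" "continuous_on UNIV p"
  "!!x. x \<in> {- R - 1..R + 1} ==> abs(be x - p x) <= e"
proof -
 obtain g where g: "real_polynomial_function g" "!!x. x \<in> {- R - 1..R + 1} ==> abs(be x - g x) < e"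
  using Stone_Weierstrass_real_polynomial_function[OF compact_Icc continuous_on_subset[OF assms(1) subset_UNIV] assms(2), of "- R - 1" "R + 1"] by blast
 then obtain a n where gn: "g = (%x. \<Sum>i\<le>n. a i * x ^ i)" using real_polynomial_function_iff_sum by blast
 show ?thesis
 proof (rule that[of g "%x. \<Sum>i\<le>n. a i * (real i * x ^ (i - 1))"])
  show "(g has_real_derivative (\<Sum>i\<le>n. a i * (real i * x ^ (i - 1)))) (at x)" for x
   unfolding gn by (intro DERIV_sum DERIV_cmult) (auto intro!: deqs)
  show "continuous_on UNIV (%x. \<Sum>i\<le>n. a i * (real i * x ^ (i - 1)))" "continuous_on UNIV g"
   unfolding gn by (intro cints)+
 qed (use g(2) in "auto intro: less_imp_le")
qed

lemma nu_integral_measurable: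
 assumes be: "continuous_on UNIV (be :: real => real)"
 shows "(%z. \<integral>x. be x \<partial>nu z) \<in> BM"
proof -
 define P where "P = (%k p. (EX p'. (ALL x. (p has_real_derivative p' x) (at x)) & continuous_on UNIV p') & continuous_on UNIV p &
  (ALL x. x \<in> {- R - 1..R + 1} --> abs(be x - p x) <= 1 / real (Suc k)))"
 have "EX p. P k p" for k
 proof -
  have k: "1 / real (Suc k) > 0" by simp
  obtain p p' where "!!x. (p has_real_derivative p' x) (at x)" "continuous_on UNIV p'" "continuous_on UNIV p"
   "!!x. x \<in> {- R - 1..R + 1} ==> abs(be x - p x) <= 1 / real (Suc k)"
   by (rule poly_approx[OF be k]) blast
  thus ?thesis unfolding P_def by (intro exI[of _ p]) blast
 qed
 then obtain p where p: "!!k. P k (p k)" by metis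
 show ?thesis
 proof (rule borel_measurable_LIMSEQ_real)
  show "(%z. \<integral>x. p k x \<partial>nu z) \<in> BM" for k
   using p[of k] nu_integral_measurable_C1 unfolding P_def by blast
  fix z
  have close: "abs((\<integral>x. p k x \<partial>nu z) - (\<integral>x. be x \<partial>nu z)) <= 1 / real (Suc k)" for k
   unfolding abs_minus_commute[of "\<integral>x. p k x \<partial>nu z"] by (rule nu_integral_close[OF be]) (use p[of k] in "simp_all add: P_def")
  have "(%k. 1 / real (Suc k)) ----> 0" by (rule LIMSEQ_Suc[OF lim_1_over_n])
  hence "(%k. (\<integral>x. p k x \<partial>nu z) - (\<integral>x. be x \<partial>nu z)) ----> 0"
   by (rule Lim_null_comparison[rotated]) (use close in simp)
  thus "(%k. \<integral>x. p k x \<partial>nu z) ----> (\<integral>x. be x \<partial>nu z)" by (simp add: LIM_zero_iff)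
 qed
qed

lemma nu_integral_bound:
 assumes be: "continuous_on UNIV (be :: real => real)"
 obtains K where "!!z. abs(\<integral>x. be x \<partial>nu z) <= K" "!!x. x \<in> {- R - 1..R + 1} ==> abs(be x) <= K"
proof -
 have "compact (be ` {- R - 1..R + 1})" by (intro compact_continuous_image continuous_on_subset[OF be]) auto
 from compact_imp_bounded[OF this] obtain C where C: "ALL y:be ` {- R - 1..R + 1}. norm y <= C" unfolding bounded_iff by blast
 have "abs((\<integral>x. be x \<partial>nu z) - (\<integral>x. 0 \<partial>nu z)) <= C" for z
  by (rule nu_integral_close[OF be]) (use C in auto)
 thus ?thesis using that[of C] C by auto
qed

text \<open>Polynomials are uniformly close to \<open>be\<close> on the window that contains all
  values of u and carries every \<open>nu z\<close>, so the continuously differentiable case extends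
  with an error proportional to the measure of D.\<close>

lemma weakstar_nu:
 assumes be: "continuous_on UNIV (be :: real => real)"
 shows "weakstar (%n z. ind A z * be (u n z)) (%z. ind A z * (\<integral>x. be x \<partial>nu z))"
proof -
 obtain K where K: "!!z. abs(\<integral>x. be x \<partial>nu z) <= K" "!!x. x \<in> {- R - 1..R + 1} ==> abs(be x) <= K"
  by (rule nu_integral_bound[OF be]) blast
 have uR: "u n z \<in> {- R - 1..R + 1}" for n z using ub[of n z] by auto
 have K0: "K >= 0" using K(1)[of undefined] by linarith
 have [measurable]: "A \<in> sets borel" "u n \<in> BM" "be \<in> BM" for n
  using A um bm_cont[OF be] by auto
 have fm: "(%z. ind A z * be (u n z)) \<in> BM" for n by measurable
 have gm: "(%z. ind A z * (\<integral>x. be x \<partial>nu z)) \<in> BM"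
  using nu_integral_measurable[OF be] by measurable
 have fb: "abs(ind A z * be (u n z)) <= K" for n z using K(2)[OF uR[of n z]] K0 by (simp add: ind_def)
 have gb: "abs(ind A z * (\<integral>x. be x \<partial>nu z)) <= K" for z using K(1)[of z] K0 by (simp add: ind_def)
 show ?thesis
 proof (rule weakstar_indicators[OF fm fb gm gb])
  fix D :: "'a set" assume D: "D \<in> sets borel" "emeasure lborel D < \<infinity>"
  have iD: "L1 (ind D :: 'a => real)" using D by (intro i_ind) auto
  define V where "V = measure lborel D"
  have V: "V >= 0" "(LBINT z. ind D z) = V" using D by (simp_all add: V_def)
  show "(%n. LBINT z. (ind A z * be (u n z)) * ind D z) ----> (\<integral>z. (ind A z * (\<integral>x. be x \<partial>nu z)) * ind D z \<partial>lborel)"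
  proof (rule LIMSEQ_I)
   fix e :: real assume e: "e > 0"
   \<comment> \<open>A third of e for replacing \<open>be\<close> by the polynomial before the
     limit, a third for the convergence with the polynomial, and a third for the replacement in the
     limit. The summand 1 covers V = 0.\<close>
   define e' where "e' = e / (3 * (V + 1))"
   have e': "e' > 0" using e V by (simp add: e'_def)
   have e'V: "e' * V < e / 3"
   proof -
   have "e' * (V + 1) = e / 3" using V(1) by (simp add: e'_def field_simps)
   thus ?thesis using e' by (simp add: distrib_left)
   qed
   obtain p p' where p: "!!x. (p has_real_derivative p' x) (at x)" "continuous_on UNIV p'" "continuous_on UNIV p"
   "!!x. x \<in> {- R - 1..R + 1} ==> abs(be x - p x) <= e'"
   by (rule poly_approx[OF be e']) blast
   obtain K' where K': "!!z. abs(\<integral>x. p x \<partial>nu z) <= K'" "!!x. x \<in> {- R - 1..R + 1} ==> abs(p x) <= K'"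
   by (rule nu_integral_bound[OF p(3)]) blast
   have K'0: "K' >= 0" using K'(1)[of undefined] by linarith
   have [measurable]: "p \<in> BM" using bm_cont[OF p(3)] by simp
   have pm: "(%z. ind A z * p (u n z)) \<in> BM" for n by measurable
   have qm: "(%z. ind A z * (\<integral>x. p x \<partial>nu z)) \<in> BM"
   using nu_integral_measurable[OF p(3)] by measurable
   have pb: "abs(ind A z * p (u n z)) <= K'" for n z using K'(2)[OF uR[of n z]] K'0 by (simp add: ind_def)
   have qb: "abs(ind A z * (\<integral>x. p x \<partial>nu z)) <= K'" for z using K'(1)[of z] K'0 by (simp add: ind_def)
   have close: "abs((LBINT z. f z * ind D z) - (LBINT z. g z * ind D z)) <= e' * V"
   if "L1 (%z. f z * ind D z)" "L1 (%z. g z * ind D z)" "!!z. abs(f z - g z) <= e'" for f g :: "'a => real"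
   proof -
   have "(LBINT z. f z * ind D z) - (LBINT z. g z * ind D z) = (LBINT z. f z * ind D z - g z * ind D z)"
   by (rule int_diff[symmetric, OF that(1,2)])
   hence "abs((LBINT z. f z * ind D z) - (LBINT z. g z * ind D z)) <= (LBINT z. abs(f z * ind D z - g z * ind D z))"
   by (simp only: iab)
   also have "... <= (LBINT z. e' * ind D z)"
   proof (rule integral_mono[OF integrable_abs[OF i_diff[OF that(1,2)]] i_mr[OF iD]])
   show "abs(f z * ind D z - g z * ind D z) <= e' * ind D z" for z
   using that(3)[of z] by (simp add: ind_def)
   qed
   also have "... = e' * V" using V(2) by simp
   finally show ?thesis .
   qed
   have c1: "abs((LBINT z. ind A z * be (u n z) * ind D z) - (LBINT z. ind A z * p (u n z) * ind D z)) <= e' * V" for n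
   by (rule close[OF integrable_weak_pairing[OF fm fb iD] integrable_weak_pairing[OF pm pb iD]])
   (use p(4)[OF uR] e' in "simp add: ind_def")
   have c2: "abs((\<integral>z. ind A z * (\<integral>x. be x \<partial>nu z) * ind D z \<partial>lborel) - (\<integral>z. ind A z * (\<integral>x. p x \<partial>nu z) * ind D z \<partial>lborel)) <= e' * V"
   by (rule close[OF integrable_weak_pairing[OF gm gb iD] integrable_weak_pairing[OF qm qb iD]])
   (use nu_integral_close[OF be p(3,4)] e' in "simp add: ind_def")
   obtain N where N: "!!n. n >= N ==> abs((LBINT z. ind A z * p (u n z) * ind D z) - (\<integral>z. ind A z * (\<integral>x. p x \<partial>nu z) * ind D z \<partial>lborel)) < e / 3"
   using LIMSEQ_D[OF weakstar_C1[OF p(1,2) D(1)], of "e / 3"] e by auto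
   show "EX N. ALL n>=N. norm ((LBINT z. ind A z * be (u n z) * ind D z) - (\<integral>z. ind A z * (\<integral>x. be x \<partial>nu z) * ind D z \<partial>lborel)) < e"
   proof (intro exI[of _ N] allI impI)
   fix n assume "n >= N"
   from N[OF this] c1[of n] c2 e'V
   show "norm ((LBINT z. ind A z * be (u n z) * ind D z) - (\<integral>z. ind A z * (\<integral>x. be x \<partial>nu z) * ind D z \<partial>lborel)) < e"
   unfolding real_norm_def by linarith
   qed
  qed
 qed
qed

end

section \<open>From weak formulations to integral equations in time\<close>

text \<open>Convergence is required only where \<open>F\<close> does not vanish: cut-off functions
  converge inside the domain only, and the fixed factor vanishes outside.\<close>

lemma dct_factor:
 fixes F :: "'a => real"
 assumes F: "integrable M F" and m: "!!n. c n \<in> borel_measurable M" "c' \<in> borel_measurable M"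
  and b: "!!n z. abs(c n z) <= (Bd :: real)" and l: "!!z. F z ~= 0 ==> (%n. c n z) ----> c' z"
 shows "(%n. \<integral>z. F z * c n z \<partial>M) ----> (\<integral>z. F z * c' z \<partial>M)"
proof (rule integral_dominated_convergence[where w="%z. Bd * abs(F z)"])
 have Fm: "F \<in> borel_measurable M" using F by simp
 show "(%z. F z * c' z) \<in> borel_measurable M" "(%z. F z * c n z) \<in> borel_measurable M" for n
  by (intro borel_measurable_times Fm m)+
 show "integrable M (%z. Bd * abs(F z))" using F by simp
 show "AE z in M. (%n. F z * c n z) ----> F z * c' z"
 proof (rule AE_I2)
  fix z show "(%n. F z * c n z) ----> F z * c' z"
   by (cases "F z = 0") (auto intro: tendsto_mult l)
 qed
 show "AE z in M. norm (F z * c n z) <= Bd * abs(F z)" for n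
  by (rule AE_I2) (use mult_right_mono[OF b abs_ge_zero] in "simp add: abs_mult mult.commute")
qed

definition smooth :: "(real => real) => bool" where "smooth f \<longleftrightarrow> (ALL k. Ck k f)"

lemma smooth_compose_affine: "smooth f ==> smooth (%x. f (a * x + b))"
 unfolding smooth_def using Ck_compose_affine[of "%x. a * x" _ f b] bounded_linear_mult_right[of a] by auto

lemma smooth_mult: "smooth f ==> smooth g ==> smooth (%x. f x * g x)"
 unfolding smooth_def by (auto intro: Ck_mult)

lemma smooth_sin_cos: "smooth (%x. sin (c * x))" "smooth (%x. cos (c * x))"
 unfolding smooth_def using Ck_sin_cos by auto

lemma smooth_id_affine: "smooth (%x. a * x + b)"
proof -
 have "Ck k (%x. a * x + b)" for k
  by (cases k) (auto intro!: cints Ck_Suc_realI[where f'="%x. a"] deqs Ck_const simp del: Ck.simps(2))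
 thus ?thesis by (simp add: smooth_def)
qed

lemma smooth_continuous: "smooth f ==> continuous_on UNIV f"
 unfolding smooth_def by (metis Ck.simps(1))

lemma smooth_deriv_continuous:
 assumes "smooth f" "!!x. (f has_real_derivative f' x) (at x)"
 shows "continuous_on UNIV f'"
proof -
 have "pd 1 f = f'" using assms(2) pd_1_real by blast
 moreover have "Ck 1 f" using assms(1) by (simp add: smooth_def del: Ck.simps)
 ultimately show ?thesis by simp
qed

lemma test_fun_prod:
 assumes a: "smooth a" and et: "smooth et" and I: "compact I" "!!x. x ~: I ==> a x = 0"
  and J: "compact J" "!!t. t ~: J ==> et t = 0" and O: "I \<times> J \<subseteq> Om"
 shows "test_fun Om (%z. a (fst z) * et (snd z))"
proof (rule test_funI[OF _ compact_Times[OF I(1) J(1)] O])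
 fix k
 have "Ck k (%z. a (fst z + 0))" "Ck k (%z. et (snd z + 0))"
  by (intro Ck_compose_affine bounded_linear_fst bounded_linear_snd; use a et in "simp add: smooth_def")+
 thus "Ck k (%z. a (fst z) * et (snd z))" by (auto intro: Ck_mult)
next
 fix z assume "z ~: I \<times> J"
 thus "a (fst z) * et (snd z) = 0" using I(2)[of "fst z"] J(2)[of "snd z"] by (cases z) auto
qed

lemma pd_prod:
 assumes t: "test_fun Om (%z. a (fst z) * et (snd z))"
  and a: "(a has_real_derivative a') (at x)" and et: "(et has_real_derivative et') (at t)"
 shows "pd (1, 0) (%z. a (fst z) * et (snd z)) (x, t) = a' * et t" "pd (0, 1) (%z. a (fst z) * et (snd z)) (x, t) = a x * et'"
proof -
 have "((%x. a x * et t) has_real_derivative a' * et t) (at x)" using DERIV_cmult_right[OF a] by simp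
 moreover have "((%x. a x * et t) has_real_derivative pd (1, 0) (%z. a (fst z) * et (snd z)) (x, t)) (at x)"
  using pd_fst[where x=x and y=t, OF test_fun_differentiable[OF t]] by simp
 ultimately show "pd (1, 0) (%z. a (fst z) * et (snd z)) (x, t) = a' * et t"
  by (rule DERIV_unique[rotated])
 have "((%t. a x * et t) has_real_derivative a x * et') (at t)" using DERIV_cmult[OF et] by simp
 moreover have "((%t. a x * et t) has_real_derivative pd (0, 1) (%z. a (fst z) * et (snd z)) (x, t)) (at t)"
  using pd_snd[where x=x and y=t, OF test_fun_differentiable[OF t]] by simp
 ultimately show "pd (0, 1) (%z. a (fst z) * et (snd z)) (x, t) = a x * et'"
  by (rule DERIV_unique[rotated])
qed

text \<open>The sine has no compact support in (0, 1) and must be cut off to be an admissible test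
  function. The cut-off has a derivative of order n, but only on strips of width of order 1/n at the
  two ends, where the sine is of order 1/n as well. Hence the derivatives stay bounded and dominated
  convergence applies.\<close>

lemma sin_cutoff:
 obtains a a' :: "nat => real => real" and Bd :: real
 where "!!n. smooth (a n)" "!!n x. (a n has_real_derivative a' n x) (at x)"
  "!!n x. x ~: {1 / real (n + 1)..1 - 1 / real (n + 1)} ==> a n x = 0"
  "!!n x. abs(a n x) <= Bd" "!!n x. abs(a' n x) <= Bd"
  "!!x. 0 < x ==> x < 1 ==> (%n. a n x) ----> sin (real k * pi * x)"
  "!!x. 0 < x ==> x < 1 ==> (%n. a' n x) ----> real k * pi * cos (real k * pi * x)"
proof -
 obtain th th' :: "real => real" and C where th: "!!k. Ck k th" "!!x. (th has_real_derivative th' x) (at x)" "continuous_on UNIV th'"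
  "!!x. 0 <= th x" "!!x. th x <= 1" "!!x. x <= 0 ==> th x = 0" "!!x. x >= 1 ==> th x = 1"
  "!!x. abs(th' x) <= C" "!!x. x < 0 \<or> x > 1 ==> th' x = 0"
  by (rule smooth_step) blast
 have C0: "C >= 0" using th(8)[of 0] by linarith
 have ths: "smooth th" using th(1) by (simp add: smooth_def)
 define w where "w = real k * pi"
 have w0: "w >= 0" by (simp add: w_def)
 define l where "l = (%n x. th (real (n + 1) * x + (- 1)))"
 define r where "r = (%n x. th (- real (n + 1) * x + (real (n + 1) - 1)))"
 define l' where "l' = (%n x. th' (real (n + 1) * x + (- 1)) * real (n + 1))"
 define r' where "r' = (%n x. th' (- real (n + 1) * x + (real (n + 1) - 1)) * (- real (n + 1)))"
 have dl: "(l n has_real_derivative l' n x) (at x)" for n x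
  unfolding l_def l'_def by (rule DERIV_chain2[OF th(2)]) (auto intro!: deqs)
 have dr: "(r n has_real_derivative r' n x) (at x)" for n x
  unfolding r_def r'_def by (rule DERIV_chain2[OF th(2)]) (auto intro!: deqs)
 have sl: "smooth (l n)" "smooth (r n)" for n unfolding l_def r_def by (intro smooth_compose_affine ths)+
 have lr01: "0 <= l n x" "l n x <= 1" "0 <= r n x" "r n x <= 1" for n x unfolding l_def r_def using th(4,5) by auto
 define a where "a = (%n x. (l n x * r n x) * sin (w * x))"
 define a' where "a' = (%n x. (l n x * r n x) * (cos (w * x) * w) + (l n x * r' n x + l' n x * r n x) * sin (w * x))"
 have b1: "abs(l' n x * sin (w * x)) <= 2 * C * w" for n x
 proof (cases "real (n + 1) * x + (- 1) < 0 \<or> real (n + 1) * x + (- 1) > 1")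
  case True
  thus ?thesis using th(9)[OF True] C0 w0 by (simp add: l'_def)
 next
  case False
  hence "0 <= real (n + 1) * x" "real (n + 1) * x <= 2" by linarith+
  hence x: "real (n + 1) * abs(x) <= 2" by (simp add: zero_le_mult_iff split: if_splits)
  have "abs(l' n x * sin (w * x)) = abs(th' (real (n + 1) * x + (- 1))) * (real (n + 1) * abs(sin (w * x)))"
   by (simp add: l'_def abs_mult)
  also have "... <= C * (w * 2)"
  proof (rule mult_mono)
   have "real (n + 1) * abs(sin (w * x)) <= real (n + 1) * (w * abs(x))"
   using abs_sin_x_le_abs_x[of "w * x"] w0 by (intro mlm) (auto simp: abs_mult)
   also have "... = w * (real (n + 1) * abs(x))" by simp
   also have "... <= w * 2" by (intro mlm x w0)
   finally show "real (n + 1) * abs(sin (w * x)) <= w * 2" .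
  qed (use C0 th(8) in auto)
  finally show ?thesis by simp
 qed
 have b2: "abs(r' n x * sin (w * x)) <= 2 * C * w" for n x
 proof (cases "- real (n + 1) * x + (real (n + 1) - 1) < 0 \<or> - real (n + 1) * x + (real (n + 1) - 1) > 1")
  case True
  thus ?thesis using th(9)[OF True] C0 w0 by (simp add: r'_def)
 next
  case False
  have e: "- real (n + 1) * x + (real (n + 1) - 1) = real (n + 1) * (1 - x) - 1" by (simp add: alg)
  from False have "0 <= real (n + 1) * (1 - x)" "real (n + 1) * (1 - x) <= 2" unfolding e by linarith+
  hence x: "real (n + 1) * abs(1 - x) <= 2" by (simp add: zero_le_mult_iff split: if_splits)
  \<comment> \<open>Since w is a multiple of pi, the sine at x agrees up to sign with the sine at 1
    - x, so it is small near the right end too.\<close>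
  have "sin (w * (1 - x)) = sin w * cos (w * x) - cos w * sin (w * x)"
   by (simp add: right_diff_distrib sin_diff)
  moreover have "sin w = 0" "abs(cos w) = 1" by (auto simp: w_def cos_npi)
  ultimately have se: "abs(sin (w * x)) = abs(sin (w * (1 - x)))" by (simp add: abs_mult)
  have "abs(r' n x * sin (w * x)) = abs(th' (- real (n + 1) * x + (real (n + 1) - 1))) * (real (n + 1) * abs(sin (w * (1 - x))))"
   by (simp add: r'_def abs_mult se)
  also have "... <= C * (w * 2)"
  proof (rule mult_mono)
   have "real (n + 1) * abs(sin (w * (1 - x))) <= real (n + 1) * (w * abs(1 - x))"
   using abs_sin_x_le_abs_x[of "w * (1 - x)"] w0 by (intro mlm) (auto simp: abs_mult)
   also have "... = w * (real (n + 1) * abs(1 - x))" by simp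
   also have "... <= w * 2" by (intro mlm x w0)
   finally show "real (n + 1) * abs(sin (w * (1 - x))) <= w * 2" .
  qed (use C0 th(8) in auto)
  finally show ?thesis by simp
 qed
 define Bd where "Bd = 1 + w + 4 * C * w"
 show ?thesis
 proof (rule that[of a a' Bd])
  fix n x
  show "smooth (a n)" unfolding a_def by (intro smooth_mult sl smooth_sin_cos)
  show "(a n has_real_derivative a' n x) (at x)"
   unfolding a_def a'_def
   by (rule DERIV_cong[OF DERIV_mult[OF DERIV_mult[OF dl dr] DERIV_chain2[OF DERIV_sin]]])
   (auto intro!: deqs simp: alg)
  show "a n x = 0" if "x ~: {1 / real (n + 1)..1 - 1 / real (n + 1)}"
  proof -
   have "x < 1 / real (n + 1) \<or> x > 1 - 1 / real (n + 1)" using that by (simp only: atLeastAtMost_iff) linarith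
   thus ?thesis
   proof
   assume "x < 1 / real (n + 1)"
   hence "real (n + 1) * x + (- 1) <= 0" by (simp add: field_simps)
   thus ?thesis by (simp add: a_def l_def th(6))
   next
   assume "x > 1 - 1 / real (n + 1)"
   hence "- real (n + 1) * x + (real (n + 1) - 1) <= 0" by (simp add: field_simps)
   thus ?thesis unfolding a_def r_def by (simp only: th(6) mult_zero_right mult_zero_left)
   qed
  qed
  have lr: "0 <= l n x * r n x" "l n x * r n x <= 1" using lr01[of n x] by (auto intro: mult_le_one)
  have "abs(a n x) <= 1 * 1" unfolding a_def abs_mult[of "l n x * r n x"] using lr by (intro mult_mono) auto
  thus "abs(a n x) <= Bd" using w0 mult_nonneg_nonneg[OF C0 w0] unfolding Bd_def by linarith
  have "abs((l n x * r n x) * (cos (w * x) * w)) <= 1 * (1 * w)"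
   unfolding abs_mult[of "l n x * r n x"] abs_mult[of "cos (w * x)"] using lr w0 by (intro mult_mono) auto
  moreover have "abs(l n x * (r' n x * sin (w * x))) <= 1 * (2 * C * w)"
   unfolding abs_mult[of "l n x"] using lr01[of n x] b2[of n x] by (intro mult_mono) auto
  moreover have "abs(r n x * (l' n x * sin (w * x))) <= 1 * (2 * C * w)"
   unfolding abs_mult[of "r n x"] using lr01[of n x] b1[of n x] by (intro mult_mono) auto
  moreover have "a' n x = (l n x * r n x) * (cos (w * x) * w) + l n x * (r' n x * sin (w * x)) + r n x * (l' n x * sin (w * x))"
   by (simp add: a'_def alg)
  ultimately show "abs(a' n x) <= Bd" unfolding Bd_def by linarith
 next
  fix x :: real assume x: "0 < x" "x < 1"
  obtain N where N: "2 / x < real N" "2 / (1 - x) < real N"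
  proof -
   obtain N1 N2 where "2 / x < real N1" "2 / (1 - x) < real N2" using reals_Archimedean2 by meson
   hence "2 / x < real (max N1 N2)" "2 / (1 - x) < real (max N1 N2)" by auto
   thus ?thesis using that by blast
  qed
  have ev: "l n x = 1 & r n x = 1 & l' n x = 0 & r' n x = 0" if "n >= N" for n
  proof -
   have "2 / x < real (n + 1)" "2 / (1 - x) < real (n + 1)" using N that by auto
   hence "2 < real (n + 1) * x" "2 < real (n + 1) * (1 - x)" using x by (simp_all add: divide_less_eq)
   hence 1: "real (n + 1) * x + (- 1) > 1" "- real (n + 1) * x + (real (n + 1) - 1) > 1" by (simp_all add: alg)
   show ?thesis unfolding l_def r_def l'_def r'_def
   using th(7)[OF less_imp_le[OF 1(1)]] th(7)[OF less_imp_le[OF 1(2)]] th(9)[OF disjI2[OF 1(1)]] th(9)[OF disjI2[OF 1(2)]] by simp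
  qed
  show "(%n. a n x) ----> sin (real k * pi * x)"
   by (intro tendsto_eventually eventually_sequentiallyI[of N]) (use ev in "simp add: a_def w_def")
  show "(%n. a' n x) ----> real k * pi * cos (real k * pi * x)"
   by (intro tendsto_eventually eventually_sequentiallyI[of N]) (use ev in "simp add: a'_def w_def")
 qed
qed

lemma AE_zero_if_prim_zero:
 assumes T: "T > 0" and h: "L1 h" and hz: "!!t. t ~: {0<..T} ==> h t = 0"
  and p0: "!!b. 0 < b ==> b < T ==> prim h b = 0"
 shows "AEL t. h t = 0"
proof (rule AE_zero_if_interval_integrals_zero[OF h])
 fix b
 have "prim h b = 0"
 proof -
  consider "b <= 0" | "0 < b" "b < T" | "b >= T" by linarith
  thus ?thesis
  proof cases
   case 1 thus ?thesis by (intro prim_eq_0[of 0]) (auto simp: hz)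
  next
   case 2 thus ?thesis by (rule p0)
  next
   case 3
   have "prim h T = 0"
   proof (rule LIMSEQ_unique)
   have c: "isCont (prim h) T" using continuous_prim[OF h] by (simp add: continuous_on_eq_continuous_at)
   have "(%n. T - T / (real (n + 2))) ----> T - 0"
   by (intro tendsto_diff tendsto_const LIMSEQ_ignore_initial_segment[of "%n. T / real n" 0 2] lim_const_over_n)
   hence "(%n. T - T / (real (n + 2))) ----> T" by simp
   from isCont_tendsto_compose[OF c this]
   show "(%n. prim h (T - T / (real (n + 2)))) ----> prim h T" .
   have "prim h (T - T / real (n + 2)) = 0" for n
   by (rule p0) (use T in "auto simp: field_simps intro!: add_pos_nonneg mult_nonneg_nonneg")
   thus "(%n. prim h (T - T / (real (n + 2)))) ----> 0" by simp
   qed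
   moreover have "prim h b - prim h T = (LBINT s. ind {T<..b} s * h s)" by (rule prim_diff[OF h 3])
   moreover have "(%s. ind {T<..b} s * h s) = (%s. 0)" by (rule ext) (auto simp: hz ind_def)
   ultimately show ?thesis by simp
  qed
 qed
 thus "(LBINT x. ind {..b} x * h x) = 0" by (simp add: prim_def)
qed

text \<open>Test functions approximating the positive part of b - t give the twice integrated
  identity: the integral of f up to b equals the integral of (b - t) h plus f0 b. The right side is
  also the integral of f0 + \<open>prim h\<close> up to b, so the difference \<open>k\<close> has
  vanishing primitive. An indicator in place of the positive part would leave the derivative of the
  cut-off uncontrolled.\<close>

lemma time_derivative_AE:
 fixes f h :: "real => real"
 assumes T: "T > 0" and f: "L1 f" and h: "L1 h"
  and fz: "!!t. t ~: {0<..T} ==> f t = 0" and hz: "!!t. t ~: {0<..T} ==> h t = 0"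
  and eq: "!!et et' J. smooth et ==> (!!t. (et has_real_derivative et' t) (at t)) ==> compact J ==> J \<subseteq> {..<T} ==> (!!t. t ~: J ==> et t = 0) ==>
   (LBINT t. f t * et' t) + (LBINT t. h t * et t) + f0 * et 0 = 0"
 shows "AEL t. t \<in> {0<..<T} --> f t = f0 + prim h t"
proof -
 obtain th th' :: "real => real" and C where th: "!!k. Ck k th" "!!x. (th has_real_derivative th' x) (at x)" "continuous_on UNIV th'"
  "!!x. 0 <= th x" "!!x. th x <= 1" "!!x. x <= 0 ==> th x = 0" "!!x. x >= 1 ==> th x = 1"
  "!!x. abs(th' x) <= C" "!!x. x < 0 \<or> x > 1 ==> th' x = 0"
  by (rule smooth_step) blast
 have C0: "C >= 0" using th(8)[of 0] by linarith
 have ths: "smooth th" using th(1) by (simp add: smooth_def)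
 have [measurable]: "th \<in> BM" "th' \<in> BM"
  using bm_cont[OF smooth_continuous[OF ths]] bm_cont[OF th(3)] by auto
 have key: "(LBINT t. ind {..<b} t * f t) = (LBINT t. ind {..<b} t * ((b - t) * h t)) + f0 * b"
  if b: "0 < b" "b < T" for b
 proof -
  define N where "N = (%m::nat. real (m + 1))"
  \<comment> \<open>The factor \<open>th (1 * t + 2)\<close> only makes the support compact on the
    left and is 1 from -1 onwards. The last factor smooths the corner at b; where its derivative is
    of order \<open>N m\<close>, the factor b - t is at most of order 1 /
    \<open>N m\<close>.\<close>
  define et where "et = (%m t. (th (1 * t + 2) * (- 1 * t + b)) * th (- N m * t + N m * b))"
  define d where "d = (%m t. (th (1 * t + 2) * (- 1 * t + b)) * (th' (- N m * t + N m * b) * (- N m)) + (th (1 * t + 2) * (- 1) + th' (1 * t + 2) * (- 1 * t + b)) * th (- N m * t + N m * b))"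
  have E: "(LBINT t. f t * d m t) + (LBINT t. h t * et m t) + f0 * et m 0 = 0" for m
  proof (rule eq)
   show "smooth (et m)" unfolding et_def by (intro smooth_mult smooth_compose_affine ths smooth_id_affine)
   show "(et m has_real_derivative d m t) (at t)" for t
   proof -
   have 1: "((%t. th (1 * t + 2)) has_real_derivative th' (1 * t + 2)) (at t)"
   by (rule DERIV_cong[OF DERIV_chain2[OF th(2)]]) (auto intro!: deqs)
   have 2: "((%t. - 1 * t + b) has_real_derivative - 1) (at t)" by (auto intro!: deqs)
   have 3: "((%t. th (- N m * t + N m * b)) has_real_derivative th' (- N m * t + N m * b) * (- N m)) (at t)"
   by (rule DERIV_chain2[OF th(2)]) (auto intro!: deqs)
   show ?thesis unfolding et_def d_def
   by (rule DERIV_cong[OF DERIV_mult[OF DERIV_mult[OF 1 2] 3]]) (simp add: mult_ac)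
   qed
   show "compact {- 2..b}" "{- 2..b} \<subseteq> {..<T}" using b by auto
   show "et m t = 0" if "t ~: {- 2..b}" for t
   proof (cases "t < - 2")
   case True thus ?thesis by (simp add: et_def th(6))
   next
   case False
   hence "b < t" using that by auto
   hence "N m * b <= N m * t" by (simp add: N_def)
   hence "- N m * t + N m * b <= 0" by simp
   thus ?thesis unfolding et_def by (simp only: th(6) mult_zero_right)
   qed
  qed
  have rho: "th (1 * t + 2) = 1" "th' (1 * t + 2) = 0" if "t > 0" for t
   using th(7)[of "1 * t + 2"] th(9)[of "1 * t + 2"] that by auto
  define c1 where "c1 = (%m t. ind {0<..} t * d m t)"
  define c2 where "c2 = (%m t. ind {0<..T} t * et m t)"
  have Np: "N m > 0" for m by (simp add: N_def)
  have c1b: "abs(c1 m t) <= C + 1" for m t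
  proof (cases "t > 0")
   case True
   have "abs(th' (- N m * t + N m * b) * (N m * (b - t))) <= C"
   proof (cases "- N m * t + N m * b < 0 \<or> - N m * t + N m * b > 1")
   case True thus ?thesis using th(9)[OF True] C0 by simp
   next
   case False
   hence "abs(N m * (b - t)) <= 1" by (simp add: alg)
   hence "abs(th' (- N m * t + N m * b)) * abs(N m * (b - t)) <= C * 1" by (intro mult_mono th(8) C0) auto
   thus ?thesis by (simp add: abs_mult)
   qed
   moreover have "abs(th (- N m * t + N m * b)) <= 1" using th(4)[of "- N m * t + N m * b"] th(5)[of "- N m * t + N m * b"] by simp
   moreover have "d m t = - (th' (- N m * t + N m * b) * (N m * (b - t))) - th (- N m * t + N m * b)"
   unfolding d_def rho[OF True] by (simp add: alg)
   ultimately have "abs(d m t) <= C + 1" by linarith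
   thus ?thesis using True by (simp add: c1_def)
  qed (use C0 in "simp add: c1_def")
  have c2b: "abs(c2 m t) <= T + b" for m t
  proof (cases "t \<in> {0<..T}")
   case True
   hence "et m t = (b - t) * th (- N m * t + N m * b)" using rho(1)[of t] by (simp add: et_def)
   moreover have "abs(b - t) * abs(th (- N m * t + N m * b)) <= (T + b) * 1"
   using True b th(4)[of "- N m * t + N m * b"] th(5)[of "- N m * t + N m * b"] by (intro mult_mono) auto
   ultimately show ?thesis using True by (simp add: c2_def abs_mult)
  qed (use b T in "simp add: c2_def")
  have ev: "eventually (%m. th (- N m * t + N m * b) = (if t < b then 1 else 0) & (b - t) * th' (- N m * t + N m * b) = 0) sequentially" for t
  proof (cases "t < b")
   case True
   obtain M where M: "2 / (b - t) < real M" using reals_Archimedean2 by blast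
   show ?thesis
   proof (rule eventually_sequentiallyI[of M])
   fix m assume "M <= m"
   hence "2 / (b - t) < N m" using M by (simp add: N_def)
   hence "2 < N m * (b - t)" using True by (simp add: divide_less_eq)
   hence "- N m * t + N m * b > 1" by (simp add: alg)
   thus "th (- N m * t + N m * b) = (if t < b then 1 else 0) & (b - t) * th' (- N m * t + N m * b) = 0"
   using th(7)[of "- N m * t + N m * b"] th(9)[of "- N m * t + N m * b"] True by simp
   qed
  next
   case False
   show ?thesis
   proof (rule always_eventually, rule allI)
   fix m
   show "th (- N m * t + N m * b) = (if t < b then 1 else 0) & (b - t) * th' (- N m * t + N m * b) = 0"
   proof (cases "t = b")
   case True thus ?thesis using th(6)[of 0] by simp
   next
   case n: False
   hence "N m * b < N m * t" using False Np[of m] by simp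
   thus ?thesis using th(6)[of "- N m * t + N m * b"] th(9)[of "- N m * t + N m * b"] False by simp
   qed
   qed
  qed
  have l1: "(%m. LBINT t. f t * c1 m t) ----> (LBINT t. f t * (- ind {..<b} t))"
  proof (rule dct_factor[OF f _ _ c1b])
   show "c1 m \<in> BL" for m unfolding c1_def d_def by measurable
   show "(%t. - ind {..<b} t :: real) \<in> BL" by measurable
   fix t assume "f t ~= 0"
   hence t: "t > 0" using fz[of t] by auto
   show "(%m. c1 m t) ----> - ind {..<b} t"
   proof (rule tendsto_eventually)
   show "eventually (%m. c1 m t = - ind {..<b} t) sequentially"
   using ev[of t]
   proof eventually_elim
   case (elim m)
   have "d m t = - (N m * ((b - t) * th' (- N m * t + N m * b))) - th (- N m * t + N m * b)"
   unfolding d_def rho[OF t] by (simp add: alg)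
   also have "... = - ind {..<b} t" using elim by (auto simp: ind_def)
   finally show ?case using t by (simp add: c1_def)
   qed
   qed
  qed
  have l2: "(%m. LBINT t. h t * c2 m t) ----> (LBINT t. h t * (ind {..<b} t * (b - t)))"
  proof (rule dct_factor[OF h _ _ c2b])
   show "c2 m \<in> BL" for m unfolding c2_def et_def by measurable
   show "(%t. ind {..<b} t * (b - t) :: real) \<in> BL" by measurable
   fix t assume "h t ~= 0"
   hence t: "t \<in> {0<..T}" using hz[of t] by auto
   show "(%m. c2 m t) ----> ind {..<b} t * (b - t)"
   proof (rule tendsto_eventually)
   show "eventually (%m. c2 m t = ind {..<b} t * (b - t)) sequentially"
   using ev[of t] by eventually_elim (use t rho(1)[of t] in "auto simp: c2_def et_def ind_def")
   qed
  qed
  have l3: "(%m. f0 * et m 0) ----> f0 * b"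
  proof (rule tendsto_eventually)
   show "eventually (%m. f0 * et m 0 = f0 * b) sequentially"
   using ev[of 0] by eventually_elim (use b th(7)[of 2] in "auto simp: et_def")
  qed
  have e1: "f t * d m t = f t * c1 m t" for t m using fz[of t] by (cases "t > 0") (auto simp: c1_def)
  have e2: "h t * et m t = h t * c2 m t" for t m using hz[of t] by (cases "t \<in> {0<..T}") (auto simp: c2_def)
  have "(%m. 0) ----> (LBINT t. f t * (- ind {..<b} t)) + (LBINT t. h t * (ind {..<b} t * (b - t))) + f0 * b"
   using tendsto_add[OF tendsto_add[OF l1 l2] l3] E unfolding e1 e2 by simp
  hence "0 = (LBINT t. f t * (- ind {..<b} t)) + (LBINT t. h t * (ind {..<b} t * (b - t))) + f0 * b"
   by (rule LIMSEQ_unique[OF tendsto_const])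
  thus ?thesis by (simp add: mult_ac)
 qed
 define k where "k = (%t. ind {0<..<T} t * (f t - f0 - prim h t))"
 have pb: "abs(f0 + prim h t) <= abs(f0) + (LBINT s. abs(h s))" for t using prim_bound[OF h, of t] by linarith
 have [measurable]: "prim h \<in> BM" by (rule prim_measurable[OF h])
 have iT: "L1 (ind {0<..<T} :: real => real)" using T by (intro i_ind) auto
 have ik2: "L1 (%t. ind {0<..<T} t * (f0 + prim h t))"
  by (rule imb(1)[OF iT]) (use pb in auto)
 have ik1: "L1 (%t. ind {0<..<T} t * f t)" by (rule i_im[OF f]) simp
 have kk: "k = (%t. ind {0<..<T} t * f t - ind {0<..<T} t * (f0 + prim h t))"
  by (rule ext) (simp add: k_def alg)
 have ik: "L1 k" unfolding kk by (rule i_diff[OF ik1 ik2])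
 have p0: "prim k b = 0" if b: "0 < b" "b < T" for b
 proof -
  have ib: "L1 (ind {0<..b} :: real => real)" using b by (intro i_ind) auto
  \<comment> \<open>The chain rule for (b - t) times \<open>prim h\<close> is an integration by
    parts: both boundary terms vanish, and the weighted integral of h becomes the integral of
    \<open>prim h\<close>.\<close>
  have id1: "((%z::real * real. (b - fst z) * snd z) has_derivative (%d. (- snd z) * fst d + (b - fst z) * snd d)) (at z)" for z
   by (auto intro!: deqs simp: alg)
  have ch: "(b - b) * (0 + prim h b) - (b - 0) * (0 + prim h 0) = (LBINT s. ind {0<..b} s * (- (0 + prim h s) + (b - s) * h s))"
   using ac_chain_rule(1)[of "%z. (b - fst z) * snd z" "%z. - snd z" "%z. b - fst z", OF id1 _ _ h less_imp_le[OF b(1)] refl, of 0]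
   by (simp add: cints)
  have "prim h 0 = 0" by (rule prim_eq_0[of 0]) (use hz in auto)
  have i1: "L1 (%s. ind {0<..b} s * prim h s)"
   by (rule imb(1)[OF ib]) (use prim_bound[OF h] in auto)
  have i2: "L1 (%s. ind {0<..b} s * ((b - s) * h s))"
  proof -
   have "L1 (%s. h s * (ind {0<..b} s * (b - s)))"
   by (rule imb(1)[OF h, where C=b]) (use b in "auto simp: ind_def")
   thus ?thesis by (simp add: mult_ac)
  qed
  have "0 = (LBINT s. ind {0<..b} s * ((b - s) * h s) - ind {0<..b} s * prim h s)"
   using ch \<open>prim h 0 = 0\<close> by (simp add: alg)
  also have "... = (LBINT s. ind {0<..b} s * ((b - s) * h s)) - (LBINT s. ind {0<..b} s * prim h s)"
   by (rule int_diff[OF i2 i1])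
  finally have A: "(LBINT s. ind {0<..b} s * ((b - s) * h s)) = (LBINT s. ind {0<..b} s * prim h s)" by simp
  have B1: "(LBINT t. ind {..<b} t * ((b - t) * h t)) = (LBINT s. ind {0<..b} s * ((b - s) * h s))"
   by (rule int_cong[OF refl]) (use hz in "auto simp: ind_def")
  have B2: "(LBINT t. ind {..<b} t * f t) = (LBINT t. ind {0<..b} t * f t)"
  proof (rule integral_cong_AE)
   have "AEL t. t ~= b" by (rule AE_sing)
   thus "AEL t. ind {..<b} t * f t = ind {0<..b} t * f t"
   by eventually_elim (use fz in "auto simp: ind_def")
  qed (use f in auto)
  have i3: "L1 (%s. ind {0<..b} s * f s)" by (rule i_im[OF f]) simp
  have i4: "L1 (%s. f0 * ind {0<..b} s)" using ib by simp
  have "prim k b = (LBINT t. ind {0<..b} t * f t - f0 * ind {0<..b} t - ind {0<..b} t * prim h t)"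
   unfolding prim_def k_def by (rule int_cong[OF refl]) (use b in "auto simp: ind_def")
  also have "... = (LBINT t. ind {0<..b} t * f t) - (LBINT t. f0 * ind {0<..b} t) - (LBINT t. ind {0<..b} t * prim h t)"
   by (simp only: int_diff[OF i_diff[OF i3 i4] i1] int_diff[OF i3 i4])
  also have "... = 0" using key[OF b] A B1 B2 b by simp
  finally show ?thesis .
 qed
 have "AEL t. k t = 0"
  by (rule AE_zero_if_prim_zero[OF T ik _ p0]) (auto simp: k_def)
 thus ?thesis by eventually_elim (auto simp: k_def)
qed


lemma test_fun_real:
 assumes "smooth et" "compact J" "J \<subseteq> Om" "!!t. t ~: J ==> et t = 0"
 shows "test_fun Om et"
 by (rule test_funI[OF _ assms(2-4)]) (use assms(1) in "simp add: smooth_def")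

lemma test_fun_real_bounded:
 assumes t: "test_fun Om (et :: real => real)" and d: "!!t. (et has_real_derivative et' t) (at t)"
 obtains C where "!!t. abs(et t) <= C" "!!t. abs(et' t) <= C"
proof -
 have e: "pd 1 et = et'" using d pd_1_real by blast
 have "test_fun Om et'" using test_fun_pd[OF t, of 1] e by simp
 then obtain C1 where C1: "!!t. abs(et' t) <= C1" using test_fun_bounded by metis
 obtain C2 where C2: "!!t. abs(et t) <= C2" using test_fun_bounded[OF t] by metis
 have "abs(et t) <= max C1 C2" "abs(et' t) <= max C1 C2" for t using C1[of t] C2[of t] by auto
 thus ?thesis using that by blast
qed

text \<open>By continuity of \<open>prim h\<close> the set of times in (0, T) where it is nonzero is
  open; being null as well, it is empty.\<close>

lemma AE_zero_if_prim_AE_zero: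
 assumes h: "L1 h" and hz: "!!t. t ~: {0<..T} ==> h t = 0"
  and z: "AEL t. t \<in> {0<..<T} --> prim h t = 0" and T: "T > 0"
 shows "AEL t. h t = 0"
proof -
 define S where "S = {0<..<T} \<inter> prim h -` (- {0})"
 have "open S" unfolding S_def
  by (intro open_Int open_greaterThanLessThan open_vimage continuous_prim h open_Compl closed_singleton)
 moreover have "negligible S"
 proof -
  have "AEL t. t ~: S" using z by eventually_elim (auto simp: S_def)
  hence "S \<in> null_sets lborel" using \<open>open S\<close> by (subst AE_iff_null_sets) auto
  thus ?thesis unfolding negligible_iff_null_sets by (rule null_sets_completionI)
 qed
 ultimately have "S = {}" using open_not_negligible by blast
 hence "prim h b = 0" if "0 < b" "b < T" for b using that by (auto simp: S_def)
 thus ?thesis by (intro AE_zero_if_prim_zero[OF T h hz])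
qed

lemma Q_sets[measurable]: "Q T \<in> sets borel" 
proof -
 have "{0<..<1::real} \<times> {0<..T} \<in> sets (borel \<Otimes>\<^sub>M borel)" by (intro pair_measureI) auto
 thus ?thesis unfolding Q_def borel_prod .
qed

lemma Q_finite: "emeasure lborel (Q T) < \<infinity>"
proof -
 have "emeasure (lborel \<Otimes>\<^sub>M lborel) ({0<..<1::real} \<times> {0<..T}) = emeasure lborel {0<..<1::real} * emeasure lborel {0<..T}"
  by (rule lborel.emeasure_pair_measure_Times) auto
 also have "... < \<infinity>" by (cases "T >= 0") (auto simp: ennreal_mult_less_top)
 finally show ?thesis unfolding Q_def lborel_prod .
qed

lemma set_integrable_real: "set_integrable M A f \<longleftrightarrow> integrable M (%z. ind A z * f z :: real)"
 by (simp add: set_integrable_def)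

lemma set_integral_real: "(LINT z:A|M. f z) = (\<integral>z. ind A z * f z \<partial>M)" for f :: "'a => real"
 by (simp add: set_lebesgue_integral_def)

lemma set_measurable_real: "set_borel_measurable lborel A f \<longleftrightarrow> (%z. ind A z * f z :: real) \<in> BM"
 for f :: "'a::euclidean_space => real"
 by (simp add: set_borel_measurable_def)

lemma integrable_if_square_integrable:
 fixes f :: "'a => real"
 assumes "f \<in> borel_measurable M" "A \<in> sets M" "emeasure M A < \<infinity>" "!!z. z ~: A ==> f z = 0" "integrable M (%z. (f z)^2)"
 shows "integrable M f"
proof (rule i_bound)
 show "integrable M (%z. ind A z + (f z)^2)" using assms by (auto intro!: i_ind)
 show "AE z in M. norm (f z) <= norm (ind A z + (f z)^2)"
 proof (rule AE_I2)
  fix z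
  have "0 <= (abs(f z) - 1 / 2)^2" by simp
  hence "abs(f z) <= 1 + (f z)^2" by (simp add: power2_eq_square alg abs_mult_self_eq)
  thus "norm (f z) <= norm (ind A z + (f z)^2)"
   using assms(4)[of z] by (cases "z \<in> A") auto
 qed
qed (use assms in auto)

definition sc :: "nat => (real * real => real) => real => real" where
 "sc k F t = sinc k (%x. F (x, t))"

definition cc :: "nat => (real * real => real) => real => real" where
 "cc k F t = cosc k (%x. F (x, t))"

lemma trig_fst_measurable[measurable]:
 "(%z::real * real. sin (c * fst z)) \<in> BM" "(%z::real * real. cos (c * fst z)) \<in> BM"
 by (intro bm_cont cints)+

lemma sc_fubini:
 assumes F: "L1 F" and et: "et \<in> BM" and b: "!!t. abs(et t) <= C"
 shows "(LBINT z. F z * (sin (real k * pi * fst z) * et (snd z))) = (LBINT t. sc k F t * et t)"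
  and "(LBINT z. F z * (cos (real k * pi * fst z) * et (snd z))) = (LBINT t. cc k F t * et t)"
proof -
 have "(%z::real * real. et (snd z)) \<in> BM2" using et by measurable
 hence [measurable]: "(%z::real * real. et (snd z)) \<in> BM" unfolding borel_prod .
 have b2: "abs(s * et t) <= C" if "abs(s) <= 1" for s t
  using mult_mono[OF that b[of t]] by (simp add: abs_mult)
 have i: "L1 (%z. F z * (sin (real k * pi * fst z) * et (snd z)))" "L1 (%z. F z * (cos (real k * pi * fst z) * et (snd z)))"
 proof -
  have m: "(%z::real * real. sin (real k * pi * fst z) * et (snd z)) \<in> BL"
   "(%z::real * real. cos (real k * pi * fst z) * et (snd z)) \<in> BL"
   by measurable
  show "L1 (%z. F z * (sin (real k * pi * fst z) * et (snd z)))" "L1 (%z. F z * (cos (real k * pi * fst z) * et (snd z)))"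
   by (rule imb(1)[OF F m(1), where C=C] imb(1)[OF F m(2), where C=C]; use b2 in auto)+
 qed
 show "(LBINT z. F z * (sin (real k * pi * fst z) * et (snd z))) = (LBINT t. sc k F t * et t)"
  using lp_snd(3)[OF i(1)] by (simp add: sc_def sinc_def mult.assoc[symmetric])
 show "(LBINT z. F z * (cos (real k * pi * fst z) * et (snd z))) = (LBINT t. cc k F t * et t)"
  using lp_snd(3)[OF i(2)] by (simp add: cc_def cosc_def mult.assoc[symmetric])
qed

lemma integrable_sc:
 assumes F: "L1 F"
 shows "L1 (sc k F)" "L1 (cc k F)"
proof -
 have i: "L1 (%z. F z * sin (real k * pi * fst z))" "L1 (%z. F z * cos (real k * pi * fst z))"
  by (rule imb(1)[OF F, where C=1]; (measurable | auto))+
 show "L1 (sc k F)" "L1 (cc k F)"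
  using lp_snd(2)[OF i(1)] lp_snd(2)[OF i(2)]
  unfolding sc_def[abs_def] cc_def[abs_def] sinc_def cosc_def by simp_all
qed

lemma sc_zero: "(!!x. F (x, t) = 0) ==> sc k F t = 0" "(!!x. F (x, t) = 0) ==> cc k F t = 0"
 by (simp_all add: sc_def cc_def sinc_def cosc_def)

section \<open>Fourier modes of a weak solution\<close>

locale weak_sol =
 fixes sg u0 v0 v0x :: "real => real" and u v vx :: "real * real => real" and T K :: real
 assumes T: "T > 0"
  and sgd: "!!r. sg differentiable (at r)" and sgc: "continuous_on UNIV (deriv sg)"
  and u0: "Linf_bound {0<..<1} K u0" and v0: "Linf_bound {0<..<1} K v0" and v0x: "Linf_bound {0<..<1} K v0x"
  and v0_weak: "weak_pd {0<..<1} 1 v0 v0x"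
  and ws: "weak_solution sg u0 v0 u v vx"
begin

text \<open>The suffix q marks a function cut off outside \<open>Q T\<close>, the suffix I initial
  data cut off outside (0, 1). Everything then lives on the whole space and vanishes off its domain,
  so Fubini and slices need no set integrals.\<close>

definition "uq z = ind (Q T) z * u z"
definition "vq z = ind (Q T) z * v z"
definition "vxq z = ind (Q T) z * vx z"
definition "fq z = ind (Q T) z * sg (u z)"
definition "sq z = fq z + vxq z"
definition "uI x = ind {0<..<1} x * u0 x"
definition "vI x = ind {0<..<1} x * v0 x"
definition "vxI x = ind {0<..<1} x * v0x x"

lemma outside: "z ~: Q T ==> uq z = 0" "z ~: Q T ==> vq z = 0" "z ~: Q T ==> vxq z = 0"
 "z ~: Q T ==> fq z = 0" "z ~: Q T ==> sq z = 0"
 by (simp_all add: uq_def vq_def vxq_def fq_def sq_def)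

lemma outside_t: "t ~: {0<..T} ==> uq (x, t) = 0" "t ~: {0<..T} ==> vq (x, t) = 0" "t ~: {0<..T} ==> vxq (x, t) = 0"
 "t ~: {0<..T} ==> fq (x, t) = 0" "t ~: {0<..T} ==> sq (x, t) = 0"
 by (auto simp: Q_def ind_def uq_def vq_def vxq_def fq_def sq_def)

lemma outside_x: "x ~: {0<..<1} ==> uq (x, t) = 0" "x ~: {0<..<1} ==> vq (x, t) = 0" "x ~: {0<..<1} ==> vxq (x, t) = 0"
 "x ~: {0<..<1} ==> fq (x, t) = 0" "x ~: {0<..<1} ==> sq (x, t) = 0"
 by (auto simp: Q_def ind_def uq_def vq_def vxq_def fq_def sq_def)

lemma outside_I: "x ~: {0<..<1} ==> uI x = 0" "x ~: {0<..<1} ==> vI x = 0" "x ~: {0<..<1} ==> vxI x = 0"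
 by (simp_all add: uI_def vI_def vxI_def)

lemma integrable_u: "L1 uq" and integrable_f: "L1 fq"
 using ws T unfolding weak_solution_def set_integrable_real uq_def[abs_def] fq_def[abs_def] by auto

lemma v_L2: "vq \<in> BM" "L1 (%z. (vq z)^2)"
 and vx_L2: "vxq \<in> BM" "L1 (%z. (vxq z)^2)"
proof -
 have "L2 (Q T) v" "L2 (Q T) vx" using ws T unfolding weak_solution_def by auto
 moreover have "(ind (Q T) z * w)^2 = ind (Q T) z * w^2" for z and w :: real by (simp add: ind_def)
 ultimately show "vq \<in> BM" "L1 (%z. (vq z)^2)"
  "vxq \<in> BM" "L1 (%z. (vxq z)^2)"
  unfolding L2_def set_integrable_real set_measurable_real vq_def[abs_def] vxq_def[abs_def] by simp_all
qed

lemma integrable_v: "L1 vq"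
 by (rule integrable_if_square_integrable[of _ _ "Q T"]) (use v_L2 Q_finite outside in auto)

lemma integrable_vx: "L1 vxq"
 by (rule integrable_if_square_integrable[of _ _ "Q T"]) (use vx_L2 Q_finite outside in auto)

lemma integrable_s: "L1 sq"
 unfolding sq_def[abs_def] by (intro i_add integrable_f integrable_vx)

lemma initial_integrable:
 assumes "Linf_bound {0<..<1} K (w :: real => real)"
 shows "L1 (%x. ind {0<..<1} x * w x)" "AEL x. abs(ind {0<..<1} x * w x) <= K"
proof -
 have m: "(%x. ind {0<..<1} x * w x) \<in> BM" and b: "AE x\<in>{0<..<1} in lborel. abs(w x) <= K"
  using assms unfolding Linf_bound_def set_measurable_real by auto
 have "AEL x. abs(ind {0<..<1} x * (ind {0<..<1} x * w x)) <= abs(K)"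
  using b by eventually_elim (auto simp: ind_def)
 from b have b1: "AEL x. abs(ind {0<..<1} x * w x) <= abs(K)"
  by eventually_elim (auto simp: ind_def)
 have "L1 (%x. ind {0<..<1} x * (ind {0<..<1} x * w x))"
  by (rule imb(1)[OF i01 _ b1]) (use m in simp)
 moreover have "(%x. ind {0<..<1} x * (ind {0<..<1} x * w x)) = (%x. ind {0<..<1} x * w x)"
  by (rule ext) (simp add: ind_def)
 ultimately show "L1 (%x. ind {0<..<1} x * w x)" by simp
 have K0: "K >= 0"
 proof (rule ccontr)
  assume "~ K >= 0"
  hence "AEL x. x ~: {0<..<1::real}" by (intro eventually_mono[OF b]) auto
  hence "{0<..<1::real} \<in> null_sets lborel" by (subst (asm) AE_iff_null_sets[symmetric]) auto
  thus False by (simp add: null_sets_def)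
 qed
 show "AEL x. abs(ind {0<..<1} x * w x) <= K"
  using b by eventually_elim (use K0 in "auto simp: ind_def")
qed

lemma integrable_uI: "L1 uI" and uI_bound: "AEL x. abs(uI x) <= K"
 and integrable_vI: "L1 vI" and vI_bound: "AEL x. abs(vI x) <= K"
 and integrable_vxI: "L1 vxI" and vxI_bound: "AEL x. abs(vxI x) <= K"
 unfolding uI_def[abs_def] vI_def[abs_def] vxI_def[abs_def]
 by (rule initial_integrable[OF u0] initial_integrable[OF v0] initial_integrable[OF v0x])+

lemma test_zero:
 assumes "test_fun ({0<..<1} \<times> {..<T}) ph" "snd z >= T"
 shows "ph z = 0" "pd b ph z = 0"
 using test_fun_zero[OF assms(1), of z] assms(2) by (cases z; auto)+

lemma test_zero':
 assumes "test_fun (UNIV \<times> {..<T}) ph" "snd z >= T"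
 shows "ph z = 0" "pd b ph z = 0"
 using test_fun_zero[OF assms(1), of z] assms(2) by (cases z; auto)+

lemma integrable_mult_test:
 assumes F: "L1 (F :: 'a::euclidean_space => real)" and ph: "test_fun Om ph"
 shows "L1 (%z. F z * ph z)"
proof -
 obtain C where C: "!!z. abs(ph z) <= C" using test_fun_bounded[OF ph] by metis
 show ?thesis by (rule imb(1)[OF F, where C=C]) (use C test_fun_measurable[OF ph] in auto)
qed

text \<open>The weak derivative is given only for test functions supported in t > 0. A cut-off
  depending on time alone commutes with the derivative in x, so it can be inserted and then removed
  by dominated convergence without any boundary term at t = 0.\<close>

lemma v_weak_derivative:
 assumes ph: "test_fun ({0<..<1} \<times> {..<T}) ph"
 shows "(LBINT z. vq z * pd (1, 0) ph z) = - (LBINT z. vxq z * ph z)"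
proof -
 obtain th th' :: "real => real" and C where th: "!!k. Ck k th" "!!x. (th has_real_derivative th' x) (at x)" "continuous_on UNIV th'"
  "!!x. 0 <= th x" "!!x. th x <= 1" "!!x. x <= 0 ==> th x = 0" "!!x. x >= 1 ==> th x = 1"
  "!!x. abs(th' x) <= C" "!!x. x < 0 \<or> x > 1 ==> th' x = 0"
  by (rule smooth_step) blast
 define c where "c = (%(n::nat) (z::real * real). th (real (n + 1) * snd z + (- 1)))"
 have cC: "Ck k (c n)" for k n
  unfolding c_def
  by (rule Ck_compose_affine[OF _ th(1)]) (intro bounded_linear_const_mult bounded_linear_snd)
 have cm: "c n \<in> BL" for n
  using bm_cont cC[of 0 n] by simp
 have cb: "abs(c n z) <= 1" for n z using th(4,5) by (simp add: c_def)
 have cl: "(%n. c n z) ----> 1" if z: "snd z > 0" for z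
 proof -
  obtain N where N: "2 / snd z < real N" using reals_Archimedean2 by blast
  show ?thesis
  proof (rule tendsto_eventually, rule eventually_sequentiallyI[of N])
   fix n assume "N <= n"
   hence "2 / snd z < real (n + 1)" using N by simp
   hence "2 < real (n + 1) * snd z" using z by (simp add: divide_less_eq)
   thus "c n z = 1" unfolding c_def by (intro th(7)) simp
  qed
 qed
 define ps where "ps = (%n z. c n z * ph z)"
 obtain K0 where K0: "compact K0" "K0 \<subseteq> {0<..<1} \<times> {..<T}" "!!z. z ~: K0 ==> ph z = 0"
  using test_fun_support[OF ph] by metis
 have pst: "test_fun ({0<..<1} \<times> {0<..}) (ps n)" for n
 proof (rule test_funI)
  show "Ck k (ps n)" for k unfolding ps_def using ph by (intro Ck_mult cC) (simp add: test_fun_def)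
  have "closed {z::real * real. 1 / real (n + 1) <= snd z}" by (intro closed_Collect_le cints)
  thus "compact (K0 \<inter> {z. 1 / real (n + 1) <= snd z})" by (rule compact_Int_closed[OF K0(1)])
  have "0 < t" if "1 / real (n + 1) <= t" for t
   using that by (rule less_le_trans[rotated]) simp
  thus "K0 \<inter> {z. 1 / real (n + 1) <= snd z} \<subseteq> {0<..<1} \<times> {0<..}" using K0(2) by fastforce
  fix z assume z: "z ~: K0 \<inter> {z. 1 / real (n + 1) <= snd z}"
  show "ps n z = 0"
  proof (cases "z \<in> K0")
   case True
   hence "snd z < 1 / real (n + 1)" using z by auto
   hence "real (n + 1) * snd z + (- 1) <= 0" by (simp add: field_simps)
   thus ?thesis unfolding ps_def c_def by (simp only: th(6) mult_zero_left)
  qed (simp add: ps_def K0(3))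
 qed
 have pdp: "pd (1, 0) (ps n) z = c n z * pd (1, 0) ph z" for n z
 proof -
  obtain x t where z: "z = (x, t)" by (cases z)
  have "((%x. ps n (x, t)) has_real_derivative c n (x, t) * pd (1, 0) ph (x, t)) (at x)"
   using DERIV_cmult[OF pd_fst[OF test_fun_differentiable[OF ph, of "(x, t)"]], of "c n (x, t)"] by (simp add: ps_def c_def)
  from DERIV_unique[OF pd_fst[OF test_fun_differentiable[OF pst]] this] show ?thesis by (simp add: z)
 qed
 have E: "(LBINT z. (vq z * pd (1, 0) ph z) * c n z) = - (LBINT z. (vxq z * ph z) * c n z)" for n
 proof -
  have "(LINT z:{0<..<1} \<times> {0<..}|lborel. v z * pd (1, 0) (ps n) z) = - (LINT z:{0<..<1} \<times> {0<..}|lborel. vx z * ps n z)"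
   using ws pst[of n] unfolding weak_solution_def weak_pd_def by blast
  moreover have "ind ({0<..<1} \<times> {0<..}) z * (v z * pd (1, 0) (ps n) z) = (vq z * pd (1, 0) ph z) * c n z" for z
   using test_zero(2)[OF ph, of z "(1,0)"] unfolding pdp vq_def by (cases z) (auto simp: Q_def ind_def)
  moreover have "ind ({0<..<1} \<times> {0<..}) z * (vx z * ps n z) = (vxq z * ph z) * c n z" for z
   using test_zero(1)[OF ph, of z] unfolding ps_def vxq_def by (cases z) (auto simp: Q_def ind_def)
  ultimately show ?thesis unfolding set_integral_real by simp
 qed
 have snd_pos: "snd z > 0" if "w z ~= 0" "!!z. z ~: Q T ==> w z = 0" for w :: "real * real => real" and z
  using that by (cases "z \<in> Q T") (auto simp: Q_def)
 have m1: "(%z. 1::real) \<in> BL" by simp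
 have "(%n. LBINT z. (vq z * pd (1, 0) ph z) * c n z) ----> (LBINT z. (vq z * pd (1, 0) ph z) * 1)"
  by (rule dct_factor[OF integrable_mult_test[OF integrable_v test_fun_pd[OF ph Basis_real2(1)]] cm m1 cb])
   (rule cl, rule snd_pos[of vq], use outside in auto)
 moreover have "(%n. - (LBINT z. (vxq z * ph z) * c n z)) ----> - (LBINT z. (vxq z * ph z) * 1)"
  by (rule tendsto_minus, rule dct_factor[OF integrable_mult_test[OF integrable_vx ph] cm m1 cb])
   (rule cl, rule snd_pos[of vxq], use outside in auto)
 ultimately show ?thesis unfolding E using LIMSEQ_unique by fastforce
qed

text \<open>The derivative in x is moved from the test function to v, so that the equation reads u_t
  = v_x with an integrable right side.\<close>

lemma u_equation:
 assumes ph: "test_fun ({0<..<1} \<times> {..<T}) ph"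
 shows "(LBINT z. uq z * pd (0, 1) ph z) + (LBINT z. vxq z * ph z) + (LBINT x. uI x * ph (x, 0)) = 0"
proof -
 have "test_fun ({0<..<1} \<times> UNIV) ph" by (rule test_fun_mono[OF ph]) auto
 hence "(LINT z:{0<..<1} \<times> {0<..}|lborel. u z * pd (0, 1) ph z - v z * pd (1, 0) ph z) + (LINT x:{0<..<1}|lborel. u0 x * ph (x, 0)) = 0"
  using ws unfolding weak_solution_def by blast
 moreover have "ind ({0<..<1} \<times> {0<..}) z * (u z * pd (0, 1) ph z - v z * pd (1, 0) ph z) = uq z * pd (0, 1) ph z - vq z * pd (1, 0) ph z" for z
  using test_zero(2)[OF ph, of z] unfolding uq_def vq_def by (cases z) (auto simp: Q_def ind_def)
 moreover have "ind {0<..<1} x * (u0 x * ph (x, 0)) = uI x * ph (x, 0)" for x by (simp add: uI_def)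
 moreover have "(LBINT z. uq z * pd (0, 1) ph z - vq z * pd (1, 0) ph z) = (LBINT z. uq z * pd (0, 1) ph z) - (LBINT z. vq z * pd (1, 0) ph z)"
  by (intro int_diff integrable_mult_test integrable_u integrable_v) (rule test_fun_pd[OF ph Basis_real2(2)] test_fun_pd[OF ph Basis_real2(1)])+
 ultimately show ?thesis unfolding set_integral_real using v_weak_derivative[OF ph] by simp
qed

lemma v_equation:
 assumes ph: "test_fun (UNIV \<times> {..<T}) ph"
 shows "(LBINT z. vq z * pd (0, 1) ph z) - (LBINT z. sq z * pd (1, 0) ph z) + (LBINT x. vI x * ph (x, 0)) = 0"
proof -
 have "test_fun UNIV ph" by (rule test_fun_mono[OF ph]) auto
 hence "(LINT z:{0<..<1} \<times> {0<..}|lborel. v z * pd (0, 1) ph z - (sg (u z) + vx z) * pd (1, 0) ph z) + (LINT x:{0<..<1}|lborel. v0 x * ph (x, 0)) = 0"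
  using ws unfolding weak_solution_def by blast
 moreover have "ind ({0<..<1} \<times> {0<..}) z * (v z * pd (0, 1) ph z - (sg (u z) + vx z) * pd (1, 0) ph z) = vq z * pd (0, 1) ph z - sq z * pd (1, 0) ph z" for z
  using test_zero'(2)[OF ph, of z] unfolding sq_def fq_def vxq_def vq_def by (cases z) (auto simp: Q_def ind_def)
 moreover have "ind {0<..<1} x * (v0 x * ph (x, 0)) = vI x * ph (x, 0)" for x by (simp add: vI_def)
 moreover have "(LBINT z. vq z * pd (0, 1) ph z - sq z * pd (1, 0) ph z) = (LBINT z. vq z * pd (0, 1) ph z) - (LBINT z. sq z * pd (1, 0) ph z)"
  by (intro int_diff integrable_mult_test integrable_s integrable_v) (rule test_fun_pd[OF ph Basis_real2(2)] test_fun_pd[OF ph Basis_real2(1)])+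
 ultimately show ?thesis unfolding set_integral_real by simp
qed

lemma modes_tested:
 assumes et: "smooth et" "!!t. (et has_real_derivative et' t) (at t)" "compact J" "J \<subseteq> {..<T}" "!!t. t ~: J ==> et t = 0"
 shows "(LBINT t. (real k * pi * cc k vq t + sc k vxq t) * et t) = 0"
  "(LBINT t. sc k uq t * et' t) + (LBINT t. sc k vxq t * et t) + sinc k uI * et 0 = 0"
  "(LBINT t. cc k vq t * et' t) + (LBINT t. (real k * pi * sc k sq t) * et t) + cosc k vI * et 0 = 0"
proof -
 have t1: "test_fun {..<T} et" by (rule test_fun_real[OF et(1,3,4,5)])
 obtain C where C: "!!t. abs(et t) <= C" "!!t. abs(et' t) <= C" by (rule test_fun_real_bounded[OF t1 et(2)]) blast
 have m[measurable]: "et \<in> BM" "et' \<in> BM"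
  using bm_cont[OF smooth_continuous[OF et(1)]] bm_cont[OF smooth_deriv_continuous[OF et(1,2)]] by auto
 have "(%z::real * real. et (snd z)) \<in> BM2" "(%z::real * real. et' (snd z)) \<in> BM2" by measurable
 hence ms[measurable]: "(%z::real * real. et (snd z)) \<in> BM" "(%z::real * real. et' (snd z)) \<in> BM" unfolding borel_prod .
 have iF: "L1 (%z. F z * et (snd z))" "L1 (%z. F z * et' (snd z))" if "L1 F" for F :: "real * real => real"
  by (rule imb(1)[OF that, where C=C]; use C in auto)+
 obtain a a' :: "nat => real => real" and Bd where a: "!!n. smooth (a n)" "!!n x. (a n has_real_derivative a' n x) (at x)"
  "!!n x. x ~: {1 / real (n + 1)..1 - 1 / real (n + 1)} ==> a n x = 0"
  "!!n x. abs(a n x) <= Bd" "!!n x. abs(a' n x) <= Bd"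
  "!!x. 0 < x ==> x < 1 ==> (%n. a n x) ----> sin (real k * pi * x)"
  "!!x. 0 < x ==> x < 1 ==> (%n. a' n x) ----> real k * pi * cos (real k * pi * x)"
  by (rule sin_cutoff[of k]) blast
 have ac: "continuous_on UNIV (a n)" "continuous_on UNIV (a' n)" for n
  using smooth_continuous[OF a(1)] smooth_deriv_continuous[OF a(1,2)] by auto
 have am: "(%z::real * real. a n (fst z)) \<in> BL" "(%z::real * real. a' n (fst z)) \<in> BL" for n
 proof -
  have "continuous_on UNIV (%z::real * real. a n (fst z))" "continuous_on UNIV (%z::real * real. a' n (fst z))"
   by (rule continuous_on_compose2[OF ac(1)] continuous_on_compose2[OF ac(2)]; auto intro!: cints)+
  thus "(%z::real * real. a n (fst z)) \<in> BL" "(%z::real * real. a' n (fst z)) \<in> BL"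
   using bm_cont by auto
 qed
 define ph where "ph = (%n (z::real * real). a n (fst z) * et (snd z))"
 have tf: "test_fun ({0<..<1} \<times> {..<T}) (ph n)" for n
  unfolding ph_def
 proof (rule test_fun_prod[OF a(1) et(1) _ a(3) et(3,5)])
  have "1 / real (n + 1) > 0" by simp
  hence "{1 / real (n + 1)..1 - 1 / real (n + 1)} \<subseteq> {0<..<1}" by (intro subsetI) (simp only: atLeastAtMost_iff greaterThanLessThan_iff, linarith)
  thus "{1 / real (n + 1)..1 - 1 / real (n + 1)} \<times> J \<subseteq> {0<..<1} \<times> {..<T}" using et(4) by auto
 qed auto
 have pds: "pd (1, 0) (ph n) z = a' n (fst z) * et (snd z)" "pd (0, 1) (ph n) z = a n (fst z) * et' (snd z)" for n z
  using pd_prod[OF tf[unfolded ph_def] a(2) et(2), of n "fst z" "snd z"] unfolding ph_def by (cases z; simp)+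
 have cm: "(%z::real * real. sin (real k * pi * fst z)) \<in> BL" "(%z::real * real. real k * pi * cos (real k * pi * fst z)) \<in> BL"
  by measurable
 have lim1: "(%n. LBINT z. (F z * e (snd z)) * a n (fst z)) ----> (LBINT z. (F z * e (snd z)) * sin (real k * pi * fst z))"
  "(%n. LBINT z. (F z * e (snd z)) * a' n (fst z)) ----> (LBINT z. (F z * e (snd z)) * (real k * pi * cos (real k * pi * fst z)))"
  if i: "L1 (%z. F z * e (snd z))" and o: "!!z. z ~: Q T ==> F z = 0" for F :: "real * real => real" and e
 proof -
  have fp: "0 < fst z" "fst z < 1" if "F z * e (snd z) ~= 0" for z
   using that o[of z] by (cases "z \<in> Q T"; auto simp: Q_def)+
  show "(%n. LBINT z. (F z * e (snd z)) * a n (fst z)) ----> (LBINT z. (F z * e (snd z)) * sin (real k * pi * fst z))"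
   by (rule dct_factor[OF i am(1) cm(1) a(4) a(6)[OF fp]])
  show "(%n. LBINT z. (F z * e (snd z)) * a' n (fst z)) ----> (LBINT z. (F z * e (snd z)) * (real k * pi * cos (real k * pi * fst z)))"
   by (rule dct_factor[OF i am(2) cm(2) a(5) a(7)[OF fp]])
 qed
 have fs: "(LBINT z. (F z * e (snd z)) * sin (real k * pi * fst z)) = (LBINT t. sc k F t * e t)"
  "(LBINT z. (F z * e (snd z)) * (real k * pi * cos (real k * pi * fst z))) = real k * pi * (LBINT t. cc k F t * e t)"
  if "L1 F" "e \<in> BM" "!!t. abs(e t) <= C" for F e
 proof -
  have 1: "(F z * e (snd z)) * sin (real k * pi * fst z) = F z * (sin (real k * pi * fst z) * e (snd z))" for z by simp
  have 2: "(F z * e (snd z)) * (real k * pi * cos (real k * pi * fst z)) = (real k * pi) * (F z * (cos (real k * pi * fst z) * e (snd z)))" for z by simp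
  show "(LBINT z. (F z * e (snd z)) * sin (real k * pi * fst z)) = (LBINT t. sc k F t * e t)"
   unfolding 1 by (rule sc_fubini(1)[OF that])
  show "(LBINT z. (F z * e (snd z)) * (real k * pi * cos (real k * pi * fst z))) = real k * pi * (LBINT t. cc k F t * e t)"
   unfolding 2 integral_mult_right_zero by (subst sc_fubini(2)[OF that]) simp
 qed
 show "(LBINT t. (real k * pi * cc k vq t + sc k vxq t) * et t) = 0"
 proof -
  have e: "(LBINT z. (vq z * et (snd z)) * a' n (fst z)) = - (LBINT z. (vxq z * et (snd z)) * a n (fst z))" for n
   using v_weak_derivative[OF tf[of n]] unfolding pds unfolding ph_def by (simp add: mult_ac)
  have "(LBINT z. (vq z * et (snd z)) * (real k * pi * cos (real k * pi * fst z))) = - (LBINT z. (vxq z * et (snd z)) * sin (real k * pi * fst z))"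
   using lim1(2)[OF iF(1)[OF integrable_v] outside(2)] tendsto_minus[OF lim1(1)[OF iF(1)[OF integrable_vx] outside(3)]]
   unfolding e by (rule LIMSEQ_unique)
  hence A: "real k * pi * (LBINT t. cc k vq t * et t) = - (LBINT t. sc k vxq t * et t)"
   unfolding fs(1)[OF integrable_vx m(1) C(1)] fs(2)[OF integrable_v m(1) C(1)] .
  have i1: "L1 (%t. cc k vq t * et t)" "L1 (%t. sc k vxq t * et t)"
   by (rule imb(1)[OF integrable_sc(2)[OF integrable_v]] imb(1)[OF integrable_sc(1)[OF integrable_vx]]; use C in auto)+
  have "(LBINT t. (real k * pi * cc k vq t + sc k vxq t) * et t) = (LBINT t. real k * pi * (cc k vq t * et t) + sc k vxq t * et t)"
   by (simp add: distrib_right mult.assoc)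
  also have "... = real k * pi * (LBINT t. cc k vq t * et t) + (LBINT t. sc k vxq t * et t)"
   by (subst int_add[OF i_mr[OF i1(1)] i1(2)]) (simp only: integral_mult_right_zero)
  finally show ?thesis using A by simp
 qed
 show "(LBINT t. sc k uq t * et' t) + (LBINT t. sc k vxq t * et t) + sinc k uI * et 0 = 0"
 proof -
  have e: "(LBINT z. (uq z * et' (snd z)) * a n (fst z)) + (LBINT z. (vxq z * et (snd z)) * a n (fst z)) + (LBINT x. (uI x * et 0) * a n x) = 0" for n
   using u_equation[OF tf[of n]] unfolding pds unfolding ph_def by (simp add: mult_ac)
  have am1: "a n \<in> BL" "(%x. sin (real k * pi * x)) \<in> BL" for n
   using bm_cont[OF ac(1)] by auto
  have "(%n. LBINT x. (uI x * et 0) * a n x) ----> (LBINT x. (uI x * et 0) * sin (real k * pi * x))"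
  proof (rule dct_factor[OF _ am1 a(4)])
   show "L1 (%x. uI x * et 0)" using integrable_uI by simp
   fix x assume "uI x * et 0 ~= 0"
   hence "x \<in> {0<..<1}" using outside_I(1)[of x] by (cases "x \<in> {0<..<1}") auto
   thus "(%n. a n x) ----> sin (real k * pi * x)" using a(6) by simp
  qed
  from tendsto_add[OF tendsto_add[OF lim1(1)[OF iF(2)[OF integrable_u] outside(1)] lim1(1)[OF iF(1)[OF integrable_vx] outside(3)]] this]
  have "0 = (LBINT z. (uq z * et' (snd z)) * sin (real k * pi * fst z)) + (LBINT z. (vxq z * et (snd z)) * sin (real k * pi * fst z)) + (LBINT x. (uI x * et 0) * sin (real k * pi * x))"
   unfolding e by (rule LIMSEQ_unique[OF tendsto_const])
  moreover have "(LBINT x. (uI x * et 0) * sin (real k * pi * x)) = sinc k uI * et 0"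
   unfolding sinc_def by (subst integral_mult_left_zero[symmetric]) (simp add: mult_ac)
  ultimately show ?thesis unfolding fs(1)[OF integrable_u m(2) C(2)] fs(1)[OF integrable_vx m(1) C(1)] by simp
 qed
 obtain th th' :: "real => real" and C' where th: "!!k. Ck k th" "!!x. (th has_real_derivative th' x) (at x)" "continuous_on UNIV th'"
  "!!x. 0 <= th x" "!!x. th x <= 1" "!!x. x <= 0 ==> th x = 0" "!!x. x >= 1 ==> th x = 1"
  "!!x. abs(th' x) <= C'" "!!x. x < 0 \<or> x > 1 ==> th' x = 0"
  by (rule smooth_step) blast
 have ths: "smooth th" using th(1) by (simp add: smooth_def)
 define w where "w = real k * pi"
 \<comment> \<open>Equal to the cosine on [-1, 2]; the two cut-off factors only make the support
   compact and are invisible on (0, 1).\<close>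
 define b where "b = (%x. (th (1 * x + 2) * th (- 1 * x + 3)) * cos (w * x))"
 define b' where "b' = (%x. (th (1 * x + 2) * th (- 1 * x + 3)) * (- sin (w * x) * w) + (th (1 * x + 2) * (th' (- 1 * x + 3) * (- 1)) + (th' (1 * x + 2) * 1) * th (- 1 * x + 3)) * cos (w * x))"
 have db: "(b has_real_derivative b' x) (at x)" for x
 proof -
  have 1: "((%x. th (1 * x + 2)) has_real_derivative th' (1 * x + 2) * 1) (at x)"
   by (rule DERIV_chain2[OF th(2)]) (auto intro!: deqs)
  have 2: "((%x. th (- 1 * x + 3)) has_real_derivative th' (- 1 * x + 3) * (- 1)) (at x)"
   by (rule DERIV_chain2[OF th(2)]) (auto intro!: deqs)
  have 3: "((%x. cos (w * x)) has_real_derivative - sin (w * x) * w) (at x)"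
   by (auto intro!: deqs)
  show ?thesis unfolding b_def b'_def
   by (rule DERIV_cong[OF DERIV_mult[OF DERIV_mult[OF 1 2] 3]]) (simp add: alg)
 qed
 have bs: "smooth b" unfolding b_def by (intro smooth_mult smooth_compose_affine ths smooth_sin_cos)
 have b01: "b x = cos (real k * pi * x)" "b' x = - (real k * pi) * sin (real k * pi * x)" if "x \<in> {0<..<1}" for x
 proof -
  have "th (1 * x + 2) = 1" "th (- 1 * x + 3) = 1" "th' (1 * x + 2) = 0" "th' (- 1 * x + 3) = 0"
   using that by (auto intro: th(7) th(9))
  thus "b x = cos (real k * pi * x)" "b' x = - (real k * pi) * sin (real k * pi * x)"
   unfolding b_def b'_def w_def by simp_all
 qed
 define ps where "ps = (%z::real * real. b (fst z) * et (snd z))"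
 have tp: "test_fun (UNIV \<times> {..<T}) ps"
  unfolding ps_def
 proof (rule test_fun_prod[OF bs et(1) _ _ et(3,5)])
  show "compact {-2..3::real}" by simp
  show "{-2..3} \<times> J \<subseteq> UNIV \<times> {..<T}" using et(4) by auto
  fix x :: real assume "x ~: {-2..3}"
  hence "1 * x + 2 <= 0 \<or> - 1 * x + 3 <= 0" by auto
  thus "b x = 0" unfolding b_def using th(6) by (auto simp only: mult_zero_left mult_zero_right)
 qed
 have pdp: "pd (1, 0) ps z = b' (fst z) * et (snd z)" "pd (0, 1) ps z = b (fst z) * et' (snd z)" for z
  using pd_prod[OF tp[unfolded ps_def] db et(2), of "fst z" "snd z"] unfolding ps_def by (cases z; simp)+
 show "(LBINT t. cc k vq t * et' t) + (LBINT t. (real k * pi * sc k sq t) * et t) + cosc k vI * et 0 = 0"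
 proof -
  have fx: "fst z \<in> {0<..<1}" if "z \<in> Q T" for z using that by (auto simp: Q_def)
  have e1: "vq z * pd (0, 1) ps z = vq z * (cos (real k * pi * fst z) * et' (snd z))" for z
   unfolding pdp using b01(1)[OF fx, of z] outside(2)[of z] by (cases "z \<in> Q T") auto
  have 1: "(LBINT z. vq z * pd (0, 1) ps z) = (LBINT t. cc k vq t * et' t)"
   unfolding e1 by (rule sc_fubini(2)[OF integrable_v m(2) C(2)])
  have e2: "sq z * pd (1, 0) ps z = - (real k * pi) * (sq z * (sin (real k * pi * fst z) * et (snd z)))" for z
   unfolding pdp using b01(2)[OF fx, of z] outside(5)[of z] by (cases "z \<in> Q T") auto
  have 2: "(LBINT z. sq z * pd (1, 0) ps z) = - (real k * pi) * (LBINT t. sc k sq t * et t)"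
   unfolding e2 integral_mult_right_zero by (subst sc_fubini(1)[OF integrable_s m(1) C(1)]) (rule refl)
  have e3: "vI x * ps (x, 0) = (vI x * cos (real k * pi * x)) * et 0" for x
   unfolding ps_def using b01(1)[of x] outside_I(2)[of x] by (cases "x \<in> {0<..<1}") auto
  have 3: "(LBINT x. vI x * ps (x, 0)) = cosc k vI * et 0"
   unfolding e3 cosc_def by (rule integral_mult_left_zero)
  have 4: "(LBINT t. (real k * pi * sc k sq t) * et t) = real k * pi * (LBINT t. sc k sq t * et t)"
   by (subst integral_mult_right_zero[symmetric]) (simp only: mult.assoc)
  show ?thesis using v_equation[OF tp] unfolding 1 2 3 4 by simp
 qed
qed

lemma sc_outside: "t ~: {0<..T} ==> sc k uq t = 0" "t ~: {0<..T} ==> sc k vxq t = 0" "t ~: {0<..T} ==> sc k sq t = 0"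
 "t ~: {0<..T} ==> cc k vq t = 0" "t ~: {0<..T} ==> sc k fq t = 0"
 by (intro sc_zero; rule outside_t; assumption)+

lemma mode_u: "AEL t. t \<in> {0<..<T} --> sc k uq t = sinc k uI + prim (sc k vxq) t"
 by (rule time_derivative_AE[OF T integrable_sc(1)[OF integrable_u] integrable_sc(1)[OF integrable_vx] sc_outside(1) sc_outside(2) modes_tested(2)])

lemma mode_v: "AEL t. t \<in> {0<..<T} --> cc k vq t = cosc k vI + prim (%s. real k * pi * sc k sq s) t"
proof (rule time_derivative_AE[OF T integrable_sc(2)[OF integrable_v] _ sc_outside(4) _ modes_tested(3)])
 show "L1 (%s. real k * pi * sc k sq s)" by (intro i_mr integrable_sc integrable_s)
 show "t ~: {0<..T} ==> real k * pi * sc k sq t = 0" for t using sc_outside(3) by simp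
qed

text \<open>The tested identity contains no derivative of the test function and no initial term.
  Read as an instance of \<open>time_derivative_AE\<close> with f = 0 and f0 = 0, it says that a
  primitive vanishes almost everywhere.\<close>

lemma mode_vx: "AEL t. sc k vxq t = - (real k * pi) * cc k vq t"
proof -
 define h where "h = (%t. real k * pi * cc k vq t + sc k vxq t)"
 have h: "L1 h" unfolding h_def
  by (intro i_add i_mr integrable_sc integrable_v integrable_vx)
 have hz: "t ~: {0<..T} ==> h t = 0" for t using sc_outside[of t] by (simp add: h_def)
 have "AEL t. t \<in> {0<..<T} --> (%t. 0) t = 0 + prim h t"
 proof (rule time_derivative_AE[OF T _ h _ hz])
  fix et et' :: "real => real" and J assume "smooth et" "!!t. (et has_real_derivative et' t) (at t)" "compact J" "J \<subseteq> {..<T}" "!!t. t ~: J ==> et t = 0"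
  from modes_tested(1)[OF this, of k]
  show "(LBINT t. 0 * et' t) + (LBINT t. h t * et t) + 0 * et 0 = 0" by (simp add: h_def)
 qed simp_all
 hence ae: "AEL t. t \<in> {0<..<T} --> prim h t = 0" by eventually_elim simp
 have "AEL t. h t = 0" by (rule AE_zero_if_prim_AE_zero[OF h _ ae T]) (rule hz)
 thus ?thesis by eventually_elim (simp add: h_def)
qed

text \<open>The counterpart of \<open>mode_vx\<close> at t = 0. It turns the cosine coefficient of
  the initial velocity, which the momentum equation provides, into the sine coefficient of the
  initial \<open>vx\<close> inside the initial stress.\<close>

lemma mode_v0: "sinc k vxI = - (real k * pi) * cosc k vI"
proof -
 obtain a a' :: "nat => real => real" and Bd where a: "!!n. smooth (a n)" "!!n x. (a n has_real_derivative a' n x) (at x)"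
  "!!n x. x ~: {1 / real (n + 1)..1 - 1 / real (n + 1)} ==> a n x = 0"
  "!!n x. abs(a n x) <= Bd" "!!n x. abs(a' n x) <= Bd"
  "!!x. 0 < x ==> x < 1 ==> (%n. a n x) ----> sin (real k * pi * x)"
  "!!x. 0 < x ==> x < 1 ==> (%n. a' n x) ----> real k * pi * cos (real k * pi * x)"
  by (rule sin_cutoff[of k]) blast
 have ac: "a n \<in> BL" "a' n \<in> BL" for n
  using bm_cont[OF smooth_continuous[OF a(1)]] bm_cont[OF smooth_deriv_continuous[OF a(1,2)]] by auto
 have E: "(LBINT x. vI x * a' n x) = - (LBINT x. vxI x * a n x)" for n
 proof -
  have "test_fun {0<..<1} (a n)"
  proof (rule test_fun_real[OF a(1) _ _ a(3)])
   have "1 / real (n + 1) > 0" by simp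
   thus "{1 / real (n + 1)..1 - 1 / real (n + 1)} \<subseteq> {0<..<1}" by (intro subsetI) (simp only: atLeastAtMost_iff greaterThanLessThan_iff, linarith)
  qed simp
  hence "(LINT x:{0<..<1}|lborel. v0 x * pd 1 (a n) x) = - (LINT x:{0<..<1}|lborel. v0x x * a n x)"
   using v0_weak unfolding weak_pd_def by blast
  moreover have "pd 1 (a n) x = a' n x" for x by (rule pd_1_real[OF a(2)])
  ultimately show ?thesis unfolding set_integral_real vI_def vxI_def by (simp add: mult.assoc)
 qed
 have cm: "(%x. real k * pi * cos (real k * pi * x)) \<in> BL" "(%x. sin (real k * pi * x)) \<in> BL"
  by measurable
 have pos: "0 < x" "x < 1" if "vI x ~= 0 \<or> vxI x ~= 0" for x
  using outside_I(2,3)[of x] that by (cases "x \<in> {0<..<1}"; auto)+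
 have "(%n. LBINT x. vI x * a' n x) ----> (LBINT x. vI x * (real k * pi * cos (real k * pi * x)))"
  by (rule dct_factor[OF integrable_vI ac(2) cm(1) a(5) a(7)]) (rule pos, simp)+
 moreover have "(%n. - (LBINT x. vxI x * a n x)) ----> - (LBINT x. vxI x * sin (real k * pi * x))"
  by (rule tendsto_minus, rule dct_factor[OF integrable_vxI ac(1) cm(2) a(4) a(6)]) (rule pos, simp)+
 ultimately have "(LBINT x. vI x * (real k * pi * cos (real k * pi * x))) = - (LBINT x. vxI x * sin (real k * pi * x))"
  unfolding E by (rule LIMSEQ_unique)
 moreover have "(LBINT x. vI x * (real k * pi * cos (real k * pi * x))) = real k * pi * cosc k vI"
  unfolding cosc_def by (subst integral_mult_right_zero[symmetric]) (simp add: mult_ac)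
 ultimately show ?thesis by (simp add: sinc_def)
qed

end

section \<open>Primitives of slices, comparison and Duhamel's formula\<close>

lemma prim_measurable2:
 fixes F :: "real * real => real"
 assumes "F \<in> BM"
 shows "(%z. prim (%s. F (fst z, s)) (snd z)) \<in> BM"
  "(%z. prim (%y. F (y, snd z)) (fst z)) \<in> BM"
proof -
 have F: "F \<in> BM2" using assms unfolding borel_prod .
 have eq: "borel_measurable ((borel \<Otimes>\<^sub>M borel) \<Otimes>\<^sub>M lborel) = (borel_measurable ((borel \<Otimes>\<^sub>M borel) \<Otimes>\<^sub>M borel) :: ((real * real) * real => real) set)"
  by (intro measurable_cong_sets sets_pair_measure_cong) simp_all
 have [measurable]: "(%p. F (fst (fst p), snd p)) \<in> borel_measurable ((borel \<Otimes>\<^sub>M borel) \<Otimes>\<^sub>M (borel :: real measure))"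
  "(%p. F (snd p, snd (fst p))) \<in> borel_measurable ((borel \<Otimes>\<^sub>M borel) \<Otimes>\<^sub>M (borel :: real measure))"
  by (rule measurable_compose[OF _ F]; measurable)+
 have "(%p. of_bool (snd p <= snd (fst p)) * F (fst (fst p), snd p)) \<in> borel_measurable ((borel \<Otimes>\<^sub>M borel) \<Otimes>\<^sub>M (borel :: real measure))"
  "(%p. of_bool (snd p <= fst (fst p)) * F (snd p, snd (fst p))) \<in> borel_measurable ((borel \<Otimes>\<^sub>M borel) \<Otimes>\<^sub>M (borel :: real measure))"
  by measurable
 hence "(%z. LBINT s. of_bool (s <= snd z) * F (fst z, s)) \<in> BM2"
  "(%z. LBINT s. of_bool (s <= fst z) * F (s, snd z)) \<in> BM2"
  by (intro lborel.borel_measurable_lebesgue_integral; simp add: case_prod_beta' eq)+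
 thus "(%z. prim (%s. F (fst z, s)) (snd z)) \<in> BM"
  "(%z. prim (%y. F (y, snd z)) (fst z)) \<in> BM"
  unfolding prim_def borel_prod by (simp_all add: ind_def)
qed

lemma sinc_prim_swap:
 assumes F: "L1 F"
 shows "sinc k (%x. prim (%s. F (x, s)) t) = prim (sc k F) t"
  and "L1 (%x. prim (%s. F (x, s)) t)"
proof -
 have "(%z::real * real. ind {..t} (snd z) :: real) \<in> BM2" by measurable
 hence [measurable]: "(%z::real * real. ind {..t} (snd z) :: real) \<in> BM" unfolding borel_prod .
 have i: "L1 (%z. F z * (sin (real k * pi * fst z) * ind {..t} (snd z)))"
 proof (rule imb(1)[OF F, where C=1])
  show "(%z::real * real. sin (real k * pi * fst z) * ind {..t} (snd z)) \<in> BL" by measurable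
 qed (auto simp: ind_def)
 have i2: "L1 (%z. F z * ind {..t} (snd z))"
 proof (rule imb(1)[OF F, where C=1])
  show "(%z::real * real. ind {..t} (snd z) :: real) \<in> BL" by measurable
 qed (auto simp: ind_def)
 have e: "(LBINT s. F (x, s) * (sin (real k * pi * x) * ind {..t} s)) = prim (%s. F (x, s)) t * sin (real k * pi * x)" for x
  unfolding prim_def by (subst integral_mult_left_zero[symmetric]) (simp add: mult_ac)
 have "sinc k (%x. prim (%s. F (x, s)) t) = (\<integral>x. \<integral>s. F (x, s) * (sin (real k * pi * x) * ind {..t} s) \<partial>lborel \<partial>lborel)"
  unfolding sinc_def e ..
 also have "... = (LBINT z. F z * (sin (real k * pi * fst z) * ind {..t} (snd z)))"
  using lp_fst(3)[OF i] by simp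
 also have "... = (LBINT s. sc k F s * ind {..t} s)" by (rule sc_fubini(1)[OF F, where C=1]) (auto simp: ind_def)
 also have "... = prim (sc k F) t" by (simp add: prim_def mult.commute)
 finally show "sinc k (%x. prim (%s. F (x, s)) t) = prim (sc k F) t" .
 show "L1 (%x. prim (%s. F (x, s)) t)"
  using lp_fst(2)[OF i2] by (simp add: prim_def mult.commute)
qed

lemma prim_add: "L1 f ==> L1 g ==> prim (%s. f s + g s) t = prim f t + prim g t"
 unfolding prim_def distrib_left by (intro int_add i_im) auto

lemma prim_cmult: "prim (%s. c * f s) t = c * prim f t"
 unfolding prim_def by (subst integral_mult_right_zero[symmetric]) (simp add: mult.left_commute)

lemma sinc_add: "L1 f ==> L1 g ==> sinc k (%x. f x + g x) = sinc k f + sinc k g"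
 unfolding sinc_def distrib_right by (intro int_add i_trig)

lemma sinc_diff: "L1 f ==> L1 g ==> sinc k (%x. f x - g x) = sinc k f - sinc k g"
 unfolding sinc_def left_diff_distrib by (intro int_diff i_trig)

lemma sinc_0: "sinc 0 f = 0" by (simp add: sinc_def)

text \<open>Integration by parts, obtained from \<open>ac_chain_rule\<close>. The boundary term at x
  = 1 survives because the cosine does not vanish there; it carries the total integral
  \<open>cosc 0 g\<close>.\<close>

lemma sinc_prim:
 assumes g: "L1 g" and z: "!!x. x ~: {0<..<1} ==> g x = 0"
 shows "real k * pi * sinc k (%x. ind {0<..<1} x * prim g x) = cosc k g - cos (real k * pi) * cosc 0 g"
  and "L1 (%x. ind {0<..<1} x * prim g x)"
proof -
 define w where "w = real k * pi"
 have [measurable]: "prim g \<in> BM" by (rule prim_measurable[OF g])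
 show ip: "L1 (%x. ind {0<..<1} x * prim g x)"
  by (rule imb(1)[OF i01]) (use prim_bound[OF g] in auto)
 have d: "((%z::real * real. snd z * cos (w * fst z)) has_derivative (%d. (- (w * snd z * sin (w * fst z))) * fst d + cos (w * fst z) * snd d)) (at z)" for z
  by (auto intro!: deqs simp: alg)
 have "prim g 1 * cos (w * 1) - prim g 0 * cos (w * 0) = (LBINT s. ind {0<..1} s * (- (w * prim g s * sin (w * s)) + cos (w * s) * g s))"
  using ac_chain_rule(1)[of "%z. snd z * cos (w * fst z)" "%z. - (w * snd z * sin (w * fst z))" "%z. cos (w * fst z)", OF d _ _ g zero_le_one refl, of 0]
  by (simp add: cints)
 moreover have "prim g 0 = 0" by (rule prim_eq_0[of 0]) (use z in auto)
 moreover have "prim g 1 = cosc 0 g"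
 proof -
  have "(%s. ind {..1} s * g s) = g" using z by (intro ext) (auto simp: ind_def)
  thus ?thesis by (simp add: prim_def cosc_def)
 qed
 moreover have "(%s. ind {0<..1} s * (- (w * prim g s * sin (w * s)) + cos (w * s) * g s)) = (%s. g s * cos (w * s) - w * ((ind {0<..<1} s * prim g s) * sin (w * s)))"
 proof (rule ext)
  fix s :: real
  have "sin w = 0" by (simp add: w_def)
  thus "ind {0<..1} s * (- (w * prim g s * sin (w * s)) + cos (w * s) * g s) = g s * cos (w * s) - w * ((ind {0<..<1} s * prim g s) * sin (w * s))"
   using z[of s] by (cases "s \<in> {0<..<1}"; cases "s = 1") (auto simp: ind_def)
 qed
 moreover have "(LBINT s. g s * cos (w * s) - w * ((ind {0<..<1} s * prim g s) * sin (w * s))) = cosc k g - w * sinc k (%x. ind {0<..<1} x * prim g x)"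
  unfolding sinc_def cosc_def w_def
  by (subst int_diff[OF i_trig(2)[OF g] i_mr[OF i_trig(1)[OF ip]]]) (simp only: integral_mult_right_zero)
 ultimately show "real k * pi * sinc k (%x. ind {0<..<1} x * prim g x) = cosc k g - cos (real k * pi) * cosc 0 g"
  by (simp add: w_def alg)
qed

text \<open>If the bound failed at \<open>t1\<close>, let \<open>t0\<close> be the last earlier time
  at which \<open>c - prim h t <= W\<close>. After \<open>t0\<close> the sign condition makes
  \<open>prim h\<close> nondecreasing, so \<open>c - prim h\<close> could not have risen above W.
  Only continuity of \<open>prim h\<close> is used, none of h.\<close>

lemma ode_comparison:
 assumes h: "L1 h" and hz: "!!s. s <= 0 ==> h s = 0"
  and sg: "AEL s. s \<in> {0<..<T} --> c - prim h s > W --> h s >= 0" and c: "c <= W"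
  and t1: "0 <= t1" "t1 <= T"
 shows "c - prim h t1 <= (W :: real)"
proof (rule ccontr)
 assume "~ c - prim h t1 <= W"
 hence gt: "c - prim h t1 > W" by simp
 define S where "S = {0..t1} \<inter> {t. c - prim h t <= W}"
 have cS: "closed S" unfolding S_def
  by (intro closed_Int closed_atLeastAtMost closed_Collect_le cints continuous_prim h)
 have "prim h 0 = 0" by (rule prim_eq_0[of 0]) (use hz in auto)
 hence 0: "0 \<in> S" using c t1 by (simp add: S_def)
 have bd: "bdd_above S" by (rule bdd_aboveI[of _ t1]) (simp add: S_def)
 define t0 where "t0 = Sup S"
 have t0: "t0 \<in> S" unfolding t0_def by (rule closed_contains_Sup) (use 0 bd cS in auto)
 have up: "c - prim h s > W" if "s \<in> {t0<..t1}" for s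
 proof (rule ccontr)
  assume "~ W < c - prim h s"
  hence "s \<in> S" using that t0 by (auto simp: S_def)
  from cSup_upper[OF this bd] that show False by (simp add: t0_def)
 qed
 have "t0 <= t1" using t0 by (simp add: S_def)
 have "0 <= (LBINT s. ind {t0<..t1} s * h s)"
 proof (rule integral_nonneg_AE)
  have "AEL s. s ~= t1" by (rule AE_sing)
  with sg show "AEL s. 0 <= ind {t0<..t1} s * h s"
  proof eventually_elim
   case (elim s)
   show ?case
   proof (cases "s \<in> {t0<..t1}")
   case True
   hence "s \<in> {0<..<T}" using t0 t1 elim(2) by (auto simp: S_def)
   thus ?thesis using elim(1) up[OF True] True by simp
   qed simp
  qed
 qed
 hence "prim h t0 <= prim h t1" using prim_diff[OF h \<open>t0 <= t1\<close>] by simp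
 moreover have "c - prim h t0 <= W" using t0 by (simp add: S_def)
 ultimately show False using gt by linarith
qed

text \<open>The Duhamel integral of the forcing \<open>ga\<close> for the k-th mode. The exponential
  in t is pulled out so that t otherwise occurs only as a limit of integration, which makes
  continuity evident; \<open>duh_eq\<close> restores the convolution.\<close>

definition duh :: "nat => (real => real) => real => real" where
 "duh k ga t = exp (- eig k * t) * (LBINT s. ind {0<..t} s * (exp (eig k * s) * ga s))"

lemma integrable_exp_mult:
 fixes t c :: real
 assumes ga: "L1 ga"
 shows "L1 (%s. ind {0<..t} s * (exp (c * s) * ga s))"
proof -
 have b: "abs(ind {0<..t} s * exp (c * s)) <= exp (abs(c) * abs(t))" for s
 proof (cases "s \<in> {0<..t}")
  case True
  have "c * s <= abs(c * s)" by (rule abs_ge_self)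
  also have "abs(c * s) = abs(c) * abs(s)" by (rule abs_mult)
  also have "... <= abs(c) * abs(t)" by (rule mlm) (use True in auto)
  finally have "exp (c * s) <= exp (abs(c) * abs(t))" by (simp only: exp_le_cancel_iff)
  thus ?thesis using True by (simp only: indicator_simps mult_1_left abs_exp_cancel)
 qed simp
 have m: "(%s. ind {0<..t} s * exp (c * s)) \<in> BL" by measurable
 have "L1 (%s. ga s * (ind {0<..t} s * exp (c * s)))"
  by (rule imb(1)[OF ga m]) (rule AE_I2, rule b)
 thus ?thesis by (simp only: mult_ac)
qed

lemma duh_eq: "duh k ga t = (LBINT s. ind {0<..t} s * (exp (- eig k * (t - s)) * ga s))"
 unfolding duh_def by (subst integral_mult_right_zero[symmetric]) (simp add: right_diff_distrib exp_diff exp_minus field_simps flip: exp_add)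

text \<open>The equation is only an integral equation valid almost everywhere. The chain rule along
  its right side, multiplied by the integrating factor, gives an exact identity in which the terms
  with s cancel under the integral.\<close>

lemma duh_solves:
 assumes s: "L1 s" and ga: "L1 ga"
  and z: "!!t. t ~: {0<..T} ==> s t = 0" "!!t. t ~: {0<..T} ==> ga t = 0"
  and eq: "AEL t. t \<in> {0<..<T} --> s t = c + prim (%r. ga r - eig k * s r) t"
 shows "AEL t. t \<in> {0<..<T} --> s t = exp (- eig k * t) * c + duh k ga t"
proof -
 define l where "l = eig k"
 define h where "h = (%r. ga r - l * s r)"
 have h: "L1 h" unfolding h_def using s ga by simp
 have p0: "prim h 0 = 0" by (rule prim_eq_0[of 0]) (use z in "auto simp: h_def")
 have d: "((%z::real * real. exp (l * fst z) * snd z) has_derivative (%d. (l * exp (l * fst z) * snd z) * fst d + exp (l * fst z) * snd d)) (at z)" for z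
  by (auto intro!: deqs simp: alg)
 show ?thesis
  using eq
 proof eventually_elim
  case (elim t)
  show ?case
  proof
   assume t: "t \<in> {0<..<T}"
   have "exp (l * t) * (c + prim h t) - exp (l * 0) * (c + prim h 0) = (LBINT r. ind {0<..t} r * (l * exp (l * r) * (c + prim h r) + exp (l * r) * h r))"
   using ac_chain_rule(1)[of "%z. exp (l * fst z) * snd z" "%z. l * exp (l * fst z) * snd z" "%z. exp (l * fst z)", OF d _ _ h _ refl, of 0 t c] t
   by (simp add: cints)
   also have "... = (LBINT r. ind {0<..t} r * (exp (l * r) * ga r))"
   proof (rule integral_cong_AE)
   show "AEL r. ind {0<..t} r * (l * exp (l * r) * (c + prim h r) + exp (l * r) * h r) = ind {0<..t} r * (exp (l * r) * ga r)"
   using eq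
   proof eventually_elim
   case (elim r)
   show ?case
   proof (cases "r \<in> {0<..t}")
   case True
   hence "s r = c + prim h r" using elim t by (simp add: h_def l_def)
   thus ?thesis using True by (simp add: h_def alg)
   qed simp
   qed
   have [measurable]: "prim h \<in> BM" "h \<in> BM" "ga \<in> BM"
   using prim_measurable[OF h] h ga by auto
   show "(%r. ind {0<..t} r * (l * exp (l * r) * (c + prim h r) + exp (l * r) * h r)) \<in> BL"
   "(%r. ind {0<..t} r * (exp (l * r) * ga r)) \<in> BL" by measurable
   qed
   finally have "exp (l * t) * (c + prim h t) = c + (LBINT r. ind {0<..t} r * (exp (l * r) * ga r))"
   using p0 by simp
   hence "exp (- l * t) * (exp (l * t) * (c + prim h t)) = exp (- l * t) * c + duh k ga t"
   by (simp add: duh_def l_def distrib_left)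
   moreover have "exp (- l * t) * (exp (l * t) * (c + prim h t)) = c + prim h t" by (simp flip: mult.assoc exp_add)
   ultimately show "s t = exp (- eig k * t) * c + duh k ga t" using elim t by (simp add: h_def l_def)
  qed
 qed
qed

lemma integral_exp_le:
 fixes l t :: real
 assumes "l > 0" "t >= 0"
 shows "(LBINT s. ind {0<..t} s * exp (- l * (t - s))) <= 1 / l"
  and "L1 (%s. ind {0<..t} s * exp (- l * (t - s)))"
proof -
 have "has_bochner_integral lborel (%s. exp (- l * (t - s)) * ind {0..t} s) (exp (- l * (t - t)) / l - exp (- l * (t - 0)) / l)"
  by (rule has_bochner_integral_FTC_Icc_real[where F="%s. exp (- l * (t - s)) / l"])
   (use assms in "auto intro!: deqs cints")
 hence i: "L1 (%s. exp (- l * (t - s)) * ind {0..t} s)"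
  and e: "(LBINT s. exp (- l * (t - s)) * ind {0..t} s) = 1 / l - exp (- l * t) / l"
  by (auto simp: has_bochner_integral_iff)
 have ae: "AEL s. ind {0<..t} s * exp (- l * (t - s)) = exp (- l * (t - s)) * ind {0..t} s"
  using AE_sing[of "0::real"] by eventually_elim (auto simp: ind_def)
 show "L1 (%s. ind {0<..t} s * exp (- l * (t - s)))"
  by (rule integrable_cong_AE_imp[OF i]) (use ae in "auto elim: eventually_mono")
 have "(LBINT s. ind {0<..t} s * exp (- l * (t - s))) = 1 / l - exp (- l * t) / l"
  unfolding e[symmetric] by (rule integral_cong_AE) (use ae in auto)
 also have "... <= 1 / l" using assms by simp
 finally show "(LBINT s. ind {0<..t} s * exp (- l * (t - s))) <= 1 / l" .
qed

text \<open>From 2 a b <= a^2 + b^2 under the integral. The separation is chosen for the sum over k: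
  the first part sums like 1 / \<open>eig k\<close>, the second by Bessel's inequality.\<close>

lemma duh_bound_L2:
 assumes ga: "L1 ga" and ga2: "L1 (%s. (ga s)^2)" and t: "t >= 0" and l: "eig k > 0"
 shows "2 * abs(duh k ga t) <= 1 / (2 * eig k) + (LBINT s. (ga s)^2)"
proof -
 have i: "L1 (%s. ind {0<..t} s * (exp (- eig k * (t - s)) * ga s))"
 proof -
  have "(%s. ind {0<..t} s * (exp (- eig k * (t - s)) * ga s)) = (%s. exp (- eig k * t) * (ind {0<..t} s * (exp (eig k * s) * ga s)))"
   by (rule ext) (simp add: right_diff_distrib exp_diff exp_minus field_simps flip: exp_add)
  thus ?thesis using integrable_exp_mult[OF ga] by simp
 qed
 have l2: "2 * eig k > 0" using l by simp
 note e2 = integral_exp_le[OF l2 t]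
 have "2 * abs(duh k ga t) <= 2 * (LBINT s. abs(ind {0<..t} s * (exp (- eig k * (t - s)) * ga s)))"
  unfolding duh_eq using iab[of lborel "%s. ind {0<..t} s * (exp (- eig k * (t - s)) * ga s)"] by linarith
 also have "... = (LBINT s. 2 * abs(ind {0<..t} s * (exp (- eig k * (t - s)) * ga s)))" by simp
 also have "... <= (LBINT s. ind {0<..t} s * exp (- (2 * eig k) * (t - s)) + (ga s)^2)"
 proof (rule integral_mono)
  show "L1 (%s. 2 * abs(ind {0<..t} s * (exp (- eig k * (t - s)) * ga s)))" using i by simp
  show "L1 (%s. ind {0<..t} s * exp (- (2 * eig k) * (t - s)) + (ga s)^2)" using e2(2) ga2 by simp
  fix s
  define a where "a = exp (- eig k * (t - s))"
  have a2: "exp (- (2 * eig k) * (t - s)) = a^2" by (simp add: a_def power2_eq_square flip: exp_add) 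
  have "0 <= (a - abs(ga s))^2" by simp
  hence "2 * (a * abs(ga s)) <= a^2 + (ga s)^2" by (simp add: power2_eq_square alg)
  moreover have "a >= 0" by (simp add: a_def)
  ultimately show "2 * abs(ind {0<..t} s * (exp (- eig k * (t - s)) * ga s)) <= ind {0<..t} s * exp (- (2 * eig k) * (t - s)) + (ga s)^2"
   unfolding a2 a_def[symmetric] by (cases "s \<in> {0<..t}") (simp_all add: abs_mult)
 qed
 also have "... = (LBINT s. ind {0<..t} s * exp (- (2 * eig k) * (t - s))) + (LBINT s. (ga s)^2)"
  by (rule int_add[OF e2(2) ga2])
 also have "... <= 1 / (2 * eig k) + (LBINT s. (ga s)^2)" using e2(1) by simp
 finally show ?thesis .
qed

lemma duh_bound:
 assumes ga: "L1 ga" and G: "AEL s. abs(ga s) <= G" and t: "t >= 0" and l: "eig k > 0"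
 shows "abs(duh k ga t) <= G / eig k"
proof -
 have "AE s in lborel :: real measure. 0 <= G" using G by eventually_elim auto
 moreover have "ae_filter (lborel :: real measure) ~= bot" by (simp add: ae_filter_eq_bot_iff)
 ultimately have G0: "G >= 0" by (simp add: eventually_const_iff)
 have i: "L1 (%s. ind {0<..t} s * (exp (- eig k * (t - s)) * ga s))"
 proof -
  have "(%s. ind {0<..t} s * (exp (- eig k * (t - s)) * ga s)) = (%s. exp (- eig k * t) * (ind {0<..t} s * (exp (eig k * s) * ga s)))"
   by (rule ext) (simp add: right_diff_distrib exp_diff exp_minus field_simps flip: exp_add)
  thus ?thesis using integrable_exp_mult[OF ga] by simp
 qed
 note e = integral_exp_le[OF l t]
 have "abs(duh k ga t) <= (LBINT s. abs(ind {0<..t} s * (exp (- eig k * (t - s)) * ga s)))"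
  unfolding duh_eq by (rule iab)
 also have "... <= (LBINT s. G * (ind {0<..t} s * exp (- eig k * (t - s))))"
 proof (rule integral_mono_AE)
  show "L1 (%s. abs(ind {0<..t} s * (exp (- eig k * (t - s)) * ga s)))" using i by simp
  show "L1 (%s. G * (ind {0<..t} s * exp (- eig k * (t - s))))" using e(2) by simp
  show "AEL s. abs(ind {0<..t} s * (exp (- eig k * (t - s)) * ga s)) <= G * (ind {0<..t} s * exp (- eig k * (t - s)))"
   using G
  proof eventually_elim
   case (elim s)
   have "exp (- eig k * (t - s)) * abs(ga s) <= exp (- eig k * (t - s)) * G" using elim by (intro mlm) auto
   thus ?case by (cases "s \<in> {0<..t}") (simp_all add: abs_mult mult.commute)
  qed
 qed
 also have "... = G * (LBINT s. ind {0<..t} s * exp (- eig k * (t - s)))" by simp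
 also have "... <= G * (1 / eig k)" using e(1) G0 by (intro mlm) auto
 finally show ?thesis by simp
qed

lemma eig_pos: "k ~= 0 ==> eig k > 0" by (simp add: eig_def)

lemma summable_inverse_eig: "summable (%k. 1 / eig k)"
proof -
 have "summable (%k. (1 / pi^2) * inverse (real k ^ 2))" by (intro summable_mult inverse_power_summable) auto
 thus ?thesis by (simp add: eig_def power_mult_distrib divide_inverse mult.commute)
qed

lemma continuous_duh:
 assumes ga: "L1 ga" and z: "!!t. t ~: {0<..T} ==> ga t = 0"
 shows "continuous_on {..T} (duh k ga)"
proof -
 define h where "h = (%s. ind {0<..T} s * (exp (eig k * s) * ga s))"
 have h: "L1 h" unfolding h_def by (rule integrable_exp_mult[OF ga])
 have e: "duh k ga t = exp (- eig k * t) * prim h t" if "t \<in> {..T}" for t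
 proof -
  have "(%s. ind {0<..t} s * (exp (eig k * s) * ga s)) = (%s. ind {..t} s * h s)"
   using that by (intro ext) (auto simp: h_def ind_def)
  thus ?thesis by (simp add: duh_def prim_def)
 qed
 have "continuous_on {..T} (%t. exp (- eig k * t) * prim h t)"
  by (intro cints continuous_on_subset[OF continuous_prim[OF h]]) auto
 thus ?thesis by (rule continuous_on_eq) (use e in simp)
qed

lemma duh_measurable:
 assumes ga: "ga \<in> BM"
 shows "duh k ga \<in> BM"
proof -
 have "(%p. of_bool (0 < snd p & snd p <= fst p) * (exp (eig k * snd p) * ga (snd p))) \<in> borel_measurable (borel \<Otimes>\<^sub>M (borel :: real measure))"
  using ga by measurable
 moreover have "borel_measurable (borel \<Otimes>\<^sub>M lborel) = (BM2 :: (real * real => real) set)"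
  by (intro measurable_cong_sets sets_pair_measure_cong) simp_all
 ultimately have "(%t. LBINT s. of_bool (0 < s & s <= t) * (exp (eig k * s) * ga s)) \<in> BM"
  by (intro lborel.borel_measurable_lebesgue_integral) (simp add: case_prod_beta')
 hence "(%t. exp (- eig k * t) * (LBINT s. of_bool (0 < s & s <= t) * (exp (eig k * s) * ga s))) \<in> BM"
  by measurable
 thus ?thesis unfolding duh_def[abs_def] by (simp add: ind_def)
qed

lemma AE_lborel_swap:
 assumes P: "{z. P (fst z) (snd z)} \<in> sets borel" and ae: "AEL x. AEL t. P (x::real) (t::real)"
 shows "AEL t. AEL x. P x t"
proof (rule iffD1[OF lborel_pair.AE_commute ae])
 show "{z \<in> space (lborel \<Otimes>\<^sub>M lborel). P (fst z) (snd z)} \<in> sets (lborel \<Otimes>\<^sub>M lborel)"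
  unfolding lborel_prod using P by simp
qed

section \<open>Uniform bound for the deformation\<close>

text \<open>The parameters are the constants shared by the whole family: E controls kinetic energy
  and dissipation, beyond \<open>m0\<close> the function \<open>sg\<close> has the sign of its
  argument, \<open>Cs\<close> and \<open>Cd\<close> bound \<open>sg\<close> and its derivative on
  [-R, R]. In R the quantity (1 + E) / 2 + K bounds the primitive of v; it is counted twice, for
  passing from u to u - P and for returning.\<close>

locale energy_sol = weak_sol +
 fixes E m0 R Cs Cd :: real
 assumes K0: "K >= 0" and E0: "E >= 0" and m0: "m0 >= 0"
  and v_energy: "AEL t. t \<in> {0<..<T} --> L1 (%x. (vq (x, t))^2) & (LBINT x. (vq (x, t))^2) <= E"
  and vx_energy: "(LBINT z. (vxq z)^2) <= E"
  and sg_pos: "!!r. r >= m0 ==> sg r >= 0" and sg_neg: "!!r. r <= - m0 ==> sg r <= 0"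
  and R: "R = K + 2 * ((1 + E) / 2 + K) + m0"
  and Cs: "!!r. abs(r) <= R ==> abs(sg r) <= Cs" and Cd: "!!r. abs(r) <= R ==> abs(deriv sg r) <= Cd"
begin

lemma sg_deriv: "(sg has_real_derivative deriv sg r) (at r)"
 using sgd[of r] by (simp add: DERIV_deriv_iff_real_differentiable)

lemma sg_cont: "continuous_on UNIV sg"
 using sg_deriv by (auto simp: continuous_on_eq_continuous_at intro: DERIV_isCont)

lemma sg_measurable[measurable]: "sg \<in> BM" "deriv sg \<in> BM"
 using bm_cont[OF sg_cont] bm_cont[OF sgc] by auto

lemma meas[measurable]: "uq \<in> BM" "vq \<in> BM" "vxq \<in> BM"
 "fq \<in> BM" "sq \<in> BM" "uI \<in> BM" "vI \<in> BM" "vxI \<in> BM"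
 using integrable_u integrable_v integrable_vx integrable_f integrable_s integrable_uI integrable_vI integrable_vxI by auto

text \<open>A representative of u that is an indefinite time integral on every line of constant x,
  so that the chain rule can be applied to it.\<close>

definition U :: "real * real => real" where "U z = uI (fst z) + prim (%s. vxq (fst z, s)) (snd z)"

lemma fst_snd_measurable[measurable]: "f \<in> BM ==> (%z::real * real. f (fst z)) \<in> BM"
 "f \<in> BM ==> (%z::real * real. f (snd z)) \<in> BM" for f :: "real => real"
proof -
 assume f: "f \<in> BM"
 hence "(%z::real * real. f (fst z)) \<in> BM2" by measurable
 thus "(%z::real * real. f (fst z)) \<in> BM" unfolding borel_prod .
 from f have "(%z::real * real. f (snd z)) \<in> BM2" by measurable
 thus "(%z::real * real. f (snd z)) \<in> BM" unfolding borel_prod .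
qed

lemma U_measurable[measurable]: "U \<in> BM"
 unfolding U_def[abs_def] using prim_measurable2(1)[OF meas(3)] by measurable

lemma time_set: "{z::real * real. snd z \<in> {0<..<T} --> P z} \<in> sets borel" if "{z. P z} \<in> sets borel"
proof -
 have "{z::real * real. snd z \<in> {0<..<T}} \<in> sets borel"
 proof -
  have "{z::real * real. snd z \<in> {0<..<T}} = UNIV \<times> {0<..<T}" by auto
  thus ?thesis by (simp add: borel_open open_Times)
 qed
 moreover have "{z::real * real. snd z \<in> {0<..<T} --> P z} = (- {z::real * real. snd z \<in> {0<..<T}}) \<union> {z. P z}" by auto
 ultimately show ?thesis using that by auto
qed

lemma eq_set: "f \<in> BM ==> g \<in> BM ==> {z. f z = g z} \<in> sets borel" for f g :: "real * real => real"
proof -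
 assume [measurable]: "f \<in> BM" "g \<in> BM"
 have "{z \<in> space borel. f z = g z} \<in> sets borel" by measurable
 thus ?thesis by simp
qed

text \<open>For almost every t the sine coefficients of both sides agree for all k simultaneously, a
  countable family of null sets being discarded; uniqueness in x finishes the slice.\<close>

lemma U_eq: "AEL z. snd z \<in> {0<..<T} --> uq z = U z"
proof (rule AE_lborel_pairI)
 show "{z. snd z \<in> {0<..<T} --> uq z = U z} \<in> sets borel" by (intro time_set eq_set meas U_measurable)
 have "AEL t. ALL k. t \<in> {0<..<T} --> sc k uq t = sinc k uI + prim (sc k vxq) t"
  unfolding AE_all_countable using mode_u by simp
 moreover have "AEL t. L1 (%x. uq (x, t))" by (rule lp_snd(1)[OF integrable_u])
 ultimately show "AEL t. AEL x. snd (x, t) \<in> {0<..<T} --> uq (x, t) = U (x, t)"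
 proof eventually_elim
  case (elim t)
  have "AEL x. uq (x, t) = U (x, t)" if t: "t \<in> {0<..<T}"
  proof -
   note p = sinc_prim_swap[OF integrable_vx]
   have "AEL x. uq (x, t) - (uI x + prim (%s. vxq (x, s)) t) = 0"
   proof (rule sin_uniqueness)
   show "L1 (%x. uq (x, t) - (uI x + prim (%s. vxq (x, s)) t))"
   by (intro i_diff i_add elim(2) integrable_uI p(2))
   show "uq (x, t) - (uI x + prim (%s. vxq (x, s)) t) = 0" if "x ~: {0<..<1}" for x
   using that by (simp add: outside_x outside_I prim_def)
   fix k
   have "sinc k (%x. uq (x, t) - (uI x + prim (%s. vxq (x, s)) t)) = sc k uq t - (sinc k uI + prim (sc k vxq) t)"
   unfolding sc_def[of k uq t] p(1)[symmetric]
   by (simp only: sinc_diff[OF elim(2) i_add[OF integrable_uI p(2)]] sinc_add[OF integrable_uI p(2)])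
   thus "sinc k (%x. uq (x, t) - (uI x + prim (%s. vxq (x, s)) t)) = 0" using elim(1) t by simp
   qed
   thus ?thesis by eventually_elim (simp add: U_def)
  qed
  thus ?case by simp
 qed
qed

text \<open>The first summand arises from |v| <= 1/2 + v^2 / 2. The summand K ensures K <=
  \<open>Pm\<close>, which later absorbs the primitive of the initial velocity.\<close>

definition Pm :: real where "Pm = (1 + E) / 2 + K"

lemma prim_vI_bound: "abs(prim vI x) <= K"
proof -
 have "abs(prim vI x) <= (LBINT s. abs(vI s))" by (rule prim_bound[OF integrable_vI])
 also have "(LBINT s. abs(vI s)) <= (LBINT s. K * ind {0<..<1::real} s)"
 proof (rule integral_mono_AE)
  show "L1 (%s. abs(vI s))" using integrable_vI by simp
  have "L1 (%s. K * (ind {0<..<1::real} s :: real))" by (intro i_mr i01)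
  thus "L1 (%s. K * ind {0<..<1::real} s)" .
  show "AEL s. abs(vI s) <= K * ind {0<..<1::real} s"
   using vI_bound
  proof eventually_elim
   case (elim s)
   thus ?case by (cases "s \<in> {0<..<1}") (simp_all add: outside_I)
  qed
 qed
 also have "(LBINT s. K * ind {0<..<1::real} s) = K" by simp
 finally show ?thesis .
qed

lemma P_bound: "AEL t. t \<in> {0<..<T} --> (ALL x. abs(prim (%y. vq (y, t)) x) <= Pm)"
proof -
 have "AEL t. L1 (%x. vq (x, t))" by (rule lp_snd(1)[OF integrable_v])
 with v_energy show ?thesis
 proof eventually_elim
  case (elim t)
  show ?case
  proof (intro impI allI)
   fix x assume t: "t \<in> {0<..<T}"
   hence e: "L1 (%x. (vq (x, t))^2)" "(LBINT x. (vq (x, t))^2) <= E" using elim by auto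
   have "abs(prim (%y. vq (y, t)) x) <= (LBINT y. abs(vq (y, t)))" by (rule prim_bound[OF elim(2)])
   also have "... <= (LBINT y. ind {0<..<1::real} y * (1 / 2) + (vq (y, t))^2 * (1 / 2))"
   proof (rule integral_mono)
   show "L1 (%y. ind {0<..<1::real} y * (1 / 2) + (vq (y, t))^2 * (1 / 2))"
   by (intro i_add i_ml i01 e(1))
   fix y
   have "0 <= (abs(vq (y, t)) - 1)^2" by simp
   hence "abs(vq (y, t)) <= 1 / 2 + (vq (y, t))^2 * (1 / 2)" by (simp add: power2_eq_square alg)
   thus "abs(vq (y, t)) <= ind {0<..<1::real} y * (1 / 2) + (vq (y, t))^2 * (1 / 2)"
   using outside_x(2)[of y t] by (cases "y \<in> {0<..<1}") auto
   qed (use elim(2) in simp)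
   also have "... = (LBINT y. ind {0<..<1::real} y * (1 / 2)) + (LBINT y. (vq (y, t))^2 * (1 / 2))"
   proof (rule int_add)
   have "L1 (%y. (ind {0<..<1::real} y :: real) * (1 / 2))" by (intro i_ml i01)
   thus "L1 (%y. ind {0<..<1::real} y * (1 / 2) :: real)" .
   qed (intro i_ml e(1))
   also have "... <= Pm" using e(2) K0 by (simp add: Pm_def field_simps)
   finally show "abs(prim (%y. vq (y, t)) x) <= Pm" .
  qed
 qed
qed

text \<open>The sine coefficients of both primitives follow from \<open>sinc_prim\<close>. Their
  boundary terms at x = 1 cancel because the mode k = 0 of v, the total momentum, is constant in
  time; the remaining cosine modes evolve by the sine modes of the stress.\<close>

lemma P_eq: "AEL z. snd z \<in> {0<..<T} --> fst z \<in> {0<..<1} -->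
  prim (%y. vq (y, snd z)) (fst z) = prim vI (fst z) + prim (%s. sq (fst z, s)) (snd z)"
proof -
 have [measurable]: "(%z. prim (%y. vq (y, snd z)) (fst z)) \<in> BM" "(%z. prim (%s. sq (fst z, s)) (snd z)) \<in> BM"
  "prim vI \<in> BM"
  using prim_measurable2[OF meas(2)] prim_measurable2[OF meas(5)] prim_measurable[OF integrable_vI] by auto
 have "AEL z. snd z \<in> {0<..<T} --> ind {0<..<1::real} (fst z) * prim (%y. vq (y, snd z)) (fst z) = ind {0<..<1::real} (fst z) * prim vI (fst z) + prim (%s. sq (fst z, s)) (snd z)"
 proof (rule AE_lborel_pairI)
  show "{z. snd z \<in> {0<..<T} --> ind {0<..<1::real} (fst z) * prim (%y. vq (y, snd z)) (fst z) = ind {0<..<1::real} (fst z) * prim vI (fst z) + prim (%s. sq (fst z, s)) (snd z)} \<in> sets borel"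
  proof (intro time_set eq_set)
   have [measurable]: "(%z::real * real. ind {0<..<1::real} (fst z) :: real) \<in> BM"
   by (rule fst_snd_measurable) measurable
   show "(%z. ind {0<..<1::real} (fst z) * prim (%y. vq (y, snd z)) (fst z)) \<in> BM"
   "(%z. ind {0<..<1::real} (fst z) * prim vI (fst z) + prim (%s. sq (fst z, s)) (snd z)) \<in> BM" by measurable
  qed
  have "AEL t. ALL k. t \<in> {0<..<T} --> cc k vq t = cosc k vI + prim (%s. real k * pi * sc k sq s) t"
   unfolding AE_all_countable using mode_v by simp
  moreover have "AEL t. L1 (%x. vq (x, t))" by (rule lp_snd(1)[OF integrable_v])
  ultimately show "AEL t. AEL x. snd (x, t) \<in> {0<..<T} --> ind {0<..<1::real} (fst (x, t)) * prim (%y. vq (y, snd (x, t))) (fst (x, t)) = ind {0<..<1::real} (fst (x, t)) * prim vI (fst (x, t)) + prim (%s. sq (fst (x, t), s)) (snd (x, t))"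
  proof eventually_elim
   case (elim t)
   have "AEL x. ind {0<..<1::real} x * prim (%y. vq (y, t)) x = ind {0<..<1::real} x * prim vI x + prim (%s. sq (x, s)) t" if t: "t \<in> {0<..<T}"
   proof -
   note p = sinc_prim_swap[OF integrable_s]
   have oa: "vq (x, t) = 0" if "x ~: {0<..<1}" for x using that by (rule outside_x(2))
   have ob: "vI x = 0" if "x ~: {0<..<1}" for x using that by (rule outside_I(2))
   note a1 = sinc_prim(1)[of "%x. vq (x, t)", OF elim(2) oa] and a2 = sinc_prim(2)[of "%x. vq (x, t)", OF elim(2) oa]
   note b1 = sinc_prim(1)[of vI, OF integrable_vI ob] and b2 = sinc_prim(2)[of vI, OF integrable_vI ob]
   have a: "real k * pi * sinc k (%x. ind {0<..<1::real} x * prim (%y. vq (y, t)) x) = cosc k (%x. vq (x, t)) - cos (real k * pi) * cosc 0 (%x. vq (x, t))"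
   "L1 (%x. ind {0<..<1::real} x * prim (%y. vq (y, t)) x)" for k
   by (rule a1 a2; assumption)+
   have b: "real k * pi * sinc k (%x. ind {0<..<1::real} x * prim vI x) = cosc k vI - cos (real k * pi) * cosc 0 vI"
   "L1 (%x. ind {0<..<1::real} x * prim vI x)" for k
   by (rule b1 b2; assumption)+
   have bp: "L1 (%x. ind {0<..<1::real} x * prim vI x + prim (%s. sq (x, s)) t)"
   by (rule i_add[OF b(2) p(2)])
   have "AEL x. ind {0<..<1::real} x * prim (%y. vq (y, t)) x - (ind {0<..<1::real} x * prim vI x + prim (%s. sq (x, s)) t) = 0"
   proof (rule sin_uniqueness)
   show "L1 (%x. ind {0<..<1::real} x * prim (%y. vq (y, t)) x - (ind {0<..<1::real} x * prim vI x + prim (%s. sq (x, s)) t))"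
   by (intro i_diff i_add a(2) b(2) p(2))
   show "ind {0<..<1::real} x * prim (%y. vq (y, t)) x - (ind {0<..<1::real} x * prim vI x + prim (%s. sq (x, s)) t) = 0" if "x ~: {0<..<1}" for x
   using that by (simp add: outside_x prim_def)
   fix k
   have S: "sinc k (%x. ind {0<..<1::real} x * prim (%y. vq (y, t)) x - (ind {0<..<1::real} x * prim vI x + prim (%s. sq (x, s)) t))
   = sinc k (%x. ind {0<..<1::real} x * prim (%y. vq (y, t)) x) - (sinc k (%x. ind {0<..<1::real} x * prim vI x) + prim (sc k sq) t)"
   unfolding sinc_diff[OF a(2) bp] sinc_add[OF b(2) p(2)] p(1) ..
   show "sinc k (%x. ind {0<..<1::real} x * prim (%y. vq (y, t)) x - (ind {0<..<1::real} x * prim vI x + prim (%s. sq (x, s)) t)) = 0"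
   proof (cases "k = 0")
   case True thus ?thesis by (simp add: sinc_0)
   next
   case False
   have c0: "cosc 0 (%x. vq (x, t)) = cosc 0 vI" using elim(1) t by (auto simp: cc_def prim_def dest: spec[of _ 0])
   have ck: "cosc k (%x. vq (x, t)) = cosc k vI + real k * pi * prim (sc k sq) t"
   using elim(1) t by (auto simp: cc_def prim_cmult)
   have "real k * pi * (sinc k (%x. ind {0<..<1::real} x * prim (%y. vq (y, t)) x) - (sinc k (%x. ind {0<..<1::real} x * prim vI x) + prim (sc k sq) t)) = 0"
   unfolding right_diff_distrib distrib_left a(1) b(1) c0 ck by simp
   thus ?thesis using False unfolding S by simp
   qed
   qed
   thus ?thesis by eventually_elim simp
   qed
   thus ?case by simp
  qed
 qed
 thus ?thesis by eventually_elim auto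
qed

lemma fq_eq: "z \<in> Q T ==> fq z = sg (uq z)" by (simp add: fq_def uq_def)

lemma AE_snd_neq: "AEL z. snd (z :: real * real) ~= T"
proof (rule AE_lborel_pairI)
 show "{z::real * real. snd z ~= T} \<in> sets borel"
 proof -
  have "open {z::real * real. snd z ~= T}" by (intro open_Collect_neq cints)
  thus ?thesis by simp
 qed
 have "AEL y. y ~= T" by (rule AE_sing)
 thus "AEL y. AEL x. snd (x :: real, y) ~= T" by eventually_elim simp
qed

lemma in_Q: "z \<in> Q T ==> snd z ~= T ==> fst z \<in> {0<..<1} & snd z \<in> {0<..<T}"
 by (auto simp: Q_def)

text \<open>A comparison argument for u - P, whose time derivative is - sg(u). As u stays within
  \<open>Pm\<close> of it, a large value of u - P forces u into the region where sg(u) has the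
  restoring sign; the lower bound is the same argument for the negative.\<close>

lemma u_bound_slice: "AEL x. x \<in> {0<..<1} --> (AEL t. t \<in> {0<..<T} --> abs(uq (x, t)) <= R)"
proof -
 have "AEL x. AEL t. snd (x, t) \<in> {0<..<T} --> uq (x, t) = U (x, t)"
  by (rule AE_pairD(1)[OF U_eq])
 moreover have "AEL x. AEL t. snd (x, t) \<in> {0<..<T} --> fst (x, t) \<in> {0<..<1} -->
  prim (%y. vq (y, snd (x, t))) (fst (x, t)) = prim vI (fst (x, t)) + prim (%s. sq (fst (x, t), s)) (snd (x, t))"
  by (rule AE_pairD(1)[OF P_eq])
 moreover note uI_bound lp_fst(1)[OF integrable_f] lp_fst(1)[OF integrable_vx]
 ultimately show ?thesis
 proof eventually_elim
  case (elim x)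
  note U = elim(1) and P = elim(2) and uK = elim(3) and f = elim(4) and vx = elim(5)
  show ?case
  proof
   assume x: "x \<in> {0<..<1}"
   \<comment> \<open>This is u - P expressed by the initial data and \<open>fq\<close> alone, hence
     defined and continuous for every t.\<close>
   define w where "w = (%t. (uI x - prim vI x) - prim (%s. fq (x, s)) t)"
   have rel: "AEL t. t \<in> {0<..<T} --> abs(uq (x, t) - w t) <= Pm & fq (x, t) = sg (uq (x, t))"
   using U P P_bound
   proof eventually_elim
   case (elim t)
   show ?case
   proof
   assume t: "t \<in> {0<..<T}"
   have "prim (%s. sq (x, s)) t = prim (%s. fq (x, s)) t + prim (%s. vxq (x, s)) t"
   unfolding sq_def by (rule prim_add[OF f vx])
   hence "uq (x, t) - w t = prim (%y. vq (y, t)) x"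
   using elim(1,2) t x by (simp add: U_def w_def)
   moreover have "(x, t) \<in> Q T" using x t by (auto simp: Q_def)
   ultimately show "abs(uq (x, t) - w t) <= Pm & fq (x, t) = sg (uq (x, t))"
   using elim(3) t fq_eq by auto
   qed
   qed
   \<comment> \<open>Beyond W the deformation exceeds \<open>m0\<close>, although it may differ from
     w by \<open>Pm\<close>. The initial value is below W too: it is at most 2 K in modulus, and K
     <= \<open>Pm\<close>.\<close>
   define W where "W = K + Pm + m0"
   have c: "abs(uI x - prim vI x) <= W"
   proof -
   have "abs(uI x - prim vI x) <= K + K" using abs_triangle_ineq4[of "uI x" "prim vI x"] uK prim_vI_bound[of x] by linarith
   moreover have "K <= Pm" using E0 by (simp add: Pm_def field_simps)
   ultimately show ?thesis using m0 unfolding W_def by linarith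
   qed
   have up: "w t <= W" if "0 <= t" "t <= T" for t
   unfolding w_def
   proof (rule ode_comparison[OF f _ _ _ that])
   show "fq (x, s) = 0" if "s <= 0" for s using that outside_t(4)[of s x] by simp
   show "AEL s. s \<in> {0<..<T} --> uI x - prim vI x - prim (%s. fq (x, s)) s > W --> fq (x, s) >= 0"
   using rel
   proof eventually_elim
   case (elim s)
   show ?case
   proof (intro impI)
   assume s: "s \<in> {0<..<T}" and gt: "uI x - prim vI x - prim (%s. fq (x, s)) s > W"
   have "w s > W" using gt by (simp add: w_def)
   hence "uq (x, s) >= m0" using elim s K0 m0 unfolding W_def by linarith
   thus "fq (x, s) >= 0" using elim s sg_pos by simp
   qed
   qed
   show "uI x - prim vI x <= W" using c by linarith
   qed
   have lo: "- w t <= W" if "0 <= t" "t <= T" for t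
   proof -
   have mf: "L1 (%s. - fq (x, s))" using f by simp
   have pm: "prim (%s. - fq (x, s)) t = - prim (%s. fq (x, s)) t" for t
   using prim_cmult[of "-1" "%s. fq (x, s)" t] by simp
   have "(- (uI x - prim vI x)) - prim (%s. - fq (x, s)) t <= W"
   proof (rule ode_comparison[OF mf _ _ _ that])
   show "- fq (x, s) = 0" if "s <= 0" for s using that outside_t(4)[of s x] by simp
   show "AEL s. s \<in> {0<..<T} --> - (uI x - prim vI x) - prim (%s. - fq (x, s)) s > W --> - fq (x, s) >= 0"
   using rel
   proof eventually_elim
   case (elim s)
   show ?case
   proof (intro impI)
   assume s: "s \<in> {0<..<T}" and gt: "- (uI x - prim vI x) - prim (%s. - fq (x, s)) s > W"
   have "- w s > W" using gt unfolding pm w_def by linarith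
   hence "uq (x, s) <= - m0" using elim s K0 m0 unfolding W_def by linarith
   thus "- fq (x, s) >= 0" using elim s sg_neg by simp
   qed
   qed
   show "- (uI x - prim vI x) <= W" using c by linarith
   qed
   thus ?thesis unfolding pm w_def by linarith
   qed
   show "AEL t. t \<in> {0<..<T} --> abs(uq (x, t)) <= R"
   using rel
   proof eventually_elim
   case (elim t)
   show ?case
   proof
   assume t: "t \<in> {0<..<T}"
   hence "w t <= W" "- w t <= W" using up[of t] lo[of t] by auto
   moreover have "R = W + Pm" by (simp add: R W_def Pm_def)
   ultimately show "abs(uq (x, t)) <= R" using elim t by linarith
   qed
   qed
  qed
 qed
qed

lemma R0: "R >= 0" using K0 E0 m0 by (simp add: R)

lemma u_bound: "AEL z. abs(uq z) <= R"
proof (rule AE_lborel_pairI)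
 show "{z. abs(uq z) <= R} \<in> sets borel"
 proof -
  have "{z \<in> space borel. abs(uq z) <= R} \<in> sets borel" by measurable
  thus ?thesis by simp
 qed
 hence m: "{z. snd z \<in> {0<..<T} --> abs(uq z) <= R} \<in> sets borel" by (rule time_set)
 have "AEL x. AEL t. t \<in> {0<..<T} --> abs(uq (x, t)) <= R"
  using u_bound_slice
 proof eventually_elim
  case (elim x)
  show ?case
  proof (cases "x \<in> {0<..<1}")
   case False thus ?thesis using R0 by (simp add: outside_x)
  qed (use elim in simp)
 qed
 moreover have "{z. snd z \<in> {0<..<T} --> abs(uq (fst z, snd z)) <= R} \<in> sets borel"
  using m unfolding prod.collapse .
 ultimately have "AEL t. AEL x. t \<in> {0<..<T} --> abs(uq (x, t)) <= R"
  by (intro AE_lborel_swap[where P="%x t. t \<in> {0<..<T} --> abs(uq (x, t)) <= R"])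
 moreover have "AEL t. t ~= T" by (rule AE_sing)
 ultimately show "AEL t. AEL x. abs(uq (x, t)) <= R"
 proof eventually_elim
  case (elim t)
  from elim(1) show ?case
  proof eventually_elim
   case (elim x)
   show ?case
   proof (cases "t \<in> {0<..T}")
   case True
   hence "t \<in> {0<..<T}" using \<open>t ~= T\<close> by auto
   thus ?thesis using elim by simp
   qed (use R0 in "simp add: outside_t")
  qed
 qed
qed

text \<open>Formally the time derivative of sg(u), since u_t = v_x; it is the forcing in the heat
  equation for the stress.\<close>

definition gq :: "real * real => real" where "gq z = deriv sg (uq z) * vxq z"
definition fI :: "real => real" where "fI x = ind {0<..<1::real} x * sg (u0 x)"
definition sI :: "real => real" where "sI x = fI x + vxI x"

lemma gq_measurable[measurable]: "gq \<in> BM" unfolding gq_def[abs_def] by measurable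

lemma gq_outside: "z ~: Q T ==> gq z = 0" "t ~: {0<..T} ==> gq (x, t) = 0" "x ~: {0<..<1} ==> gq (x, t) = 0"
 by (simp_all add: gq_def outside outside_x outside_t)

lemma integrable_g: "L1 gq"
 unfolding gq_def[abs_def]
proof (rule imb(2)[OF integrable_vx])
 show "(%z. deriv sg (uq z)) \<in> BL" by measurable
 show "AEL z. abs(deriv sg (uq z)) <= Cd" using u_bound by eventually_elim (rule Cd)
qed

lemma g_L2: "L1 (%z. (gq z)^2)" "(LBINT z. (gq z)^2) <= Cd^2 * E"
proof -
 have b: "AEL z. (gq z)^2 <= Cd^2 * (vxq z)^2"
  using u_bound
 proof eventually_elim
  case (elim z)
  have "(deriv sg (uq z))^2 <= Cd^2" using Cd[OF elim] by (simp add: abs_le_square_iff[symmetric])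
  thus ?case unfolding gq_def power_mult_distrib by (rule mult_right_mono) simp
 qed
 have i: "L1 (%z. Cd^2 * (vxq z)^2)" using vx_L2(2) by simp
 show "L1 (%z. (gq z)^2)"
  by (rule i_bound[OF i]) (use b in auto)
 hence "(LBINT z. (gq z)^2) <= (LBINT z. Cd^2 * (vxq z)^2)" by (rule integral_mono_AE[OF _ i b])
 also have "... <= Cd^2 * E" using vx_energy by (simp add: mlm)
 finally show "(LBINT z. (gq z)^2) <= Cd^2 * E" .
qed

lemma fI_eq: "x \<in> {0<..<1} ==> fI x = sg (uI x)" by (simp add: fI_def uI_def)

lemma KR: "K <= R" using K0 E0 m0 by (simp add: R)

lemma fI_props: "fI \<in> BM" "AEL x. abs(fI x) <= Cs" "L1 fI"
proof -
 have e: "fI = (%x. ind {0<..<1::real} x * sg (uI x))" by (rule ext) (simp add: fI_def uI_def ind_def)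
 show m: "fI \<in> BM" unfolding e by measurable
 show b: "AEL x. abs(fI x) <= Cs"
  using uI_bound
 proof eventually_elim
  case (elim x)
  have "abs(sg (uI x)) <= Cs" by (rule Cs) (use elim KR in linarith)
  thus ?case by (cases "x \<in> {0<..<1}") (simp_all add: e)
 qed
 have "L1 (%x. ind {0<..<1::real} x * fI x)"
  by (rule imb(1)[OF i01 _ b]) (use m in simp)
 also have "(%x. ind {0<..<1::real} x * fI x) = fI" by (rule ext) (simp add: fI_def ind_def)
 finally show "L1 fI" .
qed

lemma sI_props: "L1 sI" "AEL x. abs(sI x) <= Cs + K" "x ~: {0<..<1} ==> sI x = 0"
proof -
 show "L1 sI" unfolding sI_def[abs_def] by (intro i_add fI_props integrable_vxI)
 show "AEL x. abs(sI x) <= Cs + K" using fI_props(2) vxI_bound by eventually_elim (auto simp: sI_def)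
 show "x ~: {0<..<1} ==> sI x = 0" by (simp add: sI_def fI_def outside_I)
qed

text \<open>\<open>sg(u)\<close> is again an indefinite time integral, with density \<open>sg'(u) v\<^sub>x\<close>.\<close>

lemma slice_chain: "AEL x. x \<in> {0<..<1} --> (ALL Ps D1 D2. (ALL z. (Ps has_derivative (%d. D1 z * fst d + D2 z * snd d)) (at z)) -->
  continuous_on UNIV D1 --> continuous_on UNIV D2 --> (ALL t:{0..T}.
  Ps (t, U (x, t)) - Ps (0, uI x) = (LBINT s. ind {0<..t} s * (D1 (s, uq (x, s)) + D2 (s, uq (x, s)) * vxq (x, s))) &
  L1 (%s. ind {0<..t} s * (D1 (s, uq (x, s)) + D2 (s, uq (x, s)) * vxq (x, s)))))"
proof -
 have "AEL x. AEL t. snd (x, t) \<in> {0<..<T} --> uq (x, t) = U (x, t)"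
  by (rule AE_pairD(1)[OF U_eq])
 moreover note lp_fst(1)[OF integrable_vx] lp_fst(1)[OF integrable_u]
 ultimately show ?thesis
 proof eventually_elim
  case (elim x)
  note vx = elim(2)
  show ?case
  proof (intro impI allI ballI)
   fix Ps D1 D2 :: "real * real => real" and t
   assume d: "ALL z. (Ps has_derivative (%d. D1 z * fst d + D2 z * snd d)) (at z)"
   and c: "continuous_on UNIV D1" "continuous_on UNIV D2" and t: "t \<in> {0..T}"
   define V where "V = (%t. uI x + prim (%s. vxq (x, s)) t)"
   have p0: "prim (%s. vxq (x, s)) 0 = 0" by (rule prim_eq_0[of 0]) (use outside_t(3) in auto)
   have V0: "V 0 = uI x" by (simp add: V_def p0)
   have VU: "V s = U (x, s)" for s by (simp add: V_def U_def)
   have d': "(Ps has_derivative (%d. D1 z * fst d + D2 z * snd d)) (at z)" for z using d by blast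
   have t0: "0 <= t" using t by simp
   note ac = ac_chain_rule[OF d' c vx t0 V_def]
   have um: "(%s. uq (x, s)) \<in> BM" using elim(3) by auto
   have vm: "(%s. vxq (x, s)) \<in> BM" using vx by auto
   have Dm: "D1 \<in> BM2" "D2 \<in> BM2"
   unfolding borel_prod using c by (auto intro: bm_cont)
   have m: "(%s. ind {0<..t} s * (D1 (s, uq (x, s)) + D2 (s, uq (x, s)) * vxq (x, s))) \<in> BL"
   proof -
   have pm: "(%s. (s, uq (x, s))) \<in> borel \<rightarrow>\<^sub>M borel \<Otimes>\<^sub>M borel" using um by measurable
   have "(%s. D1 (s, uq (x, s))) \<in> BM" "(%s. D2 (s, uq (x, s))) \<in> BM"
   by (rule measurable_compose[OF pm Dm(1)], rule measurable_compose[OF pm Dm(2)])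
   thus ?thesis using vm by measurable
   qed
   have ae: "AEL s. ind {0<..t} s * (D1 (s, V s) + D2 (s, V s) * vxq (x, s)) = ind {0<..t} s * (D1 (s, uq (x, s)) + D2 (s, uq (x, s)) * vxq (x, s))"
   using elim(1) AE_sing[of T]
   proof eventually_elim
   case (elim s)
   show ?case
   proof (cases "s \<in> {0<..t}")
   case True
   hence "s \<in> {0<..<T}" using t elim(2) by auto
   thus ?thesis using elim(1) by (simp add: VU)
   qed simp
   qed
   have "(LBINT s. ind {0<..t} s * (D1 (s, V s) + D2 (s, V s) * vxq (x, s))) = (LBINT s. ind {0<..t} s * (D1 (s, uq (x, s)) + D2 (s, uq (x, s)) * vxq (x, s)))"
   by (rule integral_cong_AE[OF borel_measurable_integrable[OF ac(2)] m ae])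
   moreover have "L1 (%s. ind {0<..t} s * (D1 (s, uq (x, s)) + D2 (s, uq (x, s)) * vxq (x, s)))"
   by (rule integrable_cong_AE_imp[OF ac(2) m]) (use ae in "auto elim: eventually_mono")
   ultimately show "Ps (t, U (x, t)) - Ps (0, uI x) = (LBINT s. ind {0<..t} s * (D1 (s, uq (x, s)) + D2 (s, uq (x, s)) * vxq (x, s))) &
   L1 (%s. ind {0<..t} s * (D1 (s, uq (x, s)) + D2 (s, uq (x, s)) * vxq (x, s)))"
   using ac(1) unfolding V0[unfolded VU] VU by simp
  qed
 qed
qed

lemma f_eq: "AEL z. snd z \<in> {0<..<T} --> fq z = fI (fst z) + prim (%s. gq (fst z, s)) (snd z)"
proof -
 have d: "((%z::real * real. sg (snd z)) has_derivative (%d. 0 * fst d + deriv sg (snd z) * snd d)) (at z)" for z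
 proof -
  have "(sg has_derivative (*) (deriv sg (snd z))) (at (snd z))" using sg_deriv[of "snd z"] by (simp add: has_field_derivative_def)
  from has_derivative_compose[OF has_derivative_snd[OF has_derivative_ident] this] show ?thesis by simp
 qed
 have c: "continuous_on UNIV (%z::real * real. 0 :: real)" "continuous_on UNIV (%z::real * real. deriv sg (snd z))"
  by (auto intro!: cints continuous_on_compose2[OF sgc])
 have "AEL x. x \<in> {0<..<1} --> (ALL t:{0..T}. sg (U (x, t)) - sg (uI x) = prim (%s. gq (x, s)) t)"
  using slice_chain
 proof eventually_elim
  case (elim x)
  show ?case
  proof (intro impI ballI)
   fix t assume x: "x \<in> {0<..<1}" and t: "t \<in> {0..T}"
   have "sg (U (x, t)) - sg (uI x) = (LBINT s. ind {0<..t} s * (0 + deriv sg (uq (x, s)) * vxq (x, s)))"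
   using elim[rule_format, OF x d c t] by simp
   also have "(%s. ind {0<..t} s * (0 + deriv sg (uq (x, s)) * vxq (x, s))) = (%s. ind {..t} s * gq (x, s))"
   using outside_t(3) by (intro ext) (auto simp: gq_def ind_def)
   finally show "sg (U (x, t)) - sg (uI x) = prim (%s. gq (x, s)) t" by (simp add: prim_def)
  qed
 qed
 note ch = this
 have m: "{z. snd z \<in> {0<..<T} --> fq z = fI (fst z) + prim (%s. gq (fst z, s)) (snd z)} \<in> sets borel"
 proof (intro time_set eq_set meas)
  have [measurable]: "(%z. prim (%s. gq (fst z, s)) (snd z)) \<in> BM" by (rule prim_measurable2) simp
  note fI_props(1)[measurable]
  show "(%z. fI (fst z) + prim (%s. gq (fst z, s)) (snd z)) \<in> BM" by measurable
 qed
 have Ueq: "AEL x. AEL t. snd (x, t) \<in> {0<..<T} --> uq (x, t) = U (x, t)"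
  by (rule AE_pairD(1)[OF U_eq])
 have A: "AEL x. AEL t. t \<in> {0<..<T} --> fq (x, t) = fI x + prim (%s. gq (x, s)) t"
  using ch Ueq
 proof (eventually_elim)
  case (elim x)
  show ?case
  proof (cases "x \<in> {0<..<1}")
   case False
   thus ?thesis by (simp add: outside_x fI_def gq_outside prim_def)
  next
   case True
   have ch: "ALL t:{0..T}. sg (U (x, t)) - sg (uI x) = prim (%s. gq (x, s)) t" using elim(1) True by simp
   from elim(2) show ?thesis
   proof eventually_elim
   case (elim t)
   show ?case
   proof
   assume t: "t \<in> {0<..<T}"
   hence "(x, t) \<in> Q T" using True by (auto simp: Q_def)
   thus "fq (x, t) = fI x + prim (%s. gq (x, s)) t" using elim bspec[OF ch, of t] t fq_eq[of "(x, t)"] fI_eq[OF True] by auto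
   qed
   qed
  qed
 qed
 have "{z. snd z \<in> {0<..<T} --> fq (fst z, snd z) = fI (fst z) + prim (%s. gq (fst z, s)) (snd z)} \<in> sets borel"
  using m unfolding prod.collapse .
 hence "AEL t. AEL x. t \<in> {0<..<T} --> fq (x, t) = fI x + prim (%s. gq (x, s)) t"
  using A by (rule AE_lborel_swap[where P="%x t. t \<in> {0<..<T} --> fq (x, t) = fI x + prim (%s. gq (x, s)) t"])
 thus ?thesis by (intro AE_lborel_pairI[OF m]) (simp only: fst_conv snd_conv)
qed

end

section \<open>Series representation and bound of the stress\<close>

context energy_sol begin

text \<open>The part sg(u) moves by the forcing. The part v_x contributes the damping: its sine mode
  is - k pi times the cosine mode of v, which in turn grows by k pi times the sine mode of the
  stress.\<close>

lemma mode_s: "AEL t. t \<in> {0<..<T} --> sc k sq t = sinc k sI + prim (%r. sc k gq r - eig k * sc k sq r) t"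
proof -
 have "AEL t. AEL x. snd (x, t) \<in> {0<..<T} --> fq (x, t) = fI (fst (x, t)) + prim (%s. gq (fst (x, t), s)) (snd (x, t))"
  by (rule AE_pairD(2)[OF f_eq])
 with lp_snd(1)[OF integrable_f] lp_snd(1)[OF integrable_vx] mode_vx[of k] mode_v[of k]
 show ?thesis
 proof eventually_elim
  case (elim t)
  show ?case
  proof
   assume t: "t \<in> {0<..<T}"
   note p = sinc_prim_swap[OF integrable_g]
   have "sc k fq t = sinc k (%x. fI x + prim (%s. gq (x, s)) t)"
   unfolding sc_def sinc_def
   proof (rule integral_cong_AE)
   show "AEL x. fq (x, t) * sin (real k * pi * x) = (fI x + prim (%s. gq (x, s)) t) * sin (real k * pi * x)"
   using elim(5) by eventually_elim (use t in simp)
   show "(%x. fq (x, t) * sin (real k * pi * x)) \<in> BL" using i_trig(1)[OF elim(1)] by simp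
   show "(%x. (fI x + prim (%s. gq (x, s)) t) * sin (real k * pi * x)) \<in> BL"
   using i_trig(1)[OF i_add[OF fI_props(3) p(2)]] by simp
   qed
   also have "... = sinc k fI + prim (sc k gq) t" unfolding sinc_add[OF fI_props(3) p(2)] p(1) ..
   finally have 1: "sc k fq t = sinc k fI + prim (sc k gq) t" .
   have 2: "sc k sq t = sc k fq t + sc k vxq t" unfolding sc_def sq_def by (rule sinc_add[OF elim(1,2)])
   have 3: "sc k vxq t = sinc k vxI - eig k * prim (sc k sq) t"
   using elim(3,4) t mode_v0[of k] by (simp add: prim_cmult eig_def power2_eq_square alg)
   have 4: "sinc k sI = sinc k fI + sinc k vxI"
   unfolding sI_def[abs_def] by (rule sinc_add[OF fI_props(3) integrable_vxI])
   have im: "L1 (%r. - eig k * sc k sq r)" by (intro i_mr integrable_sc(1) integrable_s)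
   have 5: "prim (%r. sc k gq r - eig k * sc k sq r) t = prim (sc k gq) t - eig k * prim (sc k sq) t"
   using prim_add[OF integrable_sc(1)[OF integrable_g, of k] im, of t]
   prim_cmult[of "- eig k" "sc k sq" t] by simp
   show "sc k sq t = sinc k sI + prim (%r. sc k gq r - eig k * sc k sq r) t"
   using 1 2 3 4 5 by simp
  qed
 qed
qed

lemma mode_s_solved: "AEL t. t \<in> {0<..<T} --> sc k sq t = exp (- eig k * t) * sinc k sI + duh k (sc k gq) t"
 by (rule duh_solves[OF integrable_sc(1)[OF integrable_s] integrable_sc(1)[OF integrable_g] _ _ mode_s])
  (auto simp: sc_outside sc_zero gq_outside)

text \<open>Bessel's inequality on almost every time slice, integrated over time.\<close>

lemma modes_L2:
 "L1 (%t. (sc k gq t)^2)" "(\<Sum>k<N. 2 * (LBINT t. (sc k gq t)^2)) <= Cd^2 * E"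
proof -
 have b: "AEL t. (\<Sum>k<N. 2 * (sc k gq t)^2) <= (LBINT x. (gq (x, t))^2)" for N
  using lp_snd(1)[OF integrable_g] lp_snd(1)[OF g_L2(1)]
  unfolding sc_def by eventually_elim (rule bessel, use gq_outside in auto)
 note i = lp_snd(2)[OF g_L2(1)]
 have m[measurable]: "sc k gq \<in> BM" for k using integrable_sc(1)[OF integrable_g] by auto
 show i2: "L1 (%t. (sc k gq t)^2)" for k
 proof (rule i_bound[OF i])
  show "AEL t. norm ((sc k gq t)^2) <= norm (LBINT x. (gq (x, t))^2)"
   using b[of "Suc k"]
  proof eventually_elim
   case (elim t)
   have "(sc k gq t)^2 <= 2 * (sc k gq t)^2" by simp
   also have "... <= (\<Sum>k<Suc k. 2 * (sc k gq t)^2)" by (rule member_le_sum) auto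
   finally show ?case using elim by simp
  qed
 qed measurable
 have "(\<Sum>k<N. 2 * (LBINT t. (sc k gq t)^2)) = (LBINT t. (\<Sum>k<N. 2 * (sc k gq t)^2))"
  by (subst int_sum) (use i2 in simp_all)
 also have "... <= (LBINT t. (LBINT x. (gq (x, t))^2))"
  by (rule integral_mono_AE[OF _ i b]) (use i2 in simp)
 also have "... = (LBINT z. (gq z)^2)" by (rule lp_snd(3)[OF g_L2(1)])
 also have "... <= Cd^2 * E" by (rule g_L2(2))
 finally show "(\<Sum>k<N. 2 * (LBINT t. (sc k gq t)^2)) <= Cd^2 * E" .
qed

text \<open>\<open>Cs + K\<close> bounds the initial stress and, by contraction, its heat evolution;
  the bracket bounds the series of Duhamel integrals.\<close>

definition L :: real where "L = Cs + K + ((\<Sum>k. 1 / eig k) + Cd^2 * E)"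

lemma duh_sum:
 assumes t: "t >= 0"
 shows "summable (%k. abs(duh k (sc k gq) t))" "abs(sin_series (%k. duh k (sc k gq) t) x) <= (\<Sum>k. 1 / eig k) + Cd^2 * E"
proof -
 have eig0: "0 <= 1 / eig k" for k by (simp add: eig_def)
 have d: "2 * abs(duh k (sc k gq) t) <= 1 / eig k + 2 * (LBINT t. (sc k gq t)^2)" for k
 \<comment> \<open>Here \<open>eig 0\<close> is 0 and 1 / \<open>eig 0\<close> is 0 by convention;
   the inequality holds because the mode itself vanishes.\<close>
 proof (cases "k = 0")
  case True
  have "sc 0 gq = (%t. 0)" by (rule ext) (simp add: sc_def sinc_0)
  thus ?thesis using True by (simp add: duh_def eig_def)
 next
  case False
  have "2 * abs(duh k (sc k gq) t) <= 1 / (2 * eig k) + (LBINT t. (sc k gq t)^2)"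
   by (rule duh_bound_L2[OF integrable_sc(1)[OF integrable_g] modes_L2(1) t eig_pos[OF False]])
  moreover have "1 / (2 * eig k) <= 1 / eig k" using eig_pos[OF False] by (simp add: field_simps)
  moreover have "0 <= (LBINT t. (sc k gq t)^2)" by simp
  ultimately show ?thesis by linarith
 qed
 have part: "(\<Sum>k<N. 2 * abs(duh k (sc k gq) t)) <= (\<Sum>k. 1 / eig k) + Cd^2 * E" for N
 proof -
  have "(\<Sum>k<N. 2 * abs(duh k (sc k gq) t)) <= (\<Sum>k<N. 1 / eig k + 2 * (LBINT t. (sc k gq t)^2))" by (rule sum_mono) (rule d)
  also have "... = (\<Sum>k<N. 1 / eig k) + (\<Sum>k<N. 2 * (LBINT t. (sc k gq t)^2))" by (rule sum.distrib)
  also have "... <= (\<Sum>k. 1 / eig k) + Cd^2 * E"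
   by (intro add_mono modes_L2(2) sum_le_suminf summable_inverse_eig) (use eig0 in auto)
  finally show ?thesis .
 qed
 have s2: "summable (%k. 2 * abs(duh k (sc k gq) t))"
  by (rule summableI_nonneg_bounded[OF _ part]) simp
 thus s: "summable (%k. abs(duh k (sc k gq) t))" by simp
 have "abs(sin_series (%k. duh k (sc k gq) t) x) <= (\<Sum>k. 2 * abs(duh k (sc k gq) t))"
  unfolding sin_series_def
 proof (rule order_trans[OF summable_rabs])
  have b: "abs(2 * duh k (sc k gq) t * sin (real k * pi * x)) <= 2 * abs(duh k (sc k gq) t)" for k
   using mlm[OF abs_sin_le_one[of "real k * pi * x"], of "2 * abs(duh k (sc k gq) t)"] by (simp add: abs_mult)
  show a: "summable (%k. abs(2 * duh k (sc k gq) t * sin (real k * pi * x)))"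
   by (rule summable_comparison_test'[OF s2, of 0]) (use b in simp)
  show "(\<Sum>k. abs(2 * duh k (sc k gq) t * sin (real k * pi * x))) <= (\<Sum>k. 2 * abs(duh k (sc k gq) t))"
   by (rule suminf_le[OF b a s2])
 qed
 also have "... <= (\<Sum>k. 1 / eig k) + Cd^2 * E" by (rule suminf_le_const[OF s2 part])
 finally show "abs(sin_series (%k. duh k (sc k gq) t) x) <= (\<Sum>k. 1 / eig k) + Cd^2 * E" .
qed

text \<open>A version of \<open>sc k sq\<close> that is defined by a formula at every t, which is
  needed to take limits at fixed points.\<close>

definition sm :: "nat => real => real" where "sm k t = exp (- eig k * t) * sinc k sI + duh k (sc k gq) t"

lemma sin_series_measurable:
 assumes "!!k. (%z. a z k) \<in> BM"
 shows "(%z::real * real. sin_series (a z) (fst z)) \<in> BM"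
proof -
 note assms[measurable]
 show ?thesis unfolding sin_series_def by measurable
qed

text \<open>The two parts of the series are bounded differently. The coefficients of the initial
  part are summable for t > 0, but only with a bound that blows up as t tends to 0, so its size
  comes from \<open>heat_contraction\<close>; the forcing part is bounded by its absolute
  coefficients. The final time is a null set and is discarded by \<open>AE_snd_neq\<close>.\<close>

lemma stress_series: "AEL z. z \<in> Q T --> sq z = sin_series (%k. sm k (snd z)) (fst z) & abs(sq z) <= L"
proof -
 have mm: "(%z::real * real. sm k (snd z)) \<in> BM" for k
 proof (rule fst_snd_measurable(2))
  have [measurable]: "sc k gq \<in> BM" using integrable_sc(1)[OF integrable_g] by auto
  have [measurable]: "duh k (sc k gq) \<in> BM" by (rule duh_measurable) measurable
  show "sm k \<in> BM" unfolding sm_def[abs_def] by measurable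
 qed
 have ser[measurable]: "(%z. sin_series (%k. sm k (snd z)) (fst z)) \<in> BM"
  by (rule sin_series_measurable) (rule mm)
 have "AEL z. snd z \<in> {0<..<T} --> (z \<in> Q T --> sq z = sin_series (%k. sm k (snd z)) (fst z) & abs(sq z) <= L)"
 proof (rule AE_lborel_pairI)
  have "{z \<in> space borel. z \<in> Q T --> sq z = sin_series (%k. sm k (snd z)) (fst z) & abs(sq z) <= L} \<in> sets borel"
   by measurable
  thus "{z. snd z \<in> {0<..<T} --> (z \<in> Q T --> sq z = sin_series (%k. sm k (snd z)) (fst z) & abs(sq z) <= L)} \<in> sets borel"
   by (intro time_set) simp
  have "AEL t. ALL k. t \<in> {0<..<T} --> sc k sq t = sm k t"
   unfolding AE_all_countable sm_def using mode_s_solved by simp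
  with lp_snd(1)[OF integrable_s]
  show "AEL t. AEL x. snd (x, t) \<in> {0<..<T} --> ((x, t) \<in> Q T --> sq (x, t) = sin_series (%k. sm k (snd (x, t))) (fst (x, t)) & abs(sq (x, t)) <= L)"
  proof eventually_elim
   case (elim t)
   have "AEL x. x \<in> {0<..<1} --> sq (x, t) = sin_series (%k. sm k t) x & abs(sq (x, t)) <= L" if t: "t \<in> {0<..<T}"
   proof -
   have c: "sinc k (%x. sq (x, t)) = sm k t" for k using elim(2) t by (simp add: sc_def)
   have t0: "t >= 0" "t > 0" using t by auto
   define A where "A = (LBINT x. abs(sI x))"
   have sb: "abs(sinc k sI) <= A" for k
   proof -
   have "abs(sinc k sI) <= (LBINT x. abs(sI x * sin (real k * pi * x)))" unfolding sinc_def by (rule iab)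
   also have "... <= A" unfolding A_def
   proof (rule integral_mono[OF integrable_abs[OF i_trig(1)[OF sI_props(1)]] integrable_abs[OF sI_props(1)]])
   show "abs(sI x * sin (real k * pi * x)) <= abs(sI x)" for x
   using mlm[OF abs_sin_le_one[of "real k * pi * x"], of "abs(sI x)"] by (simp add: abs_mult)
   qed
   finally show ?thesis .
   qed
   have s1: "summable (%k. abs(exp (- eig k * t) * sinc k sI))"
   proof (rule summable_comparison_test'[of "%k. A * exp (- eig k * t)" 0])
   show "summable (%k. A * exp (- eig k * t))" by (intro summable_mult summable_exp_eig t0)
   show "norm (abs(exp (- eig k * t) * sinc k sI)) <= A * exp (- eig k * t)" for k
   using mult_right_mono[OF sb[of k], of "exp (- eig k * t)"] by (simp add: abs_mult mult.commute)
   qed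
   have s2: "summable (%k. abs(duh k (sc k gq) t))" by (rule duh_sum(1)[OF t0(1)])
   have s3: "summable (%k. abs(sm k t))"
   by (rule summable_comparison_test'[OF summable_add[OF s1 s2], of 0]) (simp add: sm_def abs_triangle_ineq)
   have split: "sin_series (%k. sm k t) x = sin_series (%k. exp (- eig k * t) * sinc k sI) x + sin_series (%k. duh k (sc k gq) t) x" for x
   unfolding sin_series_def suminf_add[OF summable_sin_series[OF s1] summable_sin_series[OF s2]]
   by (intro suminf_cong) (simp add: sm_def alg)
   have bd: "abs(sin_series (%k. sm k t) x) <= L" for x
   using heat_contraction[OF sI_props(1) sI_props(3) sI_props(2) t0(2), of x] duh_sum(2)[OF t0(1), of x]
   unfolding split L_def by linarith
   have "AEL x. x \<in> {0<..<1} --> sq (x, t) = sin_series (%k. sinc k (%x. sq (x, t))) x"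
   by (rule sin_series_eq[OF elim(1)]) (use s3 outside_x in "simp_all add: c")
   thus ?thesis unfolding c by eventually_elim (use bd in simp)
   qed
   thus ?case
   by (cases "t \<in> {0<..<T}") (auto simp: Q_def elim: eventually_mono)
  qed
 qed
 with AE_snd_neq show ?thesis by eventually_elim (use in_Q in blast)
qed

end

section \<open>Representation and Lipschitz bound of the velocity\<close>

text \<open>Integration by parts against the sine, which vanishes at both ends, so that in contrast
  to \<open>sinc_prim\<close> no boundary term remains.\<close>

lemma cosc_prim:
 assumes g: "L1 g" and z: "!!x. x ~: {0<..<1} ==> g x = 0"
 shows "real k * pi * cosc k (%x. ind {0<..<1} x * prim g x) = - sinc k g"
  and "L1 (%x. ind {0<..<1} x * prim g x)"
proof -
 define w where "w = real k * pi"
 have sw: "sin w = 0" by (simp add: w_def)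
 have [measurable]: "prim g \<in> BM" by (rule prim_measurable[OF g])
 show ip: "L1 (%x. ind {0<..<1} x * prim g x)"
  by (rule imb(1)[OF i01]) (use prim_bound[OF g] in auto)
 have d: "((%z::real * real. snd z * sin (w * fst z)) has_derivative (%d. (w * snd z * cos (w * fst z)) * fst d + sin (w * fst z) * snd d)) (at z)" for z
  by (auto intro!: deqs simp: alg)
 have "prim g 1 * sin (w * 1) - prim g 0 * sin (w * 0) = (LBINT s. ind {0<..1} s * (w * prim g s * cos (w * s) + sin (w * s) * g s))"
  using ac_chain_rule(1)[of "%z. snd z * sin (w * fst z)" "%z. w * snd z * cos (w * fst z)" "%z. sin (w * fst z)", OF d _ _ g zero_le_one refl, of 0]
  by (simp add: cints)
 \<comment> \<open>The chain rule integrates over an interval that includes x = 1, the modes over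
   the open one. The indicator of \<open>{1}\<close> records the difference, and its integral is
   zero.\<close>
 moreover have "(%s. ind {0<..1} s * (w * prim g s * cos (w * s) + sin (w * s) * g s)) = (%s. g s * sin (w * s) + (ind {1} s * (w * prim g 1 * cos w) + w * ((ind {0<..<1} s * prim g s) * cos (w * s))))"
 proof (rule ext)
  fix s :: real
  show "ind {0<..1} s * (w * prim g s * cos (w * s) + sin (w * s) * g s) = g s * sin (w * s) + (ind {1} s * (w * prim g 1 * cos w) + w * ((ind {0<..<1} s * prim g s) * cos (w * s)))"
   using z[of s] by (cases "s \<in> {0<..<1}"; cases "s = 1") (auto simp: ind_def)
 qed
 moreover have "(LBINT s. g s * sin (w * s) + (ind {1} s * (w * prim g 1 * cos w) + w * ((ind {0<..<1} s * prim g s) * cos (w * s)))) = sinc k g + w * cosc k (%x. ind {0<..<1} x * prim g x)"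
 proof -
  have "L1 (%s. ind {1::real} s * (w * prim g 1 * cos w))" by (intro i_ml i_ind) auto
  moreover have i: "L1 (%s. w * ((ind {0<..<1} s * prim g s) * cos (w * s)))"
   by (intro i_mr i_trig(2) ip)
  ultimately have "(LBINT s. g s * sin (w * s) + (ind {1} s * (w * prim g 1 * cos w) + w * ((ind {0<..<1} s * prim g s) * cos (w * s))))
   = (LBINT s. g s * sin (w * s)) + ((LBINT s. ind {1::real} s * (w * prim g 1 * cos w)) + (LBINT s. w * ((ind {0<..<1} s * prim g s) * cos (w * s))))"
   by (simp only: int_add[OF i_trig(1)[OF g] i_add] int_add)
  thus ?thesis by (simp add: sinc_def cosc_def w_def)
 qed
 ultimately show "real k * pi * cosc k (%x. ind {0<..<1} x * prim g x) = - sinc k g"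
  using sw by (simp add: w_def)
qed

lemma cosc_diff: "L1 f ==> L1 g ==> cosc k (%x. f x - g x) = cosc k f - cosc k g"
 unfolding cosc_def left_diff_distrib by (intro int_diff i_trig)

text \<open>For k > 0 the cosine modes of w and of \<open>prim g\<close> on (0, 1) agree by
  integration by parts, so their difference is a constant, which mode 0 determines and
  bounds.\<close>

lemma prim_representation:
 assumes w: "L1 w" "!!x. x ~: {0<..<1} ==> w x = 0" and g: "L1 g" "!!x. x ~: {0<..<1} ==> g x = 0"
  and rel: "!!k. sinc k g = - (real k * pi) * cosc k w"
 obtains c where "AEL x. x \<in> {0<..<1} --> w x = c + prim g x" "abs(c) <= abs(cosc 0 w) + (LBINT x. abs(g x))"
proof -
 define p where "p = (%x. ind {0<..<1} x * prim g x)"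
 have p: "L1 p" "real k * pi * cosc k p = - sinc k g" for k
  unfolding p_def using cosc_prim[of g] g by auto
 define c where "c = cosc 0 w - cosc 0 p"
 have ic: "L1 (%x. ind {0<..<1::real} x * c)" by (intro i_ml i01)
 have "AEL x. w x - p x - ind {0<..<1} x * c = 0"
 proof (rule cos_uniqueness)
  show "L1 (%x. w x - p x - ind {0<..<1} x * c)"
   by (intro i_diff w(1) p(1) ic)
  show "x ~: {0<..<1} ==> w x - p x - ind {0<..<1} x * c = 0" for x using w(2) by (simp add: p_def)
  fix k
  have "cosc k (%x. ind {0<..<1} x * c) = c * (LBINT x. ind {0<..<1} x * cos (real k * pi * x))"
   unfolding cosc_def by (subst integral_mult_right_zero[symmetric]) (simp add: mult_ac)
  also have "... = (if k = 0 then c else 0)" by (subst integral_cos_01) auto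
  finally have 1: "cosc k (%x. ind {0<..<1} x * c) = (if k = 0 then c else 0)" .
  have 2: "cosc k (%x. w x - p x - ind {0<..<1} x * c) = cosc k w - cosc k p - (if k = 0 then c else 0)"
   unfolding cosc_diff[OF i_diff[OF w(1) p(1)] ic] cosc_diff[OF w(1) p(1)] 1 ..
  show "cosc k (%x. w x - p x - ind {0<..<1} x * c) = 0"
  proof (cases "k = 0")
   case True thus ?thesis unfolding 2 by (simp add: c_def)
  next
   case False
   have "real k * pi * (cosc k w - cosc k p) = 0" using p(2)[of k] rel[of k] by (auto simp: alg)
   thus ?thesis using False unfolding 2 by simp
  qed
 qed
 hence 1: "AEL x. x \<in> {0<..<1} --> w x = c + prim g x" by eventually_elim (auto simp: p_def)
 have "abs(cosc 0 p) <= (LBINT x. abs(p x))" using iab[of lborel p] by (simp add: cosc_def)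
 also have "(LBINT x. abs(p x)) <= (LBINT x. ind {0<..<1::real} x * (LBINT x. abs(g x)))"
  by (rule integral_mono) (use p(1) i_ml[OF i01] prim_bound[OF g(1)] in "auto simp: p_def ind_def")
 finally have "abs(c) <= abs(cosc 0 w) + (LBINT x. abs(g x))" by (simp add: c_def)
 with 1 show ?thesis by (rule that)
qed

context energy_sol begin

lemma fq_bound: "AEL z. z \<in> Q T --> abs(fq z) <= Cs"
 using u_bound by eventually_elim (use Cs fq_eq in auto)

text \<open>The absolute value makes nonnegativity immediate.\<close>

definition La :: real where "La = abs(L + Cs)"

lemma vx_bound: "AEL z. abs(vxq z) <= La"
 using stress_series fq_bound
proof eventually_elim
 case (elim z)
 show ?case
 proof (cases "z \<in> Q T")
  case True
  hence "abs(fq z + vxq z) <= L" "abs(fq z) <= Cs" using elim by (auto simp: sq_def)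
  thus ?thesis unfolding La_def by linarith
 qed (simp add: outside La_def)
qed

lemma bound_01:
 assumes "!!x. (x::real) ~: {0<..<1} ==> g x = (0::real)" "AEL x. abs(g x) <= C" "L1 g"
 shows "(LBINT x. abs(g x)) <= C"
proof -
 have "(LBINT x. abs(g x)) <= (LBINT x. ind {0<..<1::real} x * C)"
 proof (rule integral_mono_AE)
  show "L1 (%x. ind {0<..<1::real} x * C)" by (intro i_ml i01)
  show "AEL x. abs(g x) <= ind {0<..<1} x * C"
   using assms(2)
  proof eventually_elim
   case (elim x)
   thus ?case using assms(1)[of x] by (cases "x \<in> {0<..<1}") simp_all
  qed
 qed (use assms(3) in simp)
 thus ?thesis by simp
qed

lemma cosine_0_bound: "abs(cosc 0 vI) <= K"
 using order_trans[OF iab bound_01[of vI K]] outside_I(2) vI_bound integrable_vI by (simp add: cosc_def)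

text \<open>\<open>mode_vx\<close> supplies the relation between the modes at almost every time. The
  constant is bounded because the mean of v is conserved and hence equals that of the initial
  velocity.\<close>

lemma v_representation: "AEL t. t \<in> {0<..<T} --> (EX c. abs(c) <= K + La & (AEL x. x \<in> {0<..<1} --> vq (x, t) = c + prim (%y. vxq (y, t)) x))"
proof -
 have "AEL t. ALL k. sc k vxq t = - (real k * pi) * cc k vq t" unfolding AE_all_countable using mode_vx by simp
 moreover have "AEL t. AEL x. abs(vxq (x, t)) <= La" by (rule AE_pairD(2)[OF vx_bound])
 moreover note lp_snd(1)[OF integrable_v] lp_snd(1)[OF integrable_vx] mode_v[of 0]
 ultimately show ?thesis
 proof eventually_elim
  case (elim t)
  show ?case
  proof
   assume t: "t \<in> {0<..<T}"
   have o1: "vq (x, t) = 0" if "x ~: {0<..<1}" for x using that by (rule outside_x(2))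
   have o2: "vxq (x, t) = 0" if "x ~: {0<..<1}" for x using that by (rule outside_x(3))
   have r: "sinc k (%x. vxq (x, t)) = - (real k * pi) * cosc k (%x. vq (x, t))" for k
   using elim(1) unfolding sc_def cc_def by blast
   obtain c where c: "AEL x. x \<in> {0<..<1} --> vq (x, t) = c + prim (%y. vxq (y, t)) x"
   "abs(c) <= abs(cosc 0 (%x. vq (x, t))) + (LBINT x. abs(vxq (x, t)))"
   by (rule prim_representation[OF elim(3) o1 elim(4) o2 r]) blast+
   have "cosc 0 (%x. vq (x, t)) = cosc 0 vI" using elim(5) t by (simp add: cc_def prim_def)
   hence "abs(c) <= K + La" using c(2) cosine_0_bound bound_01[OF o2 elim(2) elim(4)] by simp
   thus "EX c. abs(c) <= K + La & (AEL x. x \<in> {0<..<1} --> vq (x, t) = c + prim (%y. vxq (y, t)) x)" using c(1) by blast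
  qed
 qed
qed

lemma v0_representation: "EX c. AEL x. x \<in> {0<..<1} --> vI x = c + prim vxI x"
 using prim_representation[OF integrable_vI outside_I(2) integrable_vxI outside_I(3) mode_v0] by blast

lemma v_bound: "AEL z. abs(vq z) <= K + 2 * La"
proof (rule AE_lborel_pairI)
 have "{z \<in> space borel. abs(vq z) <= K + 2 * La} \<in> sets borel" by measurable
 thus "{z. abs(vq z) <= K + 2 * La} \<in> sets borel" by simp
 have L0: "La >= 0" by (simp add: La_def)
 have "AEL t. AEL x. abs(vxq (x, t)) <= La" by (rule AE_pairD(2)[OF vx_bound])
 with v_representation AE_sing[of T] lp_snd(1)[OF integrable_vx]
 show "AEL t. AEL x. abs(vq (x, t)) <= K + 2 * La"
 proof eventually_elim
  case (elim t)
  show ?case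
  proof (cases "t \<in> {0<..<T}")
   case False
   hence "t ~: {0<..T}" using elim(2) by auto
   thus ?thesis using K0 L0 by (simp add: outside_t)
  next
   case True
   have o2: "vxq (x, t) = 0" if "x ~: {0<..<1}" for x using that by (rule outside_x(3))
   obtain c where c: "abs(c) <= K + La" "AEL x. x \<in> {0<..<1} --> vq (x, t) = c + prim (%y. vxq (y, t)) x" using elim(1) True by blast
   from c(2) show ?thesis
   proof eventually_elim
   fix x assume x: "x \<in> {0<..<1} --> vq (x, t) = c + prim (%y. vxq (y, t)) x"
   show "abs(vq (x, t)) <= K + 2 * La"
   proof (cases "x \<in> {0<..<1}")
   case True
   thus ?thesis using x c(1) prim_bound[OF elim(3), of x] bound_01[OF o2 elim(4) elim(3)] by linarith
   qed (use K0 L0 in "simp add: outside_x")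
   qed
  qed
 qed
qed

lemma heat_v:
 assumes ph: "test_fun ({0<..<1} \<times> {..<T}) ph"
 shows "(LBINT z. vq z * pd (0, 1) ph z) + (LBINT z. vq z * pd (1, 0) (pd (1, 0) ph) z) - (LBINT z. fq z * pd (1, 0) ph z) + (LBINT x. vI x * ph (x, 0)) = 0"
proof -
 have x: "test_fun ({0<..<1} \<times> {..<T}) (pd (1, 0) ph)" by (rule test_fun_pd[OF ph Basis_real2(1)])
 have "test_fun (UNIV \<times> {..<T}) ph" by (rule test_fun_mono[OF ph]) auto
 moreover have "(LBINT z. sq z * pd (1, 0) ph z) = (LBINT z. fq z * pd (1, 0) ph z) + (LBINT z. vxq z * pd (1, 0) ph z)"
  unfolding sq_def distrib_right by (intro int_add integrable_mult_test[OF _ x] integrable_f integrable_vx)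
 ultimately show ?thesis using v_equation[of ph] v_weak_derivative[OF x] by simp
qed

section \<open>Weak chain rule, stress equation and kinetic equation\<close>

text \<open>The chain rule on almost every line of constant x, taken up to t = T and integrated over
  x; vanishing of \<open>Ps\<close> at t = T removes the upper boundary term. Since the deformation
  is an extra argument of \<open>Ps\<close>, the same identity serves for sg(u) times a test
  function and for test functions of (x, t, u).\<close>

lemma chain_tested:
 fixes Ps D1 D2 :: "(real * real) * real => real"
 assumes d: "!!x y. ((%y. Ps ((x, fst y), snd y)) has_derivative (%d. D1 ((x, fst y), snd y) * fst d + D2 ((x, fst y), snd y) * snd d)) (at y)"
  and c: "continuous_on UNIV D1" "continuous_on UNIV D2" "continuous_on UNIV Ps" and z: "!!x r. Ps ((x, T), r) = 0"
 shows "L1 (%z. ind (Q T) z * (D1 (z, uq z) + D2 (z, uq z) * vxq z))"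
  "L1 (%x. ind {0<..<1} x * Ps ((x, 0), uI x))"
  "(LBINT z. ind (Q T) z * (D1 (z, uq z) + D2 (z, uq z) * vxq z)) + (LBINT x. ind {0<..<1} x * Ps ((x, 0), uI x)) = 0"
proof -
 define Kc where "Kc = ({0..1::real} \<times> {0..T}) \<times> {- R..R}"
 have K: "compact Kc" unfolding Kc_def by (intro compact_Times compact_Icc)
 have bd: "EX C. ALL z:Kc. abs(f z) <= C" if f: "continuous_on UNIV f" for f :: "(real * real) * real => real"
 proof -
  have "compact (f ` Kc)" by (rule compact_continuous_image[OF continuous_on_subset[OF f] K]) simp
  thus ?thesis using compact_imp_bounded by (force simp: bounded_iff)
 qed
 obtain C1 where C1: "!!z. z \<in> Kc ==> abs(D1 z) <= C1" using bd[OF c(1)] by blast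
 obtain C2 where C2: "!!z. z \<in> Kc ==> abs(D2 z) <= C2" using bd[OF c(2)] by blast
 obtain C3 where C3: "!!z. z \<in> Kc ==> abs(Ps z) <= C3" using bd[OF c(3)] by blast
 have m3: "(%z. f (z, uq z)) \<in> BM" if "continuous_on UNIV f" for f :: "(real * real) * real => real"
 proof -
  have "f \<in> BM2" unfolding borel_prod by (rule bm_cont[OF that])
  moreover have "(%z. (z, uq z)) \<in> borel \<rightarrow>\<^sub>M borel \<Otimes>\<^sub>M borel" by measurable
  ultimately show ?thesis by (rule measurable_compose[rotated])
 qed
 have [measurable]: "(%z. D1 (z, uq z)) \<in> BM" "(%z. D2 (z, uq z)) \<in> BM" using m3 c by auto
 have inK: "(z, uq z) \<in> Kc" if "z \<in> Q T" "abs(uq z) <= R" for z using that by (auto simp: Kc_def Q_def abs_le_iff)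
 have iQ: "L1 (ind (Q T) :: real * real => real)" using Q_finite by (intro i_ind) auto
 have "L1 (%z. ind (Q T) z * (ind (Q T) z * D1 (z, uq z)))"
  by (rule imb(1)[OF iQ, of _ "abs(C1)"], measurable)
   (use u_bound in "eventually_elim; force simp: ind_def dest: inK C1")
 moreover have "L1 (%z. (ind (Q T) z * D2 (z, uq z)) * vxq z)"
  by (rule imb(2)[OF integrable_vx, of _ "abs(C2)"], measurable)
   (use u_bound in "eventually_elim; force simp: ind_def dest: inK C2")
 ultimately have "L1 (%z. ind (Q T) z * (ind (Q T) z * D1 (z, uq z)) + (ind (Q T) z * D2 (z, uq z)) * vxq z)"
  by (rule i_add)
 moreover have "(%z. ind (Q T) z * (ind (Q T) z * D1 (z, uq z)) + (ind (Q T) z * D2 (z, uq z)) * vxq z) = (%z. ind (Q T) z * (D1 (z, uq z) + D2 (z, uq z) * vxq z))"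
  by (rule ext) (simp add: ind_def)
 ultimately show i: "L1 (%z. ind (Q T) z * (D1 (z, uq z) + D2 (z, uq z) * vxq z))" by simp
 have mI: "(%x. Ps ((x, 0), uI x)) \<in> BM"
 proof -
  have "Ps \<in> borel_measurable ((borel \<Otimes>\<^sub>M borel) \<Otimes>\<^sub>M borel)" unfolding borel_prod by (rule bm_cont[OF c(3)])
  moreover have "(%x. ((x, 0), uI x)) \<in> borel \<rightarrow>\<^sub>M (borel \<Otimes>\<^sub>M borel) \<Otimes>\<^sub>M borel" by measurable
  ultimately show ?thesis by (rule measurable_compose[rotated])
 qed
 have "L1 (%x. ind {0<..<1} x * (ind {0<..<1} x * Ps ((x, 0), uI x)))"
 proof (rule imb(1)[OF i01, of _ "abs(C3)"])
  show "(%x. ind {0<..<1} x * Ps ((x, 0), uI x)) \<in> BL" using mI by measurable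
  show "AEL x. abs(ind {0<..<1} x * Ps ((x, 0), uI x)) <= abs(C3)"
   using uI_bound
  proof eventually_elim
   case (elim x)
   hence "((x, 0), uI x) \<in> Kc" if "x \<in> {0<..<1}" using that KR T by (auto simp: Kc_def)
   thus ?case using C3[of "((x, 0), uI x)"] by (cases "x \<in> {0<..<1}") auto
  qed
 qed
 moreover have "(%x. ind {0<..<1} x * (ind {0<..<1} x * Ps ((x, 0), uI x))) = (%x. ind {0<..<1::real} x * Ps ((x, 0), uI x))"
  by (rule ext) (simp add: ind_def)
 ultimately show "L1 (%x. ind {0<..<1} x * Ps ((x, 0), uI x))" by simp
 have "AEL x. (LBINT t. ind (Q T) (x, t) * (D1 ((x, t), uq (x, t)) + D2 ((x, t), uq (x, t)) * vxq (x, t))) = - (ind {0<..<1} x * Ps ((x, 0), uI x))"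
  using slice_chain
 proof eventually_elim
  case (elim x)
  show ?case
  proof (cases "x \<in> {0<..<1}")
   case False
   hence "(x, t) ~: Q T" for t by (auto simp: Q_def)
   thus ?thesis using False by simp
  next
   case True
   have cx: "continuous_on UNIV (%y. f ((x, fst y), snd y))" if "continuous_on UNIV f" for f :: "(real * real) * real => real"
   by (rule continuous_on_compose2[OF that]) (auto intro!: cints)
   have "Ps ((x, T), U (x, T)) - Ps ((x, 0), uI x) = (LBINT s. ind {0<..T} s * (D1 ((x, s), uq (x, s)) + D2 ((x, s), uq (x, s)) * vxq (x, s)))"
   using elim[rule_format, of "%y. Ps ((x, fst y), snd y)" "%y. D1 ((x, fst y), snd y)" "%y. D2 ((x, fst y), snd y)" T, OF True d cx[OF c(1)] cx[OF c(2)]] T by simp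
   moreover have "ind {0<..T} s = (ind (Q T) (x, s) :: real)" for s using True by (simp add: Q_def ind_def)
   ultimately show ?thesis using True by (simp add: z)
  qed
 qed
 hence "(LBINT x. (LBINT t. ind (Q T) (x, t) * (D1 ((x, t), uq (x, t)) + D2 ((x, t), uq (x, t)) * vxq (x, t)))) = (LBINT x. - (ind {0<..<1} x * Ps ((x, 0), uI x)))"
  by (intro integral_cong_AE) (use lp_fst(2)[OF i] mI in "auto intro!: borel_measurable_times")
 thus "(LBINT z. ind (Q T) z * (D1 (z, uq z) + D2 (z, uq z) * vxq z)) + (LBINT x. ind {0<..<1} x * Ps ((x, 0), uI x)) = 0"
  using lp_fst(3)[OF i] by simp
qed

end

lemma Ck_slice: "Ck k ph ==> Ck k (%x. ph (x, c))" for ph :: "real * real => real"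
proof (induction k arbitrary: ph)
 case 0
 thus ?case by (auto intro!: cints continuous_on_compose2[of UNIV ph])
next
 case (Suc k)
 have "((%x. ph (x, c)) has_real_derivative pd (1, 0) ph (x, c)) (at x)" for x
  using Suc.prems by (intro pd_fst) simp
 moreover have "Ck k (%x. pd (1, 0) ph (x, c))" using Suc.prems Basis_real2(1) by (intro Suc.IH) simp
 ultimately show ?case by (rule Ck_Suc_realI)
qed

lemma test_fun_slice:
 assumes ph: "test_fun ({0<..<1} \<times> J) (ph :: real * real => real)"
 shows "test_fun {0<..<1} (%x. ph (x, c))" "pd 1 (%x. ph (x, c)) x = pd (1, 0) ph (x, c)"
proof -
 obtain K where K: "compact K" "K \<subseteq> {0<..<1} \<times> J" "!!z. z ~: K ==> ph z = 0"
  using test_fun_support[OF ph] by metis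
 show "test_fun {0<..<1} (%x. ph (x, c))"
 proof (rule test_funI)
  show "Ck k (%x. ph (x, c))" for k using ph by (intro Ck_slice) (simp add: test_fun_def)
  have "closed (UNIV \<times> {c})" by (intro closed_Times) auto
  thus "compact (fst ` (K \<inter> UNIV \<times> {c}))" using K(1) by (intro compact_continuous_image compact_Int_closed cints)
  show "fst ` (K \<inter> UNIV \<times> {c}) \<subseteq> {0<..<1}" using K(2) by auto
  fix x assume "x ~: fst ` (K \<inter> UNIV \<times> {c})"
  hence "(x, c) ~: K" by force
  thus "ph (x, c) = 0" by (rule K(3))
 qed
 show "pd 1 (%x. ph (x, c)) x = pd (1, 0) ph (x, c)"
  by (rule pd_1_real[OF pd_fst[OF test_fun_differentiable[OF ph]]])
qed

lemma AE_fst: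
 assumes "AEL z. P (z :: 'a::euclidean_space)"
 shows "AEL y. P (fst (y :: 'a \<times> 'b::euclidean_space))"
proof -
 from AE_E[OF assms] obtain N where N: "{z. ~ P z} \<subseteq> N" "N \<in> sets borel" "emeasure lborel N = 0" by auto
 have "AEL y. fst (y :: 'a \<times> 'b) ~: N"
 proof (rule AE_lborel_pairI)
  have "fst -` N \<inter> space (borel \<Otimes>\<^sub>M borel) \<in> sets ((borel :: 'a measure) \<Otimes>\<^sub>M (borel :: 'b measure))" using N(2) by measurable
  hence "fst -` N \<in> sets (borel :: ('a \<times> 'b) measure)" unfolding borel_prod by simp
  moreover have "{z :: 'a \<times> 'b. fst z ~: N} = - (fst -` N)" by auto
  ultimately show "{z :: 'a \<times> 'b. fst z ~: N} \<in> sets borel" by auto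
  have "AEL x. x ~: N" using N by (intro AE_not_in) auto
  thus "AEL y. AEL x. fst (x :: 'a, y :: 'b) ~: N" by simp
 qed
 thus ?thesis by (rule eventually_mono) (use N(1) in auto)
qed

text \<open>The substitution xi = r + et moves the dependence on r from the domain into the
  argument. The range of et may be truncated at M because f vanishes beyond N <= r + M; thus one
  interval serves all r in a bounded range.\<close>

lemma integral_above_shift:
 fixes f :: "real => real"
 assumes "!!xi. xi > N ==> f xi = 0" "N <= r + M"
 shows "(LBINT xi. of_bool (r < xi) * f xi) = (LBINT et. ind {0<..M} et * f (r + et))"
proof -
 have "(LBINT xi. of_bool (r < xi) * f xi) = (LBINT et. of_bool (r < r + 1 * et) * f (r + 1 * et))"
  using lborel_integral_real_affine[of 1 "%xi. of_bool (r < xi) * f xi" r] by simp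
 also have "(%et. of_bool (r < r + 1 * et) * f (r + 1 * et)) = (%et. ind {0<..M} et * f (r + et))"
  using assms by (intro ext) (auto simp: ind_def)
 finally show ?thesis .
qed

lemma integral_above_derivative:
 fixes g :: "real => real"
 assumes d: "!!xi. (g has_real_derivative g' xi) (at xi)" and c: "continuous_on UNIV g'" and z: "!!xi. xi > N ==> g xi = 0" "!!xi. xi > N ==> g' xi = 0"
 shows "(LBINT xi. of_bool (r < xi) * g' xi) = - g r" "L1 (%xi. of_bool (r < xi) * g' xi)"
proof -
 define b where "b = max r N + 1"
 have b: "r <= b" "b > N" by (auto simp: b_def)
 have m: "g' \<in> BM" by (rule bm_cont[OF c])
 have "has_bochner_integral lborel (%x. g' x * ind {r .. b} x) (g b - g r)"
  by (rule has_bochner_integral_FTC_Icc_real[OF b(1)]) (use d c in "auto simp: continuous_on_eq_continuous_at")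
 hence h: "L1 (%x. g' x * ind {r .. b} x)" "(LBINT x. g' x * ind {r .. b} x) = - g r"
  using z(1)[OF b(2)] by (auto simp: has_bochner_integral_iff)
 have ae: "AEL x. g' x * ind {r .. b} x = of_bool (r < x) * g' x"
  using AE_sing[of r]
 proof eventually_elim
  case (elim x)
  thus ?case using z(2)[of x] b(2) by (cases "x <= b") (auto simp: ind_def)
 qed
 have m2: "(%x. of_bool (r < x) * g' x) \<in> BL" using m by measurable
 show "L1 (%xi. of_bool (r < xi) * g' xi)" by (rule integrable_cong_AE_imp[OF h(1) m2]) (use ae in "auto elim: eventually_mono")
 show "(LBINT xi. of_bool (r < xi) * g' xi) = - g r"
  using integral_cong_AE[OF borel_measurable_integrable[OF h(1)] m2 ae] h(2) by simp
qed

lemma phase_Basis: "((0, 1), 0) \<in> (Basis :: ((real * real) * real) set)" "((0, 0), 1) \<in> (Basis :: ((real * real) * real) set)"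
 by (auto simp: Basis_prod_def zero_prod_def)

lemma phase_derivative:
 assumes "test_fun Om (ph :: (real * real) * real => real)"
 shows "((%y. ph ((x, fst y), snd y + et)) has_derivative (%d. pd ((0, 1), 0) ph ((x, fst y), snd y + et) * fst d + pd ((0, 0), 1) ph ((x, fst y), snd y + et) * snd d)) (at y)"
  and "((%xi. ph (z, xi)) has_real_derivative pd ((0, 0), 1) ph (z, xi)) (at xi)"
proof -
 define f' where "f' = (%p. frechet_derivative ph (at p))"
 have f': "(ph has_derivative f' p) (at p)" for p
  unfolding f'_def by (rule has_derivative_frechet[OF test_fun_differentiable[OF assms]])
 have lin: "f' p ((0, a), b) = pd ((0, 1), 0) ph p * a + pd ((0, 0), 1) ph p * b" for p a b
 proof -
  interpret bounded_linear "f' p" using f' by (rule has_derivative_bounded_linear)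
  have "((0, a), b) = a *\<^sub>R ((0, 1), 0) + b *\<^sub>R ((0::real, 0::real), 1::real)" by simp
  thus ?thesis by (simp only: add scaleR) (simp add: pd_def f'_def)
 qed
 have 1: "((%y. ((x, fst y), snd y + et)) has_derivative (%d. ((0, fst d), snd d))) (at y)" for y :: "real * real"
  by (auto intro!: deqs)
 show "((%y. ph ((x, fst y), snd y + et)) has_derivative (%d. pd ((0, 1), 0) ph ((x, fst y), snd y + et) * fst d + pd ((0, 0), 1) ph ((x, fst y), snd y + et) * snd d)) (at y)"
  using has_derivative_compose[OF 1 f'] by (simp add: lin)
 have 2: "((%xi. (z, xi)) has_derivative (%d. (0, d))) (at xi)" by (auto intro!: deqs)
 have "((%xi. ph (z, xi)) has_derivative (%d. f' (z, xi) ((0, 0), d))) (at xi)"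
  using has_derivative_compose[OF 2 f'] by (simp add: zero_prod_def)
 thus "((%xi. ph (z, xi)) has_real_derivative pd ((0, 0), 1) ph (z, xi)) (at xi)"
  unfolding has_field_derivative_def by (rule has_derivative_eq_rhs) (simp add: lin fun_eq_iff)
qed

lemma phase_support:
 assumes ph: "test_fun Om (ph :: (real * real) * real => real)"
 obtains N where "N >= 0" "!!z xi. abs(xi) > N ==> ph (z, xi) = 0" "!!b z xi. abs(xi) > N ==> pd b ph (z, xi) = 0"
proof -
 obtain K where K: "compact K" "!!z. z ~: K ==> ph z = 0" "!!b z. z ~: K ==> pd b ph z = 0"
  using test_fun_support[OF ph] by metis
 obtain N where N: "!!y. y \<in> K ==> norm y <= N" using compact_imp_bounded[OF K(1)] by (auto simp: bounded_iff)
 have "(z, xi) ~: K" if "abs(xi) > max 0 N" for z xi using N[of "(z, xi)"] norm_snd_le[of xi z] that by auto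
 thus ?thesis using K by (intro that[of "max 0 N"]) auto
qed

lemma continuous_compact_integrable:
 fixes f g :: "'a::euclidean_space => real"
 assumes ph: "test_fun Om ph" and h: "continuous_on UNIV h"
 shows "L1 (%z. h z * ph z)"
proof -
 obtain K where K: "compact K" "!!z. z ~: K ==> ph z = 0" using test_fun_support[OF ph] by metis
 have c: "continuous_on UNIV (%z. h z * ph z)" by (intro continuous_on_mult h test_fun_continuous[OF ph])
 have "compact ((%z. h z * ph z) ` K)" by (rule compact_continuous_image[OF continuous_on_subset[OF c] K(1)]) simp
 then obtain C where C: "!!z. z \<in> K ==> abs(h z * ph z) <= C" using compact_imp_bounded by (force simp: bounded_iff)
 have "abs(h z * ph z) <= max 0 C" for z using C[of z] K(2)[of z] by (cases "z \<in> K") auto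
 thus ?thesis
  by (intro ibf[of _ _ K "max 0 C"])
   (use bm_cont[OF c] K borel_compact[OF K(1)] emeasure_compact_finite[OF K(1)] in "auto simp: emeasure_lborel_cbox")
qed

context energy_sol begin

text \<open>The two parts of the stress are treated separately. The momentum equation tested with
  the x-derivative of \<open>ph\<close> governs v_x, after an exchange of mixed derivatives; the
  chain rule for sg(u) times \<open>ph\<close> governs sg(u). The sum of both has the forcing
  \<open>gq\<close> as its only remainder.\<close>

lemma heat_s:
 assumes ph: "test_fun ({0<..<1} \<times> {..<T}) ph"
 shows "(LBINT z. sq z * pd (0, 1) ph z) + (LBINT z. sq z * pd (1, 0) (pd (1, 0) ph) z) + (LBINT z. gq z * ph z) + (LBINT x. sI x * ph (x, 0)) = 0"
proof -
 have tx: "test_fun ({0<..<1} \<times> {..<T}) (pd (1, 0) ph)" by (rule test_fun_pd[OF ph Basis_real2(1)])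
 have tt: "test_fun ({0<..<1} \<times> {..<T}) (pd (0, 1) ph)" by (rule test_fun_pd[OF ph Basis_real2(2)])
 have "test_fun (UNIV \<times> {..<T}) (pd (1, 0) ph)" by (rule test_fun_mono[OF tx]) auto
 from v_equation[OF this] v_weak_derivative[OF tt]
 have 1: "- (LBINT z. vxq z * pd (0, 1) ph z) - (LBINT z. sq z * pd (1, 0) (pd (1, 0) ph) z) + (LBINT x. vI x * pd (1, 0) ph (x, 0)) = 0"
  unfolding pd_mixed[OF ph] by simp
 have "(LINT x:{0<..<1}|lborel. v0 x * pd 1 (%x. ph (x, 0)) x) = - (LINT x:{0<..<1}|lborel. v0x x * ph (x, 0))"
  using v0_weak test_fun_slice(1)[OF ph, of 0] unfolding weak_pd_def by blast
 hence 2: "(LBINT x. vI x * pd (1, 0) ph (x, 0)) = - (LBINT x. vxI x * ph (x, 0))"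
  unfolding set_integral_real test_fun_slice(2)[OF ph] vI_def vxI_def by (simp add: mult.assoc)
 have d: "((%y. sg (snd y) * ph (x, fst y)) has_derivative (%d. (sg (snd y) * pd (0, 1) ph (x, fst y)) * fst d + (deriv sg (snd y) * ph (x, fst y)) * snd d)) (at y)" for x y
 proof -
  have a: "((%y. ph (x, fst y)) has_derivative (%d. fst d * pd (0, 1) ph (x, fst y))) (at y)" for y :: "real * real"
   using has_derivative_compose[OF has_derivative_fst[OF has_derivative_ident] pd_snd[where x=x and y="fst y", OF test_fun_differentiable[OF ph], unfolded has_field_derivative_def]]
   by (simp add: mult.commute)
  have b: "((%y. sg (snd y)) has_derivative (%d. snd d * deriv sg (snd y))) (at y)" for y :: "real * real"
   using has_derivative_compose[OF has_derivative_snd[OF has_derivative_ident] sg_deriv[of "snd y", unfolded has_field_derivative_def]]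
   by (simp add: mult.commute)
  show ?thesis by (rule has_derivative_eq_rhs[OF has_derivative_mult[OF b a]]) (simp add: fun_eq_iff mult_ac)
 qed
 have cs: "continuous_on UNIV (%p::(real * real) * real. a (snd p) * b (fst p))" if "continuous_on UNIV a" "continuous_on UNIV b" for a :: "real => real" and b :: "real * real => real"
  by (intro continuous_on_mult continuous_on_compose2[OF that(1)] continuous_on_compose2[OF that(2)] cints) auto
 have "(LBINT z. ind (Q T) z * (sg (uq z) * pd (0, 1) ph z + deriv sg (uq z) * ph z * vxq z)) + (LBINT x. ind {0<..<1} x * (sg (uI x) * ph (x, 0))) = 0"
  using chain_tested(3)[of "%p. sg (snd p) * ph (fst p)" "%p. sg (snd p) * pd (0, 1) ph (fst p)" "%p. deriv sg (snd p) * ph (fst p)"]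
   d cs[OF sg_cont test_fun_continuous[OF tt]] cs[OF sgc test_fun_continuous[OF ph]] cs[OF sg_cont test_fun_continuous[OF ph]] test_zero(1)[OF ph] by simp
 moreover have "ind (Q T) z * (sg (uq z) * pd (0, 1) ph z + deriv sg (uq z) * ph z * vxq z) = fq z * pd (0, 1) ph z + gq z * ph z" for z
  by (cases "z \<in> Q T") (simp_all add: fq_eq outside gq_def)
 moreover have "ind {0<..<1} x * (sg (uI x) * ph (x, 0)) = fI x * ph (x, 0)" for x by (simp add: fI_def uI_def ind_def)
 moreover have "(LBINT z. fq z * pd (0, 1) ph z + gq z * ph z) = (LBINT z. fq z * pd (0, 1) ph z) + (LBINT z. gq z * ph z)"
  by (intro int_add integrable_mult_test[OF _ tt] integrable_mult_test[OF _ ph] integrable_f integrable_g)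
 ultimately have 3: "(LBINT z. fq z * pd (0, 1) ph z) + (LBINT z. gq z * ph z) + (LBINT x. fI x * ph (x, 0)) = 0" by simp
 have 4: "(LBINT z. sq z * pd (0, 1) ph z) = (LBINT z. fq z * pd (0, 1) ph z) + (LBINT z. vxq z * pd (0, 1) ph z)"
  unfolding sq_def distrib_right by (intro int_add integrable_mult_test[OF _ tt] integrable_f integrable_vx)
 have 5: "(LBINT x. sI x * ph (x, 0)) = (LBINT x. fI x * ph (x, 0)) + (LBINT x. vxI x * ph (x, 0))"
  unfolding sI_def distrib_right by (intro int_add integrable_mult_test[OF _ test_fun_slice(1)[OF ph]] fI_props(3) integrable_vxI)
 show ?thesis using 1 2 3 4 5 by simp
qed

lemma kinetic:
 assumes ph: "test_fun (({0<..<1} \<times> {..<T}) \<times> UNIV) ph"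
 shows "(LBINT y. of_bool (uq (fst y) < snd y) * (ind (Q T) (fst y) * (pd ((0, 1), 0) ph y + (sq (fst y) - sg (snd y)) * pd ((0, 0), 1) ph y - deriv sg (snd y) * ph y)))
   + (LBINT y. of_bool (uI (fst y) < snd y) * (ind {0<..<1} (fst y) * ph ((fst y, 0), snd y))) = 0"
proof -
 define pht where "pht = pd ((0, 1), 0) ph"
 define phx where "phx = pd ((0, 0), 1) ph"
 have tt: "test_fun (({0<..<1} \<times> {..<T}) \<times> UNIV) pht" and tx: "test_fun (({0<..<1} \<times> {..<T}) \<times> UNIV) phx"
  unfolding pht_def phx_def by (rule test_fun_pd[OF ph], rule phase_Basis)+
 obtain N where N: "N >= 0" "!!z xi. abs(xi) > N ==> ph (z, xi) = 0" "!!b z xi. abs(xi) > N ==> pd b ph (z, xi) = 0"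
  using phase_support[OF ph] by metis
 have Nt: "pht (z, xi) = 0" "phx (z, xi) = 0" "ph (z, xi) = 0" if "xi > N" for z xi using N that by (auto simp: pht_def phx_def)
 \<comment> \<open>For |u| <= R and et > M the argument u + et exceeds N, where \<open>ph\<close>
   vanishes, so et may be restricted to a bounded interval.\<close>
 define M where "M = N + R"
 note cont = test_fun_continuous[OF ph] test_fun_continuous[OF tt] test_fun_continuous[OF tx]
 note meas2[measurable] = test_fun_measurable[OF ph, folded borel_prod] test_fun_measurable[OF tt, folded borel_prod] test_fun_measurable[OF tx, folded borel_prod]
 note meas3[measurable] = meas(1,3,5)[folded borel_prod] meas(6)
 note Qs[measurable] = Q_sets[of T, folded borel_prod]
 have shc: "continuous_on UNIV (%p::(real * real) * real. f (fst p, snd p + et))" if "continuous_on UNIV f" for f et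
  by (rule continuous_on_compose2[OF that]) (auto intro!: cints)
 have ch: "(LBINT z. ind (Q T) z * (pht (z, uq z + et) + phx (z, uq z + et) * vxq z)) = - (LBINT x. ind {0<..<1} x * ph ((x, 0), uI x + et))" for et
  using chain_tested(3)[of "%p. ph (fst p, snd p + et)" "%p. pht (fst p, snd p + et)" "%p. phx (fst p, snd p + et)"]
   phase_derivative(1)[OF ph] shc[OF cont(1)] shc[OF cont(2)] shc[OF cont(3)] test_fun_zero(1)[OF ph] unfolding pht_def phx_def by (simp add: add_eq_0_iff)
 obtain C where C: "!!z. abs(ph z) <= C" using test_fun_bounded[OF ph] by metis
 obtain Ct where Ct: "!!z. abs(pht z) <= Ct" using test_fun_bounded[OF tt] by metis
 obtain Cx where Cx: "!!z. abs(phx z) <= Cx" using test_fun_bounded[OF tx] by metis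
 have fin: "emeasure lborel (A \<times> {0<..M}) < \<infinity>" if "A \<in> sets borel" "emeasure lborel A < \<infinity>" for A :: "'b::euclidean_space set"
 proof -
  have "emeasure lborel (A \<times> {0<..M}) = emeasure lborel A * emeasure lborel {0<..M}"
   unfolding lborel_prod[symmetric] using that by (intro lborel.emeasure_pair_measure_Times) auto
  moreover have "emeasure lborel {0<..M} < \<infinity>" using N(1) R0 by (simp add: M_def)
  ultimately show ?thesis using that(2) by (simp add: ennreal_mult_less_top)
 qed
 have QM: "Q T \<times> {0<..M} \<in> sets borel" "{0<..<1::real} \<times> {0<..M} \<in> sets borel"
  unfolding borel_prod[symmetric] by measurable
 have b: "abs(ind A a * ind A' b * c) <= Cc" if "abs(c) <= Cc" for A A' a b and c Cc :: real
  using that by (auto simp: ind_def)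
 \<comment> \<open>\<open>G\<close> and \<open>H\<close> are the space-time and the initial
   integrand after the shift xi = u + et. For each fixed et their integrals in the remaining
   variables are opposite by the chain rule; boundedness of the range of et makes both
   integrable.\<close>
 define G where "G = (%y. ind (Q T) (fst y) * ind {0<..M} (snd y) * pht (fst y, uq (fst y) + snd y) + ind (Q T) (fst y) * ind {0<..M} (snd y) * phx (fst y, uq (fst y) + snd y) * vxq (fst y))"
 have iG0: "L1 (%y. ind (Q T) (fst y) * ind {0<..M} (snd y) * f (fst y, uq (fst y) + snd y))"
  if [measurable]: "f \<in> borel_measurable ((borel \<Otimes>\<^sub>M borel) \<Otimes>\<^sub>M borel)" and Cf: "!!z. abs(f z) <= Cf" for f :: "(real * real) * real => real" and Cf
 proof (rule ibf[OF _ _ fin[OF Q_sets Q_finite] b[OF Cf]])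
  have "(%y. ind (Q T) (fst y) * ind {0<..M} (snd y) * f (fst y, uq (fst y) + snd y)) \<in> borel_measurable ((borel \<Otimes>\<^sub>M borel) \<Otimes>\<^sub>M borel)"
   by measurable
  thus "(%y. ind (Q T) (fst y) * ind {0<..M} (snd y) * f (fst y, uq (fst y) + snd y)) \<in> BL"
   unfolding borel_prod by simp
 qed (use QM in "auto simp: ind_def")
 have vm: "(%y. vxq (fst (y :: (real * real) * real))) \<in> BL"
 proof -
  have "(%y. vxq (fst (y :: (real * real) * real))) \<in> borel_measurable ((borel \<Otimes>\<^sub>M borel) \<Otimes>\<^sub>M borel)" by measurable
  thus ?thesis unfolding borel_prod by simp
 qed
 have iG: "L1 G"
  unfolding G_def by (intro i_add iG0[OF meas2(2) Ct] imb(1)[OF iG0[OF meas2(3) Cx] vm AE_fst[OF vx_bound]])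
 define H where "H = (%y. ind {0<..<1} (fst y) * ind {0<..M} (snd y) * ph ((fst y, 0), uI (fst y) + snd y))"
 have iH: "L1 H"
  unfolding H_def
 proof (rule ibf[OF _ _ fin[of "{0<..<1}"] b[OF C]])
  have "(%y. ind {0<..<1} (fst y) * ind {0<..M} (snd y) * ph ((fst y, 0), uI (fst y) + snd y)) \<in> BM2" by measurable
  thus "(%y. ind {0<..<1} (fst y) * ind {0<..M} (snd y) * ph ((fst y, 0), uI (fst y) + snd y)) \<in> BL"
   unfolding borel_prod by simp
 qed (use QM in "auto simp: ind_def")
 have GH: "(LBINT y. G y) = - (LBINT y. H y)"
 proof -
  have "(LBINT z. G (z, et)) = - (LBINT x. H (x, et))" for et
  proof (cases "et \<in> {0<..M}")
   case True
   hence "(%z. G (z, et)) = (%z. ind (Q T) z * (pht (z, uq z + et) + phx (z, uq z + et) * vxq z))"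
   "(%x. H (x, et)) = (%x. ind {0<..<1} x * ph ((x, 0), uI x + et))"
   unfolding G_def H_def by (simp_all add: fun_eq_iff alg)
   thus ?thesis using ch by simp
  qed (simp add: G_def H_def)
  thus ?thesis using lp_snd(3)[OF iG] lp_snd(3)[OF iH] by simp
 qed
 have cz: "continuous_on UNIV (%xi. f (z, xi))" if "continuous_on UNIV f" for f :: "(real * real) * real => real" and z
  by (rule continuous_on_compose2[OF that]) (auto intro!: cints)
 define W where "W = (%y. of_bool (uq (fst y) < snd y) * (ind (Q T) (fst y) * (pht y + (sq (fst y) - sg (snd y)) * phx y - deriv sg (snd y) * ph y)))"
 have iW: "L1 W"
 proof -
  have s2: "continuous_on UNIV (%y::(real * real) * real. a (snd y))" if "continuous_on UNIV a" for a :: "real => real"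
   by (rule continuous_on_compose2[OF that]) (auto intro!: cints)
  have i1: "L1 (%y. 1 * pht y - sg (snd y) * phx y - deriv sg (snd y) * ph y)"
   by (intro i_diff continuous_compact_integrable[OF tt] continuous_compact_integrable[OF tx] continuous_compact_integrable[OF ph] s2 sg_cont sgc continuous_on_const)
  have i2: "L1 (%y. sq (fst y) * (1 * phx y))"
  proof (rule imb(2)[OF continuous_compact_integrable[OF tx continuous_on_const]])
   have "(%y. sq (fst (y :: (real * real) * real))) \<in> borel_measurable ((borel \<Otimes>\<^sub>M borel) \<Otimes>\<^sub>M borel)" by measurable
   thus "(%y. sq (fst (y :: (real * real) * real))) \<in> BL" unfolding borel_prod by simp
   have "AEL z. abs(sq z) <= abs(L)" using stress_series
   proof eventually_elim
   case (elim z) thus ?case by (cases "z \<in> Q T") (auto simp: outside sq_def)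
   qed
   thus "AEL y. abs(sq (fst (y :: (real * real) * real))) <= abs(L)" by (rule AE_fst)
  qed
  have "(%y. of_bool (uq (fst y) < snd y) * ind (Q T) (fst y) :: real) \<in> borel_measurable ((borel \<Otimes>\<^sub>M borel) \<Otimes>\<^sub>M (borel :: real measure))" by measurable
  hence bm: "(%y. of_bool (uq (fst y) < snd y) * ind (Q T) (fst y) :: real) \<in> borel_measurable (lborel :: ((real * real) * real) measure)" unfolding borel_prod by simp
  have "L1 (%y. (of_bool (uq (fst y) < snd y) * ind (Q T) (fst y)) * ((1 * pht y - sg (snd y) * phx y - deriv sg (snd y) * ph y) + sq (fst y) * (1 * phx y)))"
   by (rule imb(2)[OF i_add[OF i1 i2] bm, of 1]) (auto simp: ind_def)
  thus ?thesis unfolding W_def by (simp add: alg)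
 qed
 define V where "V = (%y. of_bool (uI (fst y) < snd y) * (ind {0<..<1} (fst y) * ph ((fst y, 0), snd y)))"
 have iV: "L1 V"
  unfolding V_def
 proof (rule ibf[of _ _ "{0<..<1} \<times> {- N..N}" C])
  have "(%y. of_bool (uI (fst y) < snd y) * (ind {0<..<1} (fst y) * ph ((fst y, 0), snd y))) \<in> BM2" by measurable
  thus "(%y. of_bool (uI (fst y) < snd y) * (ind {0<..<1} (fst y) * ph ((fst y, 0), snd y))) \<in> BL"
   unfolding borel_prod by simp
  show "{0<..<1} \<times> {- N..N} \<in> sets (lborel :: (real * real) measure)" unfolding sets_lborel borel_prod[symmetric] by measurable
  have "emeasure lborel ({0<..<1::real} \<times> {- N..N}) = emeasure lborel {0<..<1::real} * emeasure lborel {- N..N}"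
   unfolding lborel_prod[symmetric] by (intro lborel.emeasure_pair_measure_Times) auto
  thus "emeasure lborel ({0<..<1::real} \<times> {- N..N}) < \<infinity>" using N(1) by (simp add: ennreal_mult_less_top)
  fix y :: "real * real"
  show "abs(of_bool (uI (fst y) < snd y) * (ind {0<..<1} (fst y) * ph ((fst y, 0), snd y))) <= C"
   using C[of "((fst y, 0), snd y)"] by (auto simp: ind_def)
  show "of_bool (uI (fst y) < snd y) * (ind {0<..<1} (fst y) * ph ((fst y, 0), snd y)) = 0" if "y ~: {0<..<1} \<times> {- N..N}"
  proof (cases "fst y \<in> {0<..<1}")
   case True
   hence "abs(snd y) > N" using that by (cases y) auto
   thus ?thesis using N(2) by simp
  qed simp
 qed
 have "(LBINT y. W y) = (LBINT y. G y)"
  unfolding lp_fst(3)[OF iW, symmetric] lp_fst(3)[OF iG, symmetric]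
 proof (rule integral_cong_AE)
  show "AEL z. (LBINT xi. W (z, xi)) = (LBINT et. G (z, et))"
   using u_bound
  proof eventually_elim
   case (elim z)
   show ?case
   proof (cases "z \<in> Q T")
   case True
   define r where "r = uq z"
   have NM: "N <= r + M" using elim by (simp add: r_def M_def)
   define s where "s = sq z"
   \<comment> \<open>The speed s - sg(xi) equals v_x at xi = u. The terms with \<open>phx\<close>
     and \<open>deriv sg\<close> form a total xi-derivative, whose integral over xi > u is - v_x
     \<open>ph (z, u)\<close>; this is also v_x times the integral of \<open>phx\<close>. Thus the
     nonlinear speed is replaced by the constant v_x, as the chain rule demands.\<close>
   have s: "s - sg r = vxq z" using True by (simp add: s_def r_def sq_def fq_eq)
   have dd: "((%xi. (s - sg xi) * ph (z, xi)) has_real_derivative ((s - sg xi) * phx (z, xi) - deriv sg xi * ph (z, xi))) (at xi)" for xi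
   unfolding phx_def by (rule deqs sg_deriv phase_derivative(2)[OF ph] refl)+ simp
   have cc: "continuous_on UNIV (%xi. (s - sg xi) * phx (z, xi) - deriv sg xi * ph (z, xi))"
   by (intro cints sg_cont sgc cz cont)
   note A = integral_above_derivative[OF dd cc, of N r]
   have A1: "(LBINT xi. of_bool (r < xi) * ((s - sg xi) * phx (z, xi) - deriv sg xi * ph (z, xi))) = - ((s - sg r) * ph (z, r))"
   "L1 (%xi. of_bool (r < xi) * ((s - sg xi) * phx (z, xi) - deriv sg xi * ph (z, xi)))"
   by (rule A; simp add: Nt)+
   have d2: "((%xi. ph (z, xi)) has_real_derivative phx (z, xi)) (at xi)" for xi unfolding phx_def by (rule phase_derivative(2)[OF ph])
   have A2: "(LBINT xi. of_bool (r < xi) * phx (z, xi)) = - ph (z, r)" "L1 (%xi. of_bool (r < xi) * phx (z, xi))"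
   using integral_above_derivative[OF d2 cz[OF cont(3)], of N r] Nt by auto
   have bb: "abs(of_bool (r < xi) * f (z, xi)) <= Cf" if "!!z. abs(f z) <= Cf" for f :: "(real * real) * real => real" and Cf xi using that[of "(z, xi)"] by (cases "r < xi") auto
   have A3: "L1 (%xi. of_bool (r < xi) * pht (z, xi))"
   proof (rule ibf[of _ _ "{r..r + M}" Ct])
   have "(%xi. pht (z, xi)) \<in> BM" by (rule bm_cont[OF cz[OF cont(2)]])
   thus "(%xi. of_bool (r < xi) * pht (z, xi)) \<in> BL" by measurable
   show "of_bool (r < xi) * pht (z, xi) = 0" if "xi ~: {r..r + M}" for xi using that Nt(1)[of xi z] NM by (cases "r < xi") auto
   show "abs(of_bool (r < xi) * pht (z, xi)) <= Ct" for xi by (rule bb) (rule Ct)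
   qed (auto simp: emeasure_lborel_Icc_eq)
   have "(LBINT xi. W (z, xi)) = (LBINT xi. of_bool (r < xi) * pht (z, xi) + of_bool (r < xi) * ((s - sg xi) * phx (z, xi) - deriv sg xi * ph (z, xi)))"
   using True by (intro int_cong) (auto simp: W_def r_def s_def)
   also have "... = (LBINT xi. of_bool (r < xi) * pht (z, xi)) - vxq z * ph (z, r)"
   unfolding int_add[OF A3 A1(2)] A1(1) s by simp
   also have "... = (LBINT xi. of_bool (r < xi) * pht (z, xi)) + (LBINT xi. of_bool (r < xi) * phx (z, xi) * vxq z)"
   by (simp add: A2(1))
   also have "... = (LBINT xi. of_bool (r < xi) * (pht (z, xi) + phx (z, xi) * vxq z))"
   by (subst int_add[OF A3 i_ml[OF A2(2)], symmetric]) (simp add: alg)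
   also have "... = (LBINT et. ind {0<..M} et * (pht (z, r + et) + phx (z, r + et) * vxq z))"
   by (rule integral_above_shift[OF _ NM]) (simp add: Nt)
   also have "... = (LBINT et. G (z, et))"
   using True by (intro int_cong) (auto simp: G_def r_def alg)
   finally show ?thesis .
   qed (simp add: W_def G_def)
  qed
 qed (use lp_fst(2)[OF iW] lp_fst(2)[OF iG] in auto)
 moreover have "(LBINT y. V y) = (LBINT y. H y)"
  unfolding lp_fst(3)[OF iV, symmetric] lp_fst(3)[OF iH, symmetric]
 proof (rule integral_cong_AE)
  show "AEL x. (LBINT xi. V (x, xi)) = (LBINT et. H (x, et))"
   using uI_bound
  proof eventually_elim
   case (elim x)
   have "N <= uI x + M" using elim KR by (simp add: M_def)
   from integral_above_shift[of N "%xi. ph ((x, 0), xi)", OF Nt(3) this] show ?case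
   by (cases "x \<in> {0<..<1}") (simp_all add: V_def H_def)
  qed
 qed (use lp_fst(2)[OF iV] lp_fst(2)[OF iH] in auto)
 ultimately show ?thesis using GH unfolding W_def V_def pht_def phx_def by simp
qed

end

section \<open>Limits of products, series and primitives\<close>

lemma dct_mult:
 fixes ph :: "'a => real"
 assumes ph: "integrable M ph" and m: "!!n. c n \<in> borel_measurable M" "c' \<in> borel_measurable M"
  and b: "!!n. AE z in M. abs(c n z) <= (Bd :: real)" and l: "AE z in M. (%n. c n z) ----> c' z"
 shows "(%n. \<integral>z. c n z * ph z \<partial>M) ----> (\<integral>z. c' z * ph z \<partial>M)"
proof (rule integral_dominated_convergence)
 have [measurable]: "ph \<in> borel_measurable M" using ph by auto
 note m[measurable]
 show "(%z. c' z * ph z) \<in> borel_measurable M" "(%z. c n z * ph z) \<in> borel_measurable M" for n by measurable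
 show "integrable M (%z. Bd * abs(ph z))" using ph by simp
 show "AE z in M. (%n. c n z * ph z) ----> c' z * ph z" using l by eventually_elim (rule tendsto_mult_right)
 show "AE z in M. norm (c n z * ph z) <= Bd * abs(ph z)" for n
  using b[of n] by eventually_elim (simp add: abs_mult mult_right_mono)
qed

lemma AE_limit_bound:
 assumes "!!n. AE z in M. abs(c n z) <= (Bd :: real)" "AE z in M. (%n. c n z) ----> c' z"
 shows "AE z in M. abs(c' z) <= Bd"
proof -
 have "AE z in M. ALL n. abs(c n z) <= Bd" unfolding AE_all_countable using assms(1) by blast
 with assms(2) show ?thesis
 proof eventually_elim
  case (elim z)
  show ?case by (rule LIMSEQ_le_const2[OF tendsto_rabs[OF elim(1)]]) (use elim(2) in blast)
 qed
qed

lemma weakstar_strong: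
 assumes "!!n. c n \<in> BM" "c' \<in> BM"
  and "!!n. AEL z. abs(c n z) <= Bd" "AEL z. (%n. c n z) ----> c' z"
 shows "weakstar c c'"
 unfolding weakstar_def using dct_mult[of lborel _ c c' Bd] assms by simp

lemma weakstar_cong_AE:
 assumes w: "weakstar f g" and m: "!!n. f n \<in> BM" "!!n. f' n \<in> BM"
  and ae: "!!n. AEL z. f n z = f' n z"
 shows "weakstar f' g"
 unfolding weakstar_def
proof (intro allI impI)
 fix ph :: "'a => real" assume ph: "L1 ph"
 hence [measurable]: "ph \<in> BM" by auto
 note m[measurable]
 have "(LBINT z. f n z * ph z) = (LBINT z. f' n z * ph z)" for n
  by (rule integral_cong_AE) (use ae[of n] in "measurable, auto elim: eventually_mono")
 thus "(%n. LBINT z. f' n z * ph z) ----> (LBINT z. g z * ph z)" using weakstarD[OF w ph] by simp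
qed

lemma weakstar_diff:
 assumes w: "weakstar f g" "weakstar f' g'" and m: "!!n. f n \<in> BM" "!!n. f' n \<in> BM" "g \<in> BM" "g' \<in> BM"
  and b: "!!n. AEL z. abs(f n z) <= Bd" "!!n. AEL z. abs(f' n z) <= Bd'" "AEL z. abs(g z) <= Bd" "AEL z. abs(g' z) <= Bd'"
 shows "weakstar (%n z. f n z - f' n z) (%z. g z - g' z)"
 unfolding weakstar_def
proof (intro allI impI)
 fix ph :: "'a => real" assume ph: "L1 ph"
 have i: "L1 (%z. h z * ph z)" if "h \<in> BM" "AEL z. abs(h z) <= C" for h C
  by (rule imb(2)[OF ph _ that(2)]) (use that(1) in simp)
 show "(%n. LBINT z. (f n z - f' n z) * ph z) ----> (LBINT z. (g z - g' z) * ph z)"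
  unfolding left_diff_distrib int_diff[OF i[OF m(1) b(1)] i[OF m(2) b(2)]] int_diff[OF i[OF m(3) b(3)] i[OF m(4) b(4)]]
  by (intro tendsto_diff weakstarD w ph)
qed

text \<open>In f n * s n the factor s n is replaced by its limit: the error vanishes in L^1 against
  \<open>ph\<close> by dominated convergence, and the main term pairs f n with the fixed integrable
  function \<open>s' * ph\<close>.\<close>

lemma weakstar_mult_strong:
 assumes w: "weakstar f g" and m: "!!n. f n \<in> BM" "!!n. s n \<in> BM" "s' \<in> BM"
  and b: "!!n. AEL z. abs(f n z) <= Bd" "!!n. AEL z. abs(s n z) <= Bs" and l: "AEL z. (%n. s n z) ----> s' z"
 shows "weakstar (%n z. f n z * s n z) (%z. g z * s' z)"
 unfolding weakstar_def
proof (intro allI impI)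
 fix ph :: "'a => real" assume ph: "L1 ph"
 note m[measurable]
 have [measurable]: "ph \<in> BM" using ph by auto
 have bs: "AEL z. abs(s' z) <= Bs" by (rule AE_limit_bound[OF b(2) l])
 have i_s: "L1 (%z. s' z * ph z)" by (rule imb(2)[OF ph _ bs]) simp
 have isn: "L1 (%z. s n z * ph z)" for n by (rule imb(2)[OF ph _ b(2)]) simp
 have i1: "L1 (%z. f n z * (s' z * ph z))" for n by (rule imb(2)[OF i_s _ b(1)]) simp
 have i2: "L1 (%z. f n z * (s n z * ph z))" for n by (rule imb(2)[OF isn _ b(1)]) simp
 have "(%n. LBINT z. (f n z * (s n z - s' z)) * ph z) ----> (LBINT z. 0 * ph z)"
 proof (rule dct_mult[OF ph])
  show "(%z. f n z * (s n z - s' z)) \<in> BL" for n by measurable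
  show "AEL z. abs(f n z * (s n z - s' z)) <= abs(Bd) * (2 * abs(Bs))" for n
   using b(1)[of n] b(2)[of n] bs
  proof eventually_elim
   case (elim z)
   have "abs(f n z) * abs(s n z - s' z) <= abs(Bd) * (2 * abs(Bs))" by (rule mult_mono) (use elim in auto)
   thus ?case by (simp add: abs_mult)
  qed
  have "AEL z. ALL n. abs(f n z) <= Bd" unfolding AE_all_countable using b(1) by blast
  with l show "AEL z. (%n. f n z * (s n z - s' z)) ----> 0"
  proof eventually_elim
   case (elim z)
   have "(%n. Bd * abs(s n z - s' z)) ----> Bd * abs(s' z - s' z)" using elim(1) by (intro tendsto_intros)
   hence "(%n. Bd * abs(s n z - s' z)) ----> 0" by simp
   thus ?case by (rule Lim_null_comparison[rotated]) (use elim(2) in "auto simp: abs_mult intro!: always_eventually mult_right_mono")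
  qed
 qed simp
 hence d: "(%n. (LBINT z. f n z * (s n z * ph z)) - (LBINT z. f n z * (s' z * ph z))) ----> 0"
  by (subst int_diff[OF i2 i1, symmetric]) (simp add: alg)
 show "(%n. LBINT z. f n z * s n z * ph z) ----> (LBINT z. g z * s' z * ph z)"
  using tendsto_add[OF d weakstarD[OF w i_s]] by (simp add: mult.assoc)
qed

lemma weakstar_Linf_I:
 assumes A: "A \<in> sets borel" and m: "!!n. (%z. ind A z * F n z) \<in> BM" "(%z. ind A z * G z) \<in> BM"
  and b: "!!n. AEL z. abs(ind A z * F n z) <= Bd" "AEL z. abs(ind A z * G z) <= Bd"
  and w: "weakstar (%n z. ind A z * F n z) (%z. ind A z * G z)"
 shows "weakstar_Linf A F G"
 unfolding weakstar_Linf_def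
proof (intro conjI allI impI)
 have L: "Linf A f" if "(%z. ind A z * f z) \<in> BM" "AEL z. abs(ind A z * f z) <= Bd" for f
  unfolding Linf_def Linf_bound_def set_measurable_real
 proof (intro exI[of _ Bd] conjI that(1))
  show "AE z\<in>A in lborel. abs(f z) <= Bd" using that(2) by eventually_elim auto
 qed
 show "Linf A (F n)" "Linf A G" for n by (rule L; fact m b)+
 fix ph :: "'a => real" assume "set_integrable lborel A ph"
 hence i: "L1 (%z. ind A z * ph z)" by (simp add: set_integrable_real)
 have "ind A z * (h z * ph z) = ind A z * h z * (ind A z * ph z)" for h and z by (simp add: ind_def)
 thus "(%n. LINT z:A|lborel. F n z * ph z) ----> (LINT z:A|lborel. G z * ph z)"
  using weakstarD[OF w i] by (simp only: set_integral_real)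
qed

text \<open>Almost every level converges when tested in z alone. Fubini and dominated convergence in
  xi then admit test functions of both variables, as the kinetic equation requires.\<close>

lemma (in young_limit) weakstar_product:
 "weakstar (%n y. ind A (fst y) * of_bool (u n (fst y) < snd y)) (%y. ind A (fst y) * F (fst y) (snd y))"
 unfolding weakstar_def
proof (intro allI impI)
 fix ph :: "'a * real => real" assume ph: "L1 ph"
 note um[measurable] A(1)[measurable]
 have m1: "(%y. ind A (fst y) * of_bool (u n (fst y) < snd y) :: real) \<in> BM" for n
 proof -
  have "(%y. ind A (fst y) * of_bool (u n (fst y) < snd y) :: real) \<in> BM2" by measurable
  thus ?thesis unfolding borel_prod .
 qed
 have m2: "(%y. ind A (fst y) * F (fst y) (snd y)) \<in> BM"
 proof -
  have [measurable]: "(%x. F (fst x) (snd x)) \<in> BM2" using Fm unfolding borel_prod .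
  have "(%y. ind A (fst y) * F (fst y) (snd y)) \<in> BM2" by measurable
  thus ?thesis unfolding borel_prod .
 qed
 have i1: "L1 (%y. (ind A (fst y) * of_bool (u n (fst y) < snd y)) * ph y)" for n
  by (rule imb(2)[OF ph, of _ 1]) (use m1 in "auto simp: ind_def")
 have i2: "L1 (%y. (ind A (fst y) * F (fst y) (snd y)) * ph y)"
  by (rule imb(2)[OF ph, of _ 1]) (use m2 F01 in "auto simp: ind_def")
 have "(%n. LBINT xi. (LBINT z. (ind A z * of_bool (u n z < xi)) * ph (z, xi))) ----> (LBINT xi. (LBINT z. (ind A z * F z xi) * ph (z, xi)))"
 proof (rule integral_dominated_convergence)
  have ia: "L1 (%y. abs(ph y))" using ph by simp
  show "L1 (%xi. LBINT z. abs(ph (z, xi)))" by (rule lp_snd(2)[OF ia])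
  show "AEL xi. (%n. LBINT z. (ind A z * of_bool (u n z < xi)) * ph (z, xi)) ----> (LBINT z. (ind A z * F z xi) * ph (z, xi))"
   using Fw lp_snd(1)[OF ph] by eventually_elim (rule weakstarD)
  show "AEL xi. norm (LBINT z. (ind A z * of_bool (u n z < xi)) * ph (z, xi)) <= (LBINT z. abs(ph (z, xi)))" for n
   using lp_snd(1)[OF i1[of n]] lp_snd(1)[OF ph]
  proof eventually_elim
   case (elim xi)
   have "abs(\<integral>z. (ind A z * of_bool (u n z < xi)) * ph (z, xi) \<partial>lborel) <= (LBINT z. abs((ind A z * of_bool (u n z < xi)) * ph (z, xi)))"
   by (rule iab)
   also have "(LBINT z. abs((ind A z * of_bool (u n z < xi)) * ph (z, xi))) <= (LBINT z. abs(ph (z, xi)))"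
   by (rule integral_mono) (use elim in "auto simp: ind_def")
   finally show ?case by simp
  qed
 qed (use lp_snd(2)[OF i1] lp_snd(2)[OF i2] in auto)
 thus "(%n. LBINT y. (ind A (fst y) * of_bool (u n (fst y) < snd y)) * ph y) ----> (LBINT y. (ind A (fst y) * F (fst y) (snd y)) * ph y)"
  using lp_snd(3)[OF i1] lp_snd(3)[OF i2] by simp
qed

text \<open>Dominated exchange of sum and limit. The point x n varies along with the coefficients,
  so that one statement gives both pointwise convergence of the series and continuity of the
  limit.\<close>

lemma sin_series_tendsto:
 fixes a :: "nat => nat => real"
 assumes l: "!!k. (%n. a n k) ----> a' k" "x ----> x'" and b: "\<forall>\<^sub>F n in sequentially. ALL k. abs(a n k) <= M k" and s: "summable M"
 shows "(%n. sin_series (a n) (x n)) ----> sin_series a' x'"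
proof -
 have "\<forall>\<^sub>F (k, n) in at_top \<times>\<^sub>F sequentially. norm (2 * a n k * sin (real k * pi * x n)) <= 2 * M k"
  unfolding eventually_prod_filter
 proof (intro exI conjI allI impI)
  show "\<forall>\<^sub>F k::nat in at_top. True" by simp
  show "\<forall>\<^sub>F n in sequentially. ALL k. abs(a n k) <= M k" by (rule b)
  fix k n assume "ALL k. abs(a n k) <= M k"
  hence "abs(a n k) * abs(sin (real k * pi * x n)) <= M k * 1" by (intro mult_mono order_trans[OF abs_ge_zero]) auto
  thus "case (k, n) of (k, n) => norm (2 * a n k * sin (real k * pi * x n)) <= 2 * M k" by (simp add: abs_mult)
 qed
 from tannerys_theorem[OF _ this summable_mult[OF s], of "%k. 2 * a' k * sin (real k * pi * x')"]
 show ?thesis unfolding sin_series_def by (simp add: tendsto_intros l)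
qed

text \<open>The continuous versions \<open>V n\<close> of \<open>w n\<close> share the Lipschitz
  constant \<open>La\<close>. The mean of \<open>w n\<close> over a short interval next to x is
  therefore close to \<open>V n x\<close>, uniformly in n, and this mean is a difference quotient of
  primitives, which converge.\<close>

lemma lipschitz_prim_convergent:
 fixes w d :: "nat => real => real" and c :: "nat => real"
 assumes w: "!!n. L1 (w n)" and d: "!!n. L1 (d n)" and b: "!!n. AEL x. abs(d n x) <= La"
  and r: "!!n. AEL x. x \<in> {0<..<1} --> w n x = c n + prim (d n) x"
  and conv: "AEL x. x \<in> {0<..<1} --> convergent (%n. prim (w n) x)"
 shows "AEL x. x \<in> {0<..<1} --> convergent (%n. w n x)"
proof -
 define V where "V = (%n x. c n + prim (d n) x)"
 have L0: "La >= 0"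
 proof -
  obtain x where "abs(d 0 x) <= La" using eventually_happens[OF b[of 0]] by (auto simp: ae_filter_eq_bot_iff)
  thus ?thesis by linarith
 qed
 have lip: "abs(V n y - V n x) <= La * (y - x)" if xy: "x <= y" for n x y
 proof -
  have "V n y - V n x = (LBINT s. ind {x<..y} s * d n s)" using prim_diff[OF d xy] by (simp add: V_def)
  also have "abs(\<integral>s. ind {x<..y} s * d n s \<partial>lborel) <= (LBINT s. abs(ind {x<..y} s * d n s))" by (rule iab)
  finally have 1: "abs(V n y - V n x) <= (LBINT s. abs(ind {x<..y} s * d n s))" .
  have i: "L1 (%s. La * ind {x<..y} s)" by (intro i_mr i_ind) (auto simp: xy)
  have i': "L1 (%s. abs(ind {x<..y} s * d n s))" by (intro integrable_abs i_im d) auto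
  have "(LBINT s. abs(ind {x<..y} s * d n s)) <= (LBINT s. La * ind {x<..y} s)"
  proof (rule integral_mono_AE[OF i' i])
   show "AEL s. abs(ind {x<..y} s * d n s) <= La * ind {x<..y} s"
   using b[of n] by eventually_elim (simp add: ind_def)
  qed
  also have "(LBINT s. La * ind {x<..y} s) = La * (y - x)" using xy by simp
  finally show ?thesis using 1 by linarith
 qed
 have cauchy: "Cauchy (%n. V n x)" if x: "x \<in> {0<..<1}" for x
  unfolding Cauchy_iff2
 proof
  fix j :: nat
  define e where "e = inverse (real (Suc j))"
  have e: "e > 0" by (simp add: e_def)
  \<comment> \<open>Small enough for \<open>V n\<close> to vary by at most e/4 on the interval from
    x to x + de, and for that interval to stay within the unit interval.\<close>
  define de where "de = min (1 - x) (e / (4 * (La + 1)))"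
  have de: "de > 0" "x + de <= 1" "La * de <= e / 4"
  proof -
   show "de > 0" using x e L0 by (simp add: de_def)
   show "x + de <= 1" by (simp add: de_def)
   have "La * de <= (La + 1) * (e / (4 * (La + 1)))" using L0 \<open>de > 0\<close> by (intro mult_mono) (auto simp: de_def)
   moreover have "l * (e / (4 * l)) = e / 4" if "l > 0" for l :: real using that by simp
   from this[of "La + 1"] have "(La + 1) * (e / (4 * (La + 1))) = e / 4" using L0 by auto
   ultimately show "La * de <= e / 4" by linarith
  qed
  \<comment> \<open>The primitives converge at almost every point only, so the end points p and q of
    the averaging interval are picked from the set of full measure.\<close>
  have good: "EX y. p < y & y < q & convergent (%n. prim (w n) y)" if pq: "0 < p" "p < q" "q <= 1" for p q
  proof (rule ccontr)
   assume "~ ?thesis"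
   with conv have "AEL y. y ~: {p<..<q}" by (elim eventually_mono) (use pq in auto)
   hence "emeasure lborel {p<..<q} = 0" by (intro AE_iff_measurable[THEN iffD1, rotated 2]) auto
   thus False using pq by simp
  qed
  obtain p where p: "x < p" "p < x + de / 2" "convergent (%n. prim (w n) p)" using good[of x "x + de / 2"] x de by auto
  obtain q where q: "x + de / 2 < q" "q < x + de" "convergent (%n. prim (w n) q)" using good[of "x + de / 2" "x + de"] x de by auto
  have pq: "p < q" "p <= q" using p q by auto
  have "convergent (%n. prim (w n) q - prim (w n) p)" using q(3) p(3) by (rule convergent_diff)
  hence "Cauchy (%n. prim (w n) q - prim (w n) p)" by (rule convergent_Cauchy)
  then obtain N where N: "!!m n. m >= N ==> n >= N ==> abs((prim (w m) q - prim (w m) p) - (prim (w n) q - prim (w n) p)) < e / 2 * (q - p)"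
   using CauchyD[of _ "e / 2 * (q - p)"] e pq by fastforce
  have close: "abs((prim (w n) q - prim (w n) p) - (q - p) * V n x) <= (q - p) * (e / 4)" for n
  proof -
   have i: "L1 (%s. ind {p<..q} s * w n s)" by (intro i_im w) auto
   have i2: "L1 (%s. ind {p<..q} s * V n x)" by (intro i_ml i_ind) (auto simp: pq)
   have "(prim (w n) q - prim (w n) p) - (q - p) * V n x = (LBINT s. ind {p<..q} s * w n s - ind {p<..q} s * V n x)"
   unfolding int_diff[OF i i2] prim_diff[OF w pq(2)] using pq by simp
   also have "abs(\<integral>s. ind {p<..q} s * w n s - ind {p<..q} s * V n x \<partial>lborel) <= (LBINT s. abs(ind {p<..q} s * w n s - ind {p<..q} s * V n x))" by (rule iab)
   finally have 1: "abs((prim (w n) q - prim (w n) p) - (q - p) * V n x) <= (LBINT s. abs(ind {p<..q} s * w n s - ind {p<..q} s * V n x))" .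
   have i3: "L1 (%s. ind {p<..q} s * (e / 4))" by (intro i_ml i_ind) (auto simp: pq)
   have "(LBINT s. abs(ind {p<..q} s * w n s - ind {p<..q} s * V n x)) <= (LBINT s. ind {p<..q} s * (e / 4))"
   proof (rule integral_mono_AE[OF integrable_abs[OF i_diff[OF i i2]] i3])
   show "AEL s. abs(ind {p<..q} s * w n s - ind {p<..q} s * V n x) <= ind {p<..q} s * (e / 4)"
   using r[of n]
   proof eventually_elim
   case (elim s)
   show ?case
   proof (cases "s \<in> {p<..q}")
   case True
   hence s: "x <= s" "s - x <= de" "s \<in> {0<..<1}" using p q x de by auto
   have "abs(V n s - V n x) <= La * (s - x)" by (rule lip[OF s(1)])
   also have "La * (s - x) <= La * de" using L0 s(2) by (rule mlm[rotated])
   finally have "abs(V n s - V n x) <= e / 4" using de(3) by linarith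
   moreover have "w n s = V n s" using elim s(3) by (simp add: V_def)
   ultimately show ?thesis using True by simp
   qed simp
   qed
   qed
   also have "(LBINT s. ind {p<..q} s * (e / 4)) = (q - p) * (e / 4)" using pq by simp
   finally show ?thesis using 1 by linarith
  qed
  show "EX M. ALL m>=M. ALL n>=M. abs(V m x - V n x) < inverse (real (Suc j))"
  proof (intro exI allI impI)
   fix m n assume "N <= m" "N <= n"
   have "(q - p) * (V m x - V n x) = (q - p) * V m x - (q - p) * V n x" by (rule right_diff_distrib)
   hence "abs((q - p) * (V m x - V n x)) < (q - p) * (e / 4) + (q - p) * (e / 4) + e / 2 * (q - p)"
   using close[of m] close[of n] N[OF \<open>N <= m\<close> \<open>N <= n\<close>] by linarith
   also have "... = (q - p) * e" by (simp add: field_simps)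
   finally have "(q - p) * abs(V m x - V n x) < (q - p) * e" using pq by (simp add: abs_mult)
   thus "abs(V m x - V n x) < inverse (real (Suc j))" using pq by (simp add: e_def)
  qed
 qed
 have "AEL x. ALL n. x \<in> {0<..<1} --> w n x = V n x" unfolding AE_all_countable V_def using r by blast
 thus ?thesis
 proof eventually_elim
  case (elim x)
  show ?case
  proof
   assume x: "x \<in> {0<..<1}"
   hence "(%n. w n x) = (%n. V n x)" using elim by auto
   thus "convergent (%n. w n x)" using cauchy[OF x] by (simp add: Cauchy_convergent)
  qed
 qed
qed

text \<open>Turns bounds valid almost everywhere into bounds at every point, as the compactness
  results require, while changing the functions on null sets only.\<close>

definition clip :: "real => real => real" where "clip R x = max (- R) (min R x)"

lemma clip_bound: "R >= 0 ==> abs(clip R x) <= R" and clip_eq: "abs(x) <= R ==> clip R x = x"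
 by (auto simp: clip_def)

lemma clip_measurable[measurable]: "f \<in> borel_measurable M ==> (%x. clip R (f x)) \<in> borel_measurable M"
 unfolding clip_def by (intro borel_measurable_max borel_measurable_min borel_measurable_const)

lemma sinc_bound:
 assumes f: "L1 f" "!!x. x ~: {0<..<1} ==> f x = 0" "AEL x. abs(f x) <= C"
 shows "abs(sinc k f) <= C"
proof -
 have "abs(sinc k f) <= (LBINT x. abs(f x * sin (real k * pi * x)))" unfolding sinc_def by (rule iab)
 also have "(LBINT x. abs(f x * sin (real k * pi * x))) <= (LBINT x. ind {0<..<1::real} x * C)"
 proof (rule integral_mono_AE[OF integrable_abs[OF i_trig(1)[OF f(1)]]])
  show "L1 (%x. ind {0<..<1::real} x * C)" by (intro i_ml i01)
  show "AEL x. abs(f x * sin (real k * pi * x)) <= ind {0<..<1} x * C"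
   using f(3)
  proof eventually_elim
   case (elim x)
   have "abs(f x) * abs(sin (real k * pi * x)) <= C * 1" using elim by (intro mult_mono) auto
   thus ?case using f(2)[of x] by (cases "x \<in> {0<..<1}") (simp_all add: abs_mult)
  qed
 qed
 finally show ?thesis by simp
qed

lemma eig_nonneg: "0 <= eig k" by (simp add: eig_def)

text \<open>The Duhamel integral of a sine mode is the pairing of F with one fixed bounded function
  of (x, t), so it passes to weak-* limits at every single t.\<close>

lemma duh_sc:
 assumes F: "L1 F"
 shows "duh k (sc k F) t = (LBINT z. F z * (sin (real k * pi * fst z) * (ind {0<..t} (snd z) * exp (- eig k * (t - snd z)))))"
proof -
 have "(LBINT z. F z * (sin (real k * pi * fst z) * (ind {0<..t} (snd z) * exp (- eig k * (t - snd z))))) = (LBINT s. sc k F s * (ind {0<..t} s * exp (- eig k * (t - s))))"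
 proof (rule sc_fubini(1)[OF F, where C=1])
  show "abs(ind {0<..t} s * exp (- eig k * (t - s))) <= 1" for s
   using mult_nonneg_nonneg[OF eig_nonneg[of k], of "t - s"] by (auto simp: ind_def)
 qed measurable
 thus ?thesis unfolding duh_eq by (simp add: mult_ac)
qed

text \<open>The bound depends only on sup bounds of the data and, for t > 0, is summable in k. It is
  the majorant for all limits of the stress series.\<close>

lemma mode_bound:
 assumes f: "L1 f" "!!x. x ~: {0<..<1} ==> f x = 0" "AEL x. abs(f x) <= C"
  and g: "L1 g" "!!x t. x ~: {0<..<1} ==> g (x, t) = 0" "AEL z. abs(g z) <= G" and t: "t >= 0"
 shows "abs(exp (- eig k * t) * sinc k f + duh k (sc k g) t) <= C * exp (- eig k * t) + G / eig k"
proof -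
 have "abs(duh k (sc k g) t) <= G / eig k"
 proof (cases "k = 0")
  case True
  have "sc 0 g = (%t. 0)" by (rule ext) (simp add: sc_def sinc_0)
  thus ?thesis using True by (simp add: duh_def eig_def)
 next
  case False
  have "AEL s. abs(sc k g s) <= G"
   using lp_snd(1)[OF g(1)] AE_pairD(2)[OF g(3)] unfolding sc_def
   by eventually_elim (rule sinc_bound, use g(2) in auto)
  thus ?thesis by (rule duh_bound[OF integrable_sc(1)[OF g(1)] _ t eig_pos[OF False]])
 qed
 moreover have "abs(exp (- eig k * t) * sinc k f) <= C * exp (- eig k * t)"
  using mult_right_mono[OF sinc_bound[OF f, of k], of "exp (- eig k * t)"] by (simp add: abs_mult mult.commute)
 ultimately show ?thesis by linarith
qed

section \<open>Limits of the stress and of functions of the deformation\<close>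

locale sol_sequence =
 fixes sg :: "real => real" and u0 v0 v0x :: "nat => real => real" and u v vx :: "nat => real * real => real" and T K E m0 R Cs Cd :: real
 assumes sol: "energy_sol sg (u0 n) (v0 n) (v0x n) (u n) (v n) (vx n) T K E m0 R Cs Cd"

sublocale sol_sequence \<subseteq> s: energy_sol sg "u0 n" "v0 n" "v0x n" "u n" "v n" "vx n" T K E m0 R Cs Cd for n by (rule sol)

context sol_sequence begin

definition G :: real where "G = abs(Cd) * s.La"

lemma g_bound: "AEL z. abs(s.gq n z) <= G"
 using s.u_bound[of n] s.vx_bound[of n]
proof eventually_elim
 case (elim z)
 have "abs(deriv sg (s.uq n z)) * abs(s.vxq n z) <= abs(Cd) * s.La"
  by (rule mult_mono) (use elim s.Cd[OF elim(1)] in auto)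
 thus ?case by (simp add: G_def s.gq_def abs_mult)
qed

end

text \<open>The function \<open>gL\<close> is just some weak-* limit of the forcing; it is not
  related to F here and serves only to define the limit stress. That the forcing tends to an
  integral against the Young measure is derived afterwards in \<open>weakstar_g\<close>. The
  convergence to \<open>v0L\<close> provides convergent primitives of the initial
  velocities.\<close>

locale limit_sol = sol_sequence +
 fixes F :: "real * real => real => real" and F0 :: "real => real => real" and gL :: "real * real => real" and sL v0L :: "real => real"
 assumes Y: "young_limit (Q T) (%n z. clip R (s.uq n z)) R F" and Y0: "young_limit {0<..<1} (%n x. clip R (s.uI n x)) R F0"
  and gw: "weakstar (%n. s.gq n) gL" and gm: "gL \<in> BM" and gb: "!!z. abs(gL z) <= G" and gz: "!!z. z ~: Q T ==> gL z = 0"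
  and sw: "weakstar (%n. s.sI n) sL" and slm: "sL \<in> BM" and sb: "!!x. abs(sL x) <= Cs + K" and sz: "!!x. x ~: {0<..<1} ==> sL x = 0"
  and vw: "weakstar (%n. s.vI n) v0L"

sublocale limit_sol \<subseteq> y: young_limit "Q T" "%n z. clip R (s.uq n z)" R F by (rule Y)
sublocale limit_sol \<subseteq> y0: young_limit "{0<..<1}" "%n x. clip R (s.uI n x)" R F0 by (rule Y0)

context limit_sol begin

lemma integrable_gL: "L1 gL"
 by (rule ibf[OF _ Q_sets[of T, folded sets_lborel] Q_finite gb gz]) (use gm in simp)

lemma integrable_sL: "L1 sL"
 by (rule ibf[of _ _ "{0<..<1}", OF _ _ _ sb sz]) (use slm in auto)

definition SmL :: "nat => real => real" where "SmL k t = exp (- eig k * t) * sinc k sL + duh k (sc k gL) t"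

text \<open>Defining the limit by its series at every point singles out the continuous
  representative; it vanishes at x = 0 and x = 1 term by term.\<close>

definition Sl :: "real * real => real" where "Sl z = sin_series (%k. SmL k (snd z)) (fst z)"

text \<open>Each mode consists of two weak-* pairings. Test functions must be integrable, which
  sines on the whole line are not; the indicators of (0, 1) and of \<open>Q T\<close> can be
  inserted because the solutions and the limits vanish outside.\<close>

lemma sm_tendsto: "(%n. s.sm n k t) ----> SmL k t"
proof -
 have i: "L1 (%x. ind {0<..<1::real} x * sin (real k * pi * x))"
  by (rule i_trig(1)[OF i01])
 have e: "(%x. f x * sin (real k * pi * x)) = (%x. f x * (ind {0<..<1} x * sin (real k * pi * x)))" if "!!x. x ~: {0<..<1} ==> f x = 0" for f :: "real => real"
 proof (rule ext)
  fix x show "f x * sin (real k * pi * x) = f x * (ind {0<..<1} x * sin (real k * pi * x))"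
   using that[of x] by (cases "x \<in> {0<..<1}") simp_all
 qed
 have "(%n. sinc k (s.sI n)) ----> sinc k sL"
 proof -
  have "(%x. sL x * sin (real k * pi * x)) = (%x. sL x * (ind {0<..<1} x * sin (real k * pi * x)))" by (rule e) (rule sz)
  moreover have "(%x. s.sI n x * sin (real k * pi * x)) = (%x. s.sI n x * (ind {0<..<1} x * sin (real k * pi * x)))" for n by (rule e) (rule s.sI_props(3))
  ultimately show ?thesis using weakstarD[OF sw i] unfolding sinc_def by simp
 qed
 moreover have "(%n. duh k (sc k (s.gq n)) t) ----> duh k (sc k gL) t"
 proof -
  define ps where "ps = (%z::real * real. sin (real k * pi * fst z) * (ind {0<..t} (snd z) * exp (- eig k * (t - snd z))))"
  have "ps \<in> BM2" unfolding ps_def by measurable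
  hence m: "ps \<in> BL" unfolding borel_prod by simp
  have b: "abs(ps z) <= 1" for z
  proof -
   have "abs(sin (real k * pi * fst z)) * abs(ind {0<..t} (snd z) * exp (- eig k * (t - snd z))) <= 1 * 1"
   using mult_nonneg_nonneg[OF eig_nonneg[of k], of "t - snd z"] by (intro mult_mono) (auto simp: ind_def)
   thus ?thesis by (simp add: ps_def abs_mult)
  qed
  have iQ: "L1 (ind (Q T) :: real * real => real)" using Q_finite by (intro i_ind) auto
  have i: "L1 (%z. ind (Q T) z * ps z)" by (rule imb(1)[OF iQ m, of 1]) (use b in simp)
  have e: "(%z. f z * ps z) = (%z. f z * (ind (Q T) z * ps z))" if "!!z. z ~: Q T ==> f z = 0" for f :: "real * real => real"
  proof (rule ext)
   fix z show "f z * ps z = f z * (ind (Q T) z * ps z)" using that[of z] by (cases "z \<in> Q T") simp_all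
  qed
  have "(%z. gL z * ps z) = (%z. gL z * (ind (Q T) z * ps z))" by (rule e) (rule gz)
  moreover have "(%z. s.gq n z * ps z) = (%z. s.gq n z * (ind (Q T) z * ps z))" for n by (rule e) (rule s.gq_outside(1))
  moreover have "duh k (sc k gL) t = (LBINT z. gL z * ps z)" "duh k (sc k (s.gq n)) t = (LBINT z. s.gq n z * ps z)" for n
   unfolding ps_def by (rule duh_sc[OF integrable_gL], rule duh_sc[OF s.integrable_g])
  ultimately show ?thesis using weakstarD[OF gw i] by simp
 qed
 ultimately show ?thesis unfolding s.sm_def SmL_def by (intro tendsto_intros)
qed

lemma sm_bounds:
 assumes "t >= 0"
 shows "abs(s.sm n k t) <= (Cs + K) * exp (- eig k * t) + G / eig k" "abs(SmL k t) <= (Cs + K) * exp (- eig k * t) + G / eig k"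
proof -
 have "x ~: {0<..<1} ==> gL (x, t) = 0" for x t by (rule gz) (auto simp: Q_def)
 thus "abs(SmL k t) <= (Cs + K) * exp (- eig k * t) + G / eig k"
  unfolding SmL_def by (intro mode_bound integrable_sL sz integrable_gL assms) (use sb gb in auto)
 show "abs(s.sm n k t) <= (Cs + K) * exp (- eig k * t) + G / eig k"
  unfolding s.sm_def by (intro mode_bound s.sI_props s.integrable_g s.gq_outside(3) assms g_bound)
qed

lemma summable_bounds: "t > 0 ==> summable (%k. (Cs + K) * exp (- eig k * t) + G / eig k)"
 using summable_mult[OF summable_inverse_eig, of G] by (intro summable_add summable_mult summable_exp_eig) auto

lemma stress_measurable[measurable]: "Sl \<in> BM" "s.sq n \<in> BM"
proof -
 have [measurable]: "sc k gL \<in> BM" for k using integrable_sc(1)[OF integrable_gL] by auto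
 have [measurable]: "duh k (sc k gL) \<in> BM" for k by (rule duh_measurable) measurable
 have [measurable]: "SmL k \<in> BM" for k unfolding SmL_def[abs_def] by measurable
 show "Sl \<in> BM" unfolding Sl_def[abs_def] by (rule s.sin_series_measurable) (rule s.fst_snd_measurable(2), measurable)
 show "s.sq n \<in> BM" by (rule s.meas)
qed

lemma stress_tendsto: "AEL z. (%n. s.sq n z) ----> ind (Q T) z * Sl z"
proof -
 have "AEL z. ALL n. z \<in> Q T --> s.sq n z = sin_series (%k. s.sm n k (snd z)) (fst z)"
  unfolding AE_all_countable by (intro allI eventually_mono[OF s.stress_series]) blast
 thus ?thesis
 proof eventually_elim
  case (elim z)
  show ?case
  proof (cases "z \<in> Q T")
   case True
   hence t: "snd z > 0" by (auto simp: Q_def)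
   have "(%n. sin_series (%k. s.sm n k (snd z)) (fst z)) ----> Sl z"
   unfolding Sl_def by (rule sin_series_tendsto[OF sm_tendsto tendsto_const _ summable_bounds[OF t]]) (use sm_bounds(1) t in simp)
   thus ?thesis using elim True by simp
  qed (simp add: s.sq_def s.outside)
 qed
qed

lemma stress_bounds: "AEL z. abs(s.sq n z) <= abs(s.L)" "AEL z. abs(ind (Q T) z * Sl z) <= abs(s.L)"
proof -
 show 1: "AEL z. abs(s.sq n z) <= abs(s.L)" for n using s.stress_series[of n]
 proof eventually_elim
  case (elim z) thus ?case by (cases "z \<in> Q T") (auto simp: s.outside s.sq_def)
 qed
 show "AEL z. abs(ind (Q T) z * Sl z) <= abs(s.L)" by (rule AE_limit_bound[OF 1 stress_tendsto])
qed

text \<open>Close to a point of positive time all times exceed half of it, so the majorant taken at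
  that half dominates the series in a neighbourhood. There is no such majorant down to t =
  0.\<close>

lemma Sl_continuous: "continuous_on ({0..1} \<times> {0<..T}) Sl"
proof (rule continuous_on_sequentiallyI)
 fix z :: "nat => real * real" and a
 assume z: "ALL n. z n \<in> {0..1} \<times> {0<..T}" and a: "a \<in> {0..1} \<times> {0<..T}" and l: "z ----> a"
 define de where "de = snd a / 2"
 have de: "de > 0" "de < snd a" using a by (auto simp: de_def)
 have lx: "(%n. fst (z n)) ----> fst a" and lt: "(%n. snd (z n)) ----> snd a" using l by (auto intro: tendsto_intros)
 show "(%n. Sl (z n)) ----> Sl a"
  unfolding Sl_def
 proof (rule sin_series_tendsto[OF _ lx _ summable_bounds[OF de(1)]])
  fix k
  have zt: "sc k gL t = 0" if "t ~: {0<..T}" for t by (rule sc_zero(1), rule gz) (use that in "auto simp: Q_def")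
  have "continuous_on {..T} (SmL k)"
   unfolding SmL_def[abs_def] by (intro cints continuous_duh[OF integrable_sc(1)[OF integrable_gL]]) (use zt in auto)
  thus "(%n. SmL k (snd (z n))) ----> SmL k (snd a)"
   by (rule continuous_on_tendsto_compose[OF _ lt]) (use z a in "auto simp: mem_Times_iff")
 next
  have "\<forall>\<^sub>F n in sequentially. snd (z n) > de" by (rule order_tendstoD(1)[OF lt de(2)])
  thus "\<forall>\<^sub>F n in sequentially. ALL k. abs(SmL k (snd (z n))) <= (Cs + K) * exp (- eig k * de) + G / eig k"
  proof eventually_elim
   case (elim n)
   show ?case
   proof
   fix k
   have "0 <= Cs + K" using sb[of 0] by linarith
   hence "(Cs + K) * exp (- eig k * snd (z n)) <= (Cs + K) * exp (- eig k * de)"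
   using elim eig_nonneg[of k] by (intro mlm) (auto intro: mlm)
   thus "abs(SmL k (snd (z n))) <= (Cs + K) * exp (- eig k * de) + G / eig k"
   using sm_bounds(2)[of "snd (z n)" k] elim de by linarith
   qed
  qed
 qed
qed

lemma Sl_boundary: "Sl (0, t) = 0" "Sl (1, t) = 0"
 by (simp_all add: Sl_def sin_series_def)

lemma weakstar_stress: "weakstar s.sq (%z. ind (Q T) z * Sl z)"
 by (rule weakstar_strong[OF stress_measurable(2) _ stress_bounds(1) stress_tendsto]) measurable

text \<open>The weak-* limit of \<open>be\<close> of the deformation, given by the Young
  measure.\<close>

definition bar :: "(real => real) => real * real => real" where "bar be z = (\<integral>r. be r \<partial>y.nu z)"

lemma bar_measurable: "continuous_on UNIV be ==> bar be \<in> BM"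
 unfolding bar_def[abs_def] by (rule y.nu_integral_measurable)

lemma continuous_clip_bound:
 assumes "continuous_on UNIV (be :: real => real)"
 obtains C where "!!z. abs(bar be z) <= C" "!!r. abs(r) <= R ==> abs(be r) <= C"
proof -
 obtain C where C: "!!z. abs(bar be z) <= C" "!!x. x \<in> {- R - 1..R + 1} ==> abs(be x) <= C"
  unfolding bar_def by (rule y.nu_integral_bound[OF assms]) blast
 have "abs(r) <= R ==> r \<in> {- R - 1..R + 1}" for r by auto
 thus ?thesis using C by (intro that) auto
qed

text \<open>The Young measure was generated by the truncated deformations, which coincide with the
  original ones almost everywhere by the uniform bound.\<close>

lemma weakstar_bar:
 assumes be: "continuous_on UNIV be"
 shows "weakstar (%n z. ind (Q T) z * be (s.uq n z)) (%z. ind (Q T) z * bar be z)"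
proof (rule weakstar_cong_AE)
 have [measurable]: "be \<in> BM" by (rule bm_cont[OF be])
 show "weakstar (%n z. ind (Q T) z * be (clip R (s.uq n z))) (%z. ind (Q T) z * bar be z)"
  unfolding bar_def by (rule y.weakstar_nu[OF be])
 show "(%z. ind (Q T) z * be (clip R (s.uq n z))) \<in> BM" "(%z. ind (Q T) z * be (s.uq n z)) \<in> BM" for n
  using s.meas(1)[of n] by measurable
 show "AEL z. ind (Q T) z * be (clip R (s.uq n z)) = ind (Q T) z * be (s.uq n z)" for n
  using s.u_bound[of n] by eventually_elim (simp add: clip_eq)
qed

lemma bar_bounds:
 assumes "continuous_on UNIV be"
 obtains C where "C >= 0" "!!n. AEL z. abs(ind (Q T) z * be (s.uq n z)) <= C" "!!z. abs(ind (Q T) z * bar be z) <= C"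
  "!!n. (%z. ind (Q T) z * be (s.uq n z)) \<in> BM" "(%z. ind (Q T) z * bar be z) \<in> BM"
proof -
 have [measurable]: "be \<in> BM" by (rule bm_cont[OF assms])
 have [measurable]: "bar be \<in> BM" by (rule bar_measurable[OF assms])
 obtain C where C: "!!z. abs(bar be z) <= C" "!!r. abs(r) <= R ==> abs(be r) <= C" by (rule continuous_clip_bound[OF assms]) blast
 have C0: "C >= 0" using C(1)[of undefined] by linarith
 show ?thesis
 proof (rule that[OF C0])
  show "AEL z. abs(ind (Q T) z * be (s.uq n z)) <= C" for n
   using s.u_bound[of n] by eventually_elim (use C C0 in "auto simp: ind_def")
  show "(%z. ind (Q T) z * be (s.uq n z)) \<in> BM" for n using s.meas(1)[of n] by measurable
 qed (use C C0 in "auto simp: ind_def")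
qed

lemma weakstar_f: "weakstar s.fq (%z. ind (Q T) z * bar sg z)"
proof -
 have "(%z. ind (Q T) z * sg (s.uq n z)) = s.fq n" for n
  by (rule ext) (simp add: s.fq_def s.uq_def ind_def)
 thus ?thesis using weakstar_bar[OF s.sg_cont] by simp
qed

text \<open>Introduced through the constitutive relation; \<open>vl_weak_derivative\<close> shows
  that it is the weak x-derivative of the limit velocity.\<close>

definition vlx :: "real * real => real" where "vlx z = Sl z - bar sg z"

lemma weakstar_vx: "weakstar s.vxq (%z. ind (Q T) z * vlx z)"
proof -
 have e: "(%z. ind (Q T) z * sg (s.uq n z)) = s.fq n" for n
  by (rule ext) (simp add: s.fq_def s.uq_def ind_def)
 obtain C where C: "C >= 0" "!!n. AEL z. abs(ind (Q T) z * sg (s.uq n z)) <= C" "!!z. abs(ind (Q T) z * bar sg z) <= C"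
  "!!n. (%z. ind (Q T) z * sg (s.uq n z)) \<in> BM" "(%z. ind (Q T) z * bar sg z) \<in> BM"
  by (rule bar_bounds[OF s.sg_cont]) blast
 have "weakstar (%n z. s.sq n z - s.fq n z) (%z. ind (Q T) z * Sl z - ind (Q T) z * bar sg z)"
  by (rule weakstar_diff[OF weakstar_stress weakstar_f _ _ _ _ stress_bounds(1) _ stress_bounds(2), of C]) (use C in "simp_all flip: e")
 thus ?thesis by (simp add: s.sq_def vlx_def alg)
qed

definition gbar :: "real * real => real" where "gbar z = (\<integral>r. deriv sg r * (Sl z - sg r) \<partial>y.nu z)"

lemma gbar_eq: "gbar z = bar (deriv sg) z * Sl z - bar (%r. deriv sg r * sg r) z"
proof -
 have "integrable (y.nu z) (%r. deriv sg r * Sl z)" "integrable (y.nu z) (%r. deriv sg r * sg r)"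
  by (intro y.integrable_nu cints s.sgc s.sg_cont)+
 thus ?thesis unfolding gbar_def bar_def right_diff_distrib by (simp add: int_diff)
qed

text \<open>With v_x = S - sg(u) the forcing is sg'(u) S - sg'(u) sg(u). The first product has the
  strongly convergent factor S, and the second is a continuous function of u alone, so the Young
  measure yields both limits.\<close>

lemma weakstar_g: "weakstar s.gq (%z. ind (Q T) z * gbar z)"
 and gbar_bound: "EX C. AEL z. abs(ind (Q T) z * gbar z) <= C" and gbar_measurable: "(%z. ind (Q T) z * gbar z) \<in> BM"
proof -
 have c: "continuous_on UNIV (%r. deriv sg r * sg r)" by (intro cints s.sgc s.sg_cont)
 obtain C where C: "C >= 0" "!!n. AEL z. abs(ind (Q T) z * deriv sg (s.uq n z)) <= C" "!!z. abs(ind (Q T) z * bar (deriv sg) z) <= C"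
  "!!n. (%z. ind (Q T) z * deriv sg (s.uq n z)) \<in> BM" "(%z. ind (Q T) z * bar (deriv sg) z) \<in> BM"
  by (rule bar_bounds[OF s.sgc]) blast
 obtain D where D: "D >= 0" "!!n. AEL z. abs(ind (Q T) z * (deriv sg (s.uq n z) * sg (s.uq n z))) <= D" "!!z. abs(ind (Q T) z * bar (%r. deriv sg r * sg r) z) <= D"
  "!!n. (%z. ind (Q T) z * (deriv sg (s.uq n z) * sg (s.uq n z))) \<in> BM" "(%z. ind (Q T) z * bar (%r. deriv sg r * sg r) z) \<in> BM"
  by (rule bar_bounds[OF c]) blast
 have Sm: "(%z. ind (Q T) z * Sl z) \<in> BM" by measurable
 have w: "weakstar (%n z. (ind (Q T) z * deriv sg (s.uq n z)) * s.sq n z) (%z. (ind (Q T) z * bar (deriv sg) z) * (ind (Q T) z * Sl z))"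
  by (rule weakstar_mult_strong[OF weakstar_bar[OF s.sgc] C(4) stress_measurable(2) Sm C(2) stress_bounds(1) stress_tendsto])
 have b: "AEL z. abs(f z * h z) <= C * abs(s.L)" if "AEL z. abs(f z) <= C" "AEL z. abs(h z) <= abs(s.L)" for f h :: "real * real => real"
  using that
 proof eventually_elim
  case (elim z)
  hence "abs(f z) * abs(h z) <= C * abs(s.L)" using C(1) by (intro mult_mono) auto
  thus ?case by (simp add: abs_mult)
 qed
 have C3: "AEL z. abs(ind (Q T) z * bar (deriv sg) z) <= C" and D3: "AEL z. abs(ind (Q T) z * bar (%r. deriv sg r * sg r) z) <= D"
  using C(3) D(3) by simp_all
 note bl = b[OF C(2) stress_bounds(1)] and bg = b[OF C3 stress_bounds(2)]
 have "weakstar (%n z. (ind (Q T) z * deriv sg (s.uq n z)) * s.sq n z - ind (Q T) z * (deriv sg (s.uq n z) * sg (s.uq n z)))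
  (%z. (ind (Q T) z * bar (deriv sg) z) * (ind (Q T) z * Sl z) - ind (Q T) z * bar (%r. deriv sg r * sg r) z)"
  by (rule weakstar_diff[OF w weakstar_bar[OF c] _ _ _ _ bl D(2) bg D3])
   (intro borel_measurable_times C(4,5) D(4,5) stress_measurable(2) Sm)+
 moreover have "(%z. (ind (Q T) z * deriv sg (s.uq n z)) * s.sq n z - ind (Q T) z * (deriv sg (s.uq n z) * sg (s.uq n z))) = s.gq n" for n
 proof (rule ext)
  fix z show "(ind (Q T) z * deriv sg (s.uq n z)) * s.sq n z - ind (Q T) z * (deriv sg (s.uq n z) * sg (s.uq n z)) = s.gq n z"
   by (cases "z \<in> Q T") (simp_all add: s.sq_def s.fq_eq s.gq_def s.outside alg)
 qed
 moreover have e: "(%z. (ind (Q T) z * bar (deriv sg) z) * (ind (Q T) z * Sl z) - ind (Q T) z * bar (%r. deriv sg r * sg r) z) = (%z. ind (Q T) z * gbar z)"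
  by (rule ext) (simp add: gbar_eq ind_def)
 ultimately show "weakstar s.gq (%z. ind (Q T) z * gbar z)" by simp
 show "(%z. ind (Q T) z * gbar z) \<in> BM"
  unfolding e[symmetric] by (intro borel_measurable_diff borel_measurable_times C(5) D(5) Sm)
 have "AEL z. abs(ind (Q T) z * gbar z) <= C * abs(s.L) + D"
  unfolding fun_cong[OF e, symmetric] using bg
 proof eventually_elim
  case (elim z) thus ?case using D(3)[of z] by linarith
 qed
 thus "EX C. AEL z. abs(ind (Q T) z * gbar z) <= C" by blast
qed

end

section \<open>Convergence of the velocity and the limit equations\<close>

lemma slice_measurable:
 fixes f :: "real * real => real"
 assumes "f \<in> BM"
 shows "(%s. f (x, s)) \<in> BM" "(%s. f (s, x)) \<in> BM"
 by (rule measurable_compose[OF _ assms], rule bm_cont, intro cints)+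

lemma strong_L2_I:
 assumes A: "A \<in> sets borel" "emeasure lborel A < \<infinity>" and m: "!!n. (%z. ind A z * f n z) \<in> BM" "g \<in> BM"
  and b: "!!n. AEL z. abs(ind A z * f n z) <= Bd" and l: "AEL z. (%n. ind A z * f n z) ----> ind A z * g z"
 shows "strong_L2 A f g"
proof -
 have [measurable]: "A \<in> sets borel" by (rule A)
 note m[measurable]
 have bg: "AEL z. abs(ind A z * g z) <= Bd" by (rule AE_limit_bound[OF b l])
 have iA: "L1 (ind A :: _ => real)" by (rule i_ind) (use A in auto)
 have L: "L2 A h" if h[measurable]: "(%z. ind A z * h z) \<in> BM" and "AEL z. abs(ind A z * h z) <= Bd" for h
 proof -
  have "AEL z. abs((ind A z * h z) * (ind A z * h z)) <= abs(Bd) * abs(Bd)"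
   using that(2) by eventually_elim (unfold abs_mult, intro mult_mono, auto)
  from imb(1)[OF iA _ this] have "L1 (%z. ind A z * ((ind A z * h z) * (ind A z * h z)))" by measurable
  also have "(%z. ind A z * ((ind A z * h z) * (ind A z * h z))) = (%z. ind A z * (h z)^2)"
   by (rule ext) (simp add: ind_def power2_eq_square)
  finally show ?thesis using h by (simp add: L2_def set_measurable_real set_integrable_real)
 qed
 have "(%n. LBINT z. (ind A z * f n z - ind A z * g z)^2 * ind A z) ----> (LBINT z. 0 * ind A z)"
 proof (rule dct_mult[OF iA, where Bd="(2 * abs(Bd))^2"])
  show "AEL z. abs((ind A z * f n z - ind A z * g z)^2) <= (2 * abs(Bd))^2" for n
   using b[of n] bg
  proof eventually_elim
   case (elim z)
   hence "abs(ind A z * f n z - ind A z * g z) <= abs(2 * abs(Bd))" by linarith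
   from abs_le_square_iff[THEN iffD1, OF this] show ?case by simp
  qed
  show "AEL z. (%n. (ind A z * f n z - ind A z * g z)^2) ----> 0"
   using l
  proof eventually_elim
   case (elim z)
   have "(%n. (ind A z * f n z - ind A z * g z)^2) ----> (ind A z * g z - ind A z * g z)^2"
   by (intro tendsto_intros elim)
   thus ?case by simp
  qed
 qed measurable
 moreover have "(%z. (ind A z * f n z - ind A z * g z)^2 * ind A z) = (%z. ind A z * (f n z - g z)^2)" for n
  by (rule ext) (simp add: ind_def)
 ultimately show ?thesis using L[OF m(1) b] L[of g] bg unfolding strong_L2_def set_integral_real by simp
qed

lemma weak_L2_I:
 assumes A: "A \<in> sets borel" "emeasure lborel A < \<infinity>" and m: "!!n. (%z. ind A z * f n z) \<in> BM" "(%z. ind A z * g z) \<in> BM"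
  and b: "!!n. AEL z. abs(ind A z * f n z) <= Bd" "AEL z. abs(ind A z * g z) <= Bd"
  and w: "weakstar (%n z. ind A z * f n z) (%z. ind A z * g z)"
 shows "weak_L2 A f g"
 unfolding weak_L2_def
proof (intro conjI allI impI)
 have [measurable]: "A \<in> sets borel" by (rule A)
 have iA: "L1 (ind A :: _ => real)" by (rule i_ind) (use A in auto)
 have L: "L2 A h" if h[measurable]: "(%z. ind A z * h z) \<in> BM" and "AEL z. abs(ind A z * h z) <= Bd" for h
 proof -
  have "AEL z. abs((ind A z * h z) * (ind A z * h z)) <= abs(Bd) * abs(Bd)"
   using that(2) by eventually_elim (unfold abs_mult, intro mult_mono, auto)
  from imb(1)[OF iA _ this] have "L1 (%z. ind A z * ((ind A z * h z) * (ind A z * h z)))" by measurable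
  also have "(%z. ind A z * ((ind A z * h z) * (ind A z * h z))) = (%z. ind A z * (h z)^2)"
   by (rule ext) (simp add: ind_def power2_eq_square)
  finally show ?thesis using h by (simp add: L2_def set_measurable_real set_integrable_real)
 qed
 show "L2 A (f n)" "L2 A g" for n by (rule L; fact m b)+
 fix ph :: "'a => real" assume "L2 A ph"
 hence p: "(%z. ind A z * ph z) \<in> BM" "L1 (%z. ind A z * (ph z)^2)"
  by (simp_all add: L2_def set_measurable_real set_integrable_real)
 have e: "(ind A z * ph z)^2 = ind A z * (ph z)^2" for z by (simp add: ind_def)
 have i: "L1 (%z. ind A z * ph z)"
  by (rule integrable_if_square_integrable[of _ _ A]) (use p A e in auto)
 have "ind A z * (h z * ph z) = ind A z * h z * (ind A z * ph z)" for h and z by (simp add: ind_def)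
 thus "(%n. LINT z:A|lborel. f n z * ph z) ----> (LINT z:A|lborel. g z * ph z)"
  using weakstarD[OF w i] by (simp only: set_integral_real)
qed

lemma emeasure_01: "{0<..<1::real} \<in> sets borel" "emeasure lborel {0<..<1::real} < \<infinity>" by auto

context limit_sol begin

lemma prim_v0_convergent: "convergent (%n. prim (s.vI n) x)"
proof -
 have i: "L1 (%r. ind {..x} r * ind {0<..<1::real} r :: real)"
  by (rule i_im[OF i01]) auto
 have "(%r. s.vI n r * (ind {..x} r * ind {0<..<1} r)) = (%r. ind {..x} r * s.vI n r)" for n
 proof (rule ext)
  fix r show "s.vI n r * (ind {..x} r * ind {0<..<1} r) = ind {..x} r * s.vI n r"
   using s.outside_I(2)[of r n] by (cases "r \<in> {0<..<1}") simp_all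
 qed
 thus ?thesis using weakstarD[OF vw i] unfolding prim_def convergent_def by auto
qed

text \<open>By \<open>P_eq\<close> the primitive of v consists of initial data and the time integral
  of the stress, which converges by dominated convergence on almost every line of constant
  x.\<close>

lemma prim_v_convergent: "AEL z. snd z \<in> {0<..<T} --> fst z \<in> {0<..<1} --> convergent (%n. prim (%y. s.vq n (y, snd z)) (fst z))"
proof -
 have "AEL x. ALL n. AEL r. abs(s.sq n (x, r)) <= abs(s.L)"
  unfolding AE_all_countable using AE_pairD(1)[OF stress_bounds(1)] by blast
 with AE_pairD(1)[OF stress_tendsto]
 have "AEL x. ALL t. convergent (%n. prim (%r. s.sq n (x, r)) t)"
 proof eventually_elim
  case (elim x)
  show ?case
  proof
   fix t
   have "L1 (%r. ind {..t} r * ind {0<..T} r :: real)"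
   by (intro i_im i_ind) (auto simp: s.T less_imp_le)
   hence "(%n. LBINT r. s.sq n (x, r) * (ind {..t} r * ind {0<..T} r)) ----> (LBINT r. (ind (Q T) (x, r) * Sl (x, r)) * (ind {..t} r * ind {0<..T} r))"
   proof (rule dct_mult)
   show "(%r. s.sq n (x, r)) \<in> BL" for n using slice_measurable(1)[OF stress_measurable(2)] by simp
   have "(%z. ind (Q T) z * Sl z) \<in> BM" by measurable
   from slice_measurable(1)[OF this] show "(%r. ind (Q T) (x, r) * Sl (x, r)) \<in> BL" by simp
   qed (use elim in auto)
   moreover have "(%r. s.sq n (x, r) * (ind {..t} r * ind {0<..T} r)) = (%r. ind {..t} r * s.sq n (x, r))" for n
   proof (rule ext)
   fix r show "s.sq n (x, r) * (ind {..t} r * ind {0<..T} r) = ind {..t} r * s.sq n (x, r)"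
   using s.outside_t(5)[of r n x] by (cases "r \<in> {0<..T}") simp_all
   qed
   ultimately show "convergent (%n. prim (%r. s.sq n (x, r)) t)" unfolding prim_def convergent_def by auto
  qed
 qed
 hence c: "AEL z. ALL t. convergent (%n. prim (%r. s.sq n (fst (z :: real * real), r)) t)" by (rule AE_fst)
 have "AEL z. ALL n. snd z \<in> {0<..<T} --> fst z \<in> {0<..<1} --> prim (%y. s.vq n (y, snd z)) (fst z) = prim (s.vI n) (fst z) + prim (%r. s.sq n (fst z, r)) (snd z)"
  unfolding AE_all_countable using s.P_eq by blast
 with c show ?thesis
 proof eventually_elim
  case (elim z)
  show ?case
  proof (intro impI)
   assume "snd z \<in> {0<..<T}" "fst z \<in> {0<..<1}"
   hence "(%n. prim (%y. s.vq n (y, snd z)) (fst z)) = (%n. prim (s.vI n) (fst z) + prim (%r. s.sq n (fst z, r)) (snd z))"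
   using elim(2) by blast
   thus "convergent (%n. prim (%y. s.vq n (y, snd z)) (fst z))"
   using convergent_add[OF prim_v0_convergent spec[OF elim(1)]] by simp
  qed
 qed
qed

lemma v_convergent: "AEL z. convergent (%n. s.vq n z)"
proof (rule AE_lborel_pairI)
 have "{z \<in> space borel. Cauchy (%n. s.vq n z)} \<in> sets borel" using s.meas(2) by measurable
 thus "{z. convergent (%n. s.vq n z)} \<in> sets borel" by (simp add: Cauchy_convergent_iff)
 have "AEL t. ALL n. t \<in> {0<..<T} --> (EX c. abs(c) <= K + s.La & (AEL x. x \<in> {0<..<1} --> s.vq n (x, t) = c + prim (%y. s.vxq n (y, t)) x))"
  unfolding AE_all_countable using s.v_representation by blast
 moreover have "AEL t. ALL n. AEL x. abs(s.vxq n (x, t)) <= s.La"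
  unfolding AE_all_countable using AE_pairD(2)[OF s.vx_bound] by blast
 moreover have "AEL t. ALL n. L1 (%x. s.vq n (x, t))" "AEL t. ALL n. L1 (%x. s.vxq n (x, t))"
  unfolding AE_all_countable using lp_snd(1)[OF s.integrable_v] lp_snd(1)[OF s.integrable_vx] by blast+
 moreover note AE_pairD(2)[OF prim_v_convergent] AE_sing[of T]
 ultimately show "AEL t. AEL x. convergent (%n. s.vq n (x, t))"
 proof eventually_elim
  case (elim t)
  show ?case
  proof (cases "t \<in> {0<..<T}")
   case False
   hence "t ~: {0<..T}" using elim(6) by auto
   thus ?thesis by (simp add: s.outside_t convergent_const)
  next
   case True
   have "ALL n. EX c. AEL x. x \<in> {0<..<1} --> s.vq n (x, t) = c + prim (%y. s.vxq n (y, t)) x" using elim(1) True by blast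
   then obtain c where c: "!!n. AEL x. x \<in> {0<..<1} --> s.vq n (x, t) = c n + prim (%y. s.vxq n (y, t)) x" by metis
   have "AEL x. x \<in> {0<..<1} --> convergent (%n. prim (%y. s.vq n (y, t)) x)"
   using elim(5) by eventually_elim (use True in simp)
   from lipschitz_prim_convergent[OF spec[OF elim(3)] spec[OF elim(4)] spec[OF elim(2)] c this]
   show ?thesis
   proof eventually_elim
   fix x assume "x \<in> {0<..<1} --> convergent (%n. s.vq n (x, t))"
   thus "convergent (%n. s.vq n (x, t))" by (cases "x \<in> {0<..<1}") (simp_all add: s.outside_x convergent_const)
   qed
  qed
 qed
qed

text \<open>A pointwise limit is measurable as it stands and inherits vanishing outside
  \<open>Q T\<close>; the unspecified value of \<open>lim\<close> at points of divergence concerns a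
  null set only.\<close>

definition vl :: "real * real => real" where "vl z = lim (%n. s.vq n z)"
definition vl0 :: "real => real" where "vl0 x = lim (%n. s.vI n x)"

lemma vl_measurable[measurable]: "vl \<in> BM" "vl0 \<in> BM"
 unfolding vl_def[abs_def] vl0_def[abs_def] using s.meas(2,7) by (auto intro!: borel_measurable_lim_metric)

lemma vl_outside: "ind (Q T) z * vl z = vl z" "ind {0<..<1} x * vl0 x = vl0 x"
 by (cases "z \<in> Q T", simp_all add: vl_def s.outside) (cases "x \<in> {0<..<1}", simp_all add: vl0_def s.outside_I)

lemma v_tendsto: "AEL z. (%n. s.vq n z) ----> vl z"
 using v_convergent unfolding convergent_LIMSEQ_iff vl_def .

lemma v0_tendsto: "AEL x. (%n. s.vI n x) ----> vl0 x"
proof -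
 obtain c where c: "!!n. AEL x. x \<in> {0<..<1} --> s.vI n x = c n + prim (s.vxI n) x" using s.v0_representation by metis
 have "AEL x. x \<in> {0<..<1} --> convergent (%n. s.vI n x)"
  by (rule lipschitz_prim_convergent[OF s.integrable_vI s.integrable_vxI s.vxI_bound c]) (simp add: prim_v0_convergent)
 thus ?thesis
 proof eventually_elim
  case (elim x)
  thus ?case unfolding vl0_def convergent_LIMSEQ_iff[symmetric]
   by (cases "x \<in> {0<..<1}") (simp_all add: s.outside_I convergent_const)
 qed
qed

lemma strong_v: "strong_L2 (Q T) v vl" "strong_L2 {0<..<1} v0 vl0"
proof -
 show "strong_L2 (Q T) v vl"
  by (rule strong_L2_I[OF Q_sets Q_finite, where Bd="K + 2 * s.La"])
   (use s.meas(2) s.v_bound v_tendsto in "simp_all add: s.vq_def[symmetric] vl_outside")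
 show "strong_L2 {0<..<1} v0 vl0"
  by (rule strong_L2_I[OF emeasure_01, where Bd=K])
   (use s.meas(7) s.vI_bound v0_tendsto in "simp_all add: s.vI_def[symmetric] vl_outside")
qed

lemma weakstar_v: "weakstar s.vq vl" "weakstar s.vI vl0"
 using weakstar_strong[OF s.meas(2) vl_measurable(1) s.v_bound v_tendsto] weakstar_strong[OF s.meas(7) vl_measurable(2) s.vI_bound v0_tendsto] .

end

lemma test_fun_integrable: "test_fun Om ph ==> L1 ph"
 using continuous_compact_integrable[of Om ph "%_. 1"] by simp

lemma AE_bdd_integrable:
 fixes f :: "'a::euclidean_space => real"
 assumes A: "A \<in> sets borel" "emeasure lborel A < \<infinity>" and m: "(%z. ind A z * f z) \<in> BM" and b: "AEL z. abs(ind A z * f z) <= C"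
 shows "L1 (%z. ind A z * f z)"
proof -
 have "L1 (ind A :: _ => real)" by (rule i_ind) (use A in auto)
 from imb(1)[OF this _ b] m have "L1 (%z. ind A z * (ind A z * f z))" by simp
 also have "(%z. ind A z * (ind A z * f z)) = (%z. ind A z * f z)" by (rule ext) (simp add: ind_def)
 finally show ?thesis .
qed

context limit_sol begin

lemma heat_equation_I:
 assumes i: "L1 (%z. ind (Q T) z * w z)" "L1 (%z. ind (Q T) z * h z)" "L1 (%z. ind (Q T) z * g z)" "L1 (%x. ind {0<..<1} x * w0 x)"
  and eq: "!!ph. test_fun ({0<..<1} \<times> {..<T}) ph ==>
   (LBINT z. (ind (Q T) z * w z) * pd (0, 1) ph z) + (LBINT z. (ind (Q T) z * w z) * pd (1, 0) (pd (1, 0) ph) z)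
   - (LBINT z. (ind (Q T) z * h z) * pd (1, 0) ph z) + (LBINT z. (ind (Q T) z * g z) * ph z) + (LBINT x. (ind {0<..<1} x * w0 x) * ph (x, 0)) = 0"
 shows "heat_equation T h g w w0"
 unfolding heat_equation_def
proof (intro conjI allI impI)
 show "set_integrable lborel (Q T) w" "set_integrable lborel (Q T) h" "set_integrable lborel (Q T) g" "set_integrable lborel {0<..<1} w0"
  using i by (simp_all add: set_integrable_real)
 fix ph :: "real * real => real" assume ph: "test_fun ({0<..<1} \<times> {..<T}) ph"
 have tx: "test_fun ({0<..<1} \<times> {..<T}) (pd (1, 0) ph)" by (rule test_fun_pd[OF ph Basis_real2(1)])
 have tt: "test_fun ({0<..<1} \<times> {..<T}) (pd (0, 1) ph)" by (rule test_fun_pd[OF ph Basis_real2(2)])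
 note j = s.integrable_mult_test[OF i(1) tt] s.integrable_mult_test[OF i(1) test_fun_pd[OF tx Basis_real2(1)]] s.integrable_mult_test[OF i(2) tx] s.integrable_mult_test[OF i(3) ph]
 have "(LINT z:Q T|lborel. w z * pd (0, 1) ph z + w z * pd (1, 0) (pd (1, 0) ph) z - h z * pd (1, 0) ph z + g z * ph z)
   = (LBINT z. (ind (Q T) z * w z) * pd (0, 1) ph z + (ind (Q T) z * w z) * pd (1, 0) (pd (1, 0) ph) z - (ind (Q T) z * h z) * pd (1, 0) ph z + (ind (Q T) z * g z) * ph z)"
  unfolding set_integral_real by (simp add: alg)
 also have "... = (LBINT z. (ind (Q T) z * w z) * pd (0, 1) ph z) + (LBINT z. (ind (Q T) z * w z) * pd (1, 0) (pd (1, 0) ph) z)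
   - (LBINT z. (ind (Q T) z * h z) * pd (1, 0) ph z) + (LBINT z. (ind (Q T) z * g z) * ph z)"
  using int_add[OF i_diff[OF i_add[OF j(1,2)] j(3)] j(4)]
   int_diff[OF i_add[OF j(1,2)] j(3)] int_add[OF j(1,2)] by simp
 finally show "(LINT z:Q T|lborel. w z * pd (0, 1) ph z + w z * pd (1, 0) (pd (1, 0) ph) z - h z * pd (1, 0) ph z + g z * ph z) + (LINT x:{0<..<1}|lborel. w0 x * ph (x, 0)) = 0"
  using eq[OF ph] unfolding set_integral_real by (simp add: mult.assoc)
qed

lemma bar_bounds_AE:
 assumes "continuous_on UNIV be"
 shows "EX C. AEL z. abs(ind (Q T) z * bar be z) <= C" "(%z. ind (Q T) z * bar be z) \<in> BM"
proof -
 obtain C where C: "!!z. abs(ind (Q T) z * bar be z) <= C" "(%z. ind (Q T) z * bar be z) \<in> BM"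
  by (rule bar_bounds[OF assms]) blast
 thus "EX C. AEL z. abs(ind (Q T) z * bar be z) <= C" by (intro exI[of _ C]) simp
 show "(%z. ind (Q T) z * bar be z) \<in> BM" by (rule C)
qed

lemma vl_bounds: "AEL z. abs(vl z) <= K + 2 * s.La" "AEL x. abs(vl0 x) <= K"
 by (rule AE_limit_bound[OF s.v_bound v_tendsto], rule AE_limit_bound[OF s.vI_bound v0_tendsto])

lemma limit_integrable:
 "L1 (%z. ind (Q T) z * Sl z)" "L1 (%z. ind (Q T) z * bar sg z)" "L1 (%z. ind (Q T) z * gbar z)"
 "L1 (%z. ind (Q T) z * vl z)" "L1 (%x. ind {0<..<1} x * vl0 x)"
proof -
 note Q = Q_sets[of T] Q_finite[of T]
 show "L1 (%z. ind (Q T) z * Sl z)" by (rule AE_bdd_integrable[OF Q _ stress_bounds(2)]) measurable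
 show "L1 (%z. ind (Q T) z * bar sg z)" using bar_bounds_AE[OF s.sg_cont] AE_bdd_integrable[OF Q] by blast
 show "L1 (%z. ind (Q T) z * gbar z)" using gbar_bound gbar_measurable AE_bdd_integrable[OF Q] by blast
 show "L1 (%z. ind (Q T) z * vl z)" by (rule AE_bdd_integrable[OF Q]) (use vl_bounds in "simp_all add: vl_outside")
 show "L1 (%x. ind {0<..<1} x * vl0 x)" by (rule AE_bdd_integrable[OF emeasure_01]) (use vl_bounds in "simp_all add: vl_outside")
qed

lemma heat_v_limit: "heat_equation T (bar sg) (%z. 0) vl vl0"
proof (rule heat_equation_I[OF limit_integrable(4,2) _ limit_integrable(5)])
 fix ph :: "real * real => real" assume ph: "test_fun ({0<..<1} \<times> {..<T}) ph"
 have tx: "test_fun ({0<..<1} \<times> {..<T}) (pd (1, 0) ph)" by (rule test_fun_pd[OF ph Basis_real2(1)])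
 note ti = test_fun_integrable[OF test_fun_pd[OF ph Basis_real2(2)]] test_fun_integrable[OF test_fun_pd[OF tx Basis_real2(1)]] test_fun_integrable[OF tx] test_fun_integrable[OF test_fun_slice(1)[OF ph]]
 have "(%n. (LBINT z. s.vq n z * pd (0, 1) ph z) + (LBINT z. s.vq n z * pd (1, 0) (pd (1, 0) ph) z) - (LBINT z. s.fq n z * pd (1, 0) ph z) + (LBINT x. s.vI n x * ph (x, 0)))
  ----> (LBINT z. vl z * pd (0, 1) ph z) + (LBINT z. vl z * pd (1, 0) (pd (1, 0) ph) z) - (LBINT z. (ind (Q T) z * bar sg z) * pd (1, 0) ph z) + (LBINT x. vl0 x * ph (x, 0))"
  by (intro tendsto_add tendsto_diff weakstarD[OF weakstar_v(1)] weakstarD[OF weakstar_f] weakstarD[OF weakstar_v(2)] ti)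
 thus "(LBINT z. (ind (Q T) z * vl z) * pd (0, 1) ph z) + (LBINT z. (ind (Q T) z * vl z) * pd (1, 0) (pd (1, 0) ph) z)
   - (LBINT z. (ind (Q T) z * bar sg z) * pd (1, 0) ph z) + (LBINT z. (ind (Q T) z * 0) * ph z) + (LBINT x. (ind {0<..<1} x * vl0 x) * ph (x, 0)) = 0"
  unfolding s.heat_v[OF ph] vl_outside by (simp add: LIMSEQ_const_iff)
qed simp

lemma sL_outside: "ind {0<..<1} x * sL x = sL x" using sz[of x] by (cases "x \<in> {0<..<1}") simp_all

text \<open>The weak equation is linear in the stress, the forcing and the initial stress; the
  nonlinearity sits in the forcing, whose limit \<open>weakstar_g\<close> has already
  identified.\<close>

lemma heat_s_limit: "heat_equation T (%z. 0) gbar Sl sL"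
proof (rule heat_equation_I[OF limit_integrable(1) _ limit_integrable(3)])
 show "L1 (%x. ind {0<..<1} x * sL x)" unfolding sL_outside by (rule integrable_sL)
 fix ph :: "real * real => real" assume ph: "test_fun ({0<..<1} \<times> {..<T}) ph"
 have tx: "test_fun ({0<..<1} \<times> {..<T}) (pd (1, 0) ph)" by (rule test_fun_pd[OF ph Basis_real2(1)])
 note ti = test_fun_integrable[OF test_fun_pd[OF ph Basis_real2(2)]] test_fun_integrable[OF test_fun_pd[OF tx Basis_real2(1)]] test_fun_integrable[OF ph] test_fun_integrable[OF test_fun_slice(1)[OF ph]]
 have "(%n. (LBINT z. s.sq n z * pd (0, 1) ph z) + (LBINT z. s.sq n z * pd (1, 0) (pd (1, 0) ph) z) + (LBINT z. s.gq n z * ph z) + (LBINT x. s.sI n x * ph (x, 0)))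
  ----> (LBINT z. (ind (Q T) z * Sl z) * pd (0, 1) ph z) + (LBINT z. (ind (Q T) z * Sl z) * pd (1, 0) (pd (1, 0) ph) z) + (LBINT z. (ind (Q T) z * gbar z) * ph z) + (LBINT x. sL x * ph (x, 0))"
  by (intro tendsto_add weakstarD[OF weakstar_stress] weakstarD[OF weakstar_g] weakstarD[OF sw] ti)
 thus "(LBINT z. (ind (Q T) z * Sl z) * pd (0, 1) ph z) + (LBINT z. (ind (Q T) z * Sl z) * pd (1, 0) (pd (1, 0) ph) z)
   - (LBINT z. (ind (Q T) z * 0) * pd (1, 0) ph z) + (LBINT z. (ind (Q T) z * gbar z) * ph z) + (LBINT x. (ind {0<..<1} x * sL x) * ph (x, 0)) = 0"
  unfolding s.heat_s[OF ph] sL_outside by (simp add: LIMSEQ_const_iff)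
qed simp

lemma vlx_integrable: "L1 (%z. ind (Q T) z * vlx z)"
 unfolding vlx_def right_diff_distrib by (intro i_diff limit_integrable)

lemma vlx_L2: "L2 (Q T) vlx"
proof -
 obtain C where C: "AEL z. abs(ind (Q T) z * bar sg z) <= C" using bar_bounds_AE[OF s.sg_cont] by blast
 have b: "AEL z. abs(ind (Q T) z * vlx z) <= abs(s.L) + C"
  using stress_bounds(2) C by eventually_elim (simp add: vlx_def right_diff_distrib)
 have m: "(%z. ind (Q T) z * vlx z) \<in> BM" using vlx_integrable by auto
 have "L1 (%z. (ind (Q T) z * vlx z) * (ind (Q T) z * vlx z))"
  by (rule imb(1)[OF vlx_integrable _ b]) (use m in simp)
 also have "(%z. (ind (Q T) z * vlx z) * (ind (Q T) z * vlx z)) = (%z. ind (Q T) z * (vlx z)^2)"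
  by (rule ext) (simp add: ind_def power2_eq_square)
 finally show ?thesis using m by (simp add: L2_def set_measurable_real set_integrable_real)
qed

lemma vl_weak_derivative: "weak_pd ({0<..<1} \<times> {0<..<T}) (1, 0) vl vlx"
 unfolding weak_pd_def
proof (intro conjI allI impI)
 have "loc_integrable ({0<..<1} \<times> {0<..<T}) f" if "L1 (%z. ind (Q T) z * f z)" for f
  unfolding loc_integrable_def
 proof (intro allI impI)
  fix K assume K: "compact K & K \<subseteq> {0<..<1::real} \<times> {0<..<T}"
  have "set_integrable lborel (Q T) f" using that by (simp add: set_integrable_real)
  thus "set_integrable lborel K f"
   by (rule set_integrable_subset) (use K in "auto simp: Q_def borel_compact")
 qed
 thus "loc_integrable ({0<..<1} \<times> {0<..<T}) vl" "loc_integrable ({0<..<1} \<times> {0<..<T}) vlx"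
  using limit_integrable(4) vlx_integrable by auto
 fix ph :: "real * real => real" assume ph: "test_fun ({0<..<1} \<times> {0<..<T}) ph"
 have ph': "test_fun ({0<..<1} \<times> {..<T}) ph" by (rule test_fun_mono[OF ph]) auto
 have "(%n. LBINT z. s.vq n z * pd (1, 0) ph z) ----> (LBINT z. vl z * pd (1, 0) ph z)"
  by (rule weakstarD[OF weakstar_v(1) test_fun_integrable[OF test_fun_pd[OF ph Basis_real2(1)]]])
 moreover have "(%n. - (LBINT z. s.vxq n z * ph z)) ----> - (LBINT z. (ind (Q T) z * vlx z) * ph z)"
  by (intro tendsto_minus weakstarD[OF weakstar_vx test_fun_integrable[OF ph]])
 ultimately have e: "(LBINT z. vl z * pd (1, 0) ph z) = - (LBINT z. (ind (Q T) z * vlx z) * ph z)"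
  unfolding s.v_weak_derivative[OF ph'] by (rule LIMSEQ_unique)
 have i: "ind ({0<..<1} \<times> {0<..<T}) z * (f z * h z) = (ind (Q T) z * f z) * h z" if "!!z. z ~: {0<..<1} \<times> {0<..<T} ==> h z = 0" for f h :: "real * real => real" and z
 proof (cases "z \<in> {0<..<1} \<times> {0<..<T}")
  case True
  hence "z \<in> Q T" by (auto simp: Q_def)
  thus ?thesis using True by simp
 qed (simp add: that)
 have a1: "ind ({0<..<1} \<times> {0<..<T}) z * (vl z * pd (1, 0) ph z) = (ind (Q T) z * vl z) * pd (1, 0) ph z" for z
  by (rule i) (rule test_fun_zero(2)[OF ph])
 have a2: "ind ({0<..<1} \<times> {0<..<T}) z * (vlx z * ph z) = (ind (Q T) z * vlx z) * ph z" for z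
  by (rule i) (rule test_fun_zero(1)[OF ph])
 show "(LINT z:{0<..<1} \<times> {0<..<T}|lborel. vl z * pd (1, 0) ph z) = - (LINT z:{0<..<1} \<times> {0<..<T}|lborel. vlx z * ph z)"
  unfolding set_integral_real a1 a2 vl_outside by (rule e)
qed

lemma kinetic_limit: "kinetic_equation sg T Sl F F0"
 unfolding kinetic_equation_def
proof (intro allI impI)
 fix ph :: "(real * real) * real => real" assume ph: "test_fun (({0<..<1} \<times> {..<T}) \<times> UNIV) ph"
 define pht where "pht = pd ((0, 1), 0) ph"
 define phx where "phx = pd ((0, 0), 1) ph"
 have tt: "test_fun (({0<..<1} \<times> {..<T}) \<times> UNIV) pht" and tx: "test_fun (({0<..<1} \<times> {..<T}) \<times> UNIV) phx"
  unfolding pht_def phx_def by (rule test_fun_pd[OF ph], rule phase_Basis)+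
 have s2: "continuous_on UNIV (%y::(real * real) * real. a (snd y))" if "continuous_on UNIV a" for a :: "real => real"
  by (rule continuous_on_compose2[OF that]) (auto intro!: cints)
 \<comment> \<open>All terms without the stress are collected into one integrable test function for
   the indicators; the compact support of \<open>ph\<close> in xi makes it integrable although
   \<open>sg\<close> is unbounded. The remaining term contains the product of the indicator with the
   stress.\<close>
 define W where "W = (%y. pht y - sg (snd y) * phx y - deriv sg (snd y) * ph y)"
 have iW: "L1 W" unfolding W_def
  by (intro i_diff test_fun_integrable[OF tt] continuous_compact_integrable[OF tx] continuous_compact_integrable[OF ph] s2 s.sg_cont s.sgc)
 have ix: "L1 phx" by (rule test_fun_integrable[OF tx])
 define f where "f = (%n (y :: (real * real) * real). ind (Q T) (fst y) * of_bool (s.uq n (fst y) < snd y) :: real)"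
 define fF where "fF = (%y :: (real * real) * real. ind (Q T) (fst y) * F (fst y) (snd y))"
 define S where "S = (%y :: (real * real) * real. ind (Q T) (fst y) * Sl (fst y))"
 have fst3: "(%y :: (real * real) * real. h (fst y)) \<in> BM" if [measurable]: "h \<in> BM" for h :: "real * real => real"
 proof -
  have "(%y :: (real * real) * real. h (fst y)) \<in> BM2" by measurable
  thus ?thesis unfolding borel_prod .
 qed
 have fmg: "(%y :: (real * real) * real. ind (Q T) (fst y) * of_bool (h (fst y) < snd y) :: real) \<in> BM"
  if [measurable]: "h \<in> BM" for h :: "real * real => real"
 proof -
  have "(%y :: (real * real) * real. ind (Q T) (fst y) * of_bool (h (fst y) < snd y) :: real) \<in> BM2" by measurable
  thus ?thesis unfolding borel_prod .
 qed
 have fm: "f n \<in> BM" for n unfolding f_def by (rule fmg) (rule s.meas)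
 have fw: "weakstar f fF"
  unfolding fF_def
 proof (rule weakstar_cong_AE[OF y.weakstar_product _ fm])
  show "(%y. ind (Q T) (fst y) * of_bool (clip R (s.uq n (fst y)) < snd y) :: real) \<in> BM" for n
   by (rule fmg) (use s.meas(1)[of n] in measurable)
  show "AEL y. ind (Q T) (fst y) * of_bool (clip R (s.uq n (fst y)) < snd y) = f n y" for n
   using AE_fst[OF s.u_bound[of n]] by eventually_elim (simp add: f_def clip_eq)
 qed
 have Sm: "S \<in> BM" unfolding S_def by (rule fst3) measurable
 have fSw: "weakstar (%n y. f n y * s.sq n (fst y)) (%y. fF y * S y)"
 proof (rule weakstar_mult_strong[OF fw fm fst3[OF stress_measurable(2)] Sm])
  show "AEL y. abs(f n y) <= 1" for n by (simp add: f_def ind_def)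
  show "AEL y. abs(s.sq n (fst y)) <= abs(s.L)" for n by (rule AE_fst[OF stress_bounds(1)])
  show "AEL y. (%n. s.sq n (fst y)) ----> S y" unfolding S_def by (rule AE_fst[OF stress_tendsto])
 qed
 define J where "J = (%y :: real * real. ph ((fst y, 0), snd y))"
 have iJ: "L1 (%y. ind {0<..<1} (fst y) * J y)"
 proof -
  obtain N where N: "N >= 0" "!!z xi. abs(xi) > N ==> ph (z, xi) = 0" using phase_support[OF ph] by metis
  obtain C where C: "!!z. abs(ph z) <= C" using test_fun_bounded[OF ph] by metis
  have "continuous_on UNIV J" unfolding J_def by (rule continuous_on_compose2[OF test_fun_continuous[OF ph]]) (auto intro!: cints)
  hence [measurable]: "J \<in> BM2" unfolding borel_prod by (rule bm_cont)
  have "(%y. ind {0<..<1} (fst y) * J y) \<in> BM2" by measurable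
  hence m: "(%y. ind {0<..<1} (fst y) * J y) \<in> BL" unfolding borel_prod by simp
  have K: "compact ({0..1::real} \<times> {- N..N})" by (intro compact_Times compact_Icc)
  show ?thesis
  proof (rule ibf[OF m])
   show "{0..1::real} \<times> {- N..N} \<in> sets lborel" using borel_compact[OF K] by simp
   show "emeasure lborel ({0..1::real} \<times> {- N..N}) < \<infinity>" by (rule emeasure_compact_finite[OF K])
   show "abs(ind {0<..<1} (fst y) * J y) <= C" for y
   using C[of "((fst y, 0), snd y)"] by (auto simp: J_def ind_def)
   show "ind {0<..<1} (fst y) * J y = 0" if "y ~: {0..1} \<times> {- N..N}" for y
   using that N(2)[of "snd y"] by (cases "fst y \<in> {0<..<1}") (auto simp: J_def mem_Times_iff)
  qed
 qed
 define f0 where "f0 = (%n (y :: real * real). ind {0<..<1} (fst y) * of_bool (s.uI n (fst y) < snd y) :: real)"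
 have fmg0: "(%y :: real * real. ind {0<..<1} (fst y) * of_bool (h (fst y) < snd y) :: real) \<in> BM"
  if [measurable]: "h \<in> BM" for h :: "real => real"
 proof -
  have "(%y :: real * real. ind {0<..<1} (fst y) * of_bool (h (fst y) < snd y) :: real) \<in> BM2" by measurable
  thus ?thesis unfolding borel_prod .
 qed
 have fw0: "weakstar f0 (%y. ind {0<..<1} (fst y) * F0 (fst y) (snd y))"
 proof (rule weakstar_cong_AE[OF y0.weakstar_product])
  show "f0 n \<in> BM" for n unfolding f0_def by (rule fmg0) (rule s.meas)
  show "(%y. ind {0<..<1} (fst y) * of_bool (clip R (s.uI n (fst y)) < snd y) :: real) \<in> BM" for n
   by (rule fmg0) (use s.meas(6)[of n] in measurable)
  have uR: "AEL x. abs(s.uI n x) <= R" for n using s.uI_bound[of n] by eventually_elim (use s.KR in simp)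
  show "AEL y. ind {0<..<1} (fst y) * of_bool (clip R (s.uI n (fst y)) < snd y) = f0 n y" for n
   using AE_fst[OF uR[of n]] by eventually_elim (simp add: f0_def clip_eq)
 qed
 have "(LBINT y. f n y * W y) + (LBINT y. (f n y * s.sq n (fst y)) * phx y) + (LBINT y. f0 n y * (ind {0<..<1} (fst y) * J y)) = 0" for n
 proof -
  have i1: "L1 (%y. f n y * W y)" by (rule imb(2)[OF iW, of _ 1]) (use fm in "auto simp: f_def ind_def")
  have i2: "L1 (%y. (f n y * s.sq n (fst y)) * phx y)"
  proof (rule imb(2)[OF ix])
   show "(%y. f n y * s.sq n (fst y)) \<in> BL" using borel_measurable_times[OF fm fst3[OF stress_measurable(2)]] by simp
   show "AEL y. abs(f n y * s.sq n (fst y)) <= abs(s.L)"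
   using AE_fst[OF stress_bounds(1)] by eventually_elim (auto simp: f_def ind_def)
  qed
  have h1: "f n y * W y + (f n y * s.sq n (fst y)) * phx y = of_bool (s.uq n (fst y) < snd y) * (ind (Q T) (fst y) * (pht y + (s.sq n (fst y) - sg (snd y)) * phx y - deriv sg (snd y) * ph y))" for y
   by (simp add: f_def W_def alg)
  have h2: "f0 n y * (ind {0<..<1} (fst y) * J y) = of_bool (s.uI n (fst y) < snd y) * (ind {0<..<1} (fst y) * ph ((fst y, 0), snd y))" for y
   by (simp add: f0_def J_def ind_def)
  show ?thesis
   unfolding int_add[OF i1 i2, symmetric] h1 h2 by (rule s.kinetic[OF ph, folded pht_def phx_def])
 qed
 moreover have "(%n. (LBINT y. f n y * W y) + (LBINT y. (f n y * s.sq n (fst y)) * phx y) + (LBINT y. f0 n y * (ind {0<..<1} (fst y) * J y)))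
  ----> (LBINT y. fF y * W y) + (LBINT y. (fF y * S y) * phx y) + (LBINT y. (ind {0<..<1} (fst y) * F0 (fst y) (snd y)) * (ind {0<..<1} (fst y) * J y))"
  by (intro tendsto_add weakstarD[OF fw iW] weakstarD[OF fSw ix] weakstarD[OF fw0 iJ])
 ultimately have lim: "(LBINT y. fF y * W y) + (LBINT y. (fF y * S y) * phx y) + (LBINT y. (ind {0<..<1} (fst y) * F0 (fst y) (snd y)) * (ind {0<..<1} (fst y) * J y)) = 0"
  by (simp add: LIMSEQ_const_iff)
 have Fb: "abs(fF y) <= 1" for y using y.F01[of "fst y" "snd y"] by (auto simp: fF_def ind_def)
 have Fm: "fF \<in> BM" unfolding fF_def by (intro borel_measurable_times fst3 y.Fm) measurable
 have i1: "L1 (%y. fF y * W y)" by (rule imb(2)[OF iW, of _ 1]) (use Fm Fb in auto)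
 have i2: "L1 (%y. (fF y * S y) * phx y)"
 proof (rule imb(2)[OF ix])
  show "(%y. fF y * S y) \<in> BL" using borel_measurable_times[OF Fm Sm] by simp
  show "AEL y. abs(fF y * S y) <= 1 * abs(s.L)"
   using AE_fst[OF stress_bounds(2)] unfolding S_def by eventually_elim (unfold abs_mult[of "fF _"], intro mult_mono Fb, auto)
 qed
 have e1: "ind (Q T \<times> UNIV) y * (case y of (z, xi) => F z xi * pd ((0, 1), 0) ph (z, xi) + (Sl z - sg xi) * F z xi * pd ((0, 0), 1) ph (z, xi) - deriv sg xi * F z xi * ph (z, xi)) = fF y * W y + (fF y * S y) * phx y" for y
  unfolding fF_def W_def S_def pht_def phx_def by (cases y) (simp add: ind_def alg)
 have e2: "ind ({0<..<1} \<times> UNIV) y * (case y of (x, xi) => F0 x xi * ph ((x, 0), xi)) = (ind {0<..<1} (fst y) * F0 (fst y) (snd y)) * (ind {0<..<1} (fst y) * J y)" for y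
  unfolding J_def by (cases y) (simp add: ind_def)
 have i3: "L1 (%y. (ind {0<..<1} (fst y) * F0 (fst y) (snd y)) * (ind {0<..<1} (fst y) * J y))"
 proof (rule imb(2)[OF iJ, of _ 1])
  have "(%y. ind {0<..<1} (fst y) * F0 (fst y) (snd y)) \<in> BM" by (intro borel_measurable_times s.fst_snd_measurable(1) y0.Fm) measurable
  thus "(%y. ind {0<..<1} (fst y) * F0 (fst y) (snd y)) \<in> BL" by simp
 qed (use y0.F01 in "auto simp: ind_def")
 show "set_integrable lborel (Q T \<times> UNIV) (%(z, xi). F z xi * pd ((0, 1), 0) ph (z, xi) + (Sl z - sg xi) * F z xi * pd ((0, 0), 1) ph (z, xi) - deriv sg xi * F z xi * ph (z, xi)) &
  set_integrable lborel ({0<..<1} \<times> UNIV) (%(x, xi). F0 x xi * ph ((x, 0), xi)) &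
  (LINT (z, xi):Q T \<times> UNIV|lborel. F z xi * pd ((0, 1), 0) ph (z, xi) + (Sl z - sg xi) * F z xi * pd ((0, 0), 1) ph (z, xi) - deriv sg xi * F z xi * ph (z, xi))
  + (LINT (x, xi):{0<..<1} \<times> UNIV|lborel. F0 x xi * ph ((x, 0), xi)) = 0"
  unfolding set_integrable_real set_integral_real e1 e2
  using i_add[OF i1 i2] int_add[OF i1 i2] i3 lim by simp
qed

end

section \<open>Translation into the notions of the theorem\<close>

lemma Linf_I:
 fixes f :: "'a::euclidean_space => real"
 assumes "(%z. ind A z * f z) \<in> BM" "AEL z. abs(ind A z * f z) <= C"
 shows "Linf A f"
 unfolding Linf_def Linf_bound_def set_measurable_real
proof (intro exI[of _ C] conjI assms(1))
 show "AE z\<in>A in lborel. abs(f z) <= C" using assms(2) by eventually_elim auto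
qed

lemma (in young_limit) Linf_F: "Linf (A \<times> UNIV) (%(z, xi). F z xi)"
proof (rule Linf_I)
 note A(1)[measurable]
 have [measurable]: "(%x. F (fst x) (snd x)) \<in> BM2" using Fm unfolding borel_prod .
 have "(%x. ind A (fst x) * F (fst x) (snd x)) \<in> BM2" by measurable
 moreover have "(%x. ind A (fst x) * F (fst x) (snd x)) = (%z. ind (A \<times> UNIV) z * (case z of (z, xi) => F z xi))"
  by (rule ext) (simp add: ind_def split: prod.split)
 ultimately show "(%z. ind (A \<times> UNIV) z * (case z of (z, xi) => F z xi)) \<in> BM" unfolding borel_prod by simp
 show "AEL z. abs(ind (A \<times> UNIV) z * (case z of (z, xi) => F z xi)) <= 1"
  using F01 by (auto simp: ind_def split: prod.split)
qed

lemma (in young_limit) weakstar_Linf_F: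
 assumes m: "!!n. (%z. ind A z * h n z) \<in> BM" and ae: "!!n. AEL z. z \<in> A --> u n z = h n z"
 shows "AEL xi. weakstar_Linf A (%n z. of_bool (h n z < xi)) (%z. F z xi)"
 using Fw
proof eventually_elim
 case (elim xi)
 note A(1)[measurable] um[measurable] m[measurable]
 \<comment> \<open>Measurability of \<open>h n\<close> is known only after multiplication by the
   indicator of A; repeating the indicator inside the comparison makes this sufficient.\<close>
 have e: "ind A z * of_bool (h n z < xi) = (ind A z * of_bool (ind A z * h n z < xi) :: real)" for n z
  by (simp add: ind_def)
 have m1: "(%z. ind A z * of_bool (h n z < xi) :: real) \<in> BM" for n
  unfolding e by measurable
 have m2: "(%z. ind A z * F z xi) \<in> BM" using F_slice by measurable
 have hw: "weakstar (%n z. ind A z * of_bool (h n z < xi)) (%z. ind A z * F z xi)"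
 proof (rule weakstar_cong_AE[OF elim _ m1])
  show "(%z. ind A z * of_bool (u n z < xi) :: real) \<in> BM" for n by measurable
  show "AEL z. ind A z * of_bool (u n z < xi) = (ind A z * of_bool (h n z < xi) :: real)" for n
   using ae[of n] by eventually_elim (simp add: ind_def)
 qed
 show ?case by (rule weakstar_Linf_I[OF A(1) m1 m2 _ _ hw, of 1]) (use F01 in "auto simp: ind_def")
qed

context limit_sol begin

lemma weakstar_Linf_bar:
 assumes be: "continuous_on UNIV be"
 shows "weakstar_Linf (Q T) (%n z. be (u n z)) (bar be)"
proof -
 have e: "(%z. ind (Q T) z * be (s.uq n z)) = (%z. ind (Q T) z * be (u n z))" for n
  by (rule ext) (simp add: s.uq_def ind_def)
 obtain C where C: "!!n. AEL z. abs(ind (Q T) z * be (s.uq n z)) <= C" "!!z. abs(ind (Q T) z * bar be z) <= C"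
  "!!n. (%z. ind (Q T) z * be (s.uq n z)) \<in> BM" "(%z. ind (Q T) z * bar be z) \<in> BM"
  by (rule bar_bounds[OF be]) blast
 have w: "weakstar (%n z. ind (Q T) z * be (u n z)) (%z. ind (Q T) z * bar be z)" using weakstar_bar[OF be] unfolding e .
 have b: "AEL z. abs(ind (Q T) z * be (u n z)) <= C" for n using C(1)[of n] unfolding fun_cong[OF e] .
 show ?thesis by (rule weakstar_Linf_I[OF Q_sets C(3)[unfolded e] C(4) b _ w]) (use C(2) in simp)
qed

lemma young: "young_measure (Q T) u y.nu"
 unfolding young_measure_def
proof (intro conjI allI impI)
 show "y.nu \<in> restrict_space borel (Q T) \<rightarrow>\<^sub>M prob_algebra borel" by (rule measurable_restrict_space1[OF y.nu_measurable])
 fix be :: "real => real" assume be: "continuous_on UNIV be"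
 show "AE z\<in>Q T in lborel. integrable (y.nu z) be" by (simp add: y.integrable_nu[OF be])
 show "weakstar_Linf (Q T) (%n z. be (u n z)) (%z. \<integral>r. be r \<partial>y.nu z)" using weakstar_Linf_bar[OF be] unfolding bar_def[abs_def] .
qed

lemma stress_limit: "AE z\<in>Q T in lborel. (%n. sg (u n z) + vx n z) ----> Sl z"
 using stress_tendsto by eventually_elim (auto simp: s.sq_def s.fq_def s.vxq_def)

lemma Linf_Sl: "Linf (Q T) Sl"
 by (rule Linf_I[OF _ stress_bounds(2)]) measurable

lemma weakstar_Linf_F: "AEL xi. weakstar_Linf (Q T) (%n z. of_bool (u n z < xi)) (%z. F z xi)"
proof (rule y.weakstar_Linf_F)
 show "(%z. ind (Q T) z * u n z) \<in> BM" for n using s.meas(1)[of n] by (simp add: s.uq_def[abs_def])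
 show "AEL z. z \<in> Q T --> clip R (s.uq n z) = u n z" for n
  using s.u_bound[of n] by eventually_elim (auto simp: clip_eq s.uq_def)
qed

lemma weakstar_Linf_F0: "AEL xi. weakstar_Linf {0<..<1} (%n x. of_bool (u0 n x < xi)) (%x. F0 x xi)"
proof (rule y0.weakstar_Linf_F)
 show "(%x. ind {0<..<1} x * u0 n x) \<in> BM" for n using s.meas(6)[of n] by (simp add: s.uI_def[abs_def])
 show "AEL x. x \<in> {0<..<1} --> clip R (s.uI n x) = u0 n x" for n
  using s.uI_bound[of n]
 proof eventually_elim
  case (elim x)
  hence "abs(s.uI n x) <= R" using s.KR by simp
  thus ?case by (simp add: clip_eq) (simp add: s.uI_def)
 qed
qed

lemma weak_stress0: "weak_L2 {0<..<1} (%n x. sg (u0 n x) + v0x n x) sL"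
proof -
 have e: "(%x. ind {0<..<1} x * (sg (u0 n x) + v0x n x)) = s.sI n" for n
  by (rule ext) (simp add: s.sI_def s.fI_def s.vxI_def alg)
 have m: "s.sI n \<in> BM" for n using s.sI_props(1)[of n] by auto
 have b: "AEL x. abs(ind {0<..<1} x * (sg (u0 n x) + v0x n x)) <= Cs + K" for n using s.sI_props(2)[of n] unfolding fun_cong[OF e] .
 show ?thesis
  by (rule weak_L2_I[OF emeasure_01 _ _ b]) (use m slm sb sw in "simp_all add: e sL_outside")
qed

end

context sol_sequence begin

lemma AE_clip: "AEL z. abs(f z) <= C ==> AEL z. clip C (f z) = f z"
 by (erule eventually_mono) (rule clip_eq)

text \<open>Four extractions in a row: for F, for \<open>F0\<close>, for the limit of the forcing,
  and jointly for the initial stress and the initial velocity. Limits obtained earlier persist along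
  the later subsequences.\<close>

lemma subsequence_exists:
 "EX r F F0 gL sL v0L. strict_mono (r :: nat => nat) &
  limit_sol sg (%n. u0 (r n)) (%n. v0 (r n)) (%n. v0x (r n)) (%n. u (r n)) (%n. v (r n)) (%n. vx (r n)) T K E m0 R Cs Cd F F0 gL sL v0L"
proof -
 have R0: "R >= 0" by (rule s.R0)
 have G0: "G >= 0" by (simp add: G_def s.La_def)
 have CK0: "Cs + K >= 0" using s.Cs[of 0] R0 s.K0 by simp
 note Q = Q_sets[of T] Q_finite[of T]
 obtain r1 F where r1: "strict_mono (r1 :: nat => nat)" and F: "(%x. F (fst x) (snd x)) \<in> BM"
  "!!z xi xi'. xi <= xi' ==> F z xi <= F z xi'" "!!z xi. continuous (at_right xi) (F z)"
  "!!z xi. xi < - R ==> F z xi = 0" "!!z xi. R <= xi ==> F z xi = 1"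
  "AEL xi. weakstar (%n z. ind (Q T) z * of_bool (clip R (s.uq (r1 n) z) < xi)) (%z. ind (Q T) z * F z xi)"
  by (rule young_distribution_exists[OF Q, of "%n z. clip R (s.uq n z)" R]) (use clip_bound[OF R0] s.meas(1) in auto)
 obtain r2 F0 where r2: "strict_mono (r2 :: nat => nat)" and F0: "(%x. F0 (fst x) (snd x)) \<in> BM"
  "!!z xi xi'. xi <= xi' ==> F0 z xi <= F0 z xi'" "!!z xi. continuous (at_right xi) (F0 z)"
  "!!z xi. xi < - R ==> F0 z xi = 0" "!!z xi. R <= xi ==> F0 z xi = 1"
  "AEL xi. weakstar (%n z. ind {0<..<1} z * of_bool (clip R (s.uI (r1 (r2 n)) z) < xi)) (%z. ind {0<..<1} z * F0 z xi)"
  by (rule young_distribution_exists[OF emeasure_01, of "%n z. clip R (s.uI (r1 n) z)" R]) (use clip_bound[OF R0] s.meas(6) in auto)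
 have "EX r. strict_mono (r :: nat => nat) & (ALL j::nat. EX g:borel_measurable borel. (ALL z. abs(g z) <= G) & (ALL z. z ~: Q T --> g z = 0) & weakstar (%n z. clip G (s.gq (r1 (r2 (r n))) z)) g)"
 proof (rule weakstar_compact[OF Q])
  show "clip G (s.gq (r1 (r2 n)) z) = 0" if "z ~: Q T" for n z using that G0 by (simp add: s.gq_outside clip_def)
 qed (use clip_bound[OF G0] s.gq_measurable in auto)
 then obtain r3 gL where r3: "strict_mono (r3 :: nat => nat)" and gL: "gL \<in> BM" "!!z. abs(gL z) <= G" "!!z. z ~: Q T ==> gL z = 0" "weakstar (%n z. clip G (s.gq (r1 (r2 (r3 n))) z)) gL"
  by blast
 define r0 where "r0 = (%n. r1 (r2 (r3 n)))"
 \<comment> \<open>A family with two members, so that a single extraction suffices: index 0 is the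
   initial stress, every other index the initial velocity.\<close>
 define f where "f = (%(j::nat) n. if j = 0 then (%x. clip (Cs + K) (s.sI (r0 n) x)) else (%x. clip K (s.vI (r0 n) x)))"
 have sm: "s.sI n \<in> BM" for n using s.sI_props(1)[of n] by auto
 have "EX r. strict_mono (r :: nat => nat) & (ALL j. EX g:borel_measurable borel. (ALL z. abs(g z) <= (if j = 0 then Cs + K else K)) & (ALL z. z ~: {0<..<1} --> g z = 0) & weakstar (%n. f j (r n)) g)"
 proof (rule weakstar_compact[OF emeasure_01])
  show "f j n \<in> BM" for j n using sm s.meas(7) by (auto simp: f_def)
  show "abs(f j n z) <= (if j = 0 then Cs + K else K)" for j n z using clip_bound[OF CK0] clip_bound[OF s.K0] by (simp add: f_def)
  show "f j n z = 0" if "z ~: {0<..<1}" for j n z using that CK0 s.K0 by (simp add: f_def s.sI_props(3) s.outside_I clip_def)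
 qed
 then obtain r4 where r4: "strict_mono (r4 :: nat => nat)" and g: "!!j. EX g:borel_measurable borel. (ALL z. abs(g z) <= (if j = 0 then Cs + K else K)) & (ALL z. z ~: {0<..<1} --> g z = 0) & weakstar (%n. f j (r4 n)) g"
  by blast
 obtain sL where sL: "sL \<in> BM" "!!z. abs(sL z) <= Cs + K" "!!z. z ~: {0<..<1} ==> sL z = 0" "weakstar (%n. f 0 (r4 n)) sL"
  using g[of 0] by auto
 obtain v0L where v0L: "weakstar (%n. f 1 (r4 n)) v0L" using g[of 1] by auto
 define r where "r = (%n. r0 (r4 n))"
 have r: "strict_mono r" unfolding r_def r0_def using r1 r2 r3 r4 by (simp add: strict_mono_def)
 have "limit_sol sg (%n. u0 (r n)) (%n. v0 (r n)) (%n. v0x (r n)) (%n. u (r n)) (%n. v (r n)) (%n. vx (r n)) T K E m0 R Cs Cd F F0 gL sL v0L"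
 proof (intro limit_sol.intro sol_sequence.intro limit_sol_axioms.intro)
  show "energy_sol sg (u0 (r n)) (v0 (r n)) (v0x (r n)) (u (r n)) (v (r n)) (vx (r n)) T K E m0 R Cs Cd" for n by (rule sol)
  have s1: "strict_mono (%n. r2 (r3 (r4 n)))" "strict_mono (%n. r3 (r4 n))" using r2 r3 r4 by (auto simp: strict_mono_def)
  show "young_limit (Q T) (%n z. clip R (s.uq (r n) z)) R F"
  proof (rule young_limit.intro[OF Q _ _ F(1-5)])
   show "AEL xi. weakstar (%n z. ind (Q T) z * of_bool (clip R (s.uq (r n) z) < xi)) (%z. ind (Q T) z * F z xi)"
   using F(6) unfolding r_def r0_def by eventually_elim (erule weakstar_subseq[OF _ s1(1)])
  qed (use clip_bound[OF R0] s.meas(1) in auto)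
  show "young_limit {0<..<1} (%n x. clip R (s.uI (r n) x)) R F0"
  proof (rule young_limit.intro[OF emeasure_01 _ _ F0(1-5)])
   show "AEL xi. weakstar (%n z. ind {0<..<1} z * of_bool (clip R (s.uI (r n) z) < xi)) (%z. ind {0<..<1} z * F0 z xi)"
   using F0(6) unfolding r_def r0_def by eventually_elim (erule weakstar_subseq[OF _ s1(2)])
  qed (use clip_bound[OF R0] s.meas(6) in auto)
  have "weakstar (%n z. clip G (s.gq (r n) z)) gL" unfolding r_def r0_def by (rule weakstar_subseq[OF gL(4) r4])
  thus "weakstar (%n. s.gq (r n)) gL"
   by (rule weakstar_cong_AE) (use AE_clip[OF g_bound] s.gq_measurable in auto)
  have "weakstar (%n z. clip (Cs + K) (s.sI (r n) z)) sL" using sL(4) by (simp add: f_def r_def)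
  thus "weakstar (%n. s.sI (r n)) sL"
   by (rule weakstar_cong_AE) (use AE_clip[OF s.sI_props(2)] sm in auto)
  have "weakstar (%n z. clip K (s.vI (r n) z)) v0L" using v0L by (simp add: f_def r_def)
  thus "weakstar (%n. s.vI (r n)) v0L"
   by (rule weakstar_cong_AE) (use AE_clip[OF s.vI_bound] s.meas(7) in auto)
  show "abs(gL z) <= sol_sequence.G K E Cs Cd" for z using gL(2) .
 qed (use gL sL in auto)
 with r show ?thesis by blast
qed

end

section \<open>Uniform constants from the energy bound\<close>

lemma initial_energy_bound:
 assumes u0: "Linf_bound {0<..<1} K u0" and v0: "Linf_bound {0<..<1} K v0" and p: "p > 1" and C: "C > 0"
  and W: "!!r. stored_energy sg r <= C * abs(r) powr p" and K0: "K >= 0"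
 shows "initial_energy sg u0 v0 <= K^2 / 2 + C * K powr p"
proof -
 define e where "e = (%x. ind {0<..<1} x * ((v0 x)^2 / 2 + stored_energy sg (u0 x)))"
 define A where "A = K^2 / 2 + C * K powr p"
 have A0: "A >= 0" using C by (simp add: A_def)
 have ae: "AEL x. e x <= ind {0<..<1} x * A"
  using u0[unfolded Linf_bound_def, THEN conjunct2] v0[unfolded Linf_bound_def, THEN conjunct2]
 proof eventually_elim
  case (elim x)
  show ?case
  proof (cases "x \<in> {0<..<1}")
   case True
   have "(v0 x)^2 <= K^2" using elim(2) True K0 by (intro abs_le_square_iff[THEN iffD1]) simp
   moreover have "C * abs(u0 x) powr p <= C * K powr p" using elim(1) True p C by (intro mlm powr_mono2) auto
   ultimately show ?thesis using True W[of "u0 x"] by (simp add: e_def A_def)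
  qed (simp add: e_def)
 qed
 have "integral\<^sup>L lborel e <= A"
 \<comment> \<open>In the non-integrable case the Bochner integral is 0 by convention, which lies
   below the nonnegative bound \<open>A\<close>.\<close>
 proof (cases "L1 e")
  case True
  have "L1 (%x. ind {0<..<1::real} x * A)" by (intro i_ml i01)
  from integral_mono_AE[OF True this ae] show ?thesis by simp
 qed (simp add: not_integrable_integral_eq A0)
 thus ?thesis unfolding initial_energy_def set_integral_real e_def A_def .
qed

lemma Linf_bound_nonneg:
 assumes "Linf_bound {0<..<1::real} K f" shows "K >= 0"
proof (rule ccontr)
 assume "~ K >= 0"
 have "AEL x. x ~: {0<..<1::real}"
  using assms unfolding Linf_bound_def by (elim conjE eventually_mono) (use \<open>~ K >= 0\<close> in force)
 hence "emeasure lborel {0<..<1::real} = 0" by (intro AE_iff_measurable[THEN iffD1, rotated 2]) auto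
 thus False by simp
qed

text \<open>The stored energy can lower the total by at most C, so half the integral of v^2 plus the
  dissipation is at most E1 + C. The factor 2 in the condition on E undoes the half.\<close>

lemma energy_consequences:
 assumes T: "T > 0" and ws: "weak_solution sg u0 v0 u v vx" and eb: "energy_bound sg u0 v0 u v vx"
  and W: "!!r. - C <= stored_energy sg r" and C: "C > 0" and E1: "initial_energy sg u0 v0 <= E1" and E: "E >= 2 * (E1 + C)"
 shows "AEL t. t \<in> {0<..<T} --> L1 (%x. (ind (Q T) (x, t) * v (x, t))^2) & (LBINT x. (ind (Q T) (x, t) * v (x, t))^2) <= E"
  and "(LBINT z. (ind (Q T) z * vx z)^2) <= E"
proof -
 have L: "L2 (Q t) vx" if "t > 0" for t using ws that unfolding weak_solution_def by blast
 define X where "X = (%t. LBINT z. ind (Q t) z * (vx z)^2)"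
 have X0: "X t >= 0" for t unfolding X_def by (rule integral_nonneg_AE) simp
 have main: "AEL t. t > 0 --> L1 (%x. ind {0<..<1} x * (v (x, t))^2) & (LBINT x. ind {0<..<1} x * (v (x, t))^2) / 2 + X t <= E1 + C"
  using eb unfolding energy_bound_def
 proof eventually_elim
  case (elim t)
  show ?case
  proof
   assume "t > 0"
   hence i: "L1 (%x. ind {0<..<1} x * (v (x, t))^2)" "L1 (%x. ind {0<..<1} x * stored_energy sg (u (x, t)))"
   and e: "(LBINT x. ind {0<..<1} x * ((v (x, t))^2 / 2 + stored_energy sg (u (x, t)))) + X t <= initial_energy sg u0 v0"
   using elim by (auto simp: L2_def set_integrable_real set_integral_real X_def)
   have "(LBINT x. ind {0<..<1} x * ((v (x, t))^2 / 2 + stored_energy sg (u (x, t))))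
   = (LBINT x. (ind {0<..<1} x * (v (x, t))^2) / 2 + ind {0<..<1} x * stored_energy sg (u (x, t)))"
   by (simp add: alg)
   also have "... = (LBINT x. ind {0<..<1} x * (v (x, t))^2) / 2 + (LBINT x. ind {0<..<1} x * stored_energy sg (u (x, t)))"
   using i by simp
   finally have s: "(LBINT x. ind {0<..<1} x * ((v (x, t))^2 / 2 + stored_energy sg (u (x, t))))
   = (LBINT x. ind {0<..<1} x * (v (x, t))^2) / 2 + (LBINT x. ind {0<..<1} x * stored_energy sg (u (x, t)))" .
   have ic: "L1 (%x. ind {0<..<1::real} x * (- C))" by (intro i_ml i01)
   have "(LBINT x. ind {0<..<1::real} x * (- C)) <= (LBINT x. ind {0<..<1} x * stored_energy sg (u (x, t)))"
   by (rule integral_mono[OF ic i(2)]) (use W in "auto simp: ind_def")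
   hence "- C <= (LBINT x. ind {0<..<1} x * stored_energy sg (u (x, t)))" by simp
   thus "L1 (%x. ind {0<..<1} x * (v (x, t))^2) & (LBINT x. ind {0<..<1} x * (v (x, t))^2) / 2 + X t <= E1 + C"
   using i(1) e s E1 by linarith
  qed
 qed
 show "AEL t. t \<in> {0<..<T} --> L1 (%x. (ind (Q T) (x, t) * v (x, t))^2) & (LBINT x. (ind (Q T) (x, t) * v (x, t))^2) <= E"
  using main
 proof eventually_elim
  case (elim t)
  show ?case
  proof
   assume t: "t \<in> {0<..<T}"
   have "(%x. (ind (Q T) (x, t) * v (x, t))^2) = (%x. ind {0<..<1} x * (v (x, t))^2)"
   using t by (intro ext) (auto simp: Q_def ind_def)
   thus "L1 (%x. (ind (Q T) (x, t) * v (x, t))^2) & (LBINT x. (ind (Q T) (x, t) * v (x, t))^2) <= E"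
   using elim t X0[of t] E by auto
  qed
 qed
 \<comment> \<open>The energy inequality holds at almost every time only, possibly not at T. Some
   time beyond T is good, and the dissipation up to T is no larger than up to that time.\<close>
 have "EX t. T < t & X t <= E1 + C"
 proof (rule ccontr)
  assume "~ ?thesis"
  with main have "AEL t. t ~: {T<..<T + 1}"
  proof (elim eventually_mono)
   fix t assume n: "\<nexists>t. T < t & X t <= E1 + C" and m: "t > 0 --> L1 (%x. ind {0<..<1} x * (v (x, t))^2) & (LBINT x. ind {0<..<1} x * (v (x, t))^2) / 2 + X t <= E1 + C"
   have nn: "0 <= (LBINT x. ind {0<..<1} x * (v (x, t))^2)" by (rule integral_nonneg_AE) simp
   have "X t <= E1 + C" if "T < t"
   proof -
   have "(LBINT x. ind {0<..<1} x * (v (x, t))^2) / 2 + X t <= E1 + C" using m T that by auto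
   with nn show ?thesis by linarith
   qed
   thus "t ~: {T<..<T + 1}" using n by auto
  qed
  hence "emeasure lborel {T<..<T + 1} = 0" by (intro AE_iff_measurable[THEN iffD1, rotated 2]) auto
  thus False by simp
 qed
 then obtain t where t: "T < t" "X t <= E1 + C" by blast
 have "(%z. (ind (Q T) z * vx z)^2) = (%z. ind (Q T) z * (vx z)^2)" by (rule ext) (simp add: ind_def)
 moreover have "X T <= X t"
  unfolding X_def
 proof (rule integral_mono)
  show "L1 (%z. ind (Q T) z * (vx z)^2)" "L1 (%z. ind (Q t) z * (vx z)^2)"
   using L[OF T] L[of t] t T by (auto simp: L2_def set_integrable_real)
  show "ind (Q T) z * (vx z)^2 <= ind (Q t) z * (vx z)^2" for z using t by (auto simp: Q_def ind_def)
 qed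
 moreover have "E1 + C <= E"
 proof -
  have "0 <= E1 + C" by (rule order_trans[OF X0 t(2)])
  hence "E1 + C <= 2 * (E1 + C)" by simp
  thus ?thesis using E by (rule order_trans)
 qed
 ultimately show "(LBINT z. (ind (Q T) z * vx z)^2) <= E" using t(2) unfolding X_def by simp
qed

theorem theorem3p3:
  fixes T p c C K :: real
    and \<sigma> :: "real \<Rightarrow> real"
    and I :: "real set"
    and u0 v0 v0x :: "real \<Rightarrow> real \<Rightarrow> real"
    and u v vx S :: "real \<Rightarrow> real \<times> real \<Rightarrow> real"
    and M :: "real \<Rightarrow> real"
  assumes "T > 0"
    and "\<forall>r. \<sigma> differentiable (at r)" and "continuous_on UNIV (deriv \<sigma>)"
    and "\<not> mono \<sigma>"
    and "filterlim \<sigma> at_top at_top" and "filterlim \<sigma> at_bot at_bot"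
    and "p > 1" and "c > 0" and "C > 0"
    and "\<forall>r. c * \<bar>r\<bar> powr p - C \<le> stored_energy \<sigma> r \<and>
             stored_energy \<sigma> r \<le> C * \<bar>r\<bar> powr p"
    and "I \<subseteq> {0<..}" and "0 islimpt I"
    and "\<forall>\<epsilon>\<in>I. Linf_bound {0<..<1} K (u0 \<epsilon>)"
    and "\<forall>\<epsilon>\<in>I. Linf_bound {0<..<1} K (v0 \<epsilon>) \<and> Linf_bound {0<..<1} K (v0x \<epsilon>) \<and>
             weak_pd {0<..<1} 1 (v0 \<epsilon>) (v0x \<epsilon>)"
    and "\<forall>\<epsilon>\<in>I. weak_solution \<sigma> (u0 \<epsilon>) (v0 \<epsilon>) (u \<epsilon>) (v \<epsilon>) (vx \<epsilon>)"
    and "\<forall>\<epsilon>\<in>I. energy_bound \<sigma> (u0 \<epsilon>) (v0 \<epsilon>) (u \<epsilon>) (v \<epsilon>) (vx \<epsilon>)"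
    and "\<forall>\<epsilon>\<in>I. \<forall>z. S \<epsilon> z = \<sigma> (u \<epsilon> z) + vx \<epsilon> z"
    and "\<forall>\<epsilon>\<in>I. M \<epsilon> = sqrt (initial_energy \<sigma> (u0 \<epsilon>) (v0 \<epsilon>))"
    and "\<forall>\<epsilon>\<in>I. filterlim (\<lambda>r. \<sigma> r - B \<sigma> r (M \<epsilon>)) at_top at_top"
    and "\<forall>\<epsilon>\<in>I. filterlim (\<lambda>r. \<sigma> r + B \<sigma> r (M \<epsilon>)) at_bot at_bot"
  shows "\<exists>(e :: nat \<Rightarrow> real) (ul :: real \<times> real \<Rightarrow> real) (vl :: real \<times> real \<Rightarrow> real)
           (vlx :: real \<times> real \<Rightarrow> real) (Sl :: real \<times> real \<Rightarrow> real)
           (\<nu> :: real \<times> real \<Rightarrow> real measure) (F :: real \<times> real \<Rightarrow> real \<Rightarrow> real)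
           (vl0 :: real \<Rightarrow> real) (Sl0 :: real \<Rightarrow> real) (F0 :: real \<Rightarrow> real \<Rightarrow> real).
     (\<forall>n. e n \<in> I) \<and> e \<longlonglongrightarrow> 0 \<and>
     weakstar_Linf (Q T) (\<lambda>n. u (e n)) ul \<and>
     strong_L2 (Q T) (\<lambda>n. v (e n)) vl \<and>
     (AE z\<in>Q T in lborel. (\<lambda>n. S (e n) z) \<longlonglongrightarrow> Sl z) \<and>
     young_measure (Q T) (\<lambda>n. u (e n)) \<nu> \<and>
     (\<forall>z\<in>Q T. \<forall>\<xi>. F z \<xi> = measure (\<nu> z) {..\<xi>}) \<and>
     Linf (Q T \<times> UNIV) (\<lambda>(z, \<xi>). F z \<xi>) \<and>
     \<comment> \<open>almost every \<open>\<xi>\<close> only: it can fail where the Young measure has an atom at \<open>\<xi>\<close>\<close>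
     (AE \<xi> in lborel. weakstar_Linf (Q T) (\<lambda>n z. of_bool (u (e n) z < \<xi>)) (\<lambda>z. F z \<xi>)) \<and>
     strong_L2 {0<..<1} (\<lambda>n. v0 (e n)) vl0 \<and>
     weak_L2 {0<..<1} (\<lambda>n x. \<sigma> (u0 (e n) x) + v0x (e n) x) Sl0 \<and>
     Linf ({0<..<1} \<times> UNIV) (\<lambda>(x, \<xi>). F0 x \<xi>) \<and>
     (AE \<xi> in lborel.
        weakstar_Linf {0<..<1} (\<lambda>n x. of_bool (u0 (e n) x < \<xi>)) (\<lambda>x. F0 x \<xi>)) \<and>
     \<comment> \<open>boundary conditions, for the continuous representative of the limit stress\<close>
     Linf (Q T) Sl \<and> continuous_on ({0..1} \<times> {0<..T}) Sl \<and>
     (\<forall>t. 0 < t \<and> t < T \<longrightarrow> Sl (0, t) = 0 \<and> Sl (1, t) = 0) \<and>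
     L2 (Q T) vlx \<and> weak_pd ({0<..<1} \<times> {0<..<T}) (1, 0) vl vlx \<and>
     kinetic_equation \<sigma> T (\<lambda>z. vlx z + (LINT r|\<nu> z. \<sigma> r)) F F0 \<and>
     heat_equation T (\<lambda>z. LINT r|\<nu> z. \<sigma> r) (\<lambda>z. 0) vl vl0 \<and>
     (AE z\<in>Q T in lborel. Sl z = (LINT r|\<nu> z. \<sigma> r) + vlx z) \<and>
     kinetic_equation \<sigma> T Sl F F0 \<and>
     heat_equation T (\<lambda>z. 0) (\<lambda>z. LINT r|\<nu> z. deriv \<sigma> r * (Sl z - \<sigma> r)) Sl Sl0"
proof -
 have \<sigma>d: "!!r. \<sigma> differentiable (at r)" and \<sigma>c: "continuous_on UNIV (deriv \<sigma>)" using assms(2,3) by auto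
 \<comment> \<open>Any sequence in I tending to 0 serves; the compactness argument is applied to it
   and returns a subsequence.\<close>
 obtain e0 :: "nat => real" where e0: "!!n. e0 n \<in> I" "e0 ----> 0"
  using assms(12) unfolding islimpt_sequential by blast
 have u0: "Linf_bound {0<..<1} K (u0 (e0 n))" and v0: "Linf_bound {0<..<1} K (v0 (e0 n))" and v0x: "Linf_bound {0<..<1} K (v0x (e0 n))"
  and wd: "weak_pd {0<..<1} 1 (v0 (e0 n)) (v0x (e0 n))" and ws: "weak_solution \<sigma> (u0 (e0 n)) (v0 (e0 n)) (u (e0 n)) (v (e0 n)) (vx (e0 n))"
  and eb: "energy_bound \<sigma> (u0 (e0 n)) (v0 (e0 n)) (u (e0 n)) (v (e0 n)) (vx (e0 n))" for n
  using assms(13-16) e0(1)[of n] by auto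
 have K0: "K >= 0" by (rule Linf_bound_nonneg[OF u0[of 0]])
 have W: "stored_energy \<sigma> r <= C * abs(r) powr p" "- C <= stored_energy \<sigma> r" for r
 proof -
  have "c * abs(r) powr p - C <= stored_energy \<sigma> r" "0 <= c * abs(r) powr p" using assms(8,10) by auto
  thus "- C <= stored_energy \<sigma> r" by linarith
  show "stored_energy \<sigma> r <= C * abs(r) powr p" using assms(10) by blast
 qed
 \<comment> \<open>The upper growth bound of the stored energy, evaluated for data bounded by K: an
   estimate of the initial energy valid for every member of the family.\<close>
 define E1 where "E1 = K^2 / 2 + C * K powr p"
 define E where "E = 2 * (E1 + C)"
 have E0: "E >= 0" using assms(9) by (simp add: E_def E1_def)
 have ie: "initial_energy \<sigma> (u0 (e0 n)) (v0 (e0 n)) <= E1" for n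
  unfolding E1_def by (rule initial_energy_bound[OF u0 v0 assms(7,9) W(1) K0])
 obtain N1 where N1: "!!r. r >= N1 ==> \<sigma> r >= 0" using assms(5) unfolding filterlim_at_top eventually_at_top_linorder by blast
 obtain N2 where N2: "!!r. r <= N2 ==> \<sigma> r <= 0" using assms(6) unfolding filterlim_at_bot eventually_at_bot_linorder by blast
 \<comment> \<open>Coercivity gives the sign of \<open>\<sigma>\<close> beyond \<open>N1\<close> on
   the right and \<open>N2\<close> on the left; a symmetric nonnegative threshold covers
   both.\<close>
 define m0 where "m0 = max 0 (max N1 (- N2))"
 define R where "R = K + 2 * ((1 + E) / 2 + K) + m0"
 have bd: "EX C. ALL r. abs(r) <= R --> abs(f r) <= C" if f: "continuous_on UNIV f" for f :: "real => real"
 proof -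
  have "compact (f ` {- R..R})" by (rule compact_continuous_image[OF continuous_on_subset[OF f] compact_Icc]) simp
  then obtain C where "ALL r:{- R..R}. abs(f r) <= C" using compact_imp_bounded by (force simp: bounded_iff)
  thus ?thesis by (intro exI[of _ C]) (auto simp: abs_le_iff)
 qed
 have "continuous_on UNIV \<sigma>" using \<sigma>d by (simp add: continuous_on_eq_continuous_at differentiable_imp_continuous_within)
 then obtain Cs where Cs: "!!r. abs(r) <= R ==> abs(\<sigma> r) <= Cs" using bd by blast
 obtain Cd where Cd: "!!r. abs(r) <= R ==> abs(deriv \<sigma> r) <= Cd" using bd[OF \<sigma>c] by blast
 have es: "energy_sol \<sigma> (u0 (e0 n)) (v0 (e0 n)) (v0x (e0 n)) (u (e0 n)) (v (e0 n)) (vx (e0 n)) T K E m0 R Cs Cd" for n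
 proof -
  interpret w: weak_sol \<sigma> "u0 (e0 n)" "v0 (e0 n)" "v0x (e0 n)" "u (e0 n)" "v (e0 n)" "vx (e0 n)" T K
   by (rule weak_sol.intro[OF assms(1) \<sigma>d \<sigma>c u0 v0 v0x wd ws])
  note ec = energy_consequences[where E=E, OF assms(1) ws[of n] eb[of n] W(2) assms(9) ie[of n], folded w.vq_def w.vxq_def]
  show ?thesis
  proof unfold_locales
   show "AEL t. t \<in> {0<..<T} --> L1 (%x. (w.vq (x, t))^2) & (LBINT x. (w.vq (x, t))^2) <= E"
   by (rule ec(1)) (simp add: E_def)
   show "(LBINT z. (w.vxq z)^2) <= E" by (rule ec(2)) (simp add: E_def)
   show "R = K + 2 * ((1 + E) / 2 + K) + m0" by (rule R_def)
  qed (use K0 E0 N1 N2 Cs Cd in "auto simp: m0_def")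
 qed
 interpret q: sol_sequence \<sigma> "%n. u0 (e0 n)" "%n. v0 (e0 n)" "%n. v0x (e0 n)" "%n. u (e0 n)" "%n. v (e0 n)" "%n. vx (e0 n)" T K E m0 R Cs Cd
  by (rule sol_sequence.intro[OF es])
 obtain r F F0 gL sL v0L where r: "strict_mono (r :: nat => nat)"
  and ls: "limit_sol \<sigma> (%n. u0 (e0 (r n))) (%n. v0 (e0 (r n))) (%n. v0x (e0 (r n))) (%n. u (e0 (r n))) (%n. v (e0 (r n))) (%n. vx (e0 (r n))) T K E m0 R Cs Cd F F0 gL sL v0L"
  using q.subsequence_exists by blast
 define e where "e = (%n. e0 (r n))"
 interpret l: limit_sol \<sigma> "%n. u0 (e n)" "%n. v0 (e n)" "%n. v0x (e n)" "%n. u (e n)" "%n. v (e n)" "%n. vx (e n)" T K E m0 R Cs Cd F F0 gL sL v0L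
  using ls unfolding e_def .
 have eI: "e n \<in> I" for n by (simp add: e_def e0)
 have e_lim: "e ----> 0" unfolding e_def using LIMSEQ_subseq_LIMSEQ[OF e0(2) r] by (simp add: comp_def)
 have S: "S (e n) z = \<sigma> (u (e n) z) + vx (e n) z" for n z using assms(17) eI by blast
 have bar: "(\<integral>r. \<sigma> r \<partial>l.y.nu z) = l.bar \<sigma> z" for z by (simp add: l.bar_def)
 \<comment> \<open>As \<open>vlx\<close> was defined by the constitutive relation, the speed in the
   system for (F, v) is literally the limit stress, and both forms of the kinetic equation
   coincide.\<close>
 have G: "(%z. l.vlx z + (\<integral>r. \<sigma> r \<partial>l.y.nu z)) = l.Sl" by (rule ext) (simp add: l.vlx_def bar)
 show ?thesis
 proof (intro exI conjI)
  show "ALL n. e n \<in> I" using eI by blast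
  show "e ----> 0" by (rule e_lim)
  show "weakstar_Linf (Q T) (%n. u (e n)) (l.bar (%r. r))" using l.weakstar_Linf_bar[of "%r. r"] by (simp add: continuous_on_id)
  show "strong_L2 (Q T) (%n. v (e n)) l.vl" "strong_L2 {0<..<1} (%n. v0 (e n)) l.vl0" by (rule l.strong_v)+
  show "AE z\<in>Q T in lborel. (%n. S (e n) z) ----> l.Sl z" unfolding S by (rule l.stress_limit)
  show "young_measure (Q T) (%n. u (e n)) l.y.nu" by (rule l.young)
  show "ALL z:Q T. ALL \<xi>. F z \<xi> = measure (l.y.nu z) {..\<xi>}" by (simp add: l.y.measure_nu)
  show "Linf (Q T \<times> UNIV) (%(z, \<xi>). F z \<xi>)" by (rule l.y.Linf_F)
  show "AEL \<xi>. weakstar_Linf (Q T) (%n z. of_bool (u (e n) z < \<xi>)) (%z. F z \<xi>)" by (rule l.weakstar_Linf_F)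
  show "weak_L2 {0<..<1} (%n x. \<sigma> (u0 (e n) x) + v0x (e n) x) sL" by (rule l.weak_stress0)
  show "Linf ({0<..<1} \<times> UNIV) (%(x, \<xi>). F0 x \<xi>)" by (rule l.y0.Linf_F)
  show "AEL \<xi>. weakstar_Linf {0<..<1} (%n x. of_bool (u0 (e n) x < \<xi>)) (%x. F0 x \<xi>)" by (rule l.weakstar_Linf_F0)
  show "Linf (Q T) l.Sl" by (rule l.Linf_Sl)
  show "continuous_on ({0..1} \<times> {0<..T}) l.Sl" by (rule l.Sl_continuous)
  show "ALL t. 0 < t & t < T --> l.Sl (0, t) = 0 & l.Sl (1, t) = 0" by (simp add: l.Sl_boundary)
  show "L2 (Q T) l.vlx" by (rule l.vlx_L2)
  show "weak_pd ({0<..<1} \<times> {0<..<T}) (1, 0) l.vl l.vlx" by (rule l.vl_weak_derivative)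
  show "kinetic_equation \<sigma> T (%z. l.vlx z + (\<integral>r. \<sigma> r \<partial>l.y.nu z)) F F0" unfolding G by (rule l.kinetic_limit)
  show "heat_equation T (%z. \<integral>r. \<sigma> r \<partial>l.y.nu z) (%z. 0) l.vl l.vl0" unfolding bar by (rule l.heat_v_limit)
  show "AE z\<in>Q T in lborel. l.Sl z = (\<integral>r. \<sigma> r \<partial>l.y.nu z) + l.vlx z" by (simp add: bar l.vlx_def)
  show "kinetic_equation \<sigma> T l.Sl F F0" by (rule l.kinetic_limit)
  show "heat_equation T (%z. 0) (%z. \<integral>r. deriv \<sigma> r * (l.Sl z - \<sigma> r) \<partial>l.y.nu z) l.Sl sL"
   using l.heat_s_limit unfolding l.gbar_def[abs_def] .
 qed
qed

end
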